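(* Let $1\le d\le m-1$. The degree $\psi_{QP}(m,d)$ of the central curve of a generic convex quadratic program with $m$ variables and $d$ linear equality constraints satisfies $$\psi_{QP}(m,d)\le\sum_{k=0}^{m-d-1}\binom{m-k-2}{d-1}2^k.$$ The right-hand side is the normalized volume of the Newton polytope of a polynomial in the $m$ variables $\lambda,y_1,\dots,y_d,t_1,\dots,t_{m-d-1}$ whose support consists of the monomials $$\lambda,\;1,\;t_1,\dots,t_{m-d-1},\;t_1^2,\,t_1t_2,\dots,t_{m-d-1}^2,$$ $$y_1,\,y_1t_1,\dots,y_1t_{m-d-1},\;\dots,\;y_d,\,y_dt_1,\dots,y_dt_{m-d-1},$$ that is, $\lambda$, all monomials of degree at most $2$ in $t_1,\dots,t_{m-d-1}$, and all products $y_i$ and $y_it_j$ with $1\le i\le d$, $1\le j\le m-d-1$.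
   Context: The quadratic program is: minimize $\frac12x^tQx+cx$ subject to $Ax=b$, $x\ge0$, where $Q$ is a real $m\times m$ (symmetric) positive definite matrix, $c\in\mathbb R^m$ is a row vector, $A$ is a real $d\times m$ matrix of rank $d$, and $b\in\mathbb R^d$. For $\lambda>0$ consider the KKT system in $(x,y)\in\mathbb R^m\times\mathbb R^d$: $x^tQ+c-\lambda\left(\frac1{x_1},\dots,\frac1{x_m}\right)-y^tA=0$, $Ax=b$, $x\ge0$. The data are assumed to be such that for each $\lambda>0$ this system has a unique solution $(x^*(\lambda),y^*(\lambda))$. The central curve is the projection onto $\mathbb C^m$ of the Zariski closure in $\mathbb C^m\times\mathbb C^d$ of $\{(x^*(\lambda),y^*(\lambda)):\lambda>0\}$. Its degree is the number of points in its intersection with a generic (affine) hyperplane of $\mathbb C^m$. $\psi_{QP}(m,d)$ denotes this degree when $Q,c,A,b$ are all generic (outside a proper algebraic subset of the data space, within the data for which the central path exists). The normalized volume of an $n$-dimensional lattice polytope is $n!$ times its Euclidean volume (so a unimodular simplex has volume $1$). *)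

theory Defs
  imports "HOL-Analysis.Analysis" "HOL-Library.Poly_Mapping"
begin

section \<open>Polynomials, Zariski closure and genericity\<close>

text \<open>A monomial with variables in \<^typ>\<open>'v\<close> is its finitely supported exponent vector;
  the support of a polynomial is the set of its \<^const>\<open>Poly_Mapping.keys\<close>.\<close>

type_synonym ('v, 'a) mpoly = "('v \<Rightarrow>\<^sub>0 nat) \<Rightarrow>\<^sub>0 'a"

definition eval_mpoly :: "('v, 'a::comm_semiring_1) mpoly \<Rightarrow> ('v \<Rightarrow> 'a) \<Rightarrow> 'a" where
  "eval_mpoly p z =
     (\<Sum>\<mu>\<in>Poly_Mapping.keys p. Poly_Mapping.lookup p \<mu> *
        (\<Prod>v\<in>Poly_Mapping.keys \<mu>. z v ^ Poly_Mapping.lookup \<mu> v))"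

definition zero_locus :: "('v, 'a::comm_semiring_1) mpoly set \<Rightarrow> ('v \<Rightarrow> 'a) set" where
  "zero_locus F = {z. \<forall>p\<in>F. eval_mpoly p z = 0}"

definition zariski_closure :: "('v \<Rightarrow> 'a::comm_semiring_1) set \<Rightarrow> ('v \<Rightarrow> 'a) set" where
  "zariski_closure S = zero_locus {p. \<forall>s\<in>S. eval_mpoly p s = 0}"

text \<open>\<open>P\<close> holds on the parameter space \<open>D\<close> outside a proper algebraic subset of \<open>D\<close>; the map
  \<open>coords\<close> lists the coordinates of a parameter. It is used below only for spaces \<open>D\<close>
  that are (Zariski open in) a linear space.\<close>

definition generically_on ::
    "('u \<Rightarrow> 'v \<Rightarrow> 'a::comm_semiring_1) \<Rightarrow> 'u set \<Rightarrow> ('u \<Rightarrow> bool) \<Rightarrow> bool" where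
  "generically_on coords D P \<longleftrightarrow>
     (\<exists>F. (\<exists>u\<in>D. coords u \<notin> zero_locus F) \<and> (\<forall>u\<in>D. coords u \<notin> zero_locus F \<longrightarrow> P u))"

section \<open>Degree of a curve\<close>

definition affine_hyperplane :: "(complex^'n) \<times> complex \<Rightarrow> (complex^'n) set" where
  "affine_hyperplane h = {x. (\<Sum>i\<in>UNIV. fst h $ i * x $ i) = snd h}"

definition hyperplane_coords :: "(complex^'n) \<times> complex \<Rightarrow> 'n option \<Rightarrow> complex" where
  "hyperplane_coords h = case_option (snd h) (\<lambda>i. fst h $ i)"

definition has_degree :: "(complex^'n) set \<Rightarrow> nat \<Rightarrow> bool" where
  "has_degree C n \<longleftrightarrow>
     generically_on hyperplane_coords {h. fst h \<noteq> 0}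
       (\<lambda>h. finite (C \<inter> affine_hyperplane h) \<and> card (C \<inter> affine_hyperplane h) = n)"

section \<open>Quadratic programs and their central curves\<close>

text \<open>Data \<open>(Q, c, A, b)\<close> of: minimize \<open>1/2 x\<^sup>t Q x + c x\<close> subject to \<open>A x = b\<close>, \<open>x \<ge> 0\<close>.\<close>

type_synonym ('m, 'd) qp = "(real^'m^'m) \<times> (real^'m) \<times> (real^'m^'d) \<times> (real^'d)"

datatype ('m, 'd) qp_index = Q_entry 'm 'm | c_entry 'm | A_entry 'd 'm | b_entry 'd

fun qp_coords :: "('m::finite, 'd::finite) qp \<Rightarrow> ('m, 'd) qp_index \<Rightarrow> real" where
  "qp_coords (Q, c, A, b) (Q_entry i j) = Q $ i $ j"
| "qp_coords (Q, c, A, b) (c_entry i) = c $ i"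
| "qp_coords (Q, c, A, b) (A_entry k i) = A $ k $ i"
| "qp_coords (Q, c, A, b) (b_entry k) = b $ k"

definition qp_space :: "('m::finite, 'd::finite) qp set" where
  "qp_space = {(Q, c, A, b). transpose Q = Q}"

text \<open>The condition \<open>x \<ge> 0\<close> appears as \<open>x > 0\<close> because the system involves \<open>1/x\<^sub>i\<close>,
  which HOL would evaluate to \<open>0\<close> at \<open>x\<^sub>i = 0\<close>. The barrier parameter is called \<open>\<tau>\<close>.\<close>

fun kkt :: "('m::finite, 'd::finite) qp \<Rightarrow> real \<Rightarrow> (real^'m) \<times> (real^'d) \<Rightarrow> bool" where
  "kkt (Q, c, A, b) \<tau> (x, y) \<longleftrightarrow>
     x v* Q + c - \<tau> *\<^sub>R (\<chi> i. 1 / x $ i) - y v* A = 0 \<and>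
     A *v x = b \<and> (\<forall>i. 0 < x $ i)"

definition positive_definite :: "real^'n^'n \<Rightarrow> bool" where
  "positive_definite Q \<longleftrightarrow> transpose Q = Q \<and> (\<forall>x. x \<noteq> 0 \<longrightarrow> 0 < x \<bullet> (Q *v x))"

definition admissible :: "('m::finite, 'd::finite) qp \<Rightarrow> bool" where
  "admissible D \<longleftrightarrow>
     (case D of (Q, c, A, b) \<Rightarrow> positive_definite Q \<and> rank A = CARD('d)) \<and>
     (\<forall>\<tau>>0. \<exists>!z. kkt D \<tau> z)"

definition central_path :: "('m::finite, 'd::finite) qp \<Rightarrow> real \<Rightarrow> (real^'m) \<times> (real^'d)" where
  "central_path D \<tau> = (THE z. kkt D \<tau> z)"

text \<open>The space \<open>\<complex>\<^sup>m \<times> \<complex>\<^sup>d\<close>, as functions on the disjoint union of the two index types.\<close>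

definition complex_point :: "(real^'m) \<times> (real^'d) \<Rightarrow> 'm + 'd \<Rightarrow> complex" where
  "complex_point z = case_sum (\<lambda>i. of_real (fst z $ i)) (\<lambda>k. of_real (snd z $ k))"

definition central_curve :: "('m::finite, 'd::finite) qp \<Rightarrow> (complex^'m) set" where
  "central_curve D =
     (\<lambda>z. \<chi> i. z (Inl i)) ` zariski_closure {complex_point (central_path D \<tau>) |\<tau>. 0 < \<tau>}"

definition is_generic_qp_degree :: "'m::finite itself \<Rightarrow> 'd::finite itself \<Rightarrow> nat \<Rightarrow> bool" where
  "is_generic_qp_degree _ _ n \<longleftrightarrow>
     generically_on qp_coords qp_space
       (\<lambda>D :: ('m, 'd) qp. admissible D \<longrightarrow> has_degree (central_curve D) n)"

definition psi_QP :: "'m::finite itself \<Rightarrow> 'd::finite itself \<Rightarrow> nat" where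
  "psi_QP m d = (THE n. is_generic_qp_degree m d n)"

section \<open>Newton polytopes\<close>

definition newton_polytope :: "('n::finite, 'a::zero) mpoly \<Rightarrow> (real^'n) set" where
  "newton_polytope p =
     convex hull ((\<lambda>\<mu>. \<chi> i. real (Poly_Mapping.lookup \<mu> i)) ` Poly_Mapping.keys p)"

definition normalized_volume :: "(real^'n) set \<Rightarrow> real" where
  "normalized_volume P = fact CARD('n) * measure lebesgue P"

abbreviation var :: "'v \<Rightarrow> ('v \<Rightarrow>\<^sub>0 nat)" where
  "var v \<equiv> Poly_Mapping.single v 1"

text \<open>The variables of the polynomial are indexed by \<^typ>\<open>'n\<close>: \<open>l\<close> plays the role of \<open>\<lambda>\<close>,
  \<open>Y k\<close> that of \<open>y\<^sub>k\<close>, and all remaining indices are the \<open>t\<^sub>j\<close> (there may be none).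
  Sums of exponent vectors are products of monomials.\<close>

definition qp_support :: "'n \<Rightarrow> ('d \<Rightarrow> 'n) \<Rightarrow> ('n \<Rightarrow>\<^sub>0 nat) set" where
  "qp_support l Y =
     (let T = - insert l (range Y) in
        {var l, 0} \<union> {var t |t. t \<in> T} \<union> {var s + var t |s t. s \<in> T \<and> t \<in> T} \<union>
        {var (Y k) |k. True} \<union> {var (Y k) + var t |k t. t \<in> T})"

end

theory Submission
	imports Defs "HOL-Library.Uprod" "HOL-Complex_Analysis.Complex_Analysis"
		"HOL-Computational_Algebra.Field_as_Ring" "HOL-Computational_Algebra.Polynomial_Factorial"
		"HOL-Computational_Algebra.Fundamental_Theorem_Algebra"
begin

text \<open>
	The Zariski closure of a central path is an irreducible curve, because polynomials in \<open>x(\<tau>)\<close> and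
	\<open>y(\<tau>)\<close> are analytic functions of \<open>\<tau> > 0\<close>. The degree of such a curve is the least \<open>n\<close> for which
	the monomials \<open>u\<^sup>i v\<^sup>j\<close> with \<open>j \<le> n\<close> in any two linear forms are dependent on the curve; a generic
	hyperplane section has that many points. Power series coefficients of the path at \<open>\<tau>\<close> are rational
	functions of the program, the point and \<open>\<tau>\<close>, so independence of such monomials on one path implies
	it on generic paths, and the largest degree occurring is the generic one.

	For the bound, the points of a hyperplane section solve \<open>x\<^sub>i z\<^sub>i = \<tau>\<close> for all \<open>i\<close>, where \<open>x\<close> and
	\<open>z = Q x + c - A\<^sup>t y\<close> lie in complementary linear spaces in general position. Scaling the points to
	\<open>\<tau> = 1\<close>, functions on a finite set of solutions are spanned by as many products of linear forms as
	the sum counts.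
\<close>

text \<open>Since \<open>psi_QP\<close> is a definite description, existence and uniqueness of the
  generic degree belong to the proof. Uniqueness needs admissible programs outside every proper
  algebraic set: a generic program is joined to a strictly feasible one by a polynomial curve, and
  strictly feasible programs have a central path. Existence needs that independence on one path
  spreads to generic paths; the a priori bound provides the path of maximal degree from which to
  start.

  The obstacle is that the closure of a path may be smaller than the variety of the KKT equations.
  The degree is therefore read off from linear independence of functions on the path. The equations
  serve only for the upper bound, where it suffices that each point of the section is some solution.

  No mixed volume is computed. Bound and volume meet in the sum of the binomials (m-1 choose i) over
  i < m-d. On the algebraic side it arises because a function modulo x_i z_i is known from its class
  modulo one factor and from a cofactor modulo the other one. This split follows Pascal's rule,
  until only quadrics in one space are left and each of them doubles the count.\<close>

no_notation fps_nth (infixl \<open>$\<close> 75)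

section \<open>Polynomial functions\<close>

text \<open>Polynomials are handled as functions: substitution becomes composition, and rule
  induction replaces computations with exponents. Formal polynomials return only where the
  definitions of closure and genericity ask for them.\<close>

inductive polyfun :: "(('v => complex) => complex) => bool" where
	const: "polyfun (\<lambda>_. c)"
| var: "polyfun (\<lambda>z. z v)"
| add: "polyfun p ==> polyfun q ==> polyfun (\<lambda>z. p z + q z)"
| mult: "polyfun p ==> polyfun q ==> polyfun (\<lambda>z. p z * q z)"

named_theorems polyfun_intros
declare polyfun.intros [polyfun_intros]

lemma polyfun_uminus [polyfun_intros]: "polyfun p ==> polyfun (\<lambda>z. - p z)"
	using polyfun.mult[OF polyfun.const[of "-1"]] by simp

lemma polyfun_diff [polyfun_intros]: "polyfun p ==> polyfun q ==> polyfun (\<lambda>z. p z - q z)"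
	using polyfun.add[OF _ polyfun_uminus] by simp

lemma polyfun_sum [polyfun_intros]: "(\<And>a. a \<in> A ==> polyfun (p a)) ==> polyfun (\<lambda>z. \<Sum>a\<in>A. p a z)"
	by (induction A rule: infinite_finite_induct) (auto intro: polyfun.intros)

lemma polyfun_prod [polyfun_intros]: "(\<And>a. a \<in> A ==> polyfun (p a)) ==> polyfun (\<lambda>z. \<Prod>a\<in>A. p a z)"
	by (induction A rule: infinite_finite_induct) (auto intro: polyfun.intros)

lemma polyfun_power [polyfun_intros]: "polyfun p ==> polyfun (\<lambda>z. p z ^ n)"
	by (induction n) (auto intro: polyfun.intros)

lemma polyfun_compose: "polyfun p ==> (\<And>v. polyfun (f v)) ==> polyfun (\<lambda>z. p (\<lambda>v. f v z))"
	by (induction rule: polyfun.induct) (auto intro: polyfun_intros)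

lemma polyfun_det [polyfun_intros]:
	"(\<And>i j. polyfun (\<lambda>z. M z $ i $ j)) ==> polyfun (\<lambda>z. det (M z :: complex^'n::finite^'n))"
	unfolding det_def by (intro polyfun_intros)

text \<open>The coordinates may be any polynomials in t, not just linear ones. Genericity arguments
  restrict to such a curve, where a nonzero polynomial has finitely many roots.\<close>

lemma polyfun_poly_line:
	assumes "polyfun p"
	shows "\<exists>q. \<forall>t. p (\<lambda>v. poly (c v) t) = poly q t" using assms
proof induction
	case (const c) show ?case by (rule exI[of _ "[:c:]"]) simp
next
	case (var v) show ?case by blast
next
	case (add p q)
	then obtain P Q where "\<And>t. p (\<lambda>v. poly (c v) t) = poly P t" "\<And>t. q (\<lambda>v. poly (c v) t) = poly Q t"
		by blast
	then show ?case by (intro exI[of _ "P + Q"]) simp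
next
	case (mult p q)
	then obtain P Q where "\<And>t. p (\<lambda>v. poly (c v) t) = poly P t" "\<And>t. q (\<lambda>v. poly (c v) t) = poly Q t"
		by blast
	then show ?case by (intro exI[of _ "P * Q"]) simp
qed

lemma poly_nonzero_real_avoid:
	fixes q :: "complex poly"
	assumes "poly q a \<noteq> 0" "e > 0"
	shows "\<exists>t::real. 0 < t \<and> t < e \<and> poly q (of_real t) \<noteq> 0"
proof -
	have "q \<noteq> 0" using assms by auto
	then have "finite {x. poly q x = 0}" by (rule poly_roots_finite)
	then have "finite (of_real -` {x. poly q x = 0} :: real set)"
		by (rule finite_vimageI) (simp add: inj_on_def)
	moreover have "infinite {0<..<e}" using assms(2) by simp
	ultimately have "\<exists>t. t \<in> {0<..<e} - (of_real -` {x. poly q x = 0})"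
		by (metis Diff_infinite_finite finite.emptyI ex_in_conv)
	then show ?thesis by auto
qed

text \<open>This is the irreducibility of affine space: on the line through a and b, p is nonzero at
  t = 0 and q at t = 1, so the product of the two restrictions is a nonzero polynomial, which has a
  real non-root.\<close>

lemma polyfun_avoid_line:
	assumes "polyfun p" "polyfun q" "p a \<noteq> 0" "q b \<noteq> 0"
	shows "\<exists>t::real. p (\<lambda>v. a v + of_real t * (b v - a v)) \<noteq> 0 \<and>
		q (\<lambda>v. a v + of_real t * (b v - a v)) \<noteq> 0"
proof -
	define c where "c v = [:a v, b v - a v:]" for v
	obtain P where P: "\<And>t. p (\<lambda>v. poly (c v) t) = poly P t" using polyfun_poly_line[OF assms(1)] by blast
	obtain Q where Q: "\<And>t. q (\<lambda>v. poly (c v) t) = poly Q t" using polyfun_poly_line[OF assms(2)] by blast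
	have "poly P 0 \<noteq> 0" using P[of 0] assms(3) by (simp add: c_def)
	moreover have "poly Q 1 \<noteq> 0" using Q[of 1] assms(4) by (simp add: c_def)
	ultimately have "P * Q \<noteq> 0" by auto
	then obtain x where "poly (P * Q) x \<noteq> 0" by (metis poly_all_0_iff_0)
	from poly_nonzero_real_avoid[OF this zero_less_one]
	obtain t :: real where "poly (P * Q) (of_real t) \<noteq> 0" by blast
	then show ?thesis
		using P[of "of_real t"] Q[of "of_real t"] by (intro exI[of _ t]) (auto simp: c_def algebra_simps)
qed

lemma polyfun_mult_nonzero:
	assumes "polyfun p" "polyfun q" "p a \<noteq> 0" "q b \<noteq> 0"
	shows "\<exists>z. p z * q z \<noteq> 0"
proof -
	obtain t :: real where t: "p (\<lambda>v. a v + of_real t * (b v - a v)) \<noteq> 0"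
		"q (\<lambda>v. a v + of_real t * (b v - a v)) \<noteq> 0"
		using polyfun_avoid_line[where p = p and q = q, OF assms(1,2,3,4)] by (elim exE conjE) (rule that)
	then show ?thesis by (intro exI[of _ "\<lambda>v. a v + of_real t * (b v - a v)"]) simp
qed

text \<open>Real points are Zariski dense: the line Re z + t Im z passes through z at t = \<i>, so p
  does not vanish identically on it, and its points with real t are real.\<close>

lemma polyfun_nonzero_real:
	fixes p :: "('v => complex) => complex"
	assumes "polyfun p" "p z \<noteq> 0"
	shows "\<exists>x::'v => real. p (\<lambda>v. of_real (x v)) \<noteq> 0"
proof -
	define c :: "'v => complex poly" where "c v = [:of_real (Re (z v)), of_real (Im (z v)):]" for v
	obtain P where P: "\<And>t. p (\<lambda>v. poly (c v) t) = poly P t" using polyfun_poly_line[OF assms(1)] by blast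
	have "(\<lambda>v. poly (c v) \<i>) = z" by (auto simp: c_def complex_eq_iff)
	then have "poly P \<i> \<noteq> 0" using P[of \<i>] assms(2) by simp
	from poly_nonzero_real_avoid[OF this zero_less_one]
	obtain t :: real where t: "poly P (of_real t) \<noteq> 0" by blast
	have "(\<lambda>v. poly (c v) (of_real t)) = (\<lambda>v. of_real (Re (z v) + t * Im (z v)))"
		by (auto simp: c_def complex_eq_iff)
	then have "p (\<lambda>v. of_real (Re (z v) + t * Im (z v))) \<noteq> 0" using P[of "of_real t"] t by simp
	then show ?thesis by (intro exI[of _ "\<lambda>v. Re (z v) + t * Im (z v)"])
qed

text \<open>The final clause, vanishing of the coefficients beyond n, allows sums of different
  lengths to be padded to a common one.\<close>

lemma polyfun_expand:
	assumes "polyfun p"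
	shows "\<exists>n a. (\<forall>j. polyfun (a j)) \<and> (\<forall>j z w. a j (z(v := w)) = a j z) \<and>
		(\<forall>z. p z = (\<Sum>j\<le>n. a j z * z v ^ j)) \<and> (\<forall>j>n. \<forall>z. a j z = 0)" using assms
proof induction
	case (const c)
	show ?case by (rule exI[of _ 0], rule exI[of _ "\<lambda>j z. if j = 0 then c else 0"])
			 (auto intro: polyfun.intros)
next
	case (var u)
	show ?case
	proof (cases "u = v")
		case True
		then show ?thesis by (intro exI[of _ 1], intro exI[of _ "\<lambda>j z. if j = 1 then 1 else 0"])
				 (auto intro: polyfun.intros)
	next
		case False
		then show ?thesis
		proof (intro exI[of _ 0], intro exI[of _ "\<lambda>j z. if j = 0 then z u else 0"] conjI allI)
			show "polyfun (\<lambda>z. if j = 0 then z u else 0)" for j :: nat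
				by (cases "j = 0") (auto intro: polyfun.intros)
		qed (use False in auto)
	qed
next
	case (add p q)
	from add.IH(1) obtain n a where
		a: "\<And>j. polyfun (a j)" "\<And>j z w. a j (z(v := w)) = a j z" "\<And>z. p z = (\<Sum>j\<le>n. a j z * z v ^ j)"
			 "\<And>j z. j > n ==> a j z = 0" by blast
	from add.IH(2) obtain m b where
		b: "\<And>j. polyfun (b j)" "\<And>j z w. b j (z(v := w)) = b j z" "\<And>z. q z = (\<Sum>j\<le>m. b j z * z v ^ j)"
			 "\<And>j z. j > m ==> b j z = 0" by blast
	have 1: "p z = (\<Sum>j\<le>max n m. a j z * z v ^ j)" for z
		unfolding a(3) by (rule sum.mono_neutral_left) (auto simp: a(4))
	have 2: "q z = (\<Sum>j\<le>max n m. b j z * z v ^ j)" for z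
		unfolding b(3) by (rule sum.mono_neutral_left) (auto simp: b(4))
	show ?case by (rule exI[of _ "max n m"], rule exI[of _ "\<lambda>j z. a j z + b j z"])
			 (simp add: 1 2 a b sum.distrib distrib_right polyfun.add del: fun_upd_apply)
next
	case (mult p q)
	from mult.IH(1) obtain n a where
		a: "\<And>j. polyfun (a j)" "\<And>j z w. a j (z(v := w)) = a j z" "\<And>z. p z = (\<Sum>j\<le>n. a j z * z v ^ j)"
			 "\<And>j z. j > n ==> a j z = 0" by blast
	from mult.IH(2) obtain m b where
		b: "\<And>j. polyfun (b j)" "\<And>j z w. b j (z(v := w)) = b j z" "\<And>z. q z = (\<Sum>j\<le>m. b j z * z v ^ j)"
			 "\<And>j z. j > m ==> b j z = 0" by blast
	have 1: "p z * q z = (\<Sum>j\<le>n+m. (\<Sum>i\<le>j. a i z * b (j - i) z) * z v ^ j)" for z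
		unfolding a(3) b(3) using polynomial_product[of n "\<lambda>j. a j z" m "\<lambda>j. b j z" "z v"] a(4) b(4) by simp
	have 2: "(\<Sum>i\<le>j. a i z * b (j - i) z) = 0" if "j > n + m" for j z
	proof (intro sum.neutral ballI)
		fix i assume "i \<in> {..j}"
		then have "i > n \<or> j - i > m" using that by auto
		then show "a i z * b (j - i) z = 0" using a(4) b(4) by auto
	qed
	show ?case by (rule exI[of _ "n + m"], rule exI[of _ "\<lambda>j z. \<Sum>i\<le>j. a i z * b (j - i) z"])
			 (use 1 2 in \<open>simp add: a(1,2) b(1,2) polyfun_intros del: fun_upd_apply\<close>)
qed

text \<open>The partial derivative is again a polynomial function. It will be taken of the
  coefficients of a relation whose parameters are the linear forms.\<close>

lemma polyfun_deriv:
	assumes "polyfun p"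
	shows "\<exists>p'. polyfun p' \<and> (\<forall>z. ((\<lambda>\<epsilon>. p (z(v := z v + \<epsilon>))) has_field_derivative p' z) (at 0))"
	using assms
proof induction
	case (const c)
	show ?case by (rule exI[of _ "\<lambda>_. 0"]) (auto intro: polyfun.intros)
next
	case (var u)
	show ?case by (rule exI[of _ "\<lambda>_. if u = v then 1 else 0"])
			(auto intro!: polyfun.intros derivative_eq_intros)
next
	case (add p q)
	then obtain p' q' where "polyfun p'" "polyfun q'"
		"\<And>z. ((\<lambda>\<epsilon>. p (z(v := z v + \<epsilon>))) has_field_derivative p' z) (at 0)"
		"\<And>z. ((\<lambda>\<epsilon>. q (z(v := z v + \<epsilon>))) has_field_derivative q' z) (at 0)" by blast
	then show ?case
		by (intro exI[of _ "\<lambda>z. p' z + q' z"]) (simp add: polyfun.intros DERIV_add del: fun_upd_apply)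
next
	case (mult p q)
	then obtain p' q' where d: "polyfun p'" "polyfun q'"
		"\<And>z. ((\<lambda>\<epsilon>. p (z(v := z v + \<epsilon>))) has_field_derivative p' z) (at 0)"
		"\<And>z. ((\<lambda>\<epsilon>. q (z(v := z v + \<epsilon>))) has_field_derivative q' z) (at 0)" by blast
	show ?case
	proof (intro exI[of _ "\<lambda>z. p' z * q z + p z * q' z"] conjI allI)
		show "polyfun (\<lambda>z. p' z * q z + p z * q' z)" using d mult by (auto intro!: polyfun.intros)
		show "((\<lambda>\<epsilon>. p (z(v := z v + \<epsilon>)) * q (z(v := z v + \<epsilon>))) has_field_derivative p' z * q z + p z * q' z) (at 0)" for z
			using DERIV_mult[OF d(3)[of z] d(4)[of z]] by (simp add: algebra_simps)
	qed
qed

text \<open>The point x is tied to z only by \<open>d z * x k = n k z\<close> and need not be a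
  quotient. The conclusion thus also covers points where d vanishes but the identity is
  known.\<close>

lemma polyfun_clear_denominator:
	assumes "polyfun q" "polyfun d" "\<And>k. polyfun (n k)"
	shows "\<exists>M q'. polyfun q' \<and> (\<forall>z x. (\<forall>k. d z * x k = n k z) --> q' z = d z ^ M * q x)" using assms(1)
proof induction
	case (const c)
	show ?case by (rule exI[of _ 0], rule exI[of _ "\<lambda>_. c"]) (auto intro: polyfun.intros)
next
	case (var v)
	show ?case by (rule exI[of _ 1], rule exI[of _ "n v"]) (auto intro: assms)
next
	case (add p q)
	from add.IH(1) obtain M p' where p': "polyfun p'"
		"\<And>z x. (\<forall>k. d z * x k = n k z) ==> p' z = d z ^ M * p x" by blast
	from add.IH(2) obtain K q' where q': "polyfun q'"
		"\<And>z x. (\<forall>k. d z * x k = n k z) ==> q' z = d z ^ K * q x" by blast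
	show ?case by (rule exI[of _ "M + K"], rule exI[of _ "\<lambda>z. d z ^ K * p' z + d z ^ M * q' z"])
			 (simp add: p' q' power_add distrib_left polyfun_intros assms)
next
	case (mult p q)
	from mult.IH(1) obtain M p' where p': "polyfun p'"
		"\<And>z x. (\<forall>k. d z * x k = n k z) ==> p' z = d z ^ M * p x" by blast
	from mult.IH(2) obtain K q' where q': "polyfun q'"
		"\<And>z x. (\<forall>k. d z * x k = n k z) ==> q' z = d z ^ K * q x" by blast
	show ?case by (rule exI[of _ "M + K"], rule exI[of _ "\<lambda>z. p' z * q' z"])
			 (simp add: p' q' power_add polyfun_intros assms)
qed

text \<open>The exact power of one variable is divided out, so that the remaining factor does not
  vanish identically on the hyperplane where this variable is 0.\<close>

lemma polyfun_divide_var: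
	assumes "polyfun p" "p z0 \<noteq> 0"
	shows "\<exists>e p'. polyfun p' \<and> (\<forall>z. p z = z v ^ e * p' z) \<and> (\<exists>z. z v = 0 \<and> p' z \<noteq> 0)"
proof -
	obtain n a where a: "\<And>j. polyfun (a j)" "\<And>j z w. a j (z(v := w)) = a j z"
		"\<And>z. p z = (\<Sum>j\<le>n. a j z * z v ^ j)" "\<And>j z. j > n ==> a j z = 0"
		using polyfun_expand[OF assms(1), of v] by blast
	have ex: "\<exists>j z. a j z \<noteq> 0"
	proof (rule ccontr)
		assume "\<not> ?thesis"
		then have "p z0 = 0" unfolding a(3) by simp
		with assms(2) show False by simp
	qed
	define e where "e = (LEAST j. \<exists>z. a j z \<noteq> 0)"
	have e: "\<exists>z. a e z \<noteq> 0" unfolding e_def using ex by (rule LeastI_ex)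
	have small: "a j z = 0" if "j < e" for j z using that not_less_Least unfolding e_def by blast
	have en: "e \<le> n" using e a(4) by (meson not_le)
	show ?thesis
	proof (rule exI[of _ e], rule exI[of _ "\<lambda>z. \<Sum>j\<in>{e..n}. a j z * z v ^ (j - e)"], intro conjI allI)
		show "polyfun (\<lambda>z. \<Sum>j\<in>{e..n}. a j z * z v ^ (j - e))" by (intro polyfun_intros a)
		show "p z = z v ^ e * (\<Sum>j\<in>{e..n}. a j z * z v ^ (j - e))" for z
		proof -
			have "p z = (\<Sum>j\<in>{e..n}. a j z * z v ^ j)"
				unfolding a(3) by (rule sum.mono_neutral_right) (auto intro: small)
			also have "\<dots> = (\<Sum>j\<in>{e..n}. z v ^ e * (a j z * z v ^ (j - e)))"
				by (intro sum.cong refl) (auto simp: power_add[symmetric])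
			finally show ?thesis by (simp add: sum_distrib_left)
		qed
		obtain z where z: "a e z \<noteq> 0" using e by blast
		have "(\<Sum>j\<in>{e..n}. a j (z(v := 0)) * (z(v := 0)) v ^ (j - e)) = (\<Sum>j\<in>{e}. a j z)"
			by (rule sum.mono_neutral_cong_right) (use en in \<open>auto simp: a(2) power_0_left\<close>)
		then show "\<exists>z. z v = 0 \<and> (\<Sum>j\<in>{e..n}. a j z * z v ^ (j - e)) \<noteq> 0"
			using z by (intro exI[of _ "z(v := 0)"]) auto
	qed
qed

subsection \<open>Polynomial functions and formal polynomials\<close>

lemma eval_mpoly_superset:
	assumes "finite S" "Poly_Mapping.keys p \<subseteq> S"
	shows "eval_mpoly p z = (\<Sum>\<mu>\<in>S. Poly_Mapping.lookup p \<mu> *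
				(\<Prod>v\<in>Poly_Mapping.keys \<mu>. z v ^ Poly_Mapping.lookup \<mu> v))" unfolding eval_mpoly_def
	by (rule sum.mono_neutral_left) (use assms in \<open>auto simp: in_keys_iff\<close>)

lemma eval_mpoly_zero [simp]: "eval_mpoly 0 z = 0" by (simp add: eval_mpoly_def)

lemma eval_mpoly_add: "eval_mpoly (p + q) z = eval_mpoly p z + eval_mpoly q z"
proof -
	let ?S = "Poly_Mapping.keys p \<union> Poly_Mapping.keys q"
	have "eval_mpoly (p + q) z = (\<Sum>\<mu>\<in>?S. Poly_Mapping.lookup (p + q) \<mu> *
				(\<Prod>v\<in>Poly_Mapping.keys \<mu>. z v ^ Poly_Mapping.lookup \<mu> v))"
		by (rule eval_mpoly_superset) (auto dest: Poly_Mapping.keys_add[THEN subsetD])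
	then show ?thesis by (simp add: eval_mpoly_superset[of ?S p] eval_mpoly_superset[of ?S q] lookup_add
				algebra_simps sum.distrib)
qed

lemma eval_mpoly_single: "eval_mpoly (Poly_Mapping.single \<mu> c) z =
		 c * (\<Prod>v\<in>Poly_Mapping.keys \<mu>. z v ^ Poly_Mapping.lookup \<mu> v)"
	by (subst eval_mpoly_superset[of "{\<mu>}"]) auto

lemma eval_mpoly_sum: "eval_mpoly (\<Sum>a\<in>A. p a) z = (\<Sum>a\<in>A. eval_mpoly (p a) z)"
	by (induction A rule: infinite_finite_induct) (auto simp: eval_mpoly_add)

lemma poly_mapping_as_sum:
	"p = (\<Sum>\<mu>\<in>Poly_Mapping.keys p. Poly_Mapping.single \<mu> (Poly_Mapping.lookup p \<mu>))"
	by (rule poly_mapping_eqI) (auto simp: lookup_sum lookup_single when_def in_keys_iff)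

lemma monomial_add:
	fixes z :: "'v => 'a::comm_semiring_1"
	shows "(\<Prod>v\<in>Poly_Mapping.keys (\<mu> + \<nu>). z v ^ Poly_Mapping.lookup (\<mu> + \<nu>) v) =
		(\<Prod>v\<in>Poly_Mapping.keys \<mu>. z v ^ Poly_Mapping.lookup \<mu> v) *
		(\<Prod>v\<in>Poly_Mapping.keys \<nu>. z v ^ Poly_Mapping.lookup \<nu> v)"
proof -
	let ?S = "Poly_Mapping.keys \<mu> \<union> Poly_Mapping.keys \<nu>"
	have sup: "(\<Prod>v\<in>Poly_Mapping.keys \<kappa>. z v ^ Poly_Mapping.lookup \<kappa> v) =
			(\<Prod>v\<in>?S. z v ^ Poly_Mapping.lookup \<kappa> v)" if "Poly_Mapping.keys \<kappa> \<subseteq> ?S" for \<kappa>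
		by (rule prod.mono_neutral_left) (use that in \<open>auto simp: in_keys_iff\<close>)
	show ?thesis unfolding sup[OF Poly_Mapping.keys_add] sup[of \<mu>, OF Un_upper1] sup[of \<nu>, OF Un_upper2]
		by (simp add: lookup_add power_add prod.distrib)
qed

lemma eval_mpoly_mult: "eval_mpoly (p * q) z = eval_mpoly p z * eval_mpoly q z"
proof -
	have "p * q = (\<Sum>\<mu>\<in>Poly_Mapping.keys p. \<Sum>\<nu>\<in>Poly_Mapping.keys q.
		Poly_Mapping.single (\<mu> + \<nu>) (Poly_Mapping.lookup p \<mu> * Poly_Mapping.lookup q \<nu>))"
		by (subst (1) poly_mapping_as_sum, subst (1) poly_mapping_as_sum[of q])
			 (simp add: sum_product mult_single)
	then show ?thesis by (simp add: eval_mpoly_sum eval_mpoly_single monomial_add)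
			 (simp add: eval_mpoly_def sum_product algebra_simps)
qed

lemma eval_mpoly_const: "eval_mpoly (Poly_Mapping.single 0 c) z = c" by (simp add: eval_mpoly_single)

lemma eval_mpoly_var: "eval_mpoly (Poly_Mapping.single (Poly_Mapping.single v 1) 1) z = z v"
	by (simp add: eval_mpoly_single)

lemma polyfun_eval_mpoly: "polyfun (eval_mpoly p)" unfolding eval_mpoly_def by (intro polyfun_intros)

lemma polyfun_imp_mpoly: "polyfun p ==> \<exists>P. \<forall>z. eval_mpoly P z = p z"
proof (induction rule: polyfun.induct)
	case (const c)
	show ?case by (intro exI[of _ "Poly_Mapping.single 0 c"] allI eval_mpoly_const)
next
	case (var v)
	show ?case by (intro exI[of _ "Poly_Mapping.single (Poly_Mapping.single v 1) 1"] allI eval_mpoly_var)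
next
	case (add p q)
	then obtain P Q where "\<And>z. eval_mpoly P z = p z" "\<And>z. eval_mpoly Q z = q z" by blast
	then show ?case by (intro exI[of _ "P + Q"]) (simp add: eval_mpoly_add)
next
	case (mult p q)
	then obtain P Q where "\<And>z. eval_mpoly P z = p z" "\<And>z. eval_mpoly Q z = q z" by blast
	then show ?case by (intro exI[of _ "P * Q"]) (simp add: eval_mpoly_mult)
qed

lemma eval_mpoly_of_real:
	"of_real (eval_mpoly p x) = eval_mpoly (Poly_Mapping.map of_real p) (\<lambda>v. of_real (x v) :: complex)"
proof -
	have k: "Poly_Mapping.keys (Poly_Mapping.map complex_of_real p) = Poly_Mapping.keys p"
		by (auto simp: in_keys_iff Poly_Mapping.map.rep_eq when_def)
	show ?thesis unfolding eval_mpoly_def k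
		by (auto simp: Poly_Mapping.map.rep_eq when_def in_keys_iff intro!: sum.cong)
qed

text \<open>Genericity of programs is measured by real polynomials, whereas the certificates below
  are complex. At real points a complex polynomial is nonzero exactly where one of its two real
  parts is.\<close>

lemma polyfun_imp_real_mpoly:
	"polyfun p ==> \<exists>P Q. \<forall>x. p (\<lambda>v. of_real (x v)) = Complex (eval_mpoly P x) (eval_mpoly Q x)"
proof (induction rule: polyfun.induct)
	case (const c)
	show ?case by (intro exI[of "\<lambda>P. \<exists>Q. _ P Q" "Poly_Mapping.single 0 (Re c)"],
				intro exI[of _ "Poly_Mapping.single 0 (Im c)"]) (simp add: eval_mpoly_const)
next
	case (var v)
	show ?case by (intro exI[of "\<lambda>P. \<exists>Q. _ P Q" "Poly_Mapping.single (Poly_Mapping.single v 1) 1"],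
				intro exI[of _ 0]) (simp add: complex_of_real_def eval_mpoly_var[unfolded One_nat_def])
next
	case (add p q)
	from add.IH(1) obtain P Q where
		p: "\<And>x. p (\<lambda>v. of_real (x v)) = Complex (eval_mpoly P x) (eval_mpoly Q x)" by blast
	from add.IH(2) obtain P' Q' where
		q: "\<And>x. q (\<lambda>v. of_real (x v)) = Complex (eval_mpoly P' x) (eval_mpoly Q' x)" by blast
	have "p (\<lambda>v. of_real (x v)) + q (\<lambda>v. of_real (x v)) =
			Complex (eval_mpoly (P + P') x) (eval_mpoly (Q + Q') x)" for x
		unfolding p q eval_mpoly_add by (simp add: complex_eq_iff)
	then show ?case by blast
next
	case (mult p q)
	from mult.IH(1) obtain P Q where
		p: "\<And>x. p (\<lambda>v. of_real (x v)) = Complex (eval_mpoly P x) (eval_mpoly Q x)" by blast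
	from mult.IH(2) obtain P' Q' where
		q: "\<And>x. q (\<lambda>v. of_real (x v)) = Complex (eval_mpoly P' x) (eval_mpoly Q' x)" by blast
	have "p (\<lambda>v. of_real (x v)) * q (\<lambda>v. of_real (x v)) =
			Complex (eval_mpoly (P * P' + Poly_Mapping.single 0 (-1) * Q * Q') x)
				(eval_mpoly (P * Q' + Q * P') x)" for x
		unfolding p q eval_mpoly_add eval_mpoly_mult eval_mpoly_const by (simp add: complex_eq_iff)
	then show ?case by blast
qed

section \<open>Linear algebra with parameters\<close>

lemma nontrivial_kernel:
	fixes M :: "'a => 'b => 'k::field"
	assumes "finite B" "finite A" "card B < card A"
	shows "\<exists>c. (\<exists>a\<in>A. c a \<noteq> 0) \<and> (\<forall>b\<in>B. (\<Sum>a\<in>A. c a * M a b) = 0)" using assms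
proof (induction B arbitrary: A M rule: finite_induct)
	case empty
	then obtain a where "a \<in> A" by fastforce
	then show ?case by (intro exI[of _ "\<lambda>_. 1"]) auto
next
	case (insert b B)
	show ?case
	proof (cases "\<forall>a\<in>A. M a b = 0")
		case True
		have "card B < card A" using insert by simp
		from insert.IH[OF insert.prems(1) this, of M] True show ?thesis by auto
	next
		case False
		then obtain a0 where a0: "a0 \<in> A" "M a0 b \<noteq> 0" by blast
		define M' where "M' a b' = M a b' - M a b / M a0 b * M a0 b'" for a b'
		have "card B < card (A - {a0})" using insert a0 by simp
		from insert.IH[OF _ this, of M'] insert.prems(1) obtain c where
			c: "\<exists>a\<in>A - {a0}. c a \<noteq> 0" "\<forall>b\<in>B. (\<Sum>a\<in>A - {a0}. c a * M' a b) = 0" by auto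
		define k where "k = - (\<Sum>a\<in>A - {a0}. c a * M a b) / M a0 b"
		define c' where "c' = c(a0 := k)"
		have split: "(\<Sum>a\<in>A. c' a * M a b') = k * M a0 b' + (\<Sum>a\<in>A - {a0}. c a * M a b')" for b'
			using a0 insert.prems(1) by (subst sum.remove[of A a0]) (auto simp: c'_def intro!: sum.cong)
		have "(\<Sum>a\<in>A. c' a * M a b') = 0" if "b' \<in> B" for b'
		proof -
			have "0 = (\<Sum>a\<in>A - {a0}. c a * M a b' - c a * M a b / M a0 b * M a0 b')"
				using c(2) that by (auto simp: M'_def algebra_simps)
			also have "\<dots> = (\<Sum>a\<in>A - {a0}. c a * M a b') + k * M a0 b'"
				by (simp add: k_def sum_subtractf sum_distrib_right sum_divide_distrib sum_negf)
			finally show ?thesis using split by (simp add: algebra_simps)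
		qed
		moreover have "(\<Sum>a\<in>A. c' a * M a b) = 0" using a0 split by (simp add: k_def)
		moreover have "\<exists>a\<in>A. c' a \<noteq> 0" using c(1) by (auto simp: c'_def)
		ultimately show ?thesis by auto
	qed
qed

section \<open>Spans and linear independence of functions\<close>

inductive_set lspan :: "('w => complex) set => ('w => complex) set" for G where
	zero: "(\<lambda>_. 0) \<in> lspan G"
| base: "g \<in> G ==> g \<in> lspan G"
| add: "f \<in> lspan G ==> g \<in> lspan G ==> (\<lambda>w. f w + g w) \<in> lspan G"
| scale: "f \<in> lspan G ==> (\<lambda>w. c * f w) \<in> lspan G"

lemma lspan_sum: "(\<And>a. a \<in> A ==> f a \<in> lspan G) ==> (\<lambda>w. \<Sum>a\<in>A. f a w) \<in> lspan G"
	by (induction A rule: infinite_finite_induct) (auto intro: lspan.zero lspan.add)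

lemma lspan_mono: "f \<in> lspan G ==> G \<subseteq> H ==> f \<in> lspan H"
	by (induction rule: lspan.induct) (auto intro: lspan.intros)

lemma lspan_explicit:
	assumes "f \<in> lspan G" "finite G"
	shows "\<exists>c. \<forall>w. f w = (\<Sum>g\<in>G. c g * g w)" using assms(1)
proof induction
	case zero
	show ?case by (rule exI[of _ "\<lambda>_. 0"]) simp
next
	case (base g)
	show ?case
	proof (intro exI allI)
		fix w
		have "(\<Sum>h\<in>G. (if h = g then 1 else 0) * h w) = (\<Sum>h\<in>G. if h = g then g w else 0)"
			by (rule sum.cong) auto
		then show "g w = (\<Sum>h\<in>G. (if h = g then 1 else 0) * h w)" using base assms(2) by simp
	qed
next
	case (add f g)
	then obtain c d where "\<forall>w. f w = (\<Sum>g\<in>G. c g * g w)" "\<forall>w. g w = (\<Sum>g\<in>G. d g * g w)" by blast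
	then show ?case by (intro exI[of _ "\<lambda>g. c g + d g"]) (simp add: distrib_right sum.distrib)
next
	case (scale f k)
	then obtain c where "\<forall>w. f w = (\<Sum>g\<in>G. c g * g w)" by blast
	then show ?case by (intro exI[of _ "\<lambda>g. k * c g"]) (simp add: sum_distrib_left mult.assoc)
qed

text \<open>A notion for indexed families, so repeated functions count as dependent. The argument
  \<open>s\<close> will range over points of a curve, over complex numbers, or over the indices of
  Taylor coefficients.\<close>

definition indep :: "'a set => ('a => 's => complex) => bool" where
	"indep A f \<longleftrightarrow> (\<forall>c. (\<forall>s. (\<Sum>a\<in>A. c a * f a s) = 0) --> (\<forall>a\<in>A. c a = 0))"

lemma indepI: "(\<And>c a. (\<And>s. (\<Sum>a\<in>A. c a * f a s) = 0) ==> a \<in> A ==> c a = 0) ==> indep A f"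
	unfolding indep_def by blast

lemma indepD: "indep A f ==> (\<And>s. (\<Sum>a\<in>A. c a * f a s) = 0) ==> a \<in> A ==> c a = 0" unfolding indep_def by blast

lemma indep_mono:
	assumes "indep B f" "A \<subseteq> B" "finite B"
	shows "indep A f"
proof (rule indepI)
	fix c a assume c: "\<And>s. (\<Sum>a\<in>A. c a * f a s) = 0" and a: "a \<in> A"
	have "(\<Sum>b\<in>B. (if b \<in> A then c b else 0) * f b s) = (\<Sum>b\<in>A. c b * f b s)" for s
		by (rule sum.mono_neutral_cong_right) (use assms in auto)
	then have "(if a \<in> A then c a else 0) = 0"
		using assms a c by (intro indepD[OF assms(1), of "\<lambda>b. if b \<in> A then c b else 0"]) auto
	then show "c a = 0" using a by simp
qed

text \<open>One step of Gaussian elimination with pivot \<open>f b s1\<close>, kept free of denominators.\<close>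

lemma elimination_step:
	fixes f :: "'a => 's => complex"
	assumes "finite A" "b \<notin> A" "f b s1 \<noteq> 0"
	defines "f' \<equiv> \<lambda>a s. f b s1 * f a s - f a s1 * f b s"
	shows "indep (insert b A) f \<longleftrightarrow> indep A f'"
proof
	assume I: "indep (insert b A) f"
	show "indep A f'"
	proof (rule indepI)
		fix c a assume c: "\<And>s. (\<Sum>a\<in>A. c a * f' a s) = 0" and a: "a \<in> A"
		define d where "d = (\<lambda>x. f b s1 * c x)(b := - (\<Sum>a\<in>A. c a * f a s1))"
		have "(\<Sum>x\<in>insert b A. d x * f x s) = (\<Sum>a\<in>A. c a * f' a s)" for s
		proof -
			have "(\<Sum>x\<in>A. d x * f x s) = (\<Sum>x\<in>A. f b s1 * c x * f x s)"
				by (rule sum.cong) (use assms(2) in \<open>auto simp: d_def\<close>)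
			then show ?thesis
				using assms(1,2) by (simp add: d_def f'_def sum_subtractf sum_distrib_right sum_distrib_left
						algebra_simps)
		qed
		then have "d a = 0" using indepD[OF I, of d a] c a by auto
		then show "c a = 0" using a assms by (auto simp: d_def split: if_splits)
	qed
next
	assume I: "indep A f'"
	show "indep (insert b A) f"
	proof (rule indepI)
		fix c a assume c: "\<And>s. (\<Sum>a\<in>insert b A. c a * f a s) = 0" and a: "a \<in> insert b A"
		have c': "c b * f b s + (\<Sum>a\<in>A. c a * f a s) = 0" for s using c[of s] assms(1,2) by simp
		have "(\<Sum>a\<in>A. c a * f' a s) = f b s1 * (\<Sum>a\<in>A. c a * f a s) - (\<Sum>a\<in>A. c a * f a s1) * f b s" for s
			by (simp add: f'_def sum_subtractf sum_distrib_left sum_distrib_right algebra_simps)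
		also have "\<dots> s = 0" for s using c'[of s] c'[of s1] by algebra
		finally have z: "c x = 0" if "x \<in> A" for x using indepD[OF I] that by blast
		then have "c b * f b s1 = 0" using c'[of s1] by simp
		then show "c a = 0" using z a assms(3) by auto
	qed
qed

lemma indep_nonzero:
	assumes "indep A f" "a \<in> A" "finite A"
	shows "\<exists>s. f a s \<noteq> 0"
proof (rule ccontr)
	assume "\<not> ?thesis"
	then have "(\<Sum>x\<in>A. (if x = a then 1 else 0) * f x s) = 0" for s by (intro sum.neutral) auto
	from indepD[OF assms(1) this assms(2)] show False by simp
qed

text \<open>Independence is a Zariski open condition in \<theta>. The certificate is the product of
  the pivots of one elimination that succeeds at \<theta>0; only finitely many \<open>s\<close> are
  used as pivot columns, however many there are.\<close>

lemma indep_certificate: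
	fixes f :: "'a => ('v => complex) => 's => complex"
	assumes "finite A" "\<And>a s. a \<in> A ==> polyfun (\<lambda>\<theta>. f a \<theta> s)" "indep A (\<lambda>a. f a \<theta>0)"
	shows "\<exists>p. polyfun p \<and> p \<theta>0 \<noteq> 0 \<and> (\<forall>\<theta>. p \<theta> \<noteq> 0 --> indep A (\<lambda>a. f a \<theta>))" using assms
proof (induction A arbitrary: f rule: finite_induct)
	case empty
	show ?case by (rule exI[of _ "\<lambda>_. 1"]) (auto intro: polyfun.const simp: indep_def)
next
	case (insert b A)
	obtain s1 where s1: "f b \<theta>0 s1 \<noteq> 0" using indep_nonzero[OF insert.prems(2)] insert.hyps by auto
	define f' where "f' a \<theta> s = f b \<theta> s1 * f a \<theta> s - f a \<theta> s1 * f b \<theta> s" for a \<theta> s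
	have eq: "indep (insert b A) (\<lambda>a. f a \<theta>) = indep A (\<lambda>a. f' a \<theta>)" if "f b \<theta> s1 \<noteq> 0" for \<theta>
		using elimination_step[of A b "\<lambda>a. f a \<theta>" s1] insert.hyps that unfolding f'_def by simp
	have pf: "polyfun (\<lambda>\<theta>. f' a \<theta> s)" if "a \<in> A" for a s
		unfolding f'_def using that by (intro polyfun_intros insert.prems) auto
	have "indep A (\<lambda>a. f' a \<theta>0)" using eq[OF s1] insert.prems(2) by simp
	from insert.IH[OF pf this] obtain p where
		p: "polyfun p" "p \<theta>0 \<noteq> 0" "\<And>\<theta>. p \<theta> \<noteq> 0 ==> indep A (\<lambda>a. f' a \<theta>)" by blast
	show ?case
	proof (intro exI[of _ "\<lambda>\<theta>. p \<theta> * f b \<theta> s1"] conjI allI impI)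
		show "polyfun (\<lambda>\<theta>. p \<theta> * f b \<theta> s1)" by (intro polyfun_intros p insert.prems) auto
		show "p \<theta>0 * f b \<theta>0 s1 \<noteq> 0" using p s1 by simp
		show "indep (insert b A) (\<lambda>a. f a \<theta>)" if "p \<theta> * f b \<theta> s1 \<noteq> 0" for \<theta> using that p(3) eq by simp
	qed
qed

text \<open>By Cramer's rule the relation has polynomial coefficients.\<close>

lemma dependent_family:
	fixes f :: "'a => ('v => complex) => 's => complex"
	assumes "finite T" "t0 \<notin> T" "\<And>a s. a \<in> insert t0 T ==> polyfun (\<lambda>\<theta>. f a \<theta> s)"
		"indep T (\<lambda>a. f a \<theta>0)" "polyfun p" "p \<theta>0 \<noteq> 0" "\<And>\<theta>. p \<theta> \<noteq> 0 ==> \<not> indep (insert t0 T) (\<lambda>a. f a \<theta>)"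
	shows "\<exists>c. (\<forall>a. polyfun (c a)) \<and> c t0 \<theta>0 \<noteq> 0 \<and> (\<forall>\<theta> s. (\<Sum>a\<in>insert t0 T. c a \<theta> * f a \<theta> s) = 0)"
	using assms
proof (induction T arbitrary: f p rule: finite_induct)
	case empty
	\<comment> \<open>Where p is nonzero, a dependent one-element family consists of the zero function.
	  Hence p itself is a coefficient that works everywhere.\<close>
	have z: "p \<theta> * f t0 \<theta> s = 0" for \<theta> s
	proof (rule ccontr)
		assume *: "\<not> ?thesis"
		have "indep {t0} (\<lambda>a. f a \<theta>)"
		proof (rule indepI)
			fix c a assume "\<And>s. (\<Sum>a\<in>{t0}. c a * f a \<theta> s) = 0" "a \<in> {t0}"
			from this(1)[of s] this(2) show "c a = 0" using * by simp
		qed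
		with empty.prems(6)[of \<theta>] * show False by simp
	qed
	show ?case by (rule exI[of _ "\<lambda>_. p"]) (use empty.prems z in simp)
next
	case (insert b T)
	obtain s1 where s1: "f b \<theta>0 s1 \<noteq> 0" using indep_nonzero[OF insert.prems(3)] insert.hyps by auto
	define f' where "f' a \<theta> s = f b \<theta> s1 * f a \<theta> s - f a \<theta> s1 * f b \<theta> s" for a \<theta> s
	have bt: "b \<noteq> t0" "t0 \<notin> T" using insert.prems(1) by auto
	have pf: "polyfun (\<lambda>\<theta>. f' a \<theta> s)" if "a \<in> insert t0 T" for a s
		unfolding f'_def using that by (intro polyfun_intros insert.prems) auto
	have I: "indep T (\<lambda>a. f' a \<theta>0)"
		using elimination_step[of T b "\<lambda>a. f a \<theta>0" s1] insert.hyps insert.prems(3) s1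
		unfolding f'_def by simp
	have pp: "polyfun (\<lambda>\<theta>. p \<theta> * f b \<theta> s1)" by (intro polyfun_intros insert.prems) auto
	have dep: "\<not> indep (insert t0 T) (\<lambda>a. f' a \<theta>)" if "p \<theta> * f b \<theta> s1 \<noteq> 0" for \<theta>
		using elimination_step[of "insert t0 T" b "\<lambda>a. f a \<theta>" s1] insert.hyps that bt
			insert.prems(6)[of \<theta>] unfolding f'_def by (simp add: insert_commute)
	from insert.IH[OF bt(2) pf I pp _ dep] s1 insert.prems(5) obtain c where
		c: "\<And>a. polyfun (c a)" "c t0 \<theta>0 \<noteq> 0" "\<And>\<theta> s. (\<Sum>a\<in>insert t0 T. c a \<theta> * f' a \<theta> s) = 0" by auto
	\<comment> \<open>Back substitution: the old coefficients are multiplied by the pivot, and the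
	  coefficient of b is what makes the relation hold at \<open>s1\<close>. Outside the family the
	  value is 0 to keep every \<open>c' a\<close> polynomial.\<close>
	define c' where "c' a = (if a = b then (\<lambda>\<theta>. - (\<Sum>a\<in>insert t0 T. c a \<theta> * f a \<theta> s1))
			else (\<lambda>\<theta>. c a \<theta> * f b \<theta> s1 * (if a \<in> insert t0 T then 1 else 0)))" for a
	have *: "(\<Sum>a\<in>insert t0 (insert b T). c' a \<theta> * f a \<theta> s) = 0" for \<theta> s
	proof -
		have "(\<Sum>a\<in>insert t0 T. c' a \<theta> * f a \<theta> s) = (\<Sum>a\<in>insert t0 T. c a \<theta> * f b \<theta> s1 * f a \<theta> s)"
			by (rule sum.cong) (use bt insert.hyps in \<open>auto simp: c'_def\<close>)
		moreover have "(\<Sum>a\<in>insert t0 (insert b T). c' a \<theta> * f a \<theta> s) =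
				c' b \<theta> * f b \<theta> s + (\<Sum>a\<in>insert t0 T. c' a \<theta> * f a \<theta> s)"
			using insert.hyps bt by (simp add: insert_commute[of t0 b])
		moreover have "(\<Sum>a\<in>insert t0 T. c a \<theta> * f' a \<theta> s) = (\<Sum>a\<in>insert t0 T. c a \<theta> * f b \<theta> s1 * f a \<theta> s) -
				(\<Sum>a\<in>insert t0 T. c a \<theta> * f a \<theta> s1) * f b \<theta> s"
			unfolding f'_def sum_distrib_right sum_subtractf[symmetric]
			by (rule sum.cong) (auto simp: algebra_simps)
		ultimately show ?thesis using c(3)[of \<theta> s] by (simp add: c'_def)
	qed
	have pf': "polyfun (c' a)" for a
	proof (cases "a \<in> insert b (insert t0 T)")
		case True
		then show ?thesis using c(1) insert.prems(2)[of _ s1] unfolding c'_def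
			by (auto intro!: polyfun_intros)
	next
		case False
		then have "c' a = (\<lambda>_. 0)" by (auto simp: c'_def)
		then show ?thesis by (simp add: polyfun.const)
	qed
	have "c' t0 \<theta>0 \<noteq> 0" using c(2) s1 bt by (simp add: c'_def)
	with * pf' show ?case by (intro exI[of _ c']) simp
qed

section \<open>Algebraic dependence\<close>

lemma monomials_independent:
	fixes c :: "('i => nat) => complex"
	assumes "finite S" "\<And>\<zeta>. (\<Sum>\<alpha>\<in>PiE S (\<lambda>_. {..N}). c \<alpha> * (\<Prod>i\<in>S. \<zeta> i ^ \<alpha> i)) = 0" "\<alpha> \<in> PiE S (\<lambda>_. {..N})"
	shows "c \<alpha> = 0" using assms
proof (induction S arbitrary: c \<alpha> rule: finite_induct)
	case empty
	then show ?case by auto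
next
	case (insert x S)
	let ?P = "PiE S (\<lambda>_. {..N})"
	have PE: "PiE (insert x S) (\<lambda>_. {..N}) = (\<lambda>(y, g). g(x := y)) ` ({..N} \<times> ?P)"
		by (simp add: PiE_insert_eq)
	have inj: "inj_on (\<lambda>(y, g). g(x := y)) ({..N} \<times> ?P)"
		using inj_combinator[of x S "\<lambda>_. {..N}"] insert.hyps by simp
	have fP: "finite ?P" using insert.hyps by (auto intro: finite_PiE)
	have *: "(\<Sum>y\<le>N. (\<Sum>g\<in>?P. c (g(x := y)) * (\<Prod>i\<in>S. \<zeta> i ^ g i)) * t ^ y) = 0" for \<zeta> t
	proof -
		have P: "(\<Prod>i\<in>S. (\<zeta>(x := t)) i ^ (g(x := y)) i) = (\<Prod>i\<in>S. \<zeta> i ^ g i)" for y g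
			by (rule prod.cong) (use insert.hyps in auto)
		have "0 = (\<Sum>\<alpha>\<in>PiE (insert x S) (\<lambda>_. {..N}). c \<alpha> * (\<Prod>i\<in>insert x S. (\<zeta>(x := t)) i ^ \<alpha> i))"
			using insert.prems(1) by simp
		also have "\<dots> = (\<Sum>(y, g)\<in>{..N} \<times> ?P. c (g(x := y)) * (t ^ y * (\<Prod>i\<in>S. \<zeta> i ^ g i)))"
			unfolding PE sum.reindex[OF inj]
			by (rule sum.cong) (use insert.hyps P in \<open>auto simp del: fun_upd_apply simp add: fun_upd_same\<close>)
		also have "\<dots> = (\<Sum>y\<le>N. \<Sum>g\<in>?P. c (g(x := y)) * (t ^ y * (\<Prod>i\<in>S. \<zeta> i ^ g i)))"
			by (rule sum.cartesian_product[symmetric])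
		finally show ?thesis by (simp add: sum_distrib_right sum_distrib_left mult_ac)
	qed
	obtain y g where yg: "\<alpha> = g(x := y)" "y \<le> N" "g \<in> ?P" using insert.prems(2) unfolding PE by auto
	have "(\<Sum>g\<in>?P. c (g(x := y)) * (\<Prod>i\<in>S. \<zeta> i ^ g i)) = 0" for \<zeta>
		using *[of \<zeta>] polyfun_eq_0[of "\<lambda>y. \<Sum>g\<in>?P. c (g(x := y)) * (\<Prod>i\<in>S. \<zeta> i ^ g i)" N] yg(2) by auto
	from insert.IH[OF this yg(3)] show ?case using yg(1) by simp
qed

text \<open>The degree is bounded in each variable separately, which makes the number of exponent
  vectors an exact power.\<close>

definition monoms :: "nat => (('v => complex) => complex) set" where
	"monoms e = (\<lambda>\<alpha> z. \<Prod>v\<in>UNIV. z v ^ \<alpha> v) ` (UNIV \<rightarrow>\<^sub>E {..e})"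

lemma finite_monoms: "finite (monoms e :: (('v::finite => complex) => complex) set)"
	unfolding monoms_def by (intro finite_imageI finite_PiE) auto

lemma card_monoms: "card (monoms e :: (('v::finite => complex) => complex) set) \<le> (e + 1) ^ CARD('v)"
proof -
	have "card ((UNIV :: 'v set) \<rightarrow>\<^sub>E {..e}) = (e + 1) ^ CARD('v)" by (simp add: card_PiE)
	moreover have "finite ((UNIV :: 'v set) \<rightarrow>\<^sub>E {..e})" by (intro finite_PiE) auto
	ultimately show ?thesis unfolding monoms_def using card_image_le by fastforce
qed

lemma monoms_mult:
	assumes "f \<in> monoms d" "g \<in> monoms e"
	shows "(\<lambda>z. f z * g z) \<in> monoms (d + e)"
proof -
	obtain a b where ab: "a \<in> UNIV \<rightarrow>\<^sub>E {..d}" "f = (\<lambda>z. \<Prod>v\<in>UNIV. z v ^ a v)"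
		"b \<in> UNIV \<rightarrow>\<^sub>E {..e}" "g = (\<lambda>z. \<Prod>v\<in>UNIV. z v ^ b v)" using assms by (auto simp: monoms_def)
	have "(\<lambda>z. f z * g z) = (\<lambda>z. \<Prod>v\<in>UNIV. z v ^ (a v + b v))" by (simp add: ab power_add prod.distrib)
	moreover have "(\<lambda>v. a v + b v) \<in> UNIV \<rightarrow>\<^sub>E {..d + e}" using ab by (auto simp: PiE_def Pi_def add_mono)
	ultimately show ?thesis unfolding monoms_def by (intro image_eqI)
qed

lemma monoms_subset: "d \<le> e ==> monoms d \<subseteq> monoms e"
	unfolding monoms_def by (intro image_mono PiE_mono) auto

lemma lspan_monoms_mult:
	assumes "f \<in> lspan (monoms d)" "g \<in> lspan (monoms e)"
	shows "(\<lambda>z. f z * g z) \<in> lspan (monoms (d + e))" using assms(1)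
proof induction
	case zero show ?case by (simp add: lspan.zero)
next
	case (base f)
	from assms(2) show ?case
	proof induction
		case zero show ?case by (simp add: lspan.zero)
	next
		case (base g)
		then show ?case using \<open>f \<in> monoms d\<close> by (intro lspan.base monoms_mult)
	next
		case (add g h)
		then show ?case using lspan.add[OF add.IH] by (simp add: distrib_left)
	next
		case (scale g c)
		then show ?case using lspan.scale[OF scale.IH, of c] by (simp add: mult.left_commute)
	qed
next
	case (add g h)
	then show ?case using lspan.add[OF add.IH] by (simp add: distrib_right)
next
	case (scale g c)
	then show ?case using lspan.scale[OF scale.IH, of c] by (simp add: mult.assoc)
qed

lemma one_in_monoms: "(\<lambda>_. 1) \<in> monoms e"
proof -
	have "(\<lambda>_. 1) = (\<lambda>z :: 'a => complex. \<Prod>v\<in>UNIV. z v ^ (\<lambda>_. 0::nat) v)" by simp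
	moreover have "(\<lambda>_. 0) \<in> (UNIV :: 'a set) \<rightarrow>\<^sub>E {..e}" by auto
	ultimately show ?thesis unfolding monoms_def by (intro image_eqI)
qed

lemma polyfun_in_lspan_monoms:
	fixes p :: "('v::finite => complex) => complex"
	assumes "polyfun p"
	shows "\<exists>e. p \<in> lspan (monoms e)" using assms
proof induction
	case (const c)
	have "(\<lambda>z. c * 1) \<in> lspan (monoms 0)" by (intro lspan.scale lspan.base one_in_monoms)
	then show ?case by auto
next
	case (var v)
	have "(\<lambda>z. z v) = (\<lambda>z :: 'v => complex. \<Prod>u\<in>UNIV. z u ^ (if u = v then 1 else 0 :: nat))"
		by (simp add: if_distrib[of "\<lambda>n. _ ^ n"] prod.delta cong: if_cong)
	moreover have "(\<lambda>u. if u = v then 1 else 0 :: nat) \<in> UNIV \<rightarrow>\<^sub>E {..1}" by auto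
	ultimately have "(\<lambda>z. z v) \<in> monoms 1" unfolding monoms_def by (intro image_eqI)
	then show ?case by (blast intro: lspan.base)
next
	case (add p q)
	then obtain d e where "p \<in> lspan (monoms d)" "q \<in> lspan (monoms e)" by blast
	then have "p \<in> lspan (monoms (max d e))" "q \<in> lspan (monoms (max d e))"
		by (auto elim: lspan_mono[OF _ monoms_subset])
	then show ?case by (blast intro: lspan.add)
next
	case (mult p q)
	then show ?case by (blast intro: lspan_monoms_mult)
qed

lemma lspan_monoms_power: "p \<in> lspan (monoms e) ==> (\<lambda>z. p z ^ n) \<in> lspan (monoms (n * e))"
proof (induction n)
	case 0
	show ?case by (simp add: lspan.base one_in_monoms)
next
	case (Suc n)
	then show ?case using lspan_monoms_mult[of p e "\<lambda>z. p z ^ n" "n * e"] by simp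
qed

lemma lspan_monoms_prod: "finite A ==> (\<And>a. a \<in> A ==> p a \<in> lspan (monoms e)) ==>
		(\<lambda>z. \<Prod>a\<in>A. p a z) \<in> lspan (monoms (card A * e))"
proof (induction A rule: finite_induct)
	case empty
	show ?case by (simp add: lspan.base one_in_monoms)
next
	case (insert a A)
	then show ?case using lspan_monoms_mult[of "p a" e "\<lambda>z. \<Prod>a\<in>A. p a z" "card A * e"] by simp
qed

text \<open>The proof counts monomials of bounded degree.\<close>

lemma algebraic_dependence:
	fixes f :: "'f::finite => ('v::finite => complex) => complex"
	assumes card: "CARD('v) < CARD('f)" and q: "polyfun q"
		and g: "\<And>i. polyfun (g i)" "\<And>i z. q z \<noteq> 0 ==> q z * f i z = g i z"
	shows "\<exists>P. polyfun P \<and> (\<exists>\<zeta>. P \<zeta> \<noteq> 0) \<and> (\<forall>z. q z \<noteq> 0 --> P (\<lambda>i. f i z) = 0)"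
proof -
	let ?F = "CARD('f)" and ?V = "CARD('v)"
	obtain e0 where e0: "q \<in> lspan (monoms e0)" using polyfun_in_lspan_monoms[OF q] by blast
	obtain e1 where e1: "\<And>i. g i \<in> lspan (monoms (e1 i))" using polyfun_in_lspan_monoms[OF g(1)] by metis
	define e where "e = e0 + (\<Sum>i\<in>UNIV. e1 i)"
	have le: "e1 i \<le> e" for i unfolding e_def by (rule trans_le_add2, rule member_le_sum) auto
	have qe: "q \<in> lspan (monoms e)" by (rule lspan_mono[OF e0 monoms_subset]) (simp add: e_def)
	have ge: "g i \<in> lspan (monoms e)" for i by (rule lspan_mono[OF e1 monoms_subset[OF le]])
	\<comment> \<open>With this N the number of available monomials is at most N (N + 1)^V, below (N +
	  1)^(V + 1), hence below the number (N + 1)^F of monomials in the functions f.\<close>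
	define N where "N = (?F * e + 1) ^ ?V"
	let ?A = "(UNIV :: 'f set) \<rightarrow>\<^sub>E {..N}"
	let ?B = "monoms (?F * (N * e)) :: (('v => complex) => complex) set"
	\<comment> \<open>The monomial in the f i with exponent \<alpha>, multiplied by the common
	  denominator \<open>q z ^ (?F * N)\<close>.\<close>
	define G where "G \<alpha> z = (\<Prod>i\<in>UNIV. g i z ^ \<alpha> i * q z ^ (N - \<alpha> i))" for \<alpha> z
	have G: "G \<alpha> \<in> lspan ?B" if "\<alpha> \<in> ?A" for \<alpha>
	proof -
		have "(\<lambda>z. g i z ^ \<alpha> i * q z ^ (N - \<alpha> i)) \<in> lspan (monoms (N * e))" for i
		proof -
			have "(\<lambda>z. g i z ^ \<alpha> i * q z ^ (N - \<alpha> i)) \<in> lspan (monoms (\<alpha> i * e + (N - \<alpha> i) * e))"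
				by (intro lspan_monoms_mult lspan_monoms_power ge qe)
			moreover have "\<alpha> i * e + (N - \<alpha> i) * e = N * e"
				using that by (simp add: add_mult_distrib[symmetric] PiE_iff)
			ultimately show ?thesis by simp
		qed
		then show ?thesis unfolding G_def by (intro lspan_monoms_prod) auto
	qed
	have "\<forall>\<alpha>\<in>?A. \<exists>c. \<forall>w. G \<alpha> w = (\<Sum>b\<in>?B. c b * b w)" using lspan_explicit[OF G finite_monoms] by blast
	then obtain M where M: "\<And>\<alpha> w. \<alpha> \<in> ?A ==> G \<alpha> w = (\<Sum>b\<in>?B. M \<alpha> b * b w)" by (auto dest!: bchoice)
	have fA: "finite ?A" by (intro finite_PiE) auto
	have "card ?B \<le> (?F * (N * e) + 1) ^ ?V" by (rule card_monoms)
	also have "\<dots> \<le> ((?F * e + 1) * (N + 1)) ^ ?V" by (intro power_mono) (auto simp: algebra_simps)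
	also have "\<dots> = N * (N + 1) ^ ?V" by (simp only: power_mult_distrib N_def[symmetric])
	also have "\<dots> < (N + 1) * (N + 1) ^ ?V" by simp
	also have "\<dots> = (N + 1) ^ (?V + 1)" by simp
	also have "\<dots> \<le> (N + 1) ^ ?F" using card by (intro power_increasing) auto
	also have "\<dots> = card ?A" by (simp add: card_PiE)
	finally have "card ?B < card ?A" .
	from nontrivial_kernel[OF finite_monoms fA this, of M] obtain c where
		c: "\<exists>\<alpha>\<in>?A. c \<alpha> \<noteq> 0" "\<And>b. b \<in> ?B ==> (\<Sum>\<alpha>\<in>?A. c \<alpha> * M \<alpha> b) = 0" by blast
	have rel: "(\<Sum>\<alpha>\<in>?A. c \<alpha> * G \<alpha> z) = 0" for z
	proof -
		have "(\<Sum>\<alpha>\<in>?A. c \<alpha> * G \<alpha> z) = (\<Sum>\<alpha>\<in>?A. \<Sum>b\<in>?B. c \<alpha> * M \<alpha> b * b z)"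
			by (rule sum.cong) (auto simp: M sum_distrib_left mult.assoc)
		also have "\<dots> = (\<Sum>b\<in>?B. (\<Sum>\<alpha>\<in>?A. c \<alpha> * M \<alpha> b) * b z)"
			by (subst sum.swap) (simp add: sum_distrib_right)
		finally show ?thesis using c(2) by simp
	qed
	define P where "P \<zeta> = (\<Sum>\<alpha>\<in>?A. c \<alpha> * (\<Prod>i\<in>UNIV. \<zeta> i ^ \<alpha> i))" for \<zeta>
	have "polyfun P" unfolding P_def by (intro polyfun_intros)
	moreover have "\<exists>\<zeta>. P \<zeta> \<noteq> 0"
	proof (rule ccontr)
		assume "\<not> ?thesis"
		then have "(\<Sum>\<alpha>\<in>?A. c \<alpha> * (\<Prod>i\<in>UNIV. \<zeta> i ^ \<alpha> i)) = 0" for \<zeta> by (simp add: P_def)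
		from monomials_independent[OF finite this] c(1) show False by blast
	qed
	moreover have "P (\<lambda>i. f i z) = 0" if qz: "q z \<noteq> 0" for z
	proof -
		have "G \<alpha> z = q z ^ (?F * N) * (\<Prod>i\<in>UNIV. f i z ^ \<alpha> i)" if a: "\<alpha> \<in> ?A" for \<alpha>
		proof -
			have "g i z ^ \<alpha> i * q z ^ (N - \<alpha> i) = q z ^ N * f i z ^ \<alpha> i" for i
			proof -
				have "g i z ^ \<alpha> i * q z ^ (N - \<alpha> i) = f i z ^ \<alpha> i * (q z ^ \<alpha> i * q z ^ (N - \<alpha> i))"
					unfolding g(2)[OF qz, symmetric] power_mult_distrib by (simp add: mult_ac)
				also have "q z ^ \<alpha> i * q z ^ (N - \<alpha> i) = q z ^ N"
					using a by (simp add: power_add[symmetric] PiE_iff)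
				finally show ?thesis by simp
			qed
			then show ?thesis by (simp add: G_def prod.distrib power_mult[symmetric] mult.commute)
		qed
		then have "q z ^ (?F * N) * P (\<lambda>i. f i z) = 0"
			using rel[of z] by (simp add: P_def sum_distrib_left mult.left_commute)
		then show ?thesis using qz by simp
	qed
	ultimately show ?thesis by blast
qed

section \<open>Plane projections of a curve\<close>

subsection \<open>Bivariate polynomials\<close>

text \<open>The inner variable is the first argument \<open>a\<close>, the outer one is \<open>b\<close>.\<close>

definition poly2 :: "complex poly poly => complex => complex => complex" where
	"poly2 Q a b = poly (poly Q [:b:]) a"

lemma poly2_add [simp]: "poly2 (P + Q) a b = poly2 P a b + poly2 Q a b"
	and poly2_mult [simp]: "poly2 (P * Q) a b = poly2 P a b * poly2 Q a b"
	and poly2_smult [simp]: "poly2 (smult r Q) a b = poly r a * poly2 Q a b"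
	and poly2_zero [simp]: "poly2 0 a b = 0" by (simp_all add: poly2_def)

lemma poly2_sum: "poly2 (\<Sum>i\<in>A. P i) a b = (\<Sum>i\<in>A. poly2 (P i) a b)" by (simp add: poly2_def poly_sum)

lemma poly2_monom: "poly2 (monom (monom c i) j) a b = c * a ^ i * b ^ j"
	by (simp add: poly2_def poly_monom)

lemma poly2_altdef: "poly2 Q a b = (\<Sum>j\<le>degree Q. \<Sum>i\<le>degree (coeff Q j). coeff (coeff Q j) i * a ^ i * b ^ j)"
	unfolding poly2_def
	by (subst poly_altdef) (simp add: poly_sum poly_altdef[of "coeff Q _"] sum_distrib_right)

lemma polyfun_poly2 [polyfun_intros]: "polyfun f ==> polyfun g ==> polyfun (\<lambda>z. poly2 Q (f z) (g z))"
	unfolding poly2_altdef by (intro polyfun_intros)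

lemma polyfun_poly [polyfun_intros]: "polyfun f ==> polyfun (\<lambda>z. poly r (f z))"
	unfolding poly_altdef by (intro polyfun_intros)

lemma polyfun_imp_poly2:
	assumes "polyfun F"
	shows "\<exists>Q. \<forall>a b. F (case_option b (case_option a \<theta>)) = poly2 Q a b" using assms
proof induction
	case (const c)
	show ?case by (rule exI[of _ "monom (monom c 0) 0"]) (simp add: poly2_def poly_monom)
next
	case (var v)
	show ?case
	proof (cases v)
		case None
		then show ?thesis by (intro exI[of _ "monom (monom 1 0) 1"]) (simp add: poly2_def poly_monom)
	next
		case (Some w)
		then show ?thesis
		proof (cases w)
			case None
			then show ?thesis using Some
				by (intro exI[of _ "monom (monom 1 1) 0"]) (simp add: poly2_def poly_monom)
		next
			case (Some k)
			then show ?thesis using \<open>v = Some w\<close>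
				by (intro exI[of _ "monom (monom (\<theta> k) 0) 0"]) (simp add: poly2_def poly_monom)
		qed
	qed
next
	case (add p q)
	then obtain P Q where "\<forall>a b. p (case_option b (case_option a \<theta>)) = poly2 P a b"
		"\<forall>a b. q (case_option b (case_option a \<theta>)) = poly2 Q a b" by blast
	then show ?case by (intro exI[of _ "P + Q"]) simp
next
	case (mult p q)
	then obtain P Q where "\<forall>a b. p (case_option b (case_option a \<theta>)) = poly2 P a b"
		"\<forall>a b. q (case_option b (case_option a \<theta>)) = poly2 Q a b" by blast
	then show ?case by (intro exI[of _ "P * Q"]) simp
qed

lemma coeff_mult_top:
	fixes p q :: "complex poly"
	assumes "degree p \<le> a" "degree q \<le> b"
	shows "coeff (p * q) (a + b) = coeff p a * coeff q b"
proof -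
	have "coeff (p * q) (a + b) = (\<Sum>i\<le>a + b. coeff p i * coeff q (a + b - i))" by (rule coeff_mult)
	also have "\<dots> = (\<Sum>i\<in>{a}. coeff p i * coeff q (a + b - i))"
	proof (rule sum.mono_neutral_right)
		show "\<forall>i\<in>{..a + b} - {a}. coeff p i * coeff q (a + b - i) = 0"
		proof
			fix i assume "i \<in> {..a + b} - {a}"
			then have "i > a \<or> a + b - i > b" by auto
			then show "coeff p i * coeff q (a + b - i) = 0" using assms by (auto simp: coeff_eq_0)
		qed
	qed auto
	finally show ?thesis by simp
qed

text \<open>A leading term in lexicographic order: \<alpha> is the maximal inner degree and k the
  largest outer exponent at which it is attained.\<close>

lemma ex_top_coeff:
	fixes A :: "complex poly poly"
	assumes "A \<noteq> 0"
	shows "\<exists>\<alpha> k. degree (coeff A k) = \<alpha> \<and> coeff A k \<noteq> 0 \<and> (\<forall>i. degree (coeff A i) \<le> \<alpha>) \<and>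
		(\<forall>i>k. coeff (coeff A i) \<alpha> = 0)"
proof -
	define \<alpha> where "\<alpha> = Max ((\<lambda>i. degree (coeff A i)) ` {..degree A})"
	have le: "degree (coeff A i) \<le> \<alpha>" for i
	proof (cases "i \<le> degree A")
		case True then show ?thesis unfolding \<alpha>_def by (intro Max_ge) auto
	next
		case False then show ?thesis by (simp add: coeff_eq_0)
	qed
	define K where "K = {i. coeff (coeff A i) \<alpha> \<noteq> 0}"
	have "K \<subseteq> {..degree A}" unfolding K_def by (auto intro: le_degree)
	then have fin: "finite K" using finite_subset by blast
	have "\<alpha> \<in> (\<lambda>i. degree (coeff A i)) ` {..degree A}" unfolding \<alpha>_def by (rule Max_in) auto
	then obtain i where i: "degree (coeff A i) = \<alpha>" by auto
	have ne: "K \<noteq> {}"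
	proof (cases "coeff A i = 0")
		case False
		then show ?thesis using i leading_coeff_0_iff[of "coeff A i"] unfolding K_def by blast
	next
		\<comment> \<open>A zero coefficient has degree 0, so here the maximal degree is 0. All
		  coefficients are then constants, and the leading one is a nonzero constant.\<close>
		case True
		then have "\<alpha> = 0" using i by simp
		then have "degree (lead_coeff A) = 0" using le[of "degree A"] by simp
		then have "coeff (lead_coeff A) 0 \<noteq> 0" using assms leading_coeff_0_iff[of "lead_coeff A"] by auto
		then show ?thesis using \<open>\<alpha> = 0\<close> unfolding K_def by auto
	qed
	define k where "k = Max K"
	have k: "k \<in> K" unfolding k_def using fin ne by (rule Max_in)
	have "coeff (coeff A i) \<alpha> = 0" if "i > k" for i
		using that Max_ge[OF fin, of i] unfolding k_def K_def by fastforce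
	moreover have "degree (coeff A k) = \<alpha>"
		using k le[of k] le_degree[of "coeff A k" \<alpha>] unfolding K_def by auto
	moreover have "coeff A k \<noteq> 0" using k unfolding K_def by auto
	ultimately show ?thesis using le by blast
qed

text \<open>The lexicographically leading terms of the factors multiply without cancellation, so the
  inner degree is additive and a bound on the product bounds each factor.\<close>

lemma inner_degree_factor:
	fixes A B :: "complex poly poly"
	assumes "A \<noteq> 0" "B \<noteq> 0" "\<And>k. degree (coeff (A * B) k) \<le> N"
	shows "degree (coeff A k) \<le> N"
proof -
	obtain \<alpha> k1 where A: "degree (coeff A k1) = \<alpha>" "coeff A k1 \<noteq> 0" "\<And>i. degree (coeff A i) \<le> \<alpha>"
		"\<And>i. i > k1 ==> coeff (coeff A i) \<alpha> = 0" using ex_top_coeff[OF assms(1)] by blast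
	obtain \<beta> k2 where B: "degree (coeff B k2) = \<beta>" "coeff B k2 \<noteq> 0" "\<And>i. degree (coeff B i) \<le> \<beta>"
		"\<And>i. i > k2 ==> coeff (coeff B i) \<beta> = 0" using ex_top_coeff[OF assms(2)] by blast
	have "coeff (coeff (A * B) (k1 + k2)) (\<alpha> + \<beta>) =
			(\<Sum>i\<le>k1 + k2. coeff (coeff A i * coeff B (k1 + k2 - i)) (\<alpha> + \<beta>))"
		by (simp add: coeff_mult coeff_sum)
	also have "\<dots> = (\<Sum>i\<le>k1 + k2. coeff (coeff A i) \<alpha> * coeff (coeff B (k1 + k2 - i)) \<beta>)"
		by (simp add: coeff_mult_top A(3) B(3))
	also have "\<dots> = (\<Sum>i\<in>{k1}. coeff (coeff A i) \<alpha> * coeff (coeff B (k1 + k2 - i)) \<beta>)"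
	proof (rule sum.mono_neutral_right)
		show "\<forall>i\<in>{..k1 + k2} - {k1}. coeff (coeff A i) \<alpha> * coeff (coeff B (k1 + k2 - i)) \<beta> = 0"
		proof
			fix i assume "i \<in> {..k1 + k2} - {k1}"
			then have "i > k1 \<or> k1 + k2 - i > k2" by auto
			then show "coeff (coeff A i) \<alpha> * coeff (coeff B (k1 + k2 - i)) \<beta> = 0" using A(4) B(4) by auto
		qed
	qed auto
	also have "\<dots> = coeff (coeff A k1) \<alpha> * coeff (coeff B k2) \<beta>" by simp
	also have "\<dots> \<noteq> 0" using A(1,2) B(1,2) by auto
	finally have "\<alpha> + \<beta> \<le> degree (coeff (A * B) (k1 + k2))" by (rule le_degree)
	then have "\<alpha> \<le> N" using assms(3)[of "k1 + k2"] by simp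
	then show ?thesis using A(3)[of k] by simp
qed

text \<open>Gauss' lemma for polynomials over the ring of polynomials in the inner variable: the
  factor a must divide the content of the cofactor.\<close>

lemma primitive_dvd:
	fixes P Q b :: "complex poly poly"
	assumes "content Q = 1" "a \<noteq> 0" "smult a P = Q * b"
	shows "Q dvd P"
proof -
	have "[:a:] dvd Q * b" unfolding assms(3)[symmetric] by (simp add: const_poly_dvd_iff)
	then have "a dvd content (Q * b)" by (simp add: const_poly_dvd_iff_dvd_content)
	then have "a dvd content b" using assms(1) by (simp add: content_mult)
	then have "[:a:] dvd b" by (simp add: const_poly_dvd_iff_dvd_content)
	then obtain b' where b': "b = [:a:] * b'" by (elim dvdE)
	have "smult a P = smult a (Q * b')" using assms(3) b' by simp
	then have "smult a (P - Q * b') = 0" by (simp add: smult_diff_right)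
	then have "P = Q * b'" using assms(2) by simp
	then show ?thesis by simp
qed

lemma card_simple_roots:
	fixes p :: "complex poly"
	assumes "p \<noteq> 0" "\<And>v. poly p v = 0 ==> poly (pderiv p) v \<noteq> 0"
	shows "finite {v. poly p v = 0} \<and> card {v. poly p v = 0} = degree p"
proof
	show fin: "finite {v. poly p v = 0}" using assms(1) by (rule poly_roots_finite)
	have "rsquarefree p" unfolding rsquarefree_roots using assms(2) by blast
	then have "p = smult (lead_coeff p) (\<Prod>z\<in>{v. poly p v = 0}. [:- z, 1:])"
		using complex_poly_decompose_rsquarefree by metis
	then have "degree p = degree (\<Prod>z\<in>{v. poly p v = 0}. [:- z, 1:])"
		using assms(1) by (metis degree_smult_eq leading_coeff_0_iff)
	also have "\<dots> = (\<Sum>z\<in>{v. poly p v = 0}. degree [:- z, 1:])" by (rule degree_prod_eq_sum_degree) auto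
	finally show "card {v. poly p v = 0} = degree p" by simp
qed

text \<open>The Sylvester matrix of two polynomials with a common root is singular.\<close>

lemma common_root_dependent:
	fixes A B :: "complex poly"
	assumes "degree A \<le> n" "degree B \<le> m" "A \<noteq> 0" "n > 0" "m > 0" "poly A v0 = 0" "poly B v0 = 0"
	shows "\<not> indep (Inl ` {..<m} \<union> Inr ` {..<n})
		(case_sum (\<lambda>i v. v ^ i * poly A v) (\<lambda>j v. v ^ j * poly B v))"
proof
	assume I: "indep (Inl ` {..<m} \<union> Inr ` {..<n})
		(case_sum (\<lambda>i v. v ^ i * poly A v) (\<lambda>j v. v ^ j * poly B v))"
	obtain A1 where A1: "A = [:- v0, 1:] * A1" using assms(6) by (auto simp: poly_eq_0_iff_dvd elim: dvdE)
	obtain B1 where B1: "B = [:- v0, 1:] * B1" using assms(7) by (auto simp: poly_eq_0_iff_dvd elim: dvdE)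
	have A1nz: "A1 \<noteq> 0" using A1 assms(3) by auto
	have "degree A = degree [:- v0, 1:] + degree A1"
		unfolding A1 using A1nz by (intro degree_mult_eq) auto
	then have dA: "degree A1 < n" using assms(1) by simp
	have dB: "degree B1 < m"
	proof (cases "B1 = 0")
		case False
		then have "degree B = degree [:- v0, 1:] + degree B1" unfolding B1 by (intro degree_mult_eq) auto
		then show ?thesis using assms(2) by simp
	qed (use assms in simp)
	have sumB: "poly B1 v = (\<Sum>i<m. coeff B1 i * v ^ i)" for v
		unfolding poly_altdef by (rule sum.mono_neutral_left) (use dB in \<open>auto intro: coeff_eq_0\<close>)
	have sumA: "poly A1 v = (\<Sum>i<n. coeff A1 i * v ^ i)" for v
		unfolding poly_altdef by (rule sum.mono_neutral_left) (use dA in \<open>auto intro: coeff_eq_0\<close>)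
	define c where "c = case_sum (coeff B1) (\<lambda>j. - coeff A1 j)"
	have "(\<Sum>a\<in>Inl ` {..<m} \<union> Inr ` {..<n}. c a *
			case_sum (\<lambda>i v. v ^ i * poly A v) (\<lambda>j v. v ^ j * poly B v) a v) = 0" for v
	proof -
		have "(\<Sum>a\<in>Inl ` {..<m} \<union> Inr ` {..<n}. c a *
				case_sum (\<lambda>i v. v ^ i * poly A v) (\<lambda>j v. v ^ j * poly B v) a v) =
				(\<Sum>i<m. coeff B1 i * (v ^ i * poly A v)) + (\<Sum>j<n. - coeff A1 j * (v ^ j * poly B v))"
			by (subst sum.union_disjoint) (auto simp: sum.reindex c_def)
		also have "\<dots> = poly B1 v * poly A v - poly A1 v * poly B v"
			by (simp add: sumA sumB sum_distrib_right sum_negf mult.assoc)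
		also have "\<dots> = 0" by (simp add: A1 B1 algebra_simps)
		finally show ?thesis .
	qed
	note z = indepD[OF I this]
	have "coeff A1 (degree A1) = 0" using z[of "Inr (degree A1)"] dA by (simp add: c_def)
	then show False using A1nz by simp
qed

subsection \<open>The degree of a curve with prime vanishing ideal\<close>

definition lin :: "('m::finite => complex) => ('m => complex) => complex" where
	"lin h x = (\<Sum>k\<in>UNIV. h k * x k)"

lemma polyfun_lin [polyfun_intros]:
	"(\<And>k. polyfun (f k)) ==> (\<And>k. polyfun (g k)) ==> polyfun (\<lambda>z. lin (\<lambda>k. f k z) (\<lambda>k. g k z))"
	unfolding lin_def by (intro polyfun_intros)

lemma polyfun_lin_const [polyfun_intros]: "polyfun (lin h)"
	using polyfun_lin[of "\<lambda>k _. h k" "\<lambda>k x. x k"] by (simp add: polyfun.intros)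

text \<open>A monomial in the two coordinates of a plane projection of the curve. Both linear forms
  are packed into \<theta>, so that statements can be polynomial in the projection itself.\<close>

definition plane_monom ::
		"('t => 'm::finite => complex) => nat \<times> nat => ('m + 'm => complex) => 't => complex" where
	"plane_monom x a \<theta> t = lin (\<lambda>k. \<theta> (Inl k)) (x t) ^ fst a * lin (\<lambda>k. \<theta> (Inr k)) (x t) ^ snd a"

lemma polyfun_plane_monom [polyfun_intros]: "polyfun (\<lambda>\<theta>. plane_monom x a \<theta> t)"
	unfolding plane_monom_def lin_def by (intro polyfun_intros)

text \<open>Primality expresses irreducibility of the closure. The dependence condition says that
  every plane projection satisfies an equation, so the dimension is at most one; the same N serves
  for all projections.\<close>

locale prime_curve =
	fixes x :: "'t => 'm::finite => complex" and N :: nat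
	assumes prime: "\<And>p q. polyfun p ==> polyfun q ==> (\<And>t. p (x t) * q (x t) = 0) ==>
			(\<forall>t. p (x t) = 0) \<or> (\<forall>t. q (x t) = 0)"
		and nonconst: "\<exists>t t'. x t \<noteq> x t'"
		and dependent: "\<And>\<theta>. \<not> indep ({..N} \<times> {..N}) (\<lambda>a. plane_monom x a \<theta>)"
begin

text \<open>Primality allows the linear factors of r to be split off one at a time; one of them must
  vanish on the whole curve.\<close>

lemma univariate_vanish:
	assumes "r \<noteq> 0" "\<And>t. poly r (lin h (x t)) = 0"
	shows "\<exists>a. \<forall>t. lin h (x t) = a" using assms
proof (induction "degree r" arbitrary: r)
	case 0
	then obtain c where "r = [:c:]" by (metis degree_eq_zeroE)
	with 0 show ?case by auto
next
	case (Suc n)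
	then have "\<not> constant (poly r)" by (simp add: constant_degree)
	then obtain a where "poly r a = 0" using fundamental_theorem_of_algebra by blast
	then obtain s where s: "r = [:- a, 1:] * s" by (auto simp: poly_eq_0_iff_dvd elim: dvdE)
	have "s \<noteq> 0" using s Suc.prems by auto
	have "degree r = degree [:- a, 1:] + degree s"
		unfolding s using \<open>s \<noteq> 0\<close> by (intro degree_mult_eq) auto
	then have deg: "n = degree s" using Suc.hyps by simp
	have "(\<forall>t. lin h (x t) - a = 0) \<or> (\<forall>t. poly s (lin h (x t)) = 0)"
	proof (rule prime)
		show "polyfun (\<lambda>z. lin h z - a)" by (intro polyfun_intros)
		show "polyfun (\<lambda>z. poly s (lin h z))" by (intro polyfun_intros)
		show "(lin h (x t) - a) * poly s (lin h (x t)) = 0" for t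
			using Suc.prems(2)[of t] s by (simp add: algebra_simps)
	qed
	then show ?case
	proof
		assume "\<forall>t. lin h (x t) - a = 0"
		then show ?thesis by (intro exI[of _ a]) simp
	next
		assume "\<forall>t. poly s (lin h (x t)) = 0"
		then show ?thesis using Suc.hyps(1)[OF deg \<open>s \<noteq> 0\<close>] by blast
	qed
qed

lemma nonconst_if_indep:
	assumes "indep ({..N} \<times> {..<Suc j}) (\<lambda>a. plane_monom x a \<theta>)" "N > 0"
	shows "\<not> (\<forall>t. lin (\<lambda>k. \<theta> (Inl k)) (x t) = a)"
proof
	assume c: "\<forall>t. lin (\<lambda>k. \<theta> (Inl k)) (x t) = a"
	have I: "indep {(0, 0), (1, 0)} (\<lambda>a. plane_monom x a \<theta>)"
		by (rule indep_mono[OF assms(1)]) (use assms(2) in auto)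
	have "(\<Sum>b\<in>{(0, 0), (1, 0)}. (if b = (0, 0) then - a else 1) * plane_monom x b \<theta> t) = 0" for t
		using c by (simp add: plane_monom_def)
	from indepD[OF I this, of "(1, 0)"] show False by simp
qed

text \<open>For generic \<theta> the relation of this degree in v is, up to factors in u alone, the
  minimal equation of v over the field generated by u, so its degree counts the points above a
  generic value of u. The exponent of u is capped at N once and for all;
  \<open>no_smaller_relation\<close> shows that the cap hides no relation of lower degree in
  v.\<close>

definition curve_degree :: nat where
	"curve_degree = (LEAST n. \<forall>\<theta>. \<not> indep ({..N} \<times> {..n}) (\<lambda>a. plane_monom x a \<theta>))"

lemma curve_degree_dependent: "\<not> indep ({..N} \<times> {..curve_degree}) (\<lambda>a. plane_monom x a \<theta>)"
proof -
	have "\<forall>\<theta>. \<not> indep ({..N} \<times> {..curve_degree}) (\<lambda>a. plane_monom x a \<theta>)"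
		unfolding curve_degree_def by (rule LeastI[of _ N]) (use dependent in blast)
	then show ?thesis by blast
qed

lemma curve_degree_indep: "\<exists>\<theta>. indep ({..N} \<times> {..<curve_degree}) (\<lambda>a. plane_monom x a \<theta>)"
proof (cases curve_degree)
	case 0
	then show ?thesis by (simp add: indep_def)
next
	case (Suc n)
	then have "n < curve_degree" by simp
	then have "\<exists>\<theta>. indep ({..N} \<times> {..n}) (\<lambda>a. plane_monom x a \<theta>)"
		unfolding curve_degree_def using not_less_Least by blast
	then show ?thesis using Suc by (simp add: lessThan_Suc_atMost)
qed

lemma curve_degree_ge:
	assumes "indep ({..N} \<times> {..<n}) (\<lambda>a. plane_monom x a \<theta>)"
	shows "n \<le> curve_degree"
proof (rule ccontr)
	assume "\<not> ?thesis"
	then have "{..N} \<times> {..curve_degree} \<subseteq> {..N} \<times> {..<n}" by auto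
	from indep_mono[OF assms this] curve_degree_dependent show False by auto
qed

text \<open>In degree 0 every linear form would satisfy a univariate equation and so be constant,
  whereas some coordinate separates two points of the curve.\<close>

lemma curve_degree_pos: "curve_degree > 0"
proof (rule ccontr)
	assume "\<not> ?thesis"
	then have 0: "curve_degree = 0" by simp
	obtain t t' where "x t \<noteq> x t'" using nonconst by blast
	then obtain k where k: "x t k \<noteq> x t' k" by auto
	define h :: "'m => complex" where "h = (\<lambda>i. if i = k then 1 else 0)"
	have lh: "lin h y = y k" for y by (simp add: lin_def h_def if_distrib[of "\<lambda>c. c * _"] cong: if_cong)
	define \<theta> :: "'m + 'm => complex" where "\<theta> = case_sum h (\<lambda>_. 0)"
	have \<theta>: "plane_monom x (i, 0) \<theta> t = lin h (x t) ^ i" for i t by (simp add: plane_monom_def \<theta>_def)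
	from curve_degree_dependent[of \<theta>] 0 obtain c i where
		c: "\<And>t. (\<Sum>a\<in>{..N} \<times> {..0}. c a * plane_monom x a \<theta> t) = 0" "i \<le> N" "c (i, 0) \<noteq> 0"
		unfolding indep_def by fastforce
	define r where "r = (\<Sum>i\<le>N. monom (c (i, 0)) i)"
	have "coeff r i = (\<Sum>j\<le>N. if j = i then c (j, 0) else 0)" by (simp add: r_def coeff_sum)
	then have "coeff r i \<noteq> 0" using c(2,3) by simp
	then have "r \<noteq> 0" by auto
	moreover have "poly r (lin h (x t)) = 0" for t
	proof -
		have "{..N} \<times> {..0::nat} = (\<lambda>i. (i, 0)) ` {..N}" by auto
		then have "(\<Sum>a\<in>{..N} \<times> {..0}. c a * plane_monom x a \<theta> t) = (\<Sum>i\<le>N. c (i, 0) * plane_monom x (i, 0) \<theta> t)"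
			by (simp add: sum.reindex inj_on_def)
		then show ?thesis using c(1)[of t] by (simp add: r_def poly_sum poly_monom \<theta>)
	qed
	ultimately obtain a where "\<forall>t. lin h (x t) = a" using univariate_vanish by blast
	then show False using k lh by metis
qed

text \<open>One relation is wanted for all projections at once, with coefficients polynomial in
  \<theta>, because it will be differentiated in \<theta>. It comes from a largest set of monomials
  that contains all those of lower degree in v and is independent for some \<theta>: one further
  monomial makes it dependent for every \<theta>.\<close>

lemma relation_family_exists: "\<exists>T c p0 \<theta>1. T \<subseteq> {..N} \<times> {..curve_degree} \<and> (\<forall>a. polyfun (c a)) \<and>
		 (\<forall>\<theta> t. (\<Sum>a\<in>T. c a \<theta> * plane_monom x a \<theta> t) = 0) \<and> polyfun p0 \<and> p0 \<theta>1 \<noteq> 0 \<and>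
		 (\<forall>\<theta>. p0 \<theta> \<noteq> 0 --> indep ({..N} \<times> {..<curve_degree}) (\<lambda>a. plane_monom x a \<theta>) \<and>
				(\<exists>i. (i, curve_degree) \<in> T \<and> c (i, curve_degree) \<theta> \<noteq> 0))"
proof -
	let ?n = curve_degree
	define TT where "TT = {T. {..N} \<times> {..<?n} \<subseteq> T \<and> T \<subseteq> {..N} \<times> {..?n} \<and>
		(\<exists>\<theta>. indep T (\<lambda>a. plane_monom x a \<theta>))}"
	have "TT \<subseteq> Pow ({..N} \<times> {..?n})" unfolding TT_def by auto
	then have fin: "finite TT" by (rule finite_subset) auto
	have "{..N} \<times> {..<?n} \<in> TT" unfolding TT_def using curve_degree_indep by auto
	then have "TT \<noteq> {}" by auto
	then have "Max (card ` TT) \<in> card ` TT" using fin by (intro Max_in) auto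
	then obtain T where "T \<in> TT" "card T = Max (card ` TT)" by auto
	then have T: "T \<in> TT" "\<And>T'. T' \<in> TT ==> card T' \<le> card T" using fin by auto
	have Tsub: "{..N} \<times> {..<?n} \<subseteq> T" "T \<subseteq> {..N} \<times> {..?n}" using T(1) unfolding TT_def by auto
	have finT: "finite T" using Tsub(2) by (rule finite_subset) auto
	obtain \<theta>1 where \<theta>1: "indep T (\<lambda>a. plane_monom x a \<theta>1)" using T(1) unfolding TT_def by auto
	have "T \<noteq> {..N} \<times> {..?n}" using \<theta>1 curve_degree_dependent by auto
	then obtain t0 where t0: "t0 \<in> {..N} \<times> {..?n}" "t0 \<notin> T" using Tsub(2) by blast
	\<comment> \<open>The added monomial has the full degree in v, since all monomials of lower degree
	  are already in T. Its coefficient keeps the relation from dropping in degree.\<close>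
	have t0': "snd t0 = ?n"
	proof (rule ccontr)
		assume "snd t0 \<noteq> ?n"
		then have "t0 \<in> {..N} \<times> {..<?n}" using t0(1) by (cases t0) auto
		then show False using t0(2) Tsub(1) by blast
	qed
	have dep: "\<not> indep (insert t0 T) (\<lambda>a. plane_monom x a \<theta>)" for \<theta>
	proof
		assume "indep (insert t0 T) (\<lambda>a. plane_monom x a \<theta>)"
		then have "insert t0 T \<in> TT" using Tsub t0 unfolding TT_def by auto
		from T(2)[OF this] show False using finT t0 by simp
	qed
	obtain c where c: "\<And>a. polyfun (c a)" "c t0 \<theta>1 \<noteq> 0"
		"\<And>\<theta> t. (\<Sum>a\<in>insert t0 T. c a \<theta> * plane_monom x a \<theta> t) = 0"
		using dependent_family[of T t0 "\<lambda>a. plane_monom x a", OF finT t0(2) polyfun_plane_monom \<theta>1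
				polyfun.const[of 1] _ dep] by auto
	obtain p1 where p1: "polyfun p1" "p1 \<theta>1 \<noteq> 0" "\<And>\<theta>. p1 \<theta> \<noteq> 0 ==> indep T (\<lambda>a. plane_monom x a \<theta>)"
		using indep_certificate[of T "\<lambda>a. plane_monom x a", OF finT polyfun_plane_monom \<theta>1] by blast
	have t0'': "t0 = (fst t0, ?n)" using t0' by (metis prod.collapse)
	show ?thesis
	proof (rule exI[of _ "insert t0 T"], rule exI[of _ c], rule exI[of _ "\<lambda>\<theta>. p1 \<theta> * c t0 \<theta>"],
			rule exI[of _ \<theta>1], intro conjI allI impI)
		show "insert t0 T \<subseteq> {..N} \<times> {..?n}" using Tsub t0 by auto
		show "polyfun (\<lambda>\<theta>. p1 \<theta> * c t0 \<theta>)" by (intro polyfun_intros p1 c)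
		show "p1 \<theta>1 * c t0 \<theta>1 \<noteq> 0" using p1 c by simp
		show "indep ({..N} \<times> {..<?n}) (\<lambda>a. plane_monom x a \<theta>)" if "p1 \<theta> * c t0 \<theta> \<noteq> 0" for \<theta>
			using that by (intro indep_mono[OF p1(3) Tsub(1) finT]) simp
		show "\<exists>i. (i, ?n) \<in> insert t0 T \<and> c (i, ?n) \<theta> \<noteq> 0" if "p1 \<theta> * c t0 \<theta> \<noteq> 0" for \<theta>
			using that t0'' by (intro exI[of _ "fst t0"]) auto
	qed (use c in auto)
qed

end

lemma poly2_box:
	assumes "degree Q < n" "\<And>k. degree (coeff Q k) \<le> N"
	shows "poly2 Q a b = (\<Sum>(i, j)\<in>{..N} \<times> {..<n}. coeff (coeff Q j) i * (a ^ i * b ^ j))"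
proof -
	have "poly2 Q a b = (\<Sum>j<n. \<Sum>i\<le>degree (coeff Q j). coeff (coeff Q j) i * a ^ i * b ^ j)"
		unfolding poly2_altdef by (rule sum.mono_neutral_left) (use assms(1) in \<open>auto simp: coeff_eq_0\<close>)
	also have "\<dots> = (\<Sum>j<n. \<Sum>i\<le>N. coeff (coeff Q j) i * a ^ i * b ^ j)"
		by (intro sum.cong refl sum.mono_neutral_left) (use assms(2) in \<open>auto simp: coeff_eq_0\<close>)
	finally show ?thesis by (subst (asm) sum.swap) (simp add: sum.cartesian_product mult.assoc)
qed

text \<open>The variables \<open>None\<close>, \<open>Some None\<close> stand for the two plane coordinates \<open>v\<close>, \<open>u\<close>.\<close>

locale relation_family = prime_curve x N for x :: "'t => 'm::finite => complex" and N +
	fixes T :: "(nat \<times> nat) set" and c :: "nat \<times> nat => ('m + 'm => complex) => complex"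
		and p0 :: "('m + 'm => complex) => complex"
		and D :: "'m => nat \<times> nat => ('m + 'm => complex) => complex"
	assumes T: "T \<subseteq> {..N} \<times> {..curve_degree}"
		and c: "\<And>a. polyfun (c a)"
		and rel: "\<And>\<theta> t. (\<Sum>a\<in>T. c a \<theta> * plane_monom x a \<theta> t) = 0"
		and p0: "polyfun p0"
		and p0_indep: "\<And>\<theta>. p0 \<theta> \<noteq> 0 ==> indep ({..N} \<times> {..<curve_degree}) (\<lambda>a. plane_monom x a \<theta>)"
		and p0_lead: "\<And>\<theta>. p0 \<theta> \<noteq> 0 ==> \<exists>i. (i, curve_degree) \<in> T \<and> c (i, curve_degree) \<theta> \<noteq> 0"
		and D: "\<And>k a. polyfun (D k a)"
		and D_deriv: "\<And>k a \<theta>. ((\<lambda>\<epsilon>. c a (\<theta>(Inr k := \<theta> (Inr k) + \<epsilon>))) has_field_derivative D k a \<theta>) (at 0)"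
begin

abbreviation u where "u \<theta> t \<equiv> lin (\<lambda>k. \<theta> (Inl k)) (x t)"
abbreviation v where "v \<theta> t \<equiv> lin (\<lambda>k. \<theta> (Inr k)) (x t)"

lemma finT: "finite T" using T by (rule finite_subset) auto

lemma N_pos: "N > 0"
proof (rule ccontr)
	assume "\<not> ?thesis"
	then have 0: "{..N} \<times> {..N} = {(0, 0)}" by auto
	have "indep {(0, 0)} (\<lambda>a. plane_monom x a \<theta>)" for \<theta> by (rule indepI) (auto simp: plane_monom_def)
	with dependent 0 show False by metis
qed

definition P2 :: "('m + 'm => complex) => complex poly poly" where
	"P2 \<theta> = (\<Sum>a\<in>T. monom (monom (c a \<theta>) (fst a)) (snd a))"

lemma coeff_P2: "coeff (coeff (P2 \<theta>) j) i = (if (i, j) \<in> T then c (i, j) \<theta> else 0)"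
proof -
	have "coeff (coeff (P2 \<theta>) j) i = (\<Sum>a\<in>T. if a = (i, j) then c (i, j) \<theta> else 0)"
		unfolding P2_def coeff_sum by (intro sum.cong) (auto split: prod.splits)
	then show ?thesis using finT by simp
qed

lemma poly2_P2: "poly2 (P2 \<theta>) a b = (\<Sum>e\<in>T. c e \<theta> * (a ^ fst e * b ^ snd e))"
	by (simp add: P2_def poly2_sum poly2_monom mult.assoc)

lemma degree_P2: assumes "p0 \<theta> \<noteq> 0" shows "degree (P2 \<theta>) = curve_degree"
proof (rule antisym)
	show "degree (P2 \<theta>) \<le> curve_degree"
	proof (rule degree_le, intro allI impI)
		fix j assume "curve_degree < j"
		then have "(i, j) \<notin> T" for i using T by auto
		then show "coeff (P2 \<theta>) j = 0" by (intro poly_eqI) (simp add: coeff_P2)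
	qed
	obtain i where i: "(i, curve_degree) \<in> T" "c (i, curve_degree) \<theta> \<noteq> 0" using p0_lead[OF assms] by blast
	then have "coeff (coeff (P2 \<theta>) curve_degree) i \<noteq> 0" by (simp add: coeff_P2)
	then have "coeff (P2 \<theta>) curve_degree \<noteq> 0" by auto
	then show "curve_degree \<le> degree (P2 \<theta>)" by (rule le_degree)
qed

lemma P2_nonzero: "p0 \<theta> \<noteq> 0 ==> P2 \<theta> \<noteq> 0" using degree_P2 curve_degree_pos by fastforce

lemma inner_degree_P2: "degree (coeff (P2 \<theta>) j) \<le> N"
proof (rule degree_le, intro allI impI)
	fix i assume "N < i"
	then have "(i, j) \<notin> T" using T by auto
	then show "coeff (coeff (P2 \<theta>) j) i = 0" by (simp add: coeff_P2)
qed

lemma P2_vanish: "poly2 (P2 \<theta>) (u \<theta> t) (v \<theta> t) = 0"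
	using rel[of \<theta> t] by (simp add: poly2_P2 plane_monom_def)

lemma prime2:
	assumes "\<And>t. poly2 A (u \<theta> t) (v \<theta> t) * poly2 B (u \<theta> t) (v \<theta> t) = 0"
	shows "(\<forall>t. poly2 A (u \<theta> t) (v \<theta> t) = 0) \<or> (\<forall>t. poly2 B (u \<theta> t) (v \<theta> t) = 0)"
	by (rule prime[of "\<lambda>y. poly2 A (lin (\<lambda>k. \<theta> (Inl k)) y) (lin (\<lambda>k. \<theta> (Inr k)) y)"
				"\<lambda>y. poly2 B (lin (\<lambda>k. \<theta> (Inl k)) y) (lin (\<lambda>k. \<theta> (Inr k)) y)"])
		 (use assms in \<open>auto intro!: polyfun_intros\<close>)

lemma u_nonconst: assumes "p0 \<theta> \<noteq> 0" shows "\<not> (\<forall>t. u \<theta> t = a)"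
proof -
	obtain j where "curve_degree = Suc j" using curve_degree_pos gr0_implies_Suc by blast
	then show ?thesis using nonconst_if_indep[of j \<theta> a] p0_indep[OF assms] N_pos by simp
qed

text \<open>A relation of smaller degree in \<open>v\<close>, of minimal degree and made primitive, divides \<open>P2 \<theta>\<close> by
	Gauss' lemma, so its degree in \<open>u\<close> is at most \<open>N\<close>.\<close>

lemma no_smaller_relation:
	assumes p0: "p0 \<theta> \<noteq> 0" and Q: "Q \<noteq> 0" "degree Q < curve_degree" "\<And>t. poly2 Q (u \<theta> t) (v \<theta> t) = 0"
	shows False
proof -
	define R where "R j \<longleftrightarrow> (\<exists>Q. Q \<noteq> 0 \<and> degree Q = j \<and> (\<forall>t. poly2 Q (u \<theta> t) (v \<theta> t) = 0))" for j
	have "R (degree Q)" unfolding R_def using Q by blast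
	then have RL: "R (LEAST j. R j)" and le: "(LEAST j. R j) \<le> degree Q" by (auto intro: LeastI Least_le)
	then obtain Q1 where Q1: "Q1 \<noteq> 0" "degree Q1 = (LEAST j. R j)" "\<And>t. poly2 Q1 (u \<theta> t) (v \<theta> t) = 0"
		unfolding R_def by blast
	define Q0 where "Q0 = primitive_part Q1"
	have Q0: "Q0 \<noteq> 0" "degree Q0 = degree Q1" "content Q0 = 1" "Q1 = smult (content Q1) Q0"
		using Q1(1) by (auto simp: Q0_def)
	have "poly2 [:content Q1:] (u \<theta> t) (v \<theta> t) * poly2 Q0 (u \<theta> t) (v \<theta> t) = 0" for t
		using Q1(3)[of t] by (subst (asm) Q0(4)) (simp add: poly2_def)
	then consider "\<forall>t. poly2 [:content Q1:] (u \<theta> t) (v \<theta> t) = 0" | "\<forall>t. poly2 Q0 (u \<theta> t) (v \<theta> t) = 0"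
		using prime2 by blast
	then have van: "\<forall>t. poly2 Q0 (u \<theta> t) (v \<theta> t) = 0"
	proof cases
		case 1
		then have "\<And>t. poly (content Q1) (u \<theta> t) = 0" by (simp add: poly2_def)
		moreover have "content Q1 \<noteq> 0" using Q1(1) by simp
		ultimately show ?thesis using univariate_vanish u_nonconst[OF p0] by blast
	qed
	define r where "r = pseudo_mod (P2 \<theta>) Q0"
	obtain a q where aq: "a \<noteq> 0" "smult a (P2 \<theta>) = Q0 * q + r"
		using pseudo_mod(1)[OF Q0(1), of "P2 \<theta>"] unfolding r_def by blast
	have r: "r = 0 \<or> degree r < degree Q0" unfolding r_def by (rule pseudo_mod(2)[OF Q0(1)])
	have "poly2 r (u \<theta> t) (v \<theta> t) = 0" for t
	proof -
		have "poly2 (smult a (P2 \<theta>)) (u \<theta> t) (v \<theta> t) = poly2 (Q0 * q + r) (u \<theta> t) (v \<theta> t)" using aq(2) by simp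
		then show ?thesis using van P2_vanish[of \<theta> t] by simp
	qed
	then have "R (degree r)" if "r \<noteq> 0" using that unfolding R_def by blast
	then have "r = 0" using r Q0(2) Q1(2) not_less_Least[of "degree r" R] by auto
	then have "Q0 dvd P2 \<theta>" using primitive_dvd[OF Q0(3) aq(1)] aq(2) by simp
	then obtain B where B: "P2 \<theta> = Q0 * B" by (elim dvdE)
	have "B \<noteq> 0" using B P2_nonzero[OF p0] by auto
	have deg: "degree (coeff Q0 k) \<le> N" for k
		by (rule inner_degree_factor[OF Q0(1) \<open>B \<noteq> 0\<close>]) (use inner_degree_P2 B in metis)
	have lt: "degree Q0 < curve_degree" using Q0(2) Q1(2) le Q(2) by simp
	have "(\<Sum>a\<in>{..N} \<times> {..<curve_degree}. coeff (coeff Q0 (snd a)) (fst a) * plane_monom x a \<theta> t) = 0" for t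
		using van poly2_box[OF lt deg, of "u \<theta> t" "v \<theta> t"] by (simp add: plane_monom_def case_prod_unfold)
	note * = indepD[OF p0_indep[OF p0] this]
	have "coeff (coeff Q0 j) i = 0" for i j
	proof (cases "i \<le> N \<and> j < curve_degree")
		case True then show ?thesis using *[of "(i, j)"] by simp
	next
		case False
		then show ?thesis
		proof (cases "j < curve_degree")
			case True
			then show ?thesis using False deg[of j] by (intro coeff_eq_0) linarith
		next
			case j: False
			then show ?thesis using lt by (simp add: coeff_eq_0)
		qed
	qed
	then have "Q0 = 0" by (intro poly_eqI) simp
	then show False using Q0(1) by simp
qed

text \<open>The leading coefficient in v of the relation, evaluated at u = \<open>w None\<close>.
  The detour through \<open>poly2\<close> only performs this evaluation.\<close>

definition lc :: "(('m + 'm) option => complex) => complex" where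
	"lc w = poly2 (monom (coeff (P2 (\<lambda>k. w (Some k))) curve_degree) 0) (w None) 0"

lemma lc_eq: "lc w = (\<Sum>i\<le>N. (if (i, curve_degree) \<in> T then c (i, curve_degree) (\<lambda>k. w (Some k)) else 0) * w None ^ i)"
proof -
	have "lc w = poly (coeff (P2 (\<lambda>k. w (Some k))) curve_degree) (w None)"
		by (simp add: lc_def poly2_def poly_monom)
	also have "\<dots> = (\<Sum>i\<le>N. coeff (coeff (P2 (\<lambda>k. w (Some k))) curve_degree) i * w None ^ i)"
		unfolding poly_altdef
		by (rule sum.mono_neutral_left) (use inner_degree_P2 in \<open>auto simp: coeff_eq_0\<close>)
	finally show ?thesis by (simp add: coeff_P2)
qed

lemma polyfun_lc: "polyfun lc"
proof -
	have "polyfun (\<lambda>w. c a (\<lambda>k. w (Some k)))" for a by (rule polyfun_compose[OF c]) (rule polyfun.var)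
	then have "polyfun (\<lambda>w. (if (i, curve_degree) \<in> T then c (i, curve_degree) (\<lambda>k. w (Some k)) else 0) * w None ^ i)" for i
		by (cases "(i, curve_degree) \<in> T") (auto intro!: polyfun_intros)
	then have "polyfun (\<lambda>w. \<Sum>i\<le>N. (if (i, curve_degree) \<in> T then c (i, curve_degree) (\<lambda>k. w (Some k)) else 0) * w None ^ i)"
		by (intro polyfun_sum)
	then show ?thesis by (simp add: lc_eq[abs_def])
qed

lemma lc_nonzero: assumes "p0 \<theta> \<noteq> 0" shows "\<exists>a. lc (case_option a \<theta>) \<noteq> 0"
proof -
	have "coeff (P2 \<theta>) curve_degree \<noteq> 0"
		using degree_P2[OF assms] P2_nonzero[OF assms] by (metis leading_coeff_0_iff)
	then obtain a where "poly (coeff (P2 \<theta>) curve_degree) a \<noteq> 0" using poly_all_0_iff_0 by blast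
	then show ?thesis by (intro exI[of _ a]) (simp add: lc_def poly2_def poly_monom)
qed

text \<open>Pseudo-division by \<open>P2 \<theta>\<close> leaves a remainder of smaller degree, which must be zero.\<close>

lemma vanish_at_roots:
	assumes p0: "p0 \<theta> \<noteq> 0" and F: "polyfun F" "\<And>t. F (case_option (v \<theta> t) (case_option (u \<theta> t) \<theta>)) = 0"
		and root: "poly2 (P2 \<theta>) a b = 0" and lc: "lc (case_option a \<theta>) \<noteq> 0"
	shows "F (case_option b (case_option a \<theta>)) = 0"
proof -
	obtain Q where Q: "\<And>a b. F (case_option b (case_option a \<theta>)) = poly2 Q a b"
		using polyfun_imp_poly2[OF F(1)] by blast
	obtain q r where qr: "pseudo_divmod Q (P2 \<theta>) = (q, r)" by (cases "pseudo_divmod Q (P2 \<theta>)")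
	define e where "e = Suc (degree Q) - degree (P2 \<theta>)"
	define l where "l = coeff (P2 \<theta>) curve_degree"
	note dm = pseudo_divmod[OF P2_nonzero[OF p0] qr]
	have eq: "smult (l ^ e) Q = P2 \<theta> * q + r" using dm(1) by (simp add: e_def l_def degree_P2[OF p0])
	have van: "poly2 r (u \<theta> t) (v \<theta> t) = 0" for t
	proof -
		have "poly2 (smult (l ^ e) Q) (u \<theta> t) (v \<theta> t) = poly2 (P2 \<theta> * q + r) (u \<theta> t) (v \<theta> t)" using eq by simp
		moreover have "poly2 Q (u \<theta> t) (v \<theta> t) = 0" using F(2)[of t] Q by simp
		ultimately show ?thesis using P2_vanish[of \<theta> t] by simp
	qed
	have "r = 0" using no_smaller_relation[OF p0 _ _ van] dm(2) degree_P2[OF p0] by auto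
	then have "poly l a ^ e * poly2 Q a b = poly2 (P2 \<theta> * q) a b"
		using arg_cong[OF eq, of "\<lambda>Q. poly2 Q a b"] by simp
	then have "poly l a ^ e * poly2 Q a b = 0" using root by simp
	moreover have "poly l a \<noteq> 0" using lc by (simp add: lc_def l_def poly2_def poly_monom)
	ultimately show ?thesis using Q by simp
qed

end

text \<open>No base point is prescribed here: the point w2, at which the relation is nontrivial, is
  found together with a largest subfamily that is independent somewhere on the set where p is
  nonzero.\<close>

lemma dependent_relation:
	fixes f :: "'a => ('v => complex) => 's => complex"
	assumes "finite I" "\<And>a s. a \<in> I ==> polyfun (\<lambda>w. f a w s)" "polyfun p" "p w1 \<noteq> 0"
		"\<And>w. p w \<noteq> 0 ==> \<not> indep I (\<lambda>a. f a w)"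
	shows "\<exists>c w2. p w2 \<noteq> 0 \<and> (\<forall>a. polyfun (c a)) \<and> (\<exists>a\<in>I. c a w2 \<noteq> 0) \<and>
		(\<forall>w s. (\<Sum>a\<in>I. c a w * f a w s) = 0)"
proof -
	define TT where "TT = {T. T \<subseteq> I \<and> (\<exists>w. p w \<noteq> 0 \<and> indep T (\<lambda>a. f a w))}"
	have "TT \<subseteq> Pow I" unfolding TT_def by auto
	then have fin: "finite TT" by (rule finite_subset) (use assms(1) in auto)
	have "{} \<in> TT" unfolding TT_def using assms(4) by (auto simp: indep_def)
	then have "Max (card ` TT) \<in> card ` TT" using fin by (intro Max_in) auto
	then obtain T where "T \<in> TT" "card T = Max (card ` TT)" by auto
	then have T: "T \<in> TT" "\<And>T'. T' \<in> TT ==> card T' \<le> card T" using fin by auto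
	obtain w2 where w2: "p w2 \<noteq> 0" "indep T (\<lambda>a. f a w2)" and TI: "T \<subseteq> I"
		using T(1) unfolding TT_def by auto
	have finT: "finite T" using TI assms(1) by (rule finite_subset)
	have "T \<noteq> I" using w2 assms(5) by auto
	then obtain t0 where t0: "t0 \<in> I" "t0 \<notin> T" using TI by blast
	have dep: "\<not> indep (insert t0 T) (\<lambda>a. f a w)" if "p w \<noteq> 0" for w
	proof
		assume "indep (insert t0 T) (\<lambda>a. f a w)"
		then have "insert t0 T \<in> TT" using TI t0 that unfolding TT_def by auto
		from T(2)[OF this] show False using finT t0 by simp
	qed
	have pf: "\<And>a s. a \<in> insert t0 T ==> polyfun (\<lambda>w. f a w s)" using assms(2) t0 TI by blast
	obtain c where c: "\<And>a. polyfun (c a)" "c t0 w2 \<noteq> 0" "\<And>w s. (\<Sum>a\<in>insert t0 T. c a w * f a w s) = 0"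
		using dependent_family[of T t0 f, OF finT t0(2) pf w2(2) assms(3) w2(1) dep] by blast
	define c' where "c' a = (if a \<in> insert t0 T then c a else (\<lambda>_. 0))" for a
	show ?thesis
	proof (intro exI[of "\<lambda>c. \<exists>w2. _ c w2" c'] exI[of _ w2] conjI allI)
		show "polyfun (c' a)" for a by (simp add: c'_def c polyfun.const)
		show "\<exists>a\<in>I. c' a w2 \<noteq> 0" using t0 c(2) by (intro bexI[of _ t0]) (auto simp: c'_def)
		show "(\<Sum>a\<in>I. c' a w * f a w s) = 0" for w s
		proof -
			have "(\<Sum>a\<in>I. c' a w * f a w s) = (\<Sum>a\<in>insert t0 T. c a w * f a w s)"
				by (rule sum.mono_neutral_cong_right) (use assms(1) TI t0 in \<open>auto simp: c'_def\<close>)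
			then show ?thesis using c(3) by simp
		qed
	qed (use w2 in auto)
qed

context relation_family
begin

section \<open>Recovering the points of a hyperplane section from one plane coordinate\<close>

abbreviation point :: "('m + 'm => complex) => 't => ('m + 'm) option option => complex" where
	"point \<theta> t \<equiv> case_option (v \<theta> t) (case_option (u \<theta> t) \<theta>)"

text \<open>W is the partial derivative in v of the relation P below, and \<open>G k\<close> is
  minus its derivative in the parameter \<open>\<theta> (Inr k)\<close>, taken through the
  coefficients only.\<close>

definition W :: "(('m + 'm) option option => complex) => complex" where
	"W z = (\<Sum>a\<in>T. c a (\<lambda>k. z (Some (Some k))) *
		 (z (Some None) ^ fst a * (of_nat (snd a) * z None ^ (snd a - 1))))"

definition G :: "'m => (('m + 'm) option option => complex) => complex" where
	"G k z = - (\<Sum>a\<in>T. D k a (\<lambda>k. z (Some (Some k))) * (z (Some None) ^ fst a * z None ^ snd a))"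

definition P :: "(('m + 'm) option option => complex) => complex" where
	"P z = (\<Sum>a\<in>T. c a (\<lambda>k. z (Some (Some k))) * (z (Some None) ^ fst a * z None ^ snd a))"

lemma polyfun_W: "polyfun W" and polyfun_G: "polyfun (G k)" and polyfun_P: "polyfun P"
proof -
	have 1: "polyfun (\<lambda>z. c a (\<lambda>k. z (Some (Some k))))" for a
		by (rule polyfun_compose[OF c]) (rule polyfun.var)
	have 2: "polyfun (\<lambda>z. D k a (\<lambda>k. z (Some (Some k))))" for k a
		by (rule polyfun_compose[OF D]) (rule polyfun.var)
	show "polyfun W" unfolding W_def[abs_def] by (intro polyfun_intros 1)
	show "polyfun P" unfolding P_def[abs_def] by (intro polyfun_intros 1)
	show "polyfun (G k)" unfolding G_def[abs_def] by (intro polyfun_intros 2)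
qed

text \<open>The coefficients of \<open>v\<close> are varied: differentiating the relation recovers the coordinate
	\<open>x k\<close> as the quotient \<open>G k / W\<close>.\<close>

lemma coordinate_identity: "W (point \<theta> t) * x t k = G k (point \<theta> t)"
proof -
	let ?\<theta> = "\<lambda>\<epsilon>. \<theta>(Inr k := \<theta> (Inr k) + \<epsilon>)"
	let ?f = "\<lambda>\<epsilon>. \<Sum>a\<in>T. c a (?\<theta> \<epsilon>) * (u \<theta> t ^ fst a * (v \<theta> t + \<epsilon> * x t k) ^ snd a)"
	have ue: "u (?\<theta> \<epsilon>) t = u \<theta> t" for \<epsilon> by (simp add: lin_def)
	have ve: "v (?\<theta> \<epsilon>) t = v \<theta> t + \<epsilon> * x t k" for \<epsilon>
	proof -
		have "v (?\<theta> \<epsilon>) t = (\<Sum>i\<in>UNIV. \<theta> (Inr i) * x t i + (if i = k then \<epsilon> * x t k else 0))"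
			unfolding lin_def by (rule sum.cong) (auto simp: distrib_right)
		then show ?thesis by (simp add: sum.distrib lin_def)
	qed
	have "?f \<epsilon> = 0" for \<epsilon> using rel[of "?\<theta> \<epsilon>" t] unfolding plane_monom_def ue ve by simp
	then have 1: "(?f has_field_derivative 0) (at 0)" by simp
	have 2: "(?f has_field_derivative (\<Sum>a\<in>T. D k a \<theta> * (u \<theta> t ^ fst a * v \<theta> t ^ snd a) +
			c a \<theta> * (u \<theta> t ^ fst a * (of_nat (snd a) * v \<theta> t ^ (snd a - 1) * x t k)))) (at 0)"
	proof (rule DERIV_sum)
		fix a
		have d: "((\<lambda>\<epsilon>. u \<theta> t ^ fst a * (v \<theta> t + \<epsilon> * x t k) ^ snd a) has_field_derivative
				u \<theta> t ^ fst a * (of_nat (snd a) * v \<theta> t ^ (snd a - 1) * x t k)) (at 0)"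
			by (auto intro!: derivative_eq_intros)
		from DERIV_mult[OF D_deriv[of a \<theta> k] d]
		show "((\<lambda>\<epsilon>. c a (?\<theta> \<epsilon>) * (u \<theta> t ^ fst a * (v \<theta> t + \<epsilon> * x t k) ^ snd a)) has_field_derivative
				D k a \<theta> * (u \<theta> t ^ fst a * v \<theta> t ^ snd a) +
				c a \<theta> * (u \<theta> t ^ fst a * (of_nat (snd a) * v \<theta> t ^ (snd a - 1) * x t k))) (at 0)"
			by (simp add: algebra_simps)
	qed
	have "(\<Sum>a\<in>T. D k a \<theta> * (u \<theta> t ^ fst a * v \<theta> t ^ snd a)) + W (point \<theta> t) * x t k = 0"
	proof -
		have "W (point \<theta> t) * x t k = (\<Sum>a\<in>T. c a \<theta> * (u \<theta> t ^ fst a * (of_nat (snd a) * v \<theta> t ^ (snd a - 1) * x t k)))"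
			unfolding W_def sum_distrib_right by (rule sum.cong) simp_all
		then show ?thesis using DERIV_unique[OF 1 2] by (simp add: sum.distrib)
	qed
	then show ?thesis by (simp add: G_def eq_neg_iff_add_eq_0 add.commute)
qed

text \<open>The relation with parameters and u fixed, as a polynomial in v: its roots are the
  candidates for the values of v on the section.\<close>

definition A1 :: "(('m + 'm) option => complex) => complex poly" where
	"A1 w = (\<Sum>a\<in>T. monom (c a (\<lambda>k. w (Some k)) * w None ^ fst a) (snd a))"

lemma poly_A1: "poly (A1 w) b = P (case_option b w)"
	by (simp add: A1_def P_def poly_sum poly_monom mult.assoc)

lemma poly_pderiv_A1: "poly (pderiv (A1 w)) b = W (case_option b w)"
proof -
	have "pderiv (A1 w) = (\<Sum>a\<in>T. pderiv (monom (c a (\<lambda>k. w (Some k)) * w None ^ fst a) (snd a)))"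
		unfolding A1_def by (rule higher_pderiv_sum[of 1, simplified])
	then show ?thesis by (simp add: W_def poly_sum poly_monom pderiv_monom mult_ac)
qed

lemma P_P2: "P (case_option b (case_option a \<theta>)) = poly2 (P2 \<theta>) a b" by (simp add: P_def poly2_P2)

lemma degree_A1:
	assumes "lc w \<noteq> 0" shows "degree (A1 w) = curve_degree" "A1 w \<noteq> 0"
proof -
	have "coeff (A1 w) j = (\<Sum>a\<in>T. if snd a = j then c a (\<lambda>k. w (Some k)) * w None ^ fst a else 0)" for j
		by (simp add: A1_def coeff_sum)
	then have co: "coeff (A1 w) j = (\<Sum>i\<le>N. (if (i, j) \<in> T then c (i, j) (\<lambda>k. w (Some k)) else 0) * w None ^ i)" for j
	proof -
		have "coeff (A1 w) j = (\<Sum>a\<in>{a\<in>T. snd a = j}. c a (\<lambda>k. w (Some k)) * w None ^ fst a)"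
			unfolding \<open>coeff (A1 w) j = _\<close> by (rule sum.inter_filter[symmetric, OF finT])
		also have "{a\<in>T. snd a = j} = (\<lambda>i. (i, j)) ` {i. i \<le> N \<and> (i, j) \<in> T}" using T by auto
		also have "(\<Sum>a\<in>\<dots>. c a (\<lambda>k. w (Some k)) * w None ^ fst a) =
				(\<Sum>i | i \<le> N \<and> (i, j) \<in> T. c (i, j) (\<lambda>k. w (Some k)) * w None ^ i)"
			by (subst sum.reindex) (auto simp: inj_on_def)
		also have "\<dots> = (\<Sum>i\<le>N. if (i, j) \<in> T then c (i, j) (\<lambda>k. w (Some k)) * w None ^ i else 0)"
			by (subst sum.inter_filter[symmetric]) auto
		finally show ?thesis by (simp add: if_distrib[of "\<lambda>y. y * _"] cong: if_cong)
	qed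
	have top: "coeff (A1 w) curve_degree = lc w" by (simp add: co lc_eq)
	then show nz: "A1 w \<noteq> 0" using assms by auto
	have "coeff (A1 w) j = 0" if "j > curve_degree" for j
	proof -
		have "(i, j) \<notin> T" for i using that T by auto
		then show ?thesis by (simp add: co)
	qed
	then have "degree (A1 w) \<le> curve_degree" by (intro degree_le) auto
	moreover have "curve_degree \<le> degree (A1 w)" by (rule le_degree) (use top assms in simp)
	ultimately show "degree (A1 w) = curve_degree" by simp
qed

lemma polyfun_point: "polyfun F ==>
	polyfun (\<lambda>y. F (case_option (lin (\<lambda>k. \<theta> (Inr k)) y) (case_option (lin (\<lambda>k. \<theta> (Inl k)) y) \<theta>)))"
proof (erule polyfun_compose)
	show "polyfun (\<lambda>y. case_option (lin (\<lambda>k. \<theta> (Inr k)) y) (case_option (lin (\<lambda>k. \<theta> (Inl k)) y) \<theta>) a)" for a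
		by (cases a; cases "the a") (auto intro!: polyfun_intros)
qed

text \<open>In characteristic 0 the derivative of the relation in v is a nonzero polynomial of
  smaller degree, and no such polynomial vanishes on the curve.\<close>

lemma W_not_vanish:
	assumes "p0 \<theta> \<noteq> 0" shows "\<exists>t. W (point \<theta> t) \<noteq> 0"
proof (rule ccontr)
	assume *: "\<not> ?thesis"
	have d: "poly2 (pderiv (P2 \<theta>)) a b = W (case_option b (case_option a \<theta>))" for a b
	proof -
		have "pderiv (P2 \<theta>) = (\<Sum>a\<in>T. pderiv (monom (monom (c a \<theta>) (fst a)) (snd a)))"
			unfolding P2_def by (rule higher_pderiv_sum[of 1, simplified])
		also have "\<dots> = (\<Sum>a\<in>T. monom (monom (of_nat (snd a) * c a \<theta>) (fst a)) (snd a - 1))"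
			by (intro sum.cong refl) (simp add: pderiv_monom of_nat_poly smult_monom[symmetric] flip: smult_monom)
		finally show ?thesis by (simp add: W_def poly2_sum poly2_monom mult_ac)
	qed
	have deg: "degree (pderiv (P2 \<theta>)) < curve_degree"
		using degree_pderiv[of "P2 \<theta>"] degree_P2[OF assms] curve_degree_pos by simp
	have "pderiv (P2 \<theta>) \<noteq> 0" using pderiv_eq_0_iff[of "P2 \<theta>"] degree_P2[OF assms] curve_degree_pos by simp
	from no_smaller_relation[OF assms this deg] d * show False by simp
qed

lemma prime_point:
	assumes "polyfun A" "polyfun B" "\<And>t. A (point \<theta> t) * B (point \<theta> t) = 0"
	shows "(\<forall>t. A (point \<theta> t) = 0) \<or> (\<forall>t. B (point \<theta> t) = 0)"
	using prime[OF polyfun_point[OF assms(1)] polyfun_point[OF assms(2)], of \<theta> \<theta>] assms(3) by blast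

text \<open>The hyperplane form plays the role of u and a second, fixed form that of v. Generically
  v maps the section bijectively onto the roots of \<open>A1\<close>, which are simple: a root
  determines x as the quotient of G by W and then y as the quotient of Y by e. The set S asks for a
  point y0 above x0 in the closure, so e must not vanish at the recovered point.\<close>

theorem generic_hyperplane_section:
	fixes y :: "'t => 'd => complex"
	assumes e: "polyfun e" "\<exists>t. e (x t) \<noteq> 0" and Y: "\<And>k. polyfun (Y k)" "\<And>k t. e (x t) * y t k = Y k (x t)"
		and p0_nonzero: "p0 \<theta>0 \<noteq> 0"
	defines "S \<equiv> \<lambda>\<zeta>. {x0. (\<exists>y0. \<forall>q. polyfun q --> (\<forall>t. q (case_sum (x t) (y t)) = 0) --> q (case_sum x0 y0) = 0) \<and>
		lin (\<lambda>i. \<zeta> (Some i)) x0 = \<zeta> None}"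
	shows "\<exists>p. polyfun p \<and> (\<exists>\<zeta>. p \<zeta> \<noteq> 0) \<and> (\<forall>\<zeta>. p \<zeta> \<noteq> 0 --> finite (S \<zeta>) \<and> card (S \<zeta>) = curve_degree)"
proof -
	let ?n = curve_degree
	obtain M eh where eh: "polyfun eh" "\<And>z x. (\<forall>k. W z * x k = G k z) ==> eh z = W z ^ M * e x"
		using polyfun_clear_denominator[where n = G, OF e(1) polyfun_W polyfun_G] by blast
	\<comment> \<open>The zeros of B are the bad places: W = 0 means a multiple root, where x cannot be
	  recovered, and eh = 0 is the condition e = 0 cleared of denominators, where y cannot be
	  recovered.\<close>
	define B where "B z = W z * eh z" for z
	have B: "polyfun B" unfolding B_def[abs_def] by (intro polyfun_intros polyfun_W eh)
	obtain m b where b: "\<And>j. polyfun (b j)" "\<And>j z w. b j (z(None := w)) = b j z"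
		"\<And>z. B z = (\<Sum>j\<le>m. b j z * z None ^ j)" using polyfun_expand[OF B, of None] by blast
	have upd: "(case_option s w)(None := s') = case_option s' w" for s s' and w :: "('m + 'm) option => complex"
		by (rule ext) (simp split: option.split)
	define B1 where "B1 w = (\<Sum>j\<le>m. monom (b j (case_option 0 w)) j)" for w
	have B1: "poly (B1 w) s = B (case_option s w)" for w s
	proof -
		have "b j (case_option s w) = b j (case_option 0 w)" for j
			using b(2)[of j "case_option 0 w" s] by (simp add: upd)
		then show ?thesis by (simp add: B1_def poly_sum poly_monom b(3))
	qed
	have degB1: "degree (B1 w) \<le> Suc m" for w
		unfolding B1_def by (rule degree_sum_le) (auto intro: order_trans[OF degree_monom_le])
	\<comment> \<open>The rows of the Sylvester matrix of \<open>A1\<close> and \<open>B1\<close>. The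
	  degree bound for \<open>B1\<close> is taken as \<open>Suc m\<close> because
	  \<open>common_root_dependent\<close> asks for a positive one.\<close>
	define I where "I = (Inl ` {..<Suc m} \<union> Inr ` {..<?n} :: (nat + nat) set)"
	define F where "F a w s = case_sum (\<lambda>i s. s ^ i * poly (A1 w) s) (\<lambda>j s. s ^ j * poly (B1 w) s) a s" for a w s
	have finI: "finite I" by (simp add: I_def)
	have opt: "polyfun (\<lambda>w. H (case_option s w))" if "polyfun H" for H and s :: complex
	proof (rule polyfun_compose[OF that])
		show "polyfun (\<lambda>w. case_option s w a)" for a by (cases a) (auto intro!: polyfun_intros)
	qed
	have pF: "polyfun (\<lambda>w. F a w s)" for a s
		by (cases a) (auto simp: F_def poly_A1 B1 intro!: polyfun_intros opt polyfun_P B)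
	define pl where "pl w = p0 (\<lambda>k. w (Some k)) * lc w" for w
	have pl: "polyfun pl" unfolding pl_def[abs_def]
		by (intro polyfun_intros polyfun_lc polyfun_compose[OF p0])
	obtain a0 where "lc (case_option a0 \<theta>0) \<noteq> 0" using lc_nonzero[OF p0_nonzero] by blast
	then have pl0: "pl (case_option a0 \<theta>0) \<noteq> 0" using p0_nonzero by (simp add: pl_def)
	\<comment> \<open>A permanent dependence of the rows would give E of degree below n in v such that
	  E * B vanishes on the curve. By primality E vanishes there, hence all its coefficients are zero,
	  and then so is the cofactor of \<open>A1\<close>.\<close>
	have "\<exists>w1. pl w1 \<noteq> 0 \<and> indep I (\<lambda>a. F a w1)"
	proof (rule ccontr)
		assume "\<not> ?thesis"
		then have nI: "\<And>w. pl w \<noteq> 0 ==> \<not> indep I (\<lambda>a. F a w)" by blast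
		obtain d w2 where d: "pl w2 \<noteq> 0" "\<And>a. polyfun (d a)" "\<exists>a\<in>I. d a w2 \<noteq> 0"
			"\<And>w s. (\<Sum>a\<in>I. d a w * F a w s) = 0"
			using dependent_relation[of I F, OF finI pF pl pl0 nI] by blast
		define \<theta> where "\<theta> k = w2 (Some k)" for k
		have p0\<theta>: "p0 \<theta> \<noteq> 0" and lcw: "lc w2 \<noteq> 0" using d(1) by (auto simp: pl_def \<theta>_def[abs_def])
		have split: "(\<Sum>i<Suc m. d (Inl i) w * s ^ i) * poly (A1 w) s + (\<Sum>j<?n. d (Inr j) w * s ^ j) * poly (B1 w) s = 0" for w s
		proof -
			have "(\<Sum>a\<in>I. d a w * F a w s) = (\<Sum>i<Suc m. d (Inl i) w * (s ^ i * poly (A1 w) s)) +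
					(\<Sum>j<?n. d (Inr j) w * (s ^ j * poly (B1 w) s))"
				unfolding I_def by (subst sum.union_disjoint) (auto simp: sum.reindex F_def simp del: sum.lessThan_Suc)
			then show ?thesis using d(4)[of w s] by (simp add: sum_distrib_right mult.assoc del: sum.lessThan_Suc)
		qed
		define E where "E z = (\<Sum>j<?n. d (Inr j) (\<lambda>k. z (Some k)) * z None ^ j)" for z :: "('m + 'm) option option => complex"
		have pdz: "polyfun (\<lambda>z. d a (\<lambda>k. z (Some k)))" for a by (rule polyfun_compose[OF d(2)]) (rule polyfun.var)
		have E: "polyfun E" unfolding E_def[abs_def] by (intro polyfun_intros pdz)
		have "E (point \<theta> t) * B (point \<theta> t) = 0" for t
		proof -
			have "P (point \<theta> t) = 0" using P2_vanish[of \<theta> t] by (simp add: P_P2)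
			then show ?thesis using split[of "case_option (u \<theta> t) \<theta>" "v \<theta> t"] by (simp add: poly_A1 B1 E_def)
		qed
		then consider "\<forall>t. E (point \<theta> t) = 0" | "\<forall>t. B (point \<theta> t) = 0" using prime_point[OF E B] by blast
		then have Ev: "\<forall>t. E (point \<theta> t) = 0"
		proof cases
			case 2
			then have "\<And>t. W (point \<theta> t) * eh (point \<theta> t) = 0" by (simp add: B_def)
			from prime_point[OF polyfun_W eh(1) this] W_not_vanish[OF p0\<theta>]
			have eh0: "eh (point \<theta> t) = 0" for t by blast
			have "W (point \<theta> t) ^ M * e (x t) = 0" for t
				using eh(2)[of "point \<theta> t" "x t"] coordinate_identity eh0 by simp
			then have "(\<forall>t. W (point \<theta> t) ^ M = 0) \<or> (\<forall>t. e (x t) = 0)"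
				by (intro prime[OF polyfun_power[OF polyfun_point[OF polyfun_W]] e(1)]) simp
			then show ?thesis using e(2) W_not_vanish[OF p0\<theta>] by auto
		qed
		obtain Q where Q: "\<And>j. j < ?n ==> \<forall>a b. d (Inr j) (case_option a \<theta>) = poly2 (Q j) a b"
		proof -
			have "\<exists>Q. \<forall>a b. d (Inr j) (case_option a \<theta>) = poly2 Q a b" for j
				using polyfun_imp_poly2[OF pdz[of "Inr j"], of \<theta>] by simp
			then show ?thesis using that by metis
		qed
		define q where "q j = poly (Q j) 0" for j
		have q: "poly (q j) a = d (Inr j) (case_option a \<theta>)" if "j < ?n" for j a
			using spec[OF spec[OF Q[OF that], of a], of 0] by (simp add: q_def poly2_def)
		define R where "R = (\<Sum>j<?n. monom (q j) j)"
		have coR: "coeff R j = (if j < ?n then q j else 0)" for j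
			unfolding R_def coeff_sum by (simp add: if_distrib sum.delta' cong: if_cong)
		have Rv: "poly2 R (u \<theta> t) (v \<theta> t) = 0" for t
		proof -
			have "poly2 R a b = E (case_option b (case_option a \<theta>))" for a b
				by (simp add: R_def E_def poly2_sum) (auto intro!: sum.cong simp: poly2_def poly_monom q)
			then show ?thesis using Ev by simp
		qed
		have "R = 0"
		proof (rule ccontr)
			assume "R \<noteq> 0"
			have "degree R < ?n" by (rule degree_lessI) (use coR \<open>R \<noteq> 0\<close> curve_degree_pos in auto)
			from no_smaller_relation[OF p0\<theta> \<open>R \<noteq> 0\<close> this Rv] show False .
		qed
		have w2: "w2 = case_option (w2 None) \<theta>" by (rule ext) (simp add: \<theta>_def split: option.split)
		have z2: "d (Inr j) w2 = 0" if "j < ?n" for j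
			using coR[of j] \<open>R = 0\<close> that q[OF that, of "w2 None"] w2 by simp
		define r where "r = (\<Sum>i<Suc m. monom (d (Inl i) w2) i)"
		have cor: "coeff r i = (if i < Suc m then d (Inl i) w2 else 0)" for i
			unfolding r_def coeff_sum by (simp add: if_distrib sum.delta' cong: if_cong del: sum.lessThan_Suc)
		have "poly (r * A1 w2) s = 0" for s
		proof -
			have "(\<Sum>j<?n. d (Inr j) w2 * s ^ j) = 0" using z2 by simp
			then show ?thesis using split[of w2 s]
				by (simp add: r_def poly_sum poly_monom del: sum.lessThan_Suc)
		qed
		then have "r * A1 w2 = 0" using poly_all_0_iff_0 by blast
		then have "r = 0" using degree_A1(2)[OF lcw] by simp
		then have z1: "d (Inl i) w2 = 0" if "i < Suc m" for i using cor[of i] that by simp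
		from d(3) show False using z1 z2 by (auto simp: I_def)
	qed
	then obtain w1 where w1: "pl w1 \<noteq> 0" "indep I (\<lambda>a. F a w1)" by blast
	obtain p2 where p2: "polyfun p2" "p2 w1 \<noteq> 0" "\<And>w. p2 w \<noteq> 0 ==> indep I (\<lambda>a. F a w)"
		using indep_certificate[of I F, OF finI pF w1(2)] by blast
	\<comment> \<open>Only the hyperplane varies with \<zeta>; the second form is frozen at the one of
	  w1.\<close>
	define emb where "emb \<zeta> = (\<lambda>a. case a of None => \<zeta> None | Some (Inl k) => \<zeta> (Some k)
		| Some (Inr k) => w1 (Some (Inr k)))" for \<zeta> :: "'m option => complex"
	define p where "p \<zeta> = pl (emb \<zeta>) * p2 (emb \<zeta>)" for \<zeta>
	have pemb: "polyfun (\<lambda>\<zeta>. emb \<zeta> a)" for a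
		unfolding emb_def by (cases a; cases "the a") (auto intro: polyfun_intros)
	have "polyfun p"
		unfolding p_def[abs_def] using polyfun_compose[OF pl pemb] polyfun_compose[OF p2(1) pemb]
		by (intro polyfun_intros)
	moreover have "\<exists>\<zeta>. p \<zeta> \<noteq> 0"
	proof -
		have "emb (case_option (w1 None) (\<lambda>k. w1 (Some (Inl k)))) = w1"
			by (rule ext) (simp add: emb_def split: option.split sum.split)
		then show ?thesis using w1(1) p2(2)
			by (intro exI[of _ "case_option (w1 None) (\<lambda>k. w1 (Some (Inl k)))"]) (simp add: p_def)
	qed
	moreover have "finite (S \<zeta>) \<and> card (S \<zeta>) = ?n" if pz: "p \<zeta> \<noteq> 0" for \<zeta>
	proof -
		define w where "w = emb \<zeta>"
		define \<theta> where "\<theta> k = w (Some k)" for k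
		have w_eq: "w = case_option (\<zeta> None) \<theta>"
			by (rule ext) (simp add: \<theta>_def w_def emb_def split: option.split)
		have th: "\<theta> (Inl k) = \<zeta> (Some k)" for k by (simp add: \<theta>_def w_def emb_def)
		have p0\<theta>: "p0 \<theta> \<noteq> 0" and lcw: "lc w \<noteq> 0" and I: "indep I (\<lambda>a. F a w)"
			using pz p2(3)[of w] by (auto simp: p_def pl_def w_def \<theta>_def[abs_def])
		have nz: "B (case_option s w) \<noteq> 0" if "poly (A1 w) s = 0" for s
		proof
			assume "B (case_option s w) = 0"
			then have "poly (B1 w) s = 0" by (simp add: B1)
			from common_root_dependent[OF _ degB1 degree_A1(2)[OF lcw] curve_degree_pos _ that this]
			have "\<not> indep I (case_sum (\<lambda>i v. v ^ i * poly (A1 w) v) (\<lambda>j v. v ^ j * poly (B1 w) v))"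
				using degree_A1(1)[OF lcw] by (simp add: I_def)
			moreover have "(\<lambda>a. F a w) = case_sum (\<lambda>i v. v ^ i * poly (A1 w) v) (\<lambda>j v. v ^ j * poly (B1 w) v)"
				by (rule ext)+ (simp add: F_def)
			ultimately show False using I by simp
		qed
		define Rt where "Rt = {s. poly (A1 w) s = 0}"
		have R: "finite Rt \<and> card Rt = ?n"
			using card_simple_roots[OF degree_A1(2)[OF lcw]] nz degree_A1(1)[OF lcw]
			unfolding Rt_def by (auto simp: poly_pderiv_A1 B_def)
		let ?g = "lin (\<lambda>k. \<theta> (Inr k))"
		have onS: "q x0 = 0" if "x0 \<in> S \<zeta>" "polyfun q" "\<And>t. q (x t) = 0" for q x0
		proof -
			obtain y0 where y0: "\<And>q. polyfun q ==> (\<forall>t. q (case_sum (x t) (y t)) = 0) ==> q (case_sum x0 y0) = 0"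
				using \<open>x0 \<in> S \<zeta>\<close> unfolding S_def by blast
			have "polyfun (\<lambda>z :: 'm + 'd => complex. q (\<lambda>k. z (Inl k)))"
				by (rule polyfun_compose[OF that(2)]) (rule polyfun.var)
			from y0[OF this] that(3) show ?thesis by simp
		qed
		have mem: "?g x0 \<in> Rt" and coord: "W (case_option (?g x0) w) * x0 k = G k (case_option (?g x0) w)"
			if "x0 \<in> S \<zeta>" for x0 k
		proof -
			have h: "lin (\<lambda>k. \<theta> (Inl k)) x0 = \<zeta> None" using that by (simp add: S_def th)
			have "P (case_option (?g x0) (case_option (lin (\<lambda>k. \<theta> (Inl k)) x0) \<theta>)) = 0"
				by (rule onS[OF that polyfun_point[OF polyfun_P]]) (use P2_vanish[of \<theta>] in \<open>simp add: P_P2\<close>)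
			then show "?g x0 \<in> Rt" by (simp add: Rt_def poly_A1 h w_eq)
			have "(\<lambda>y. W (case_option (?g y) (case_option (lin (\<lambda>k. \<theta> (Inl k)) y) \<theta>)) * y k -
					G k (case_option (?g y) (case_option (lin (\<lambda>k. \<theta> (Inl k)) y) \<theta>))) x0 = 0"
				by (rule onS[OF that]) (use coordinate_identity[of \<theta>] in
						\<open>auto intro!: polyfun_intros polyfun_point polyfun_W polyfun_G\<close>)
			then show "W (case_option (?g x0) w) * x0 k = G k (case_option (?g x0) w)" by (simp add: h w_eq)
		qed
		have inj: "inj_on ?g (S \<zeta>)"
		proof (rule inj_onI)
			fix x0 x1 assume *: "x0 \<in> S \<zeta>" "x1 \<in> S \<zeta>" "?g x0 = ?g x1"
			have "W (case_option (?g x0) w) \<noteq> 0" using nz mem[OF *(1)] by (auto simp: Rt_def B_def)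
			then have "x0 k = x1 k" for k
				using coord[OF *(1), of k] coord[OF *(2), of k] *(3) by (metis mult_left_cancel)
			then show "x0 = x1" by auto
		qed
		have "\<exists>x0\<in>S \<zeta>. ?g x0 = s" if s: "s \<in> Rt" for s
		proof -
			\<comment> \<open>At a root s no point of the curve is known yet. The point is built from the
			  formulas for x and y, and everything that vanishes on the curve is transported to it by
			  \<open>vanish_at_roots\<close>.\<close>
			define z where "z = case_option s w"
			have Bz: "W z \<noteq> 0" "eh z \<noteq> 0" using nz[of s] s by (auto simp: Rt_def B_def z_def)
			define x0 where "x0 k = G k z / W z" for k
			have Wx: "W z * x0 k = G k z" for k using Bz by (simp add: x0_def)
			have "e x0 \<noteq> 0" using eh(2)[of z x0] Wx Bz by auto
			define y0 where "y0 k = Y k x0 / e x0" for k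
			have ey: "e x0 * y0 k = Y k x0" for k using \<open>e x0 \<noteq> 0\<close> by (simp add: y0_def)
			have root: "poly2 (P2 \<theta>) (\<zeta> None) s = 0" using s by (simp add: Rt_def poly_A1 w_eq P_P2)
			have vanz: "H z = 0" if "polyfun H" "\<And>t. H (point \<theta> t) = 0" for H
				using vanish_at_roots[OF p0\<theta> that root] lcw by (simp add: z_def w_eq)
			have vanx: "q x0 = 0" if q: "polyfun q" "\<And>t. q (x t) = 0" for q
			proof -
				obtain M' q' where q': "polyfun q'" "\<And>z x. (\<forall>k. W z * x k = G k z) ==> q' z = W z ^ M' * q x"
					using polyfun_clear_denominator[where n = G, OF q(1) polyfun_W polyfun_G] by blast
				have "q' (point \<theta> t) = 0" for t
					using q'(2)[of "point \<theta> t" "x t"] coordinate_identity q(2) by simp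
				from vanz[OF q'(1) this] have "W z ^ M' * q x0 = 0" using q'(2)[of z x0] Wx by simp
				then show ?thesis using Bz by simp
			qed
			have vanxy: "q (case_sum x0 y0) = 0" if q: "polyfun q" "\<And>t. q (case_sum (x t) (y t)) = 0" for q
			proof -
				let ?N = "case_sum (\<lambda>k x. e x * x k) Y"
				have "polyfun (?N k)" for k by (cases k) (auto intro!: polyfun_intros e Y)
				from polyfun_clear_denominator[where n = ?N, OF q(1) e(1) this]
				obtain M' q' where q': "polyfun q'" "\<And>x xy. (\<forall>k. e x * xy k = ?N k x) ==> q' x = e x ^ M' * q xy"
					by blast
				have "q' (x t) = 0" for t
				proof -
					have "e (x t) * case_sum (x t) (y t) k = ?N k (x t)" for k by (cases k) (auto simp: Y)
					then show ?thesis using q'(2)[of "x t" "case_sum (x t) (y t)"] q(2) by simp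
				qed
				from vanx[OF q'(1) this] have "q' x0 = 0" .
				moreover have "e x0 * case_sum x0 y0 k = ?N k x0" for k by (cases k) (auto simp: ey)
				ultimately have "e x0 ^ M' * q (case_sum x0 y0) = 0" using q'(2)[of x0 "case_sum x0 y0"] by simp
				then show ?thesis using \<open>e x0 \<noteq> 0\<close> by simp
			qed
			\<comment> \<open>The identity between the form of the vector G and the corresponding plane
			  coordinate times W holds along the curve, hence also at z. So the new point lies on the
			  hyperplane and has v-value s.\<close>
			have lin_eq: "lin (\<lambda>k. \<theta> (\<sigma> k)) x0 = z a"
				if "\<And>t. lin (\<lambda>k. \<theta> (\<sigma> k)) (x t) = point \<theta> t a" for \<sigma> a
			proof -
				have "(\<lambda>z. (\<Sum>k\<in>UNIV. z (Some (Some (\<sigma> k))) * G k z) - z a * W z) z = 0"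
				proof (rule vanz)
					show "polyfun (\<lambda>z. (\<Sum>k\<in>UNIV. z (Some (Some (\<sigma> k))) * G k z) - z a * W z)"
						by (intro polyfun_intros polyfun_W polyfun_G)
					show "(\<Sum>k\<in>UNIV. point \<theta> t (Some (Some (\<sigma> k))) * G k (point \<theta> t)) - point \<theta> t a * W (point \<theta> t) = 0" for t
						unfolding coordinate_identity[symmetric] that[of t, symmetric]
						by (simp add: lin_def sum_distrib_right mult_ac)
				qed
				then have "W z * (lin (\<lambda>k. \<theta> (\<sigma> k)) x0 - z a) = 0"
					by (simp add: Wx[symmetric] lin_def right_diff_distrib sum_distrib_left mult_ac)
						 (simp add: z_def w_eq mult_ac)
				then show ?thesis using Bz by simp
			qed
			have "lin (\<lambda>k. \<theta> (Inl k)) x0 = z (Some None)" by (rule lin_eq) simp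
			then have "lin (\<lambda>k. \<zeta> (Some k)) x0 = \<zeta> None" by (simp add: z_def w_eq th)
			then have "x0 \<in> S \<zeta>" unfolding S_def using vanxy by blast
			moreover have "?g x0 = z None" by (rule lin_eq) simp
			ultimately show ?thesis by (intro bexI[of _ x0]) (simp add: z_def)
		qed
		then have "?g ` S \<zeta> = Rt" using mem by blast
		then have "bij_betw ?g (S \<zeta>) Rt" using inj by (simp add: bij_betw_def)
		then show ?thesis using R by (metis bij_betw_finite bij_betw_same_card)
	qed
	ultimately show ?thesis by blast
qed

end

context prime_curve
begin

theorem curve_degree_count:
	fixes y :: "'t => 'd => complex"
	assumes e: "polyfun e" "\<exists>t. e (x t) \<noteq> 0" and Y: "\<And>k. polyfun (Y k)" "\<And>k t. e (x t) * y t k = Y k (x t)"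
	defines "S \<equiv> \<lambda>\<zeta>. {x0. (\<exists>y0. \<forall>q. polyfun q --> (\<forall>t. q (case_sum (x t) (y t)) = 0) --> q (case_sum x0 y0) = 0) \<and>
		lin (\<lambda>i. \<zeta> (Some i)) x0 = \<zeta> None}"
	shows "\<exists>p. polyfun p \<and> (\<exists>\<zeta>. p \<zeta> \<noteq> 0) \<and> (\<forall>\<zeta>. p \<zeta> \<noteq> 0 --> finite (S \<zeta>) \<and> card (S \<zeta>) = curve_degree)"
proof -
	obtain T c p0 \<theta>1 where *: "T \<subseteq> {..N} \<times> {..curve_degree}" "\<And>a. polyfun (c a)"
		"\<And>\<theta> t. (\<Sum>a\<in>T. c a \<theta> * plane_monom x a \<theta> t) = 0" "polyfun p0" "p0 \<theta>1 \<noteq> 0"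
		"\<And>\<theta>. p0 \<theta> \<noteq> 0 ==> indep ({..N} \<times> {..<curve_degree}) (\<lambda>a. plane_monom x a \<theta>)"
		"\<And>\<theta>. p0 \<theta> \<noteq> 0 ==> \<exists>i. (i, curve_degree) \<in> T \<and> c (i, curve_degree) \<theta> \<noteq> 0"
		using relation_family_exists by blast
	define D where "D k a = (SOME p'. polyfun p' \<and>
		(\<forall>\<theta>. ((\<lambda>\<epsilon>. c a (\<theta>(Inr k := \<theta> (Inr k) + \<epsilon>))) has_field_derivative p' \<theta>) (at 0)))" for k a
	have D: "polyfun (D k a) \<and>
		(\<forall>\<theta>. ((\<lambda>\<epsilon>. c a (\<theta>(Inr k := \<theta> (Inr k) + \<epsilon>))) has_field_derivative D k a \<theta>) (at 0))" for k a
		unfolding D_def by (rule someI_ex[OF polyfun_deriv[OF *(2)]])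
	interpret relation_family x N T c p0 D by unfold_locales (use * D in auto)
	show ?thesis unfolding S_def by (rule generic_hyperplane_section[OF e Y *(5)])
qed

end

section \<open>A bound for the number of solutions of complementarity equations\<close>

text \<open>\<open>V X W a b\<close> is spanned by the products of \<open>a\<close> forms from \<open>X\<close> and \<open>b\<close> forms from \<open>W\<close>.\<close>

inductive V :: "('w => complex) set => ('w => complex) set => nat => nat => ('w => complex) => bool"
	for X W where
	V_one: "V X W 0 0 (\<lambda>_. 1)"
| V_zero: "V X W a b (\<lambda>_. 0)"
| V_add: "V X W a b f ==> V X W a b g ==> V X W a b (\<lambda>w. f w + g w)"
| V_scale: "V X W a b f ==> V X W a b (\<lambda>w. c * f w)"
| V_X: "\<alpha> \<in> X ==> V X W a b f ==> V X W (Suc a) b (\<lambda>w. \<alpha> w * f w)"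
| V_W: "\<beta> \<in> W ==> V X W a b f ==> V X W a (Suc b) (\<lambda>w. \<beta> w * f w)"

text \<open>The part of \<open>V X W a b\<close> generated by the products \<open>x i * z i\<close>, by the forms in \<open>C \<subseteq> X\<close> and by
	the forms in \<open>E \<subseteq> W\<close>; each generator uses up its share of the two degrees.\<close>

inductive Idl :: "('w => complex) set => ('w => complex) set => ('i => 'w => complex) =>
		('i => 'w => complex) => 'i set => ('w => complex) set => ('w => complex) set =>
		nat => nat => ('w => complex) => bool"
	for X W x z R C E where
	Id_zero: "Idl X W x z R C E a b (\<lambda>_. 0)"
| Id_add: "Idl X W x z R C E a b f ==> Idl X W x z R C E a b g ==> Idl X W x z R C E a b (\<lambda>w. f w + g w)"
| Id_scale: "Idl X W x z R C E a b f ==> Idl X W x z R C E a b (\<lambda>w. c * f w)"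
| Id_prod: "i \<in> R ==> V X W a b f ==> Idl X W x z R C E (Suc a) (Suc b) (\<lambda>w. x i w * z i w * f w)"
| Id_C: "\<alpha> \<in> C ==> V X W a b f ==> Idl X W x z R C E (Suc a) b (\<lambda>w. \<alpha> w * f w)"
| Id_E: "\<beta> \<in> E ==> V X W a b f ==> Idl X W x z R C E a (Suc b) (\<lambda>w. \<beta> w * f w)"

text \<open>In a generated product a factor from X may be buried under factors from W; commuting
  them brings it to the front, at the price of a linear combination.\<close>

lemma V_Suc_left: "V X W a' b f ==> a' = Suc a ==> f \<in> lspan {(\<lambda>w. \<alpha> w * g w) |\<alpha> g. \<alpha> \<in> X \<and> V X W a b g}"
proof (induction arbitrary: a rule: V.induct)
	case (V_X \<alpha> a0 b f)
	then show ?case by (intro lspan.base) auto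
next
	case (V_W \<beta> a' b f)
	from V_W.IH[OF V_W.prems] show ?case
	proof induction
		case zero
		show ?case by (simp add: lspan.zero)
	next
		case (base g)
		then obtain \<alpha> g' where "g = (\<lambda>w. \<alpha> w * g' w)" "\<alpha> \<in> X" "V X W a b g'" by blast
		then have "(\<lambda>w. \<beta> w * g w) = (\<lambda>w. \<alpha> w * (\<beta> w * g' w)) \<and> \<alpha> \<in> X \<and> V X W a (Suc b) (\<lambda>w. \<beta> w * g' w)"
			using V_W.hyps(1) by (auto intro: V.V_W)
		then show ?case by (intro lspan.base CollectI) (rule exI[of _ \<alpha>], rule exI[of _ "\<lambda>w. \<beta> w * g' w"])
	next
		case (add f g)
		then show ?case using lspan.add[OF add.IH] by (simp add: distrib_left)
	next
		case (scale f c)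
		then show ?case using lspan.scale[OF scale.IH, of c] by (simp add: mult.left_commute)
	qed
qed (auto intro: lspan.intros)

lemma V_Suc_right: "V X W a b' f ==> b' = Suc b ==> f \<in> lspan {(\<lambda>w. \<beta> w * g w) |\<beta> g. \<beta> \<in> W \<and> V X W a b g}"
proof (induction arbitrary: b rule: V.induct)
	case (V_W \<alpha> a0 b f)
	then show ?case by (intro lspan.base) auto
next
	case (V_X \<alpha> a b' f)
	from V_X.IH[OF V_X.prems] show ?case
	proof induction
		case zero
		show ?case by (simp add: lspan.zero)
	next
		case (base g)
		then obtain \<beta> g' where "g = (\<lambda>w. \<beta> w * g' w)" "\<beta> \<in> W" "V X W a b g'" by blast
		then have "(\<lambda>w. \<alpha> w * g w) = (\<lambda>w. \<beta> w * (\<alpha> w * g' w)) \<and> \<beta> \<in> W \<and> V X W (Suc a) b (\<lambda>w. \<alpha> w * g' w)"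
			using V_X.hyps(1) by (auto intro: V.V_X)
		then show ?case by (intro lspan.base CollectI) (rule exI[of _ \<beta>], rule exI[of _ "\<lambda>w. \<alpha> w * g' w"])
	next
		case (add f g)
		then show ?case using lspan.add[OF add.IH] by (simp add: distrib_left)
	next
		case (scale f c)
		then show ?case using lspan.scale[OF scale.IH, of c] by (simp add: mult.left_commute)
	qed
qed (auto intro: lspan.intros)

lemma lspan_subset_Id:
	assumes "f \<in> lspan S" "\<And>g. g \<in> S ==> Idl X W x z R C E a b (\<lambda>w. g w * h w)"
	shows "Idl X W x z R C E a b (\<lambda>w. f w * h w)" using assms(1)
proof induction
	case zero
	show ?case by (simp add: Id_zero)
next
	case (base g)
	then show ?case by (rule assms(2))
next
	case (add f g)
	then show ?case using Id_add[OF add.IH] by (simp add: distrib_right)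
next
	case (scale f c)
	then show ?case using Id_scale[OF scale.IH, of c] by (simp add: mult.assoc)
qed

lemma lspan_subset_Id':
	assumes "f \<in> lspan S" "\<And>g. g \<in> S ==> Idl X W x z R C E a b g"
	shows "Idl X W x z R C E a b f"
	proof -
	have "Idl X W x z R C E a b (\<lambda>w. f w * (\<lambda>_. 1) w)"
		by (rule lspan_subset_Id[OF assms(1)]) (simp add: assms(2))
	then show ?thesis by simp
qed

lemma Id_mult_X: "Idl X W x z R C E a b f ==> \<alpha> \<in> X ==> Idl X W x z R C E (Suc a) b (\<lambda>w. \<alpha> w * f w)"
proof (induction rule: Idl.induct)
	case (Id_zero a b) then show ?case by (simp add: Idl.Id_zero)
next
	case (Id_add a b f g)
	then show ?case using Idl.Id_add[OF Id_add.IH(1)[OF Id_add.prems] Id_add.IH(2)[OF Id_add.prems]] by (simp add: distrib_left)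
next
	case (Id_scale a b f c)
	then show ?case using Idl.Id_scale[OF Id_scale.IH[OF Id_scale.prems], of c] by (simp add: mult.left_commute)
next
	case (Id_prod i a b f)
	then show ?case using Idl.Id_prod[OF Id_prod.hyps(1) V_X[OF Id_prod.prems Id_prod.hyps(2)]]
		by (simp add: mult_ac)
next
	case (Id_C \<gamma> a b f)
	then show ?case using Idl.Id_C[OF Id_C.hyps(1) V_X[OF Id_C.prems Id_C.hyps(2)]] by (simp add: mult_ac)
next
	case (Id_E \<gamma> a b f)
	then show ?case using Idl.Id_E[OF Id_E.hyps(1) V_X[OF Id_E.prems Id_E.hyps(2)]] by (simp add: mult_ac)
qed

lemma Id_mult_W: "Idl X W x z R C E a b f ==> \<beta> \<in> W ==> Idl X W x z R C E a (Suc b) (\<lambda>w. \<beta> w * f w)"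
proof (induction rule: Idl.induct)
	case (Id_zero a b) then show ?case by (simp add: Idl.Id_zero)
next
	case (Id_add a b f g)
	then show ?case using Idl.Id_add[OF Id_add.IH(1)[OF Id_add.prems] Id_add.IH(2)[OF Id_add.prems]] by (simp add: distrib_left)
next
	case (Id_scale a b f c)
	then show ?case using Idl.Id_scale[OF Id_scale.IH[OF Id_scale.prems], of c] by (simp add: mult.left_commute)
next
	case (Id_prod i a b f)
	then show ?case using Idl.Id_prod[OF Id_prod.hyps(1) V_W[OF Id_prod.prems Id_prod.hyps(2)]]
		by (simp add: mult_ac)
next
	case (Id_C \<gamma> a b f)
	then show ?case using Idl.Id_C[OF Id_C.hyps(1) V_W[OF Id_C.prems Id_C.hyps(2)]] by (simp add: mult_ac)
next
	case (Id_E \<gamma> a b f)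
	then show ?case using Idl.Id_E[OF Id_E.hyps(1) V_W[OF Id_E.prems Id_E.hyps(2)]] by (simp add: mult_ac)
qed

lemma Id_mono: "Idl X W x z R C E a b f ==> R \<subseteq> R' ==> Idl X W x z R' C E a b f"
	by (induction rule: Idl.induct) (auto intro: Idl.intros)

text \<open>All contributions of the generator \<beta> are collected in one summand. It needs
  W-degree at least one, and in degree 0 the generator contributes nothing, hence the
  disjunction.\<close>

lemma Id_split_E: "Idl X W x z R C (insert \<beta> E) a b f ==>
		Idl X W x z R C E a b f \<or> (\<exists>b' f' q. b = Suc b' \<and> Idl X W x z R C E a b f' \<and> V X W a b' q \<and>
			f = (\<lambda>w. f' w + \<beta> w * q w))"
proof (cases b)
	case 0
	show "Idl X W x z R C (insert \<beta> E) a b f ==> ?thesis"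
	proof -
		have "Idl X W x z R C (insert \<beta> E) a b f ==> b = 0 ==> Idl X W x z R C E a b f"
			by (induction rule: Idl.induct) (auto intro: Idl.intros)
		then show "Idl X W x z R C (insert \<beta> E) a b f ==> ?thesis" using 0 by simp
	qed
next
	case (Suc b0)
	assume "Idl X W x z R C (insert \<beta> E) a b f"
	then have "\<forall>b'. b = Suc b' --> (\<exists>f' q. Idl X W x z R C E a b f' \<and> V X W a b' q \<and> f = (\<lambda>w. f' w + \<beta> w * q w))"
	proof (induction rule: Idl.induct)
		case (Id_zero a b)
		show ?case by (intro allI impI exI[of _ "\<lambda>_. 0"] conjI) (auto intro: Idl.intros V.intros)
	next
		case (Id_add a b f g)
		show ?case
		proof (intro allI impI)
			fix b' assume b: "b = Suc b'"
			from Id_add.IH b obtain f' q g' q' where *: "Idl X W x z R C E a b f'" "V X W a b' q" "f = (\<lambda>w. f' w + \<beta> w * q w)"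
				"Idl X W x z R C E a b g'" "V X W a b' q'" "g = (\<lambda>w. g' w + \<beta> w * q' w)" by blast
			show "\<exists>h p. Idl X W x z R C E a b h \<and> V X W a b' p \<and> (\<lambda>w. f w + g w) = (\<lambda>w. h w + \<beta> w * p w)"
				using * by (intro exI[of _ "\<lambda>w. f' w + g' w"] exI[of _ "\<lambda>w. q w + q' w"])
					(auto intro: Idl.Id_add V_add simp: algebra_simps)
		qed
	next
		case (Id_scale a b f c)
		show ?case
		proof (intro allI impI)
			fix b' assume b: "b = Suc b'"
			from Id_scale.IH b obtain f' q where *: "Idl X W x z R C E a b f'" "V X W a b' q" "f = (\<lambda>w. f' w + \<beta> w * q w)"
				by blast
			show "\<exists>h p. Idl X W x z R C E a b h \<and> V X W a b' p \<and> (\<lambda>w. c * f w) = (\<lambda>w. h w + \<beta> w * p w)"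
				using * by (intro exI[of _ "\<lambda>w. c * f' w"] exI[of _ "\<lambda>w. c * q w"])
					(auto intro: Idl.Id_scale V_scale simp: algebra_simps)
		qed
	next
		case (Id_prod i a b f)
		then show ?case
			by (intro allI impI exI[of _ "\<lambda>w. x i w * z i w * f w"] exI[of _ "\<lambda>_. 0"]) (auto intro: Idl.Id_prod V_zero)
	next
		case (Id_C \<alpha> a b f)
		then show ?case
			by (intro allI impI exI[of _ "\<lambda>w. \<alpha> w * f w"] exI[of _ "\<lambda>_. 0"]) (auto intro: Idl.Id_C V_zero)
	next
		case (Id_E \<gamma> a b f)
		show ?case
		proof (cases "\<gamma> = \<beta>")
			case True
			then show ?thesis using Id_E
				by (intro allI impI exI[of _ "\<lambda>_. 0"] exI[of _ f]) (auto intro: Idl.Id_zero)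
		next
			case False
			then show ?thesis using Id_E
				by (intro allI impI exI[of _ "\<lambda>w. \<gamma> w * f w"] exI[of _ "\<lambda>_. 0"]) (auto intro: Idl.Id_E V_zero)
		qed
	qed
	then show ?thesis using Suc by blast
qed

lemma Id_split_C:
	assumes "Idl X W x z R (insert \<alpha> C) E a b f"
	shows "a = Suc a' ==> \<exists>f' q. Idl X W x z R C E a b f' \<and> V X W a' b q \<and> f = (\<lambda>w. f' w + \<alpha> w * q w)"
		and "a = 0 ==> Idl X W x z R C E a b f"
proof -
	show "Idl X W x z R C E a b f" if "a = 0"
		using assms that by (induction rule: Idl.induct) (auto intro: Idl.intros)
	have "\<forall>a'. a = Suc a' --> (\<exists>f' q. Idl X W x z R C E a b f' \<and> V X W a' b q \<and> f = (\<lambda>w. f' w + \<alpha> w * q w))"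
		using assms
	proof (induction rule: Idl.induct)
		case (Id_zero a b)
		show ?case by (intro allI impI exI[of _ "\<lambda>_. 0"] conjI) (auto intro: Idl.intros V.intros)
	next
		case (Id_add a b f g)
		show ?case
		proof (intro allI impI)
			fix a' assume b: "a = Suc a'"
			from Id_add.IH b obtain f' q g' q' where *: "Idl X W x z R C E a b f'" "V X W a' b q" "f = (\<lambda>w. f' w + \<alpha> w * q w)"
				"Idl X W x z R C E a b g'" "V X W a' b q'" "g = (\<lambda>w. g' w + \<alpha> w * q' w)" by blast
			show "\<exists>h p. Idl X W x z R C E a b h \<and> V X W a' b p \<and> (\<lambda>w. f w + g w) = (\<lambda>w. h w + \<alpha> w * p w)"
				using * by (intro exI[of _ "\<lambda>w. f' w + g' w"] exI[of _ "\<lambda>w. q w + q' w"])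
					(auto intro: Idl.Id_add V_add simp: algebra_simps)
		qed
	next
		case (Id_scale a b f c)
		show ?case
		proof (intro allI impI)
			fix a' assume b: "a = Suc a'"
			from Id_scale.IH b obtain f' q where *: "Idl X W x z R C E a b f'" "V X W a' b q" "f = (\<lambda>w. f' w + \<alpha> w * q w)"
				by blast
			show "\<exists>h p. Idl X W x z R C E a b h \<and> V X W a' b p \<and> (\<lambda>w. c * f w) = (\<lambda>w. h w + \<alpha> w * p w)"
				using * by (intro exI[of _ "\<lambda>w. c * f' w"] exI[of _ "\<lambda>w. c * q w"])
					(auto intro: Idl.Id_scale V_scale simp: algebra_simps)
		qed
	next
		case (Id_prod i a b f)
		then show ?case
			by (intro allI impI exI[of _ "\<lambda>w. x i w * z i w * f w"] exI[of _ "\<lambda>_. 0"]) (auto intro: Idl.Id_prod V_zero)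
	next
		case (Id_E \<beta> a b f)
		then show ?case
			by (intro allI impI exI[of _ "\<lambda>w. \<beta> w * f w"] exI[of _ "\<lambda>_. 0"]) (auto intro: Idl.Id_E V_zero)
	next
		case (Id_C \<gamma> a b f)
		show ?case
		proof (cases "\<gamma> = \<alpha>")
			case True
			then show ?thesis using Id_C
				by (intro allI impI exI[of _ "\<lambda>_. 0"] exI[of _ f]) (auto intro: Idl.Id_zero)
		next
			case False
			then show ?thesis using Id_C
				by (intro allI impI exI[of _ "\<lambda>w. \<gamma> w * f w"] exI[of _ "\<lambda>_. 0"]) (auto intro: Idl.Id_C V_zero)
		qed
	qed
	then show "a = Suc a' ==> \<exists>f' q. Idl X W x z R C E a b f' \<and> V X W a' b q \<and> f = (\<lambda>w. f' w + \<alpha> w * q w)"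
		by blast
qed

text \<open>Modulo the ideal, \<open>V X W (k + s) k\<close> is spanned by at most \<open>n\<close> functions, for all \<open>k\<close> together.\<close>

definition red :: "('w => complex) set => ('w => complex) set => ('i => 'w => complex) =>
		('i => 'w => complex) => nat => 'i set => ('w => complex) set => ('w => complex) set => nat => bool" where
	"red X W x z s R C E n \<longleftrightarrow> (\<exists>G. finite G \<and> card G \<le> n \<and>
		 (\<forall>k. \<forall>f. V X W (k + s) k f --> (\<exists>g\<in>lspan G. \<exists>h. Idl X W x z R C E (k + s) k h \<and> f = (\<lambda>w. g w + h w))))"

section \<open>Reduction steps modulo the products of paired forms\<close>

lemma lspan_image_mult: "f \<in> lspan G ==> (\<lambda>w. \<alpha> w * f w) \<in> lspan ((\<lambda>g w. \<alpha> w * g w) ` G)"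
proof (induction rule: lspan.induct)
	case zero show ?case by (simp add: lspan.zero)
next
	case (base g) then show ?case by (intro lspan.base imageI)
next
	case (add f g)
	then show ?case using lspan.add[OF add.IH] by (simp add: distrib_left)
next
	case (scale f c)
	then show ?case using lspan.scale[OF scale.IH, of c] by (simp add: mult.left_commute)
qed

text \<open>The common pattern of the reduction steps: \<open>f\<close> is reduced with one more form \<open>\<alpha>\<close> killed, and the
	cofactor of \<open>\<alpha>\<close> is reduced in turn.\<close>

lemma red_step:
	assumes "red X W x z s1 R1 C1 E1 n1" "red X W x z s2 R2 C2 E2 n2"
		and "\<And>k f. Idl X W x z R1 C1 E1 (k + s1) k f ==> Idl X W x z R C E (k + s1) k f \<or>
			(\<exists>k' f' q. Idl X W x z R C E (k + s1) k f' \<and> V X W (k' + s2) k' q \<and> f = (\<lambda>w. f' w + \<alpha> w * q w) \<and>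
				(\<forall>h. Idl X W x z R2 C2 E2 (k' + s2) k' h --> Idl X W x z R C E (k + s1) k (\<lambda>w. \<alpha> w * h w)))"
	shows "red X W x z s1 R C E (n1 + n2)"
proof -
	obtain G1 where G1: "finite G1" "card G1 \<le> n1" "\<And>k f. V X W (k + s1) k f ==>
		\<exists>g\<in>lspan G1. \<exists>h. Idl X W x z R1 C1 E1 (k + s1) k h \<and> f = (\<lambda>w. g w + h w)"
		using assms(1) unfolding red_def by blast
	obtain G2 where G2: "finite G2" "card G2 \<le> n2" "\<And>k f. V X W (k + s2) k f ==>
		\<exists>g\<in>lspan G2. \<exists>h. Idl X W x z R2 C2 E2 (k + s2) k h \<and> f = (\<lambda>w. g w + h w)"
		using assms(2) unfolding red_def by blast
	let ?m = "\<lambda>g w. \<alpha> w * g w"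
	let ?G = "G1 \<union> ?m ` G2"
	have "card ?G \<le> card G1 + card (?m ` G2)" by (rule card_Un_le)
	also have "card (?m ` G2) \<le> card G2" using G2(1) by (rule card_image_le)
	finally have card: "card ?G \<le> n1 + n2" using G1(2) G2(2) by linarith
	have "\<exists>g\<in>lspan ?G. \<exists>h. Idl X W x z R C E (k + s1) k h \<and> f = (\<lambda>w. g w + h w)" if Vf: "V X W (k + s1) k f" for f k
	proof -
		obtain g h where gh: "g \<in> lspan G1" "Idl X W x z R1 C1 E1 (k + s1) k h" "f = (\<lambda>w. g w + h w)"
			using G1(3)[OF Vf] by blast
		have g: "g \<in> lspan ?G" by (rule lspan_mono[OF gh(1)]) simp
		from assms(3)[OF gh(2)] show ?thesis
		proof
			assume "Idl X W x z R C E (k + s1) k h"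
			then show ?thesis using g gh(3) by blast
		next
			assume "\<exists>k' f' q. Idl X W x z R C E (k + s1) k f' \<and> V X W (k' + s2) k' q \<and> h = (\<lambda>w. f' w + \<alpha> w * q w) \<and>
				(\<forall>h. Idl X W x z R2 C2 E2 (k' + s2) k' h --> Idl X W x z R C E (k + s1) k (\<lambda>w. \<alpha> w * h w))"
			then obtain k' f' q where q: "Idl X W x z R C E (k + s1) k f'" "V X W (k' + s2) k' q"
				"h = (\<lambda>w. f' w + \<alpha> w * q w)"
				"\<And>h. Idl X W x z R2 C2 E2 (k' + s2) k' h ==> Idl X W x z R C E (k + s1) k (\<lambda>w. \<alpha> w * h w)" by blast
			obtain g2 h2 where gh2: "g2 \<in> lspan G2" "Idl X W x z R2 C2 E2 (k' + s2) k' h2" "q = (\<lambda>w. g2 w + h2 w)"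
				using G2(3)[OF q(2)] by blast
			have "(\<lambda>w. \<alpha> w * g2 w) \<in> lspan ?G" by (rule lspan_mono[OF lspan_image_mult[OF gh2(1)]]) simp
			then have "(\<lambda>w. g w + \<alpha> w * g2 w) \<in> lspan ?G" using g by (rule lspan.add[rotated])
			moreover have "Idl X W x z R C E (k + s1) k (\<lambda>w. f' w + \<alpha> w * h2 w)"
				by (rule Id_add[OF q(1) q(4)[OF gh2(2)]])
			moreover have "f = (\<lambda>w. (g w + \<alpha> w * g2 w) + (f' w + \<alpha> w * h2 w))"
				unfolding gh(3) q(3) gh2(3) by (simp add: algebra_simps)
			ultimately show ?thesis
				by (intro bexI[of _ "\<lambda>w. g w + \<alpha> w * g2 w"] exI[of _ "\<lambda>w. f' w + \<alpha> w * h2 w"] conjI)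
		qed
	qed
	then show ?thesis unfolding red_def using card G1(1) G2(1) by (intro exI[of _ ?G]) blast
qed

text \<open>After killing \<open>z m\<close>, what is lost is a multiple of \<open>z m\<close>, and
  its cofactor matters only modulo \<open>x m\<close>, since the product of the two is in the ideal.
  In bidegree (k, k) the cofactor has bidegree (k, k - 1), so the excess s passes from 0 to
  1.\<close>

lemma red_split_z:
	assumes "red X W x z 0 R C (insert (z m) E) n1" "red X W x z 1 R (insert (x m) C) E n2"
		and "x m \<in> X" "z m \<in> W"
	shows "red X W x z 0 (insert m R) C E (n1 + n2)"
proof (rule red_step[OF assms(1,2), where \<alpha> = "z m"])
	fix k f assume "Idl X W x z R C (insert (z m) E) (k + 0) k f"
	then have f: "Idl X W x z R C (insert (z m) E) k k f" by simp
	show "Idl X W x z (insert m R) C E (k + 0) k f \<or>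
			(\<exists>k' f' q. Idl X W x z (insert m R) C E (k + 0) k f' \<and> V X W (k' + 1) k' q \<and> f = (\<lambda>w. f' w + z m w * q w) \<and>
				(\<forall>h. Idl X W x z R (insert (x m) C) E (k' + 1) k' h --> Idl X W x z (insert m R) C E (k + 0) k (\<lambda>w. z m w * h w)))"
		using Id_split_E[OF f]
	proof
		assume "Idl X W x z R C E k k f"
		then show ?thesis using Id_mono[OF _ subset_insertI] by auto
	next
		assume "\<exists>b' f' q. k = Suc b' \<and> Idl X W x z R C E k k f' \<and> V X W k b' q \<and> f = (\<lambda>w. f' w + z m w * q w)"
		then obtain k' f' q where *: "k = Suc k'" "Idl X W x z R C E k k f'" "V X W k k' q"
			"f = (\<lambda>w. f' w + z m w * q w)" by blast
		have "Idl X W x z (insert m R) C E k k (\<lambda>w. z m w * h w)"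
			if h: "Idl X W x z R (insert (x m) C) E (k' + 1) k' h" for h
		proof -
			obtain h' p where hp: "Idl X W x z R C E (k' + 1) k' h'" "V X W k' k' p" "h = (\<lambda>w. h' w + x m w * p w)"
				using Id_split_C(1)[OF h, of k'] by auto
			have 1: "Idl X W x z (insert m R) C E k k (\<lambda>w. z m w * h' w)"
				using Id_mono[OF Id_mult_W[OF hp(1) assms(4)] subset_insertI] *(1) by simp
			have 2: "Idl X W x z (insert m R) C E k k (\<lambda>w. x m w * z m w * p w)"
				unfolding *(1) by (rule Id_prod[OF insertI1 hp(2)])
			show ?thesis using Id_add[OF 1 2] by (simp add: hp(3) algebra_simps)
		qed
		then show ?thesis using * Id_mono[OF *(2) subset_insertI]
			by (intro disjI2 exI[of _ k'] exI[of _ f'] exI[of _ q]) auto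
	qed
qed

text \<open>The same split with the roles exchanged: the cofactor of \<open>x m\<close> in bidegree
  (k + 1, k) has bidegree (k, k), so s returns from 1 to 0. Only the excesses 0 and 1 ever
  occur.\<close>

lemma red_split_x:
	assumes "red X W x z 1 R (insert (x m) C) E n1" "red X W x z 0 R C (insert (z m) E) n2"
		and "x m \<in> X" "z m \<in> W"
	shows "red X W x z 1 (insert m R) C E (n1 + n2)"
proof (rule red_step[OF assms(1,2), where \<alpha> = "x m"])
	fix k f assume f: "Idl X W x z R (insert (x m) C) E (k + 1) k f"
	obtain f' q where *: "Idl X W x z R C E (k + 1) k f'" "V X W k k q" "f = (\<lambda>w. f' w + x m w * q w)"
		using Id_split_C(1)[OF f, of k] by auto
	have "Idl X W x z (insert m R) C E (k + 1) k (\<lambda>w. x m w * h w)"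
		if h: "Idl X W x z R C (insert (z m) E) (k + 0) k h" for h
	proof -
		have h': "Idl X W x z R C (insert (z m) E) k k h" using h by simp
		show ?thesis using Id_split_E[OF h']
		proof
			assume "Idl X W x z R C E k k h"
			then show ?thesis using Id_mono[OF Id_mult_X[OF _ assms(3)] subset_insertI] by simp
		next
			assume "\<exists>b' f' q. k = Suc b' \<and> Idl X W x z R C E k k f' \<and> V X W k b' q \<and> h = (\<lambda>w. f' w + z m w * q w)"
			then obtain k' h' p where hp: "k = Suc k'" "Idl X W x z R C E k k h'" "V X W k k' p"
				"h = (\<lambda>w. h' w + z m w * p w)" by blast
			have 1: "Idl X W x z (insert m R) C E (k + 1) k (\<lambda>w. x m w * h' w)"
				using Id_mono[OF Id_mult_X[OF hp(2) assms(3)] subset_insertI] by simp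
			have 2: "Idl X W x z (insert m R) C E (k + 1) k (\<lambda>w. x m w * z m w * p w)"
				using Id_prod[of m "insert m R" X W "Suc k'" k' p x z C E] hp(1,3) by simp
			show ?thesis using Id_add[OF 1 2] by (simp add: hp(4) algebra_simps)
		qed
	qed
	then show "Idl X W x z (insert m R) C E (k + 1) k f \<or>
			(\<exists>k' f' q. Idl X W x z (insert m R) C E (k + 1) k f' \<and> V X W (k' + 0) k' q \<and> f = (\<lambda>w. f' w + x m w * q w) \<and>
				(\<forall>h. Idl X W x z R C (insert (z m) E) (k' + 0) k' h --> Idl X W x z (insert m R) C E (k + 1) k (\<lambda>w. x m w * h w)))"
		using * Id_mono[OF *(1) subset_insertI] by (intro disjI2 exI[of _ k] exI[of _ f'] exI[of _ q]) auto
qed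

text \<open>When both kinds of forms come from the same set, a factor can be counted in either
  degree. This restores the excess after a form has been removed on the wrong side.\<close>

lemma V_shift: "V X X a b f ==> b = Suc b' ==> V X X (Suc a) b' f"
	and V_shift': "V X X a b f ==> a = Suc a' ==> V X X a' (Suc b) f"
proof -
	show "V X X (Suc a) b' f" if "V X X a b f" "b = Suc b'" using V_Suc_right[OF that]
		by (induction rule: lspan.induct) (auto intro: V.intros)
	show "V X X a' (Suc b) f" if "V X X a b f" "a = Suc a'" using V_Suc_left[OF that]
		by (induction rule: lspan.induct) (auto intro: V.intros)
qed

text \<open>When all forms lie in \<open>X\<close>, also the forms \<open>z m\<close> may be killed as members of \<open>C\<close>.\<close>

lemma red_split_X0:
	assumes "red X X x z 0 R (insert (z m) C) {} n1" "red X X x z 1 R (insert (x m) C) {} n2"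
		and "x m \<in> X" "z m \<in> X"
	shows "red X X x z 0 (insert m R) C {} (n1 + n2)"
proof (rule red_step[OF assms(1,2), where \<alpha> = "z m"])
	fix k f assume "Idl X X x z R (insert (z m) C) {} (k + 0) k f"
	then have f: "Idl X X x z R (insert (z m) C) {} k k f" by simp
	show "Idl X X x z (insert m R) C {} (k + 0) k f \<or>
			(\<exists>k' f' q. Idl X X x z (insert m R) C {} (k + 0) k f' \<and> V X X (k' + 1) k' q \<and> f = (\<lambda>w. f' w + z m w * q w) \<and>
				(\<forall>h. Idl X X x z R (insert (x m) C) {} (k' + 1) k' h --> Idl X X x z (insert m R) C {} (k + 0) k (\<lambda>w. z m w * h w)))"
	proof (cases k)
		case 0
		then show ?thesis using Id_mono[OF Id_split_C(2)[OF f] subset_insertI] by auto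
	next
		case (Suc k')
		obtain f' q where *: "Idl X X x z R C {} k k f'" "V X X k' k q" "f = (\<lambda>w. f' w + z m w * q w)"
			using Id_split_C(1)[OF f Suc] by blast
		have q: "V X X (k' + 1) k' q" using V_shift[OF *(2) Suc] by simp
		have "Idl X X x z (insert m R) C {} k k (\<lambda>w. z m w * h w)"
			if h: "Idl X X x z R (insert (x m) C) {} (k' + 1) k' h" for h
		proof -
			obtain h' p where hp: "Idl X X x z R C {} (k' + 1) k' h'" "V X X k' k' p" "h = (\<lambda>w. h' w + x m w * p w)"
				using Id_split_C(1)[OF h, of k'] by auto
			have 1: "Idl X X x z (insert m R) C {} k k (\<lambda>w. z m w * h' w)"
				using Id_mono[OF Id_mult_W[OF hp(1) assms(4)] subset_insertI] Suc by simp
			have 2: "Idl X X x z (insert m R) C {} k k (\<lambda>w. x m w * z m w * p w)"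
				unfolding Suc by (rule Id_prod[OF insertI1 hp(2)])
			show ?thesis using Id_add[OF 1 2] by (simp add: hp(3) algebra_simps)
		qed
		then show ?thesis using * q Id_mono[OF *(1) subset_insertI]
			by (intro disjI2 exI[of _ k'] exI[of _ f'] exI[of _ q]) auto
	qed
qed

lemma red_split_X1:
	assumes "red X X x z 1 R (insert (x m) C) {} n1" "red X X x z 0 R (insert (z m) C) {} n2"
		and "x m \<in> X" "z m \<in> X"
	shows "red X X x z 1 (insert m R) C {} (n1 + n2)"
proof (rule red_step[OF assms(1,2), where \<alpha> = "x m"])
	fix k f assume f: "Idl X X x z R (insert (x m) C) {} (k + 1) k f"
	obtain f' q where *: "Idl X X x z R C {} (k + 1) k f'" "V X X k k q" "f = (\<lambda>w. f' w + x m w * q w)"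
		using Id_split_C(1)[OF f, of k] by auto
	have "Idl X X x z (insert m R) C {} (k + 1) k (\<lambda>w. x m w * h w)"
		if h: "Idl X X x z R (insert (z m) C) {} (k + 0) k h" for h
	proof -
		have h': "Idl X X x z R (insert (z m) C) {} k k h" using h by simp
		show ?thesis
		proof (cases k)
			case 0
			then show ?thesis
				using Id_mono[OF Id_mult_X[OF Id_split_C(2)[OF h'] assms(3)] subset_insertI] by simp
		next
			case (Suc k')
			obtain h' p where hp: "Idl X X x z R C {} k k h'" "V X X k' k p" "h = (\<lambda>w. h' w + z m w * p w)"
				using Id_split_C(1)[OF h' Suc] by blast
			have p: "V X X (Suc k') k' p" by (rule V_shift[OF hp(2) Suc])
			have 1: "Idl X X x z (insert m R) C {} (k + 1) k (\<lambda>w. x m w * h' w)"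
				using Id_mono[OF Id_mult_X[OF hp(1) assms(3)] subset_insertI] by simp
			have 2: "Idl X X x z (insert m R) C {} (k + 1) k (\<lambda>w. x m w * z m w * p w)"
				using Id_prod[of m "insert m R" X X "Suc k'" k' p x z C "{}"] Suc p by simp
			show ?thesis using Id_add[OF 1 2] by (simp add: hp(3) algebra_simps)
		qed
	qed
	then show "Idl X X x z (insert m R) C {} (k + 1) k f \<or>
			(\<exists>k' f' q. Idl X X x z (insert m R) C {} (k + 1) k f' \<and> V X X (k' + 0) k' q \<and> f = (\<lambda>w. f' w + x m w * q w) \<and>
				(\<forall>h. Idl X X x z R (insert (z m) C) {} (k' + 0) k' h --> Idl X X x z (insert m R) C {} (k + 1) k (\<lambda>w. x m w * h w)))"
		using * Id_mono[OF *(1) subset_insertI] by (intro disjI2 exI[of _ k] exI[of _ f'] exI[of _ q]) auto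
qed

lemma lspan_insert: "f \<in> lspan (insert g S) ==> \<exists>c f'. f' \<in> lspan S \<and> f = (\<lambda>w. f' w + c * g w)"
proof (induction rule: lspan.induct)
	case zero
	show ?case by (intro exI[of _ 0] exI[of _ "\<lambda>_. 0"]) (simp add: lspan.zero)
next
	case (base h)
	show ?case
	proof (cases "h = g")
		case True
		then show ?thesis by (intro exI[of _ 1] exI[of _ "\<lambda>_. 0"]) (simp add: lspan.zero)
	next
		case False
		then show ?thesis using base by (intro exI[of _ 0] exI[of _ h]) (simp add: lspan.base)
	qed
next
	case (add f h)
	then obtain c f' d h' where "f' \<in> lspan S" "f = (\<lambda>w. f' w + c * g w)"
		"h' \<in> lspan S" "h = (\<lambda>w. h' w + d * g w)" by blast
	then show ?case
		by (intro exI[of _ "c + d"] exI[of _ "\<lambda>w. f' w + h' w"]) (auto intro: lspan.add simp: algebra_simps)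
next
	case (scale f k)
	then obtain c f' where "f' \<in> lspan S" "f = (\<lambda>w. f' w + c * g w)" by blast
	then show ?case
		by (intro exI[of _ "k * c"] exI[of _ "\<lambda>w. k * f' w"]) (auto intro: lspan.scale simp: algebra_simps)
qed

text \<open>The subspaces of \<open>X\<close> and \<open>W\<close> are not assumed to be closed under linear combinations, so the
	hypotheses are phrased with \<open>lspan\<close>.\<close>

lemma red_leaf:
	assumes "\<And>\<alpha>. \<alpha> \<in> X ==> \<alpha> \<in> lspan (insert (x i) C)" "\<And>\<alpha>. \<alpha> \<in> X ==> \<alpha> \<in> lspan (insert (z i) C)"
		and x: "x i \<in> X" and s: "s \<le> 1"
	shows "red X X x z s {i} C {} 1"
proof -
	let ?Idl = "Idl X X x z {i} C {}"
	\<comment> \<open>Modulo C every form is a multiple of \<open>x i\<close> and also a multiple of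
	  \<open>z i\<close>. Using the first for one factor and the second for the other makes the product
	  a multiple of \<open>x i * z i\<close>.\<close>
	have two: "?Idl (Suc a) (Suc b) (\<lambda>w. \<alpha> w * (\<beta> w * f w))" if t: "\<alpha> \<in> X" "\<beta> \<in> X" "V X X a b f" for \<alpha> \<beta> f a b
	proof -
		obtain c \<alpha>' where \<alpha>: "\<alpha>' \<in> lspan C" "\<alpha> = (\<lambda>w. \<alpha>' w + c * x i w)" using lspan_insert[OF assms(1)[OF t(1)]] by blast
		obtain d \<beta>' where \<beta>: "\<beta>' \<in> lspan C" "\<beta> = (\<lambda>w. \<beta>' w + d * z i w)" using lspan_insert[OF assms(2)[OF t(2)]] by blast
		have 1: "?Idl (Suc a) (Suc b) (\<lambda>w. \<alpha>' w * (\<beta> w * f w))"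
			by (rule lspan_subset_Id[OF \<alpha>(1)]) (rule Id_C, auto intro: V_W t)
		have 2: "?Idl (Suc a) (Suc b) (\<lambda>w. \<beta>' w * (x i w * f w))"
			by (rule lspan_subset_Id[OF \<beta>(1)]) (rule Id_C, auto intro: V_W x t)
		have 3: "?Idl (Suc a) (Suc b) (\<lambda>w. x i w * z i w * f w)" by (rule Id_prod) (auto intro: t)
		show ?thesis using Id_add[OF 1 Id_add[OF Id_scale[OF 2, of c] Id_scale[OF 3, of "c * d"]]]
			by (simp add: \<alpha>(2) \<beta>(2) algebra_simps)
	qed
	have all: "?Idl (Suc a) (Suc b) f" if f: "V X X (Suc a) (Suc b) f" for a b f
	proof (rule lspan_subset_Id'[OF V_Suc_left[OF f refl]])
		fix g assume "g \<in> {(\<lambda>w. \<alpha> w * h w) |\<alpha> h. \<alpha> \<in> X \<and> V X X a (Suc b) h}"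
		then obtain \<alpha> h where g: "g = (\<lambda>w. \<alpha> w * h w)" "\<alpha> \<in> X" "V X X a (Suc b) h" by blast
		have "?Idl (Suc a) (Suc b) (\<lambda>w. h w * \<alpha> w)"
		proof (rule lspan_subset_Id[OF V_Suc_right[OF g(3) refl]])
			fix h' assume "h' \<in> {(\<lambda>w. \<beta> w * f w) |\<beta> f. \<beta> \<in> X \<and> V X X a b f}"
			then obtain \<beta> f where "h' = (\<lambda>w. \<beta> w * f w)" "\<beta> \<in> X" "V X X a b f" by blast
			then show "?Idl (Suc a) (Suc b) (\<lambda>w. h' w * \<alpha> w)" using two[OF g(2), of \<beta> a b f] by (simp add: mult_ac)
		qed
		then show "?Idl (Suc a) (Suc b) g" by (simp add: g(1) mult.commute)
	qed
	have zero: "f \<in> lspan {\<lambda>_. 1}" if "V X X a b f" "a = 0" "b = 0" for f a b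
		using that by (induction rule: V.induct) (auto intro: lspan.intros)
	have s01: "s = 0 \<or> s = 1" using s by auto
	\<comment> \<open>Everything of positive W-degree is in the ideal, so only one bidegree remains:
	  constants for s = 0, and multiples of \<open>x i\<close> for s = 1.\<close>
	define G where "G = (if s = 0 then {\<lambda>_. 1} else {x i})"
	have "\<exists>g\<in>lspan G. \<exists>h. ?Idl (k + s) k h \<and> f = (\<lambda>w. g w + h w)" if f: "V X X (k + s) k f" for k f
	proof (cases k)
		case (Suc k')
		then have "?Idl (k + s) k f" using all[of "k' + s" k' f] f by simp
		then show ?thesis by (intro bexI[of _ "\<lambda>_. 0"] exI[of _ f]) (auto intro: lspan.zero)
	next
		case k: 0
		show ?thesis
		proof (cases "s = 0")
			case True
			then have "f \<in> lspan G" using zero[OF f] k by (simp add: G_def)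
			then show ?thesis by (intro bexI[of _ f] exI[of _ "\<lambda>_. 0"]) (auto intro: Id_zero)
		next
			case False
			then have s1: "s = 1" using s01 by simp
			have "V X X (Suc 0) 0 f" using f k s1 by simp
			from V_Suc_left[OF this refl]
			have "\<exists>g\<in>lspan G. \<exists>h. ?Idl (Suc 0) 0 h \<and> f = (\<lambda>w. g w + h w)"
			proof induction
				case zero
				show ?case by (intro bexI[of _ "\<lambda>_. 0"] exI[of _ "\<lambda>_. 0"]) (auto intro: lspan.zero Id_zero)
			next
				case (base g)
				then obtain \<alpha> h where g: "g = (\<lambda>w. \<alpha> w * h w)" "\<alpha> \<in> X" "V X X 0 0 h" by blast
				obtain r where r: "h = (\<lambda>_. r)" using lspan_explicit[OF zero[OF g(3)]] by auto
				obtain c \<alpha>' where \<alpha>: "\<alpha>' \<in> lspan C" "\<alpha> = (\<lambda>w. \<alpha>' w + c * x i w)" using lspan_insert[OF assms(1)[OF g(2)]] by blast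
				have "?Idl (Suc 0) 0 (\<lambda>w. \<alpha>' w * h w)"
					by (rule lspan_subset_Id[OF \<alpha>(1)]) (rule Id_C, auto intro: g)
				moreover have "(\<lambda>w. (r * c) * x i w) \<in> lspan G" using False by (intro lspan.scale lspan.base) (simp add: G_def)
				moreover have "g = (\<lambda>w. (r * c) * x i w + \<alpha>' w * h w)" by (simp add: g(1) \<alpha>(2) r algebra_simps)
				ultimately show ?case
					by (intro bexI[of _ "\<lambda>w. (r * c) * x i w"] exI[of _ "\<lambda>w. \<alpha>' w * h w"] conjI)
			next
				case (add f1 f2)
				then obtain g1 h1 g2 h2 where "g1 \<in> lspan G" "?Idl (Suc 0) 0 h1" "f1 = (\<lambda>w. g1 w + h1 w)"
					"g2 \<in> lspan G" "?Idl (Suc 0) 0 h2" "f2 = (\<lambda>w. g2 w + h2 w)" by blast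
				then show ?case by (intro bexI[of _ "\<lambda>w. g1 w + g2 w"] exI[of _ "\<lambda>w. h1 w + h2 w"])
						(auto intro: lspan.add Id_add simp: algebra_simps)
			next
				case (scale f1 c)
				then obtain g1 h1 where "g1 \<in> lspan G" "?Idl (Suc 0) 0 h1" "f1 = (\<lambda>w. g1 w + h1 w)" by blast
				then show ?case by (intro bexI[of _ "\<lambda>w. c * g1 w"] exI[of _ "\<lambda>w. c * h1 w"])
						(auto intro: lspan.scale Id_scale simp: algebra_simps)
			qed
			then show ?thesis using k s1 by simp
		qed
	qed
	then show ?thesis unfolding red_def by (intro exI[of _ G]) (auto simp: G_def)
qed

text \<open>Phase two of the reduction: the complete intersection of the quadrics \<open>x i * z i\<close>.\<close>

lemma red_quadrics:
	assumes "finite R" "R \<noteq> {}" "s \<le> 1"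
		and "\<And>i. i \<in> R ==> x i \<in> X" "\<And>i. i \<in> R ==> z i \<in> X"
		and "\<And>A \<alpha>. A \<subseteq> R ==> \<alpha> \<in> X ==> \<alpha> \<in> lspan (C \<union> x ` A \<union> z ` (R - A))"
	shows "red X X x z s R C {} (2 ^ (card R - 1))" using assms
proof (induction R arbitrary: s C rule: finite_ne_induct)
	case (singleton i)
	show ?case
	proof -
		have "red X X x z s {i} C {} 1"
		proof (rule red_leaf)
			show "\<alpha> \<in> lspan (insert (x i) C)" if "\<alpha> \<in> X" for \<alpha>
				using singleton.prems(4)[of "{i}" \<alpha>] that by simp
			show "\<alpha> \<in> lspan (insert (z i) C)" if "\<alpha> \<in> X" for \<alpha>
				using singleton.prems(4)[of "{}" \<alpha>] that by simp
		qed (use singleton in auto)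
		then show ?thesis by simp
	qed
next
	case (insert m R)
	have pow: "2 ^ (card (insert m R) - 1) = 2 ^ (card R - 1) + (2 ^ (card R - 1) :: nat)"
	proof -
		have "card R > 0" using insert.hyps by (simp add: card_gt_0_iff)
		then show ?thesis using insert.hyps by (cases "card R") auto
	qed
	have kill_x: "red X X x z s' R (insert (x m) C) {} (2 ^ (card R - 1))" if "s' \<le> 1" for s'
	proof (rule insert.IH[OF that])
		show "\<alpha> \<in> lspan (insert (x m) C \<union> x ` A \<union> z ` (R - A))" if "A \<subseteq> R" "\<alpha> \<in> X" for A \<alpha>
		proof -
			have "insert m R - insert m A = R - A" using insert.hyps by auto
			then show ?thesis using insert.prems(4)[of "insert m A" \<alpha>] that by (auto simp: insert_commute)
		qed
	qed (use insert.prems in auto)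
	have kill_z: "red X X x z s' R (insert (z m) C) {} (2 ^ (card R - 1))" if "s' \<le> 1" for s'
	proof (rule insert.IH[OF that])
		show "\<alpha> \<in> lspan (insert (z m) C \<union> x ` A \<union> z ` (R - A))" if "A \<subseteq> R" "\<alpha> \<in> X" for A \<alpha>
		proof -
			have "insert m R - A = insert m (R - A)" using insert.hyps that by auto
			then show ?thesis using insert.prems(4)[of A \<alpha>] that by (auto simp: insert_commute)
		qed
	qed (use insert.prems in auto)
	have "s = 0 \<or> s = 1" using insert.prems(1) by auto
	then show ?case
	proof
		assume "s = 0"
		then show ?thesis unfolding pow
			using red_split_X0[OF kill_z[of 0] kill_x[of 1]] insert.prems by simp
	next
		assume "s = 1"
		then show ?thesis unfolding pow
			using red_split_X1[OF kill_x[of 1] kill_z[of 0]] insert.prems by simp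
	qed
qed

section \<open>From the quadrics to the general count\<close>

lemma lspan_Un:
	assumes "f \<in> lspan (A \<union> B)"
	shows "\<exists>a\<in>lspan A. \<exists>b\<in>lspan B. f = (\<lambda>w. a w + b w)" using assms
proof induction
	case zero
	show ?case by (intro bexI[of _ "\<lambda>_. 0"]) (auto intro: lspan.zero)
next
	case (base g)
	then show ?case
	proof
		assume "g \<in> A"
		then show ?thesis by (intro bexI[of _ g] bexI[of _ "\<lambda>_. 0"]) (auto intro: lspan.intros)
	next
		assume "g \<in> B"
		then show ?thesis by (intro bexI[of _ "\<lambda>_. 0"] bexI[of _ g]) (auto intro: lspan.intros)
	qed
next
	case (add f g)
	then obtain a b a' b' where "a \<in> lspan A" "b \<in> lspan B" "f = (\<lambda>w. a w + b w)"
		"a' \<in> lspan A" "b' \<in> lspan B" "g = (\<lambda>w. a' w + b' w)" by blast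
	then show ?case
		by (intro bexI[of _ "\<lambda>w. a w + a' w"] bexI[of _ "\<lambda>w. b w + b' w"]) (auto intro: lspan.add)
next
	case (scale f c)
	then obtain a b where "a \<in> lspan A" "b \<in> lspan B" "f = (\<lambda>w. a w + b w)" by blast
	then show ?case
		by (intro bexI[of _ "\<lambda>w. c * a w"] bexI[of _ "\<lambda>w. c * b w"]) (auto intro: lspan.scale simp: distrib_left)
qed

lemma lspan_subset: "f \<in> lspan A ==> A \<subseteq> lspan B ==> f \<in> lspan B"
	by (induction rule: lspan.induct) (auto intro: lspan.intros)

lemma lspan_diff: "f \<in> lspan A ==> g \<in> lspan A ==> (\<lambda>w. f w - g w) \<in> lspan A"
	using lspan.add[of f A "\<lambda>w. (-1) * g w"] lspan.scale[of g A "-1"] by simp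

lemma V_mono: "V X W a b f ==> W \<subseteq> W' ==> V X W' a b f" by (induction rule: V.induct) (auto intro: V.intros)

text \<open>Modulo E every form of W is congruent to one of X. So factors from W may be replaced by
  factors from X, and each \<open>z i\<close> by the congruent form \<zeta> i of X.\<close>

lemma red_transfer:
	assumes "red X X x \<zeta> s R C {} n" "X \<subseteq> W"
		and W: "\<And>\<beta>. \<beta> \<in> W ==> \<exists>\<alpha>\<in>X. \<exists>\<eta>\<in>lspan E. \<beta> = (\<lambda>w. \<alpha> w + \<eta> w)"
		and z: "\<And>i. i \<in> R ==> (\<lambda>w. z i w - \<zeta> i w) \<in> lspan E"
		and x: "\<And>i. i \<in> R ==> x i \<in> X"
	shows "red X W x z s R C E n"
proof -
	obtain G where G: "finite G" "card G \<le> n" "\<And>k f. V X X (k + s) k f ==>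
		\<exists>g\<in>lspan G. \<exists>h. Idl X X x \<zeta> R C {} (k + s) k h \<and> f = (\<lambda>w. g w + h w)"
		using assms(1) unfolding red_def by blast
	have E: "Idl X W x z R C E a (Suc b) (\<lambda>w. \<eta> w * f w)" if "\<eta> \<in> lspan E" "V X W a b f" for \<eta> f a b
		by (rule lspan_subset_Id[OF that(1)]) (rule Id_E[OF _ that(2)])
	have reduce: "\<exists>g h. V X X a b g \<and> Idl X W x z R C E a b h \<and> f = (\<lambda>w. g w + h w)" if "V X W a b f" for a b f
		using that
	proof induction
		case V_one
		show ?case by (intro exI[of _ "\<lambda>_. 1"] exI[of _ "\<lambda>_. 0"]) (auto intro: V.V_one Id_zero)
	next
		case (V_zero a b)
		show ?case by (intro exI[of _ "\<lambda>_. 0"]) (auto intro: V.V_zero Id_zero)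
	next
		case (V_add a b f g)
		then obtain f1 h1 g1 h2 where "V X X a b f1" "Idl X W x z R C E a b h1" "f = (\<lambda>w. f1 w + h1 w)"
			"V X X a b g1" "Idl X W x z R C E a b h2" "g = (\<lambda>w. g1 w + h2 w)" by blast
		then show ?case
			by (intro exI[of _ "\<lambda>w. f1 w + g1 w"] exI[of _ "\<lambda>w. h1 w + h2 w"]) (auto intro: V.V_add Id_add)
	next
		case (V_scale a b f c)
		then obtain f1 h1 where "V X X a b f1" "Idl X W x z R C E a b h1" "f = (\<lambda>w. f1 w + h1 w)" by blast
		then show ?case by (intro exI[of _ "\<lambda>w. c * f1 w"] exI[of _ "\<lambda>w. c * h1 w"])
				(auto intro: V.V_scale Id_scale simp: distrib_left)
	next
		case (V_X \<alpha> a b f)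
		then obtain f1 h1 where *: "V X X a b f1" "Idl X W x z R C E a b h1" "f = (\<lambda>w. f1 w + h1 w)" by blast
		show ?case using V.V_X[OF V_X.hyps(1) *(1)] Id_mult_X[OF *(2) V_X.hyps(1)]
			by (intro exI[of _ "\<lambda>w. \<alpha> w * f1 w"] exI[of _ "\<lambda>w. \<alpha> w * h1 w"]) (simp add: *(3) distrib_left)
	next
		case (V_W \<beta> a b f)
		then obtain f1 h1 where *: "V X X a b f1" "Idl X W x z R C E a b h1" "f = (\<lambda>w. f1 w + h1 w)" by blast
		obtain \<alpha> \<eta> where \<beta>: "\<alpha> \<in> X" "\<eta> \<in> lspan E" "\<beta> = (\<lambda>w. \<alpha> w + \<eta> w)" using W[OF V_W.hyps(1)] by blast
		have 1: "Idl X W x z R C E a (Suc b) (\<lambda>w. \<eta> w * f1 w)" by (rule E[OF \<beta>(2) V_mono[OF *(1) assms(2)]])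
		show ?case using V.V_W[OF \<beta>(1) *(1)] Id_add[OF 1 Id_mult_W[OF *(2) V_W.hyps(1)]]
			by (intro exI[of _ "\<lambda>w. \<alpha> w * f1 w"] exI[of _ "\<lambda>w. \<eta> w * f1 w + \<beta> w * h1 w"])
				(simp add: *(3) \<beta>(3) algebra_simps)
	qed
	have incl: "Idl X W x z R C E a b h" if "Idl X X x \<zeta> R C {} a b h" for a b h using that
	proof induction
		case (Id_prod i a b f)
		have Vf: "V X W a b f" by (rule V_mono[OF Id_prod.hyps(2) assms(2)])
		have 1: "Idl X W x z R C E (Suc a) (Suc b) (\<lambda>w. (z i w - \<zeta> i w) * (x i w * f w))"
			by (rule E[OF z[OF Id_prod.hyps(1)] V_X[OF x[OF Id_prod.hyps(1)] Vf]])
		show ?case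
			using Id_add[OF Idl.Id_prod[OF Id_prod.hyps(1) Vf] Id_scale[OF 1, of "-1"]] by (simp add: algebra_simps)
	next
		case (Id_C \<alpha> a b f)
		then show ?case by (intro Idl.Id_C V_mono[OF Id_C.hyps(2) assms(2)])
	qed (auto intro: Idl.intros)
	have "\<exists>g\<in>lspan G. \<exists>h. Idl X W x z R C E (k + s) k h \<and> f = (\<lambda>w. g w + h w)" if Vf: "V X W (k + s) k f" for k f
	proof -
		obtain f1 h1 where 1: "V X X (k + s) k f1" "Idl X W x z R C E (k + s) k h1" "f = (\<lambda>w. f1 w + h1 w)"
			using reduce[OF Vf] by blast
		obtain g h where 2: "g \<in> lspan G" "Idl X X x \<zeta> R C {} (k + s) k h" "f1 = (\<lambda>w. g w + h w)"
			using G(3)[OF 1(1)] by blast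
		show ?thesis by (rule bexI[OF _ 2(1)], rule exI[of _ "\<lambda>w. h w + h1 w"])
				(simp add: 1(3) 2(3) Id_add[OF incl[OF 2(2)] 1(2)] add.assoc)
	qed
	then show ?thesis unfolding red_def using G(1,2) by (intro exI[of _ G]) blast
qed

lemma binomial_prefix_step:
	assumes "\<rho> > 0" "q \<ge> 1"
	shows "(\<Sum>i<\<rho>. q choose i) = (\<Sum>i<\<rho>. (q - 1) choose i) + (\<Sum>i<\<rho> - 1. (q - 1) choose i)"
proof -
	obtain r where r: "\<rho> = Suc r" using assms(1) gr0_implies_Suc by blast
	obtain p where p: "q = Suc p" using assms(2) by (cases q) auto
	have "(\<Sum>i<Suc r. Suc p choose i) = (\<Sum>i<Suc r. p choose i) + (\<Sum>i<r. p choose i)" by (induction r) auto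
	then show ?thesis by (simp add: r p)
qed

text \<open>Phase one. The number \<open>\<rho>\<close> counts how many of the forms \<open>x i\<close> have to be killed before all of \<open>X\<close>
	is killed, and \<open>card R - \<rho>\<close> how many of the \<open>z i\<close> are needed to express \<open>W\<close> modulo \<open>X\<close>.\<close>

lemma red_main:
	assumes "finite R" "X \<subseteq> W" "\<And>f. f \<in> lspan X ==> f \<in> X" "C \<subseteq> X"
		and "\<And>i. i \<in> R ==> x i \<in> X" "\<And>i. i \<in> R ==> z i \<in> W"
		and "\<And>A \<beta>. A \<subseteq> R ==> card A \<le> \<rho> ==> \<beta> \<in> W ==> \<beta> \<in> lspan (C \<union> E \<union> x ` A \<union> z ` (R - A))"
		and "\<And>A \<alpha>. A \<subseteq> R ==> card A = \<rho> ==> \<alpha> \<in> X ==> \<alpha> \<in> lspan (C \<union> x ` A)"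
		and "\<And>K \<alpha>. K \<subseteq> R ==> card K + \<rho> = card R ==> \<alpha> \<in> X ==> \<alpha> \<in> lspan (E \<union> z ` K) ==> \<alpha> = (\<lambda>_. 0)"
		and "\<rho> \<le> card R" "s \<le> 1" "\<rho> > 0 \<or> s = 1"
	shows "red X W x z s R C E (\<Sum>i<\<rho>. (card R - 1) choose i)" using assms
proof (induction "card R" arbitrary: R C E \<rho> s)
	case 0
	then have "\<rho> = 0" "s = 1" by auto
	have "Idl X W x z R C E (Suc k) k f" if f: "V X W (Suc k) k f" for k f
	proof (rule lspan_subset_Id'[OF V_Suc_left[OF f refl]])
		fix g assume "g \<in> {\<lambda>w. \<alpha> w * g w |\<alpha> g. \<alpha> \<in> X \<and> V X W k k g}"
		then obtain \<alpha> h where g: "g = (\<lambda>w. \<alpha> w * h w)" "\<alpha> \<in> X" "V X W k k h" by blast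
		have "\<alpha> \<in> lspan C" using "0.prems"(8)[of "{}" \<alpha>] \<open>\<rho> = 0\<close> g by simp
		then show "Idl X W x z R C E (Suc k) k g"
			unfolding g(1) by (rule lspan_subset_Id) (rule Id_C[OF _ g(3)])
	qed
	then show ?case using \<open>\<rho> = 0\<close> \<open>s = 1\<close> unfolding red_def
		by (intro exI[of _ "{}"]) (auto intro!: bexI[of _ "\<lambda>_. 0"] lspan.zero)
next
	case (Suc q R C E \<rho> s)
	note finR = Suc.prems(1) and XW = Suc.prems(2) and Xsub = Suc.prems(3) and CX = Suc.prems(4)
		and xX = Suc.prems(5) and zW = Suc.prems(6) and S = Suc.prems(7) and XX = Suc.prems(8)
		and I = Suc.prems(9)
	consider "\<rho> = 0" | "\<rho> = card R" | "0 < \<rho>" "\<rho> < card R" using Suc.prems(10) by linarith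
	then show ?case
	proof cases
		\<comment> \<open>All of X is already killed and the excess is 1, so every function contains a
		  factor from X and lies in the ideal: nothing is left to span.\<close>
		case 1
		then have s1: "s = 1" using Suc.prems(11,12) by auto
		have "Idl X W x z R C E (Suc k) k f" if f: "V X W (Suc k) k f" for k f
		proof (rule lspan_subset_Id'[OF V_Suc_left[OF f refl]])
			fix g assume "g \<in> {\<lambda>w. \<alpha> w * g w |\<alpha> g. \<alpha> \<in> X \<and> V X W k k g}"
			then obtain \<alpha> h where g: "g = (\<lambda>w. \<alpha> w * h w)" "\<alpha> \<in> X" "V X W k k h" by blast
			have "\<alpha> \<in> lspan C" using XX[of "{}" \<alpha>] 1 g by simp
			then show "Idl X W x z R C E (Suc k) k g"
				unfolding g(1) by (rule lspan_subset_Id) (rule Id_C[OF _ g(3)])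
		qed
		then show ?thesis using 1 s1 unfolding red_def
			by (intro exI[of _ "{}"]) (auto intro!: bexI[of _ "\<lambda>_. 0"] lspan.zero)
	next
		\<comment> \<open>Now W is X plus the span of E, so the situation is one of quadrics in X alone;
		  the binomial sum is a full row, a power of two.\<close>
		case 2
		have CR: "lspan (C \<union> x ` R) \<subseteq> X"
		proof
			fix f assume "f \<in> lspan (C \<union> x ` R)"
			then have "f \<in> lspan X" by (rule lspan_mono) (use CX xX in auto)
			then show "f \<in> X" by (rule Xsub)
		qed
		have W: "\<exists>\<alpha>\<in>X. \<exists>\<eta>\<in>lspan E. \<beta> = (\<lambda>w. \<alpha> w + \<eta> w)" if "\<beta> \<in> W" for \<beta>
		proof -
			have "\<beta> \<in> lspan ((C \<union> x ` R) \<union> E)" using S[of R \<beta>] 2 that by (simp add: Un_ac)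
			from lspan_Un[OF this] CR show ?thesis by blast
		qed
		then have "\<forall>i\<in>R. \<exists>\<alpha>. \<alpha> \<in> X \<and> (\<lambda>w. z i w - \<alpha> w) \<in> lspan E"
		proof (intro ballI)
			fix i assume "i \<in> R"
			from W[OF zW[OF this]] obtain \<alpha> \<eta> where *: "\<alpha> \<in> X" "\<eta> \<in> lspan E" "z i = (\<lambda>w. \<alpha> w + \<eta> w)" by blast
			then have "(\<lambda>w. z i w - \<alpha> w) = \<eta>" by auto
			then show "\<exists>\<alpha>. \<alpha> \<in> X \<and> (\<lambda>w. z i w - \<alpha> w) \<in> lspan E" using * by (intro exI[of _ \<alpha>]) simp
		qed
		then obtain \<zeta> where \<zeta>: "\<And>i. i \<in> R ==> \<zeta> i \<in> X" "\<And>i. i \<in> R ==> (\<lambda>w. z i w - \<zeta> i w) \<in> lspan E"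
			by (auto dest!: bchoice)
		have span: "\<alpha> \<in> lspan (C \<union> x ` A \<union> \<zeta> ` (R - A))" if A: "A \<subseteq> R" "\<alpha> \<in> X" for A \<alpha>
		proof -
			let ?S = "C \<union> x ` A \<union> \<zeta> ` (R - A)"
			have "card A \<le> \<rho>" using card_mono[OF finR A(1)] 2 by simp
			then have "\<alpha> \<in> lspan (C \<union> E \<union> x ` A \<union> z ` (R - A))" using S A XW by blast
			then have "\<alpha> \<in> lspan (?S \<union> E)"
			proof (rule lspan_subset)
				show "C \<union> E \<union> x ` A \<union> z ` (R - A) \<subseteq> lspan (?S \<union> E)"
				proof
					fix f assume "f \<in> C \<union> E \<union> x ` A \<union> z ` (R - A)"
					then consider "f \<in> ?S \<union> E" | i where "i \<in> R - A" "f = z i" by blast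
					then show "f \<in> lspan (?S \<union> E)"
					proof cases
						case (2 i)
						have "\<zeta> i \<in> lspan (?S \<union> E)" using 2(1) by (intro lspan.base) auto
						moreover have "(\<lambda>w. z i w - \<zeta> i w) \<in> lspan (?S \<union> E)"
							by (rule lspan_mono[OF \<zeta>(2)]) (use 2(1) in auto)
						ultimately have "(\<lambda>w. \<zeta> i w + (z i w - \<zeta> i w)) \<in> lspan (?S \<union> E)" by (rule lspan.add)
						then show ?thesis using 2(2) by simp
					qed (auto intro: lspan.base)
				qed
			qed
			from lspan_Un[OF this] obtain \<gamma> \<eta> where *: "\<gamma> \<in> lspan ?S" "\<eta> \<in> lspan E" "\<alpha> = (\<lambda>w. \<gamma> w + \<eta> w)" by blast
			have "\<gamma> \<in> lspan X" by (rule lspan_mono[OF *(1)]) (use CX xX \<zeta>(1) A in auto)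
			then have "(\<lambda>w. \<alpha> w - \<gamma> w) \<in> lspan X" by (rule lspan_diff[OF lspan.base[OF A(2)]])
			moreover have "(\<lambda>w. \<alpha> w - \<gamma> w) = \<eta>" by (auto simp: *(3))
			ultimately have "\<eta> \<in> X" using Xsub by simp
			\<comment> \<open>The spanning hypothesis yields \<alpha> only up to a part from E. That part
			  lies in X, and X meets the span of E trivially.\<close>
			then have "\<eta> = (\<lambda>_. 0)" using I[of "{}" \<eta>] 2 *(2) by simp
			then show ?thesis using * by simp
		qed
		have "red X X x \<zeta> s R C {} (2 ^ (card R - 1))"
		proof (rule red_quadrics[OF finR _ Suc.prems(11) xX \<zeta>(1) span])
			show "R \<noteq> {}" using Suc.hyps(2) by auto
		qed
		from red_transfer[OF this XW W \<zeta>(2) xX] have "red X W x z s R C E (2 ^ (card R - 1))" .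
		moreover have "(\<Sum>i<\<rho>. (card R - 1) choose i) = 2 ^ (card R - 1)"
			using choose_row_sum[of q] Suc.hyps(2)[symmetric] 2 by (simp add: lessThan_Suc_atMost)
		ultimately show ?thesis by simp
	next
		case 3
		\<comment> \<open>Killing \<open>z m\<close> leaves \<rho> unchanged, while killing
		  \<open>x m\<close> lowers it by one. The two counts add up by Pascal's rule for partial row
		  sums.\<close>
		obtain m where m: "m \<in> R" using 3 by fastforce
		define R' where "R' = R - {m}"
		have R': "R = insert m R'" "m \<notin> R'" "finite R'" "q = card R'"
			using m finR Suc.hyps(2) by (auto simp: R'_def)
		have cR: "card R = Suc (card R')" using R' by simp
		have diff: "R - insert m A = R' - A" "R - A = insert m (R' - A)" if "A \<subseteq> R'" for A
			using that R' by auto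
		have kz: "red X W x z s' R' C (insert (z m) E) (\<Sum>i<\<rho>. (card R' - 1) choose i)" if "s' \<le> 1" for s'
		proof (rule Suc.hyps(1)[OF R'(4) R'(3) XW Xsub CX])
			show "\<beta> \<in> lspan (C \<union> insert (z m) E \<union> x ` A \<union> z ` (R' - A))"
				if "A \<subseteq> R'" "card A \<le> \<rho>" "\<beta> \<in> W" for A \<beta>
				using S[of A \<beta>] that diff(2)[OF that(1)] R'(1) by (auto simp: insert_commute)
			show "\<alpha> \<in> lspan (C \<union> x ` A)" if "A \<subseteq> R'" "card A = \<rho>" "\<alpha> \<in> X" for A \<alpha>
				using XX[of A \<alpha>] that R'(1) by auto
			show "\<alpha> = (\<lambda>_. 0)" if "K \<subseteq> R'" "card K + \<rho> = card R'" "\<alpha> \<in> X" "\<alpha> \<in> lspan (insert (z m) E \<union> z ` K)" for K \<alpha>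
			proof -
				have "card (insert m K) = Suc (card K)" using that(1) R' finite_subset by (subst card_insert_disjoint) auto
				then show ?thesis using I[of "insert m K" \<alpha>] that R'(1) cR by auto
			qed
		qed (use xX zW R' 3 cR that in auto)
		have kx: "red X W x z 1 R' (insert (x m) C) E (\<Sum>i<\<rho> - 1. (card R' - 1) choose i)"
		proof (rule Suc.hyps(1)[OF R'(4) R'(3) XW Xsub])
			show "\<beta> \<in> lspan (insert (x m) C \<union> E \<union> x ` A \<union> z ` (R' - A))"
				if "A \<subseteq> R'" "card A \<le> \<rho> - 1" "\<beta> \<in> W" for A \<beta>
			proof -
				have "card (insert m A) \<le> \<rho>" using that(2) 3 card_insert_le_m1[of \<rho> A m] by simp
				then show ?thesis using S[of "insert m A" \<beta>] that diff(1)[OF that(1)] R'(1) by auto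
			qed
			show "\<alpha> \<in> lspan (insert (x m) C \<union> x ` A)" if "A \<subseteq> R'" "card A = \<rho> - 1" "\<alpha> \<in> X" for A \<alpha>
			proof -
				have "card (insert m A) = \<rho>"
					using that R' 3 finite_subset[OF that(1) R'(3)] by (subst card_insert_disjoint) auto
				then show ?thesis using XX[of "insert m A" \<alpha>] that R'(1) by auto
			qed
			show "\<alpha> = (\<lambda>_. 0)" if "K \<subseteq> R'" "card K + (\<rho> - 1) = card R'" "\<alpha> \<in> X" "\<alpha> \<in> lspan (E \<union> z ` K)" for K \<alpha>
			proof -
				have "card K + \<rho> = card R" using that(2) cR 3 by linarith
				moreover have "K \<subseteq> R" using that(1) R'(1) by auto
				ultimately show ?thesis using I[OF _ _ that(3,4)] by blast
			qed
		qed (use CX xX zW R' 3 cR in auto)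
		have bin: "(\<Sum>i<\<rho>. (card R - 1) choose i) =
				(\<Sum>i<\<rho>. (card R' - 1) choose i) + (\<Sum>i<\<rho> - 1. (card R' - 1) choose i)"
			using binomial_prefix_step[of \<rho> "card R'"] 3 cR by simp
		have "s = 0 \<or> s = 1" using Suc.prems(11) by auto
		then show ?thesis
		proof
			assume "s = 0"
			then show ?thesis unfolding bin using red_split_z[OF kz[of 0] kx] xX[OF m] zW[OF m] R'(1) by simp
		next
			assume "s = 1"
			then show ?thesis unfolding bin using red_split_x[OF kx kz[of 0]] xX[OF m] zW[OF m] R'(1)
				by (simp add: add.commute)
		qed
	qed
qed

section \<open>Counting points by the functions on them\<close>

lemma V_mult:
	assumes "V X W a b f" "V X W a' b' g"
	shows "V X W (a + a') (b + b') (\<lambda>w. f w * g w)" using assms(1)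
proof induction
	case V_one
	then show ?case using assms(2) by simp
next
	case (V_zero a b)
	show ?case by (simp add: V.V_zero)
next
	case (V_add a b f h)
	then show ?case using V.V_add[OF V_add.IH] by (simp add: distrib_right)
next
	case (V_scale a b f c)
	then show ?case using V.V_scale[OF V_scale.IH, of c] by (simp add: mult.assoc)
next
	case (V_X \<alpha> a b f)
	then show ?case using V.V_X[OF V_X.hyps(1) V_X.IH] by (simp add: mult.assoc)
next
	case (V_W \<beta> a b f)
	then show ?case using V.V_W[OF V_W.hyps(1) V_W.IH] by (simp add: mult.assoc)
qed

lemma V_prod: "finite A ==> (\<And>i. i \<in> A ==> V X W 1 1 (\<phi> i)) ==> V X W (card A) (card A) (\<lambda>w. \<Prod>i\<in>A. \<phi> i w)"
proof (induction A rule: finite_induct)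
	case empty
	show ?case using V_one[of X W] by simp
next
	case (insert i A)
	then show ?case using V_mult[of X W 1 1 "\<phi> i" "card A" "card A" "\<lambda>w. \<Prod>i\<in>A. \<phi> i w"] by simp
qed

text \<open>On P the products \<open>x i * z i\<close> equal 1, so an element of the ideal in
  bidegree (k + 1, k + 1) takes the same values as a function of bidegree (k, k). Descending in k,
  all functions of balanced bidegree on P lie in one space of dimension at most n; products of
  separating functions show that this space contains every function on P.\<close>

theorem solutions_bound:
	assumes red: "red X W x z 0 R C {} n" and P: "finite P"
		and one: "\<And>i w. i \<in> R ==> w \<in> P ==> x i w * z i w = 1"
		and zero: "\<And>\<gamma> w. \<gamma> \<in> C ==> w \<in> P ==> \<gamma> w = 0"
		and sep: "\<And>w w'. w \<in> P ==> w' \<in> P ==> w \<noteq> w' ==> \<exists>\<phi>. V X W 1 1 \<phi> \<and> \<phi> w = 0 \<and> \<phi> w' \<noteq> 0"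
	shows "card P \<le> n"
proof (rule ccontr)
	assume "\<not> ?thesis"
	obtain G where G: "finite G" "card G \<le> n" "\<And>k f. V X W k k f ==>
		\<exists>g\<in>lspan G. \<exists>h. Idl X W x z R C {} k k h \<and> f = (\<lambda>w. g w + h w)" using red unfolding red_def by auto
	have down: "(\<forall>a' b'. a = Suc a' --> b = Suc b' --> (\<exists>h'. V X W a' b' h' \<and> (\<forall>w\<in>P. h w = h' w))) \<and>
			(a = 0 \<or> b = 0 --> (\<forall>w\<in>P. h w = 0))" if "Idl X W x z R C {} a b h" for a b h using that
	proof induction
		case (Id_zero a b)
		show ?case by (auto intro!: exI[of _ "\<lambda>_. 0"] V_zero)
	next
		case (Id_add a b f g)
		show ?case
		proof (intro conjI allI impI)
			fix a' b' assume "a = Suc a'" "b = Suc b'"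
			then obtain f' g' where "V X W a' b' f'" "\<forall>w\<in>P. f w = f' w" "V X W a' b' g'" "\<forall>w\<in>P. g w = g' w"
				using Id_add.IH by blast
			then show "\<exists>h'. V X W a' b' h' \<and> (\<forall>w\<in>P. f w + g w = h' w)"
				by (intro exI[of _ "\<lambda>w. f' w + g' w"]) (auto intro: V_add)
		qed (use Id_add.IH in auto)
	next
		case (Id_scale a b f c)
		show ?case
		proof (intro conjI allI impI)
			fix a' b' assume "a = Suc a'" "b = Suc b'"
			then obtain f' where "V X W a' b' f'" "\<forall>w\<in>P. f w = f' w" using Id_scale.IH by blast
			then show "\<exists>h'. V X W a' b' h' \<and> (\<forall>w\<in>P. c * f w = h' w)"
				by (intro exI[of _ "\<lambda>w. c * f' w"]) (auto intro: V_scale)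
		qed (use Id_scale.IH in auto)
	next
		case (Id_prod i a b f)
		then show ?case using one by auto
	next
		case (Id_C \<gamma> a b f)
		then show ?case using zero by (auto intro!: exI[of _ "\<lambda>_. 0"] V_zero)
	next
		case (Id_E \<gamma> a b f)
		then show ?case by simp
	qed
	have inG: "\<exists>g\<in>lspan G. \<forall>w\<in>P. f w = g w" if "V X W k k f" for k f using that
	proof (induction k arbitrary: f)
		case 0
		obtain g h where *: "g \<in> lspan G" "Idl X W x z R C {} 0 0 h" "f = (\<lambda>w. g w + h w)" using G(3)[OF 0] by blast
		then show ?case using down[OF *(2)] by (intro bexI[of _ g]) auto
	next
		case (Suc k)
		obtain g h where *: "g \<in> lspan G" "Idl X W x z R C {} (Suc k) (Suc k) h" "f = (\<lambda>w. g w + h w)" using G(3)[OF Suc.prems] by blast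
		obtain h' where h': "V X W k k h'" "\<forall>w\<in>P. h w = h' w" using down[OF *(2)] by blast
		obtain g' where g': "g' \<in> lspan G" "\<forall>w\<in>P. h' w = g' w" using Suc.IH[OF h'(1)] by blast
		show ?case by (intro bexI[of _ "\<lambda>w. g w + g' w"] lspan.add *(1) g'(1)) (auto simp: *(3) h' g')
	qed
	have "card G < card P" using G(2) \<open>\<not> card P \<le> n\<close> by simp
	\<comment> \<open>If P had more than n points, some nonzero weight on P would annihilate the
	  spanning functions. It is refuted by a product of separators that vanishes on P except at one
	  point of nonzero weight.\<close>
	from nontrivial_kernel[OF G(1) P this, of "\<lambda>w g. g w"] obtain c where
		c: "\<exists>w\<in>P. c w \<noteq> 0" "\<And>g. g \<in> G ==> (\<Sum>w\<in>P. c w * g w) = 0" by blast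
	have cG: "(\<Sum>w\<in>P. c w * g w) = 0" if "g \<in> lspan G" for g using that
	proof induction
		case (base g) then show ?case by (rule c(2))
	next
		case (add f g) then show ?case by (simp add: distrib_left sum.distrib)
	next
		case (scale f k)
		have "(\<Sum>w\<in>P. c w * (k * f w)) = k * (\<Sum>w\<in>P. c w * f w)"
			by (simp add: sum_distrib_left mult.left_commute)
		then show ?case using scale by simp
	qed simp
	obtain w0 where w0: "w0 \<in> P" "c w0 \<noteq> 0" using c(1) by blast
	have "\<forall>w\<in>P - {w0}. \<exists>\<phi>. V X W 1 1 \<phi> \<and> \<phi> w = 0 \<and> \<phi> w0 \<noteq> 0" using sep w0 by blast
	from bchoice[OF this] obtain \<phi> where
		\<phi>: "\<And>w. w \<in> P - {w0} ==> V X W 1 1 (\<phi> w) \<and> \<phi> w w = 0 \<and> \<phi> w w0 \<noteq> 0" by auto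
	define f where "f v = (\<Prod>w\<in>P - {w0}. \<phi> w v)" for v
	have "V X W (card (P - {w0})) (card (P - {w0})) f"
		unfolding f_def[abs_def] by (rule V_prod) (use P \<phi> in auto)
	from inG[OF this] obtain g where g: "g \<in> lspan G" "\<forall>w\<in>P. f w = g w" by blast
	have f0: "f w = 0" if "w \<in> P - {w0}" for w
		unfolding f_def using that \<phi>[OF that] P by (intro prod_zero) auto
	have "f w0 \<noteq> 0" unfolding f_def using P \<phi> by auto
	have "(\<Sum>w\<in>P. c w * f w) = (\<Sum>w\<in>P. c w * g w)" by (rule sum.cong) (use g in auto)
	also have "\<dots> = 0" by (rule cG[OF g(1)])
	also have "(\<Sum>w\<in>P. c w * f w) = c w0 * f w0" using P w0 f0 by (subst sum.remove[of P w0]) auto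
	finally show False using w0 \<open>f w0 \<noteq> 0\<close> by simp
qed

section \<open>Coordinates for quadratic programs\<close>

instance uprod :: (finite) finite by standard simp

text \<open>A symmetric matrix is determined by its entries at unordered pairs of indices, so a program has
	independent coordinates indexed by the following type. The slots of \<open>c\<close> and \<open>b\<close> are also used for
	\<open>x\<close> and \<open>y\<close>.\<close>

type_synonym ('m, 'd) slot = "'m uprod + ('d \<times> 'm) + 'm + 'd"

abbreviation (input) slotQ :: "'m => 'm => ('m, 'd) slot" where "slotQ i j \<equiv> Inl (Upair i j)"
abbreviation (input) slotA :: "'d => 'm => ('m, 'd) slot" where "slotA k i \<equiv> Inr (Inl (k, i))"
abbreviation (input) slotc :: "'m => ('m, 'd) slot" where "slotc i \<equiv> Inr (Inr (Inl i))"
abbreviation (input) slotb :: "'d => ('m, 'd) slot" where "slotb k \<equiv> Inr (Inr (Inr k))"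

lemma sum_UNIV_option:
	fixes f :: "'a::finite option => 'b::comm_monoid_add"
	shows "(\<Sum>a\<in>UNIV. f a) = f None + (\<Sum>a\<in>UNIV. f (Some a))"
proof -
	have "(\<Sum>a\<in>UNIV. f a) = (\<Sum>a\<in>insert None (range Some). f a)" by (simp add: UNIV_option_conv)
	also have "\<dots> = f None + (\<Sum>a\<in>range Some. f a)" by (subst sum.insert) auto
	also have "(\<Sum>a\<in>range Some. f a) = (\<Sum>a\<in>UNIV. f (Some a))" by (subst sum.reindex) (auto simp: inj_on_def)
	finally show ?thesis .
qed

lemma sum_UNIV_sum:
	fixes f :: "'a::finite + 'b::finite => 'c::comm_monoid_add"
	shows "(\<Sum>a\<in>UNIV. f a) = (\<Sum>a\<in>UNIV. f (Inl a)) + (\<Sum>a\<in>UNIV. f (Inr a))"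
	unfolding UNIV_sum by (subst sum.union_disjoint) (auto simp: sum.reindex inj_on_def)

lemma card_Compl_finite: "card (- J) = CARD('a) - card J" for J :: "'a::finite set"
	by (simp add: Compl_eq_Diff_UNIV card_Diff_subset)

lemma det_nonzero_iff:
	fixes M :: "'a::field^'n^'n"
	shows "det M \<noteq> 0 \<longleftrightarrow> (\<forall>w. M *v w = 0 --> w = 0)"
	using invertible_det_nz[of M] invertible_left_inverse[of M] matrix_left_invertible_ker[of M] by blast

lemma rows_span:
	fixes M :: "'a::field^'n^'n"
	assumes "det M \<noteq> 0"
	shows "\<exists>c. \<forall>j. a $ j = (\<Sum>r\<in>UNIV. c $ r * M $ r $ j)"
proof -
	obtain M' where "M' ** M = mat 1"
		using assms invertible_det_nz[of M] invertible_left_inverse[of M] by blast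
	then have "(a v* M') v* M = a" by (simp add: vector_matrix_mul_assoc)
	then have "a $ j = (\<Sum>r\<in>UNIV. (a v* M') $ r * M $ r $ j)" for j
		by (metis (no_types, lifting) mult.commute sum.cong vec_lambda_beta vector_matrix_mult_def)
	then show ?thesis by blast
qed

definition slack_form :: "(('m::finite, 'd::finite) slot => complex) => 'm => ('m + 'd) option => complex" where
	"slack_form \<zeta> i j = (case j of None => \<zeta> (slotc i) | Some (Inl i') => \<zeta> (slotQ i i')
		 | Some (Inr k) => - \<zeta> (slotA k i))"

text \<open>The rows are the linear forms \<open>x i\<close> for \<open>i \<in> J\<close>, the slacks \<open>z i\<close> for \<open>i \<notin> J\<close>, the constraints
	\<open>A x = b\<close>, and the hyperplane \<open>\<eta>\<close>, all homogenized with the variable \<open>None\<close>.\<close>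

definition form_row :: "(('m::finite, 'd::finite) slot => complex) => ('m option => complex) => 'm set =>
		('m + 'd) option => ('m + 'd) option => complex" where
	"form_row \<zeta> \<eta> J r j = (case r of
		 Some (Inl i) => (if i \<in> J then (if j = Some (Inl i) then 1 else 0) else slack_form \<zeta> i j)
	 | Some (Inr k) => (case j of None => - \<zeta> (slotb k) | Some (Inl i) => \<zeta> (slotA k i) | Some (Inr _) => 0)
	 | None => (case j of None => - \<eta> None | Some (Inl i) => \<eta> (Some i) | Some (Inr _) => 0))"

lemma form_row_x: "i \<in> J ==> form_row \<zeta> \<eta> J (Some (Inl i)) = (\<lambda>j. if j = Some (Inl i) then 1 else 0)"
	and form_row_z: "i \<notin> J ==> form_row \<zeta> \<eta> J (Some (Inl i)) = slack_form \<zeta> i" by (auto simp: form_row_def)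

definition form_matrix where "form_matrix \<zeta> \<eta> J = (\<chi> r j. form_row \<zeta> \<eta> J r j)"

lemma polyfun_form_row:
	assumes "\<And>v. polyfun (\<lambda>z. \<zeta> z v)" "\<And>v. polyfun (\<lambda>z. \<eta> z v)"
	shows "polyfun (\<lambda>z. form_row (\<zeta> z) (\<eta> z) J r j)"
proof -
	have slack: "polyfun (\<lambda>z. slack_form (\<zeta> z) i j)" for i
	proof (cases j)
		case None
		then show ?thesis by (simp add: slack_form_def assms)
	next
		case (Some s)
		then show ?thesis by (cases s) (simp_all add: slack_form_def assms polyfun_uminus)
	qed
	show ?thesis
	proof (cases r)
		case None
		show ?thesis
		proof (cases j)
			case (Some s)
			then show ?thesis using None by (cases s) (simp_all add: form_row_def assms polyfun.const)
		qed (simp add: form_row_def None assms polyfun_uminus)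
	next
		case (Some s)
		show ?thesis
		proof (cases s)
			case (Inl i)
			then show ?thesis using Some slack
				by (cases "i \<in> J"; cases "j = Some (Inl i)") (simp_all add: form_row_def polyfun.const)
		next
			case (Inr k)
			show ?thesis
			proof (cases j)
				case (Some s')
				then show ?thesis using \<open>r = Some s\<close> Inr
					by (cases s') (simp_all add: form_row_def assms polyfun.const)
			qed (simp add: form_row_def Some Inr assms polyfun_uminus)
		qed
	qed
qed

lemma polyfun_det_form_matrix:
	assumes "\<And>v. polyfun (\<lambda>z. \<zeta> z v)" "\<And>v. polyfun (\<lambda>z. \<eta> z v)"
	shows "polyfun (\<lambda>z. det (form_matrix (\<zeta> z) (\<eta> z) J))"
	unfolding form_matrix_def by (rule polyfun_det) (simp add: polyfun_form_row[OF assms])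

definition eval_form :: "('n::finite => complex) => ('n => complex) => complex" where
	"eval_form a w = (\<Sum>j\<in>UNIV. a j * w j)"

lemma eval_form_unit: "eval_form a (\<lambda>j. if j = j0 then 1 else 0) = a j0"
proof -
	have "eval_form a (\<lambda>j. if j = j0 then 1 else 0) = (\<Sum>j\<in>UNIV. if j = j0 then a j else 0)"
		unfolding eval_form_def by (rule sum.cong) auto
	then show ?thesis by simp
qed

lemma eval_form_unit': "eval_form (\<lambda>j. if j = j0 then 1 else 0) w = w j0"
proof -
	have "eval_form (\<lambda>j. if j = j0 then 1 else 0) w = (\<Sum>j\<in>UNIV. if j = j0 then w j else 0)"
		unfolding eval_form_def by (rule sum.cong) auto
	then show ?thesis by simp
qed

lemma eval_form_split:
	"eval_form a w = a None * w None + ((\<Sum>i\<in>UNIV. a (Some (Inl i)) * w (Some (Inl i))) +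
		 (\<Sum>k\<in>UNIV. a (Some (Inr k)) * w (Some (Inr k))))"
	unfolding eval_form_def by (subst sum_UNIV_option, subst sum_UNIV_sum) simp

text \<open>The KKT system with the reciprocals multiplied out and without positivity. It makes
  sense at complex points of the closure, including those with a zero coordinate.\<close>

definition "kkt_solution \<zeta> x y \<tau> \<longleftrightarrow>
	(\<forall>i. x i * (\<zeta> (slotc i) + (\<Sum>j\<in>UNIV. \<zeta> (slotQ i j) * x j) - (\<Sum>k\<in>UNIV. \<zeta> (slotA k i) * y k)) = \<tau>) \<and>
	(\<forall>k. (\<Sum>i\<in>UNIV. \<zeta> (slotA k i) * x i) = \<zeta> (slotb k))"
	for \<zeta> :: "('m::finite, 'd::finite) slot => complex"

lemma form_matrix_kernel: "form_matrix \<zeta> \<eta> J *v (\<chi> j. w j) = 0 \<longleftrightarrow>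
		 (\<forall>r. eval_form (form_row \<zeta> \<eta> J r) w = 0)"
	by (simp add: vec_eq_iff form_matrix_def matrix_vector_mult_def eval_form_def)

lemma form_matrix_trivial_kernel:
	assumes "det (form_matrix \<zeta> \<eta> J) \<noteq> 0" "\<And>r. eval_form (form_row \<zeta> \<eta> J r) w = 0"
	shows "w j = 0"
proof -
	have "(\<chi> j. w j) = 0"
		using assms det_nonzero_iff[of "form_matrix \<zeta> \<eta> J"] form_matrix_kernel[of \<zeta> \<eta> J w] by blast
	then show ?thesis by (simp add: vec_eq_iff)
qed

text \<open>Selecting \<open>d\<close> variables outside \<open>J\<close> by the constraint matrix gives a nonzero determinant.\<close>

lemma det_form_matrix_nonzero_exists:
	fixes J :: "'m::finite set"
	assumes "card J + CARD('d::finite) \<le> CARD('m)"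
	shows "\<exists>\<zeta> :: ('m, 'd) slot => complex. det (form_matrix \<zeta> (\<lambda>j. if j = None then 1 else 0) J) \<noteq> 0"
proof -
	have "card (UNIV :: 'd set) \<le> card (- J)" using assms by (simp add: card_Compl_finite)
	then obtain \<sigma> :: "'d => 'm" where \<sigma>: "inj \<sigma>" "range \<sigma> \<subseteq> - J"
		using card_le_inj[of "UNIV :: 'd set" "- J"] by auto
	\<comment> \<open>Q is the identity, c and b are zero, and row k of A picks the coordinate \<sigma>
	  k outside J; the hyperplane row forces the homogenizing variable to be 0. The slack rows then
	  read off the variables y.\<close>
	define \<zeta> :: "('m, 'd) slot => complex" where
		"\<zeta> = case_sum (\<lambda>p. if \<exists>i. p = Upair i i then 1 else 0)
			(case_sum (\<lambda>(k, i). if i = \<sigma> k then 1 else 0) (\<lambda>_. 0))"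
	have Q: "\<zeta> (slotQ i j) = (if j = i then 1 else 0)" for i j by (auto simp: \<zeta>_def)
	have A: "\<zeta> (slotA k i) = (if i = \<sigma> k then 1 else 0)" for k i by (simp add: \<zeta>_def)
	have c: "\<zeta> (slotc i) = 0" and b: "\<zeta> (slotb k) = 0" for i k by (simp_all add: \<zeta>_def)
	let ?\<eta> = "\<lambda>j :: 'm option. if j = None then 1 else 0 :: complex"
	have "w = 0" if w: "form_matrix \<zeta> ?\<eta> J *v w = 0" for w
	proof -
		define v where "v j = w $ j" for j
		have "w = (\<chi> j. v j)" by (simp add: v_def)
		then have ker: "eval_form (form_row \<zeta> ?\<eta> J r) v = 0" for r
			using w form_matrix_kernel[of \<zeta> ?\<eta> J v] by simp
		have v0: "v None = 0" using ker[of None] by (simp add: eval_form_split form_row_def)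
		have xJ: "v (Some (Inl i)) = 0" if "i \<in> J" for i
			using ker[of "Some (Inl i)"] that by (simp add: form_row_x eval_form_unit')
		have "v (Some (Inl (\<sigma> k))) = 0" for k using ker[of "Some (Inr k)"]
			by (simp add: eval_form_split form_row_def A b if_distrib[of "\<lambda>c. c * _"] cong: if_cong)
		note xs = this
		have xz: "v (Some (Inl i)) = (\<Sum>k\<in>UNIV. (if i = \<sigma> k then v (Some (Inr k)) else 0))" if "i \<notin> J" for i
			using ker[of "Some (Inl i)"] that
			by (simp add: eval_form_split form_row_def slack_form_def Q A c v0 sum_negf
					if_distrib[of "\<lambda>c. c * _"] cong: if_cong)
		have y: "v (Some (Inr k)) = 0" for k
		proof -
			have "\<sigma> k \<notin> J" using \<sigma>(2) by auto
			from xz[OF this] have "0 = (\<Sum>k'\<in>UNIV. (if \<sigma> k = \<sigma> k' then v (Some (Inr k')) else 0))"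
				using xs by simp
			also have "\<dots> = (\<Sum>k'\<in>UNIV. (if k = k' then v (Some (Inr k')) else 0))"
				using \<sigma>(1) by (intro sum.cong) (auto dest: injD)
			finally show ?thesis by simp
		qed
		have "v (Some (Inl i)) = 0" for i using xJ xz[of i] y by (cases "i \<in> J") (auto intro!: sum.neutral)
		then have "v j = 0" for j using v0 y by (cases j; cases "the j") auto
		then show "w = 0" by (simp add: vec_eq_iff v_def)
	qed
	then have "det (form_matrix \<zeta> ?\<eta> J) \<noteq> 0" using det_nonzero_iff by blast
	then show ?thesis by blast
qed

lemma lspan_image:
	assumes "f \<in> lspan (g ` A)" "finite A"
	shows "\<exists>c. \<forall>w. f w = (\<Sum>a\<in>A. c a * g a w)" using assms(1)
proof induction
	case zero show ?case by (rule exI[of _ "\<lambda>_. 0"]) simp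
next
	case (base h)
	then obtain a where a: "a \<in> A" "h = g a" by blast
	have "(\<Sum>b\<in>A. (if b = a then 1 else 0) * g b w) = (\<Sum>b\<in>A. if b = a then g a w else 0)" for w
		by (rule sum.cong) auto
	then show ?case using a assms(2) by (intro exI[of _ "\<lambda>b. if b = a then 1 else 0"]) simp
next
	case (add f h)
	then obtain c d where "\<forall>w. f w = (\<Sum>a\<in>A. c a * g a w)" "\<forall>w. h w = (\<Sum>a\<in>A. d a * g a w)" by blast
	then show ?case by (intro exI[of _ "\<lambda>a. c a + d a"]) (simp add: distrib_right sum.distrib)
next
	case (scale f k)
	then obtain c where "\<forall>w. f w = (\<Sum>a\<in>A. c a * g a w)" by blast
	then show ?case by (intro exI[of _ "\<lambda>a. k * c a"]) (simp add: sum_distrib_left mult.assoc)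
qed

lemma eval_form_in_rows:
	assumes "det (form_matrix \<zeta> \<eta> J) \<noteq> 0"
	shows "\<exists>c. eval_form a = (\<lambda>w. \<Sum>r\<in>UNIV. c r * eval_form (form_row \<zeta> \<eta> J r) w) \<and>
		(\<forall>j. a j = (\<Sum>r\<in>UNIV. c r * form_row \<zeta> \<eta> J r j))"
proof -
	obtain c where "\<forall>j. (\<chi> j. a j) $ j = (\<Sum>r\<in>UNIV. c $ r * form_matrix \<zeta> \<eta> J $ r $ j)"
		using rows_span[OF assms, of "\<chi> j. a j"] by blast
	then have a: "a j = (\<Sum>r\<in>UNIV. c $ r * form_row \<zeta> \<eta> J r j)" for j by (simp add: form_matrix_def)
	have "eval_form a w = (\<Sum>r\<in>UNIV. c $ r * eval_form (form_row \<zeta> \<eta> J r) w)" for w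
	proof -
		have "eval_form a w = (\<Sum>j\<in>UNIV. \<Sum>r\<in>UNIV. c $ r * form_row \<zeta> \<eta> J r j * w j)"
			unfolding eval_form_def by (simp add: a sum_distrib_right)
		also have "\<dots> = (\<Sum>r\<in>UNIV. \<Sum>j\<in>UNIV. c $ r * form_row \<zeta> \<eta> J r j * w j)" by (rule sum.swap)
		finally show ?thesis by (simp add: eval_form_def sum_distrib_left mult.assoc)
	qed
	then show ?thesis using a by (intro exI[of _ "\<lambda>r. c $ r"]) auto
qed

text \<open>If \<open>J\<close> has the maximal cardinality, then the columns of \<open>A\<close> outside \<open>J\<close> form an invertible
	square matrix.\<close>

lemma columns_independent:
	fixes \<zeta> :: "('m::finite, 'd::finite) slot => complex"
	assumes "det (form_matrix \<zeta> \<eta> J) \<noteq> 0" "card J + CARD('d) = CARD('m)"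
		and c: "\<And>k. (\<Sum>i\<in>-J. c i * \<zeta> (slotA k i)) = 0" and i0: "i0 \<in> - J"
	shows "c i0 = 0"
proof (rule ccontr)
	assume ci0: "c i0 \<noteq> 0"
	have "card (- J) = CARD('d)" using assms(2) by (simp add: card_Compl_finite)
	moreover have "card (- J - {i0}) < card (- J)" using i0 by (intro psubset_card_mono) auto
	ultimately have "card (- J - {i0}) < card (UNIV :: 'd set)" by simp
	\<comment> \<open>Without the column i0 there is one condition fewer than unknowns, so some y
	  annihilates all the other columns. The supposed relation with \<open>c i0\<close> nonzero forces
	  y to annihilate column i0 too, contradicting the nonzero determinant.\<close>
	from nontrivial_kernel[OF _ _ this, of "\<lambda>k i. \<zeta> (slotA k i)"] obtain y where
		y: "\<exists>k. y k \<noteq> 0" "\<And>i. i \<in> - J - {i0} ==> (\<Sum>k\<in>UNIV. y k * \<zeta> (slotA k i)) = 0" by auto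
	have "0 = (\<Sum>k\<in>UNIV. y k * (\<Sum>i\<in>-J. c i * \<zeta> (slotA k i)))" using c by simp
	also have "\<dots> = (\<Sum>i\<in>-J. c i * (\<Sum>k\<in>UNIV. y k * \<zeta> (slotA k i)))"
		unfolding sum_distrib_left by (subst sum.swap) (simp add: mult.left_commute)
	also have "\<dots> = c i0 * (\<Sum>k\<in>UNIV. y k * \<zeta> (slotA k i0))"
		using i0 y(2) by (subst sum.remove[of _ i0]) auto
	finally have "(\<Sum>k\<in>UNIV. y k * \<zeta> (slotA k i0)) = 0" using ci0 by simp
	then have y0: "(\<Sum>k\<in>UNIV. y k * \<zeta> (slotA k i)) = 0" if "i \<notin> J" for i
		using y(2)[of i] that by (cases "i = i0") auto
	define w where "w j = (case j of Some (Inr k) => y k | _ => 0)" for j :: "('m + 'd) option"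
	have "eval_form (form_row \<zeta> \<eta> J r) w = 0" for r
	proof (cases r)
		case (Some s)
		show ?thesis
		proof (cases s)
			case (Inl i)
			show ?thesis
			proof (cases "i \<in> J")
				case True
				then show ?thesis by (simp add: Some Inl form_row_x eval_form_unit' w_def)
			next
				case False
				then show ?thesis using y0[of i]
					by (simp add: Some Inl form_row_z eval_form_split slack_form_def w_def sum_negf mult.commute)
			qed
		qed (simp add: Some eval_form_split form_row_def w_def)
	qed (simp add: eval_form_split form_row_def w_def)
	from form_matrix_trivial_kernel[OF assms(1) this] have "w (Some (Inr k)) = 0" for k .
	then show False using y(1) by (simp add: w_def)
qed

text \<open>The determinants express general position: any admissible choice of killed x i and z i,
  together with the constraints and the hyperplane, spans all forms. They supply the hypotheses of
  \<open>red_main\<close> with \<rho> = m - d and E empty. They also exclude solutions with \<tau> =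
  0, so that the others can be scaled to \<tau> = 1.\<close>

theorem kkt_solutions_bound:
	fixes \<zeta> :: "('m::finite, 'd::finite) slot => complex" and P :: "(('m => complex) \<times> ('d => complex)) set"
	assumes dm: "CARD('d) < CARD('m)"
		and good: "\<And>J. card J + CARD('d) \<le> CARD('m) ==> det (form_matrix \<zeta> \<eta> J) \<noteq> 0"
		and P: "finite P" "\<And>x y. (x, y) \<in> P ==> (\<exists>\<tau>. kkt_solution \<zeta> x y \<tau>) \<and> (\<Sum>i\<in>UNIV. \<eta> (Some i) * x i) = \<eta> None"
	shows "card P \<le> (\<Sum>i<CARD('m) - CARD('d). (CARD('m) - 1) choose i)"
proof -
	let ?\<rho> = "CARD('m) - CARD('d)"
	define W where "W = range (eval_form :: (('m + 'd) option => complex) => _)"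
	define X where "X = {eval_form a |a :: ('m + 'd) option => complex. \<forall>k. a (Some (Inr k)) = 0}"
	define x where "x i = eval_form (\<lambda>j :: ('m + 'd) option. if j = Some (Inl i) then 1 else 0)" for i
	define z where "z i = eval_form (slack_form \<zeta> i)" for i
	define C where "C = insert (eval_form (form_row \<zeta> \<eta> {} None)) (range (\<lambda>k. eval_form (form_row \<zeta> \<eta> {} (Some (Inr k)))))"
	have row_ind: "form_row \<zeta> \<eta> J None = form_row \<zeta> \<eta> {} None"
		"form_row \<zeta> \<eta> J (Some (Inr k)) = form_row \<zeta> \<eta> {} (Some (Inr k))" for J k
		by (auto simp: form_row_def)
	have row_x: "eval_form (form_row \<zeta> \<eta> J (Some (Inl i))) = (if i \<in> J then x i else z i)" for J i
		by (cases "i \<in> J") (simp_all add: x_def z_def eval_form_def[abs_def] form_row_def)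
	have XW: "X \<subseteq> W" by (auto simp: X_def W_def)
	have Xsub: "f \<in> X" if "f \<in> lspan X" for f using that
	proof induction
		case zero
		have "(\<lambda>_. 0) = eval_form (\<lambda>_ :: ('m + 'd) option. 0)" by (auto simp: eval_form_def)
		then show ?case unfolding X_def by blast
	next
		case (add f g)
		then obtain a b where ab: "f = eval_form a" "\<forall>k. a (Some (Inr k)) = 0" "g = eval_form b" "\<forall>k. b (Some (Inr k)) = 0"
			by (auto simp: X_def)
		have "(\<lambda>w. f w + g w) = eval_form (\<lambda>j. a j + b j)"
			by (auto simp: ab eval_form_def sum.distrib distrib_right)
		then show ?case using ab unfolding X_def by (intro CollectI exI[of _ "\<lambda>j. a j + b j"]) simp
	next
		case (scale f c)
		then obtain a where a: "f = eval_form a" "\<forall>k. a (Some (Inr k)) = 0" by (auto simp: X_def)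
		have "(\<lambda>w. c * f w) = eval_form (\<lambda>j. c * a j)"
			by (auto simp: a eval_form_def sum_distrib_left mult.assoc)
		then show ?case using a unfolding X_def by (intro CollectI exI[of _ "\<lambda>j. c * a j"]) simp
	qed auto
	have CX: "C \<subseteq> X" by (auto simp: C_def X_def form_row_def)
	have xX: "x i \<in> X" for i unfolding x_def X_def by (intro CollectI exI conjI refl) auto
	have zW: "z i \<in> W" for i by (simp add: z_def W_def)
	have row_span: "eval_form (form_row \<zeta> \<eta> J r) \<in> lspan (C \<union> x ` J \<union> z ` (- J))" for J r
	proof (cases r)
		case None
		then show ?thesis by (intro lspan.base) (auto simp: C_def row_ind(1)[of J])
	next
		case (Some s)
		then show ?thesis
		proof (cases s)
			case (Inl i)
			then show ?thesis using Some by (intro lspan.base) (simp add: row_x)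
		next
			case (Inr k)
			then show ?thesis using Some by (intro lspan.base) (auto simp: C_def row_ind(2)[of J])
		qed
	qed
	have span: "\<beta> \<in> lspan (C \<union> {} \<union> x ` J \<union> z ` (UNIV - J))" if J: "card J \<le> ?\<rho>" "\<beta> \<in> W" for J \<beta>
	proof -
		obtain a where a: "\<beta> = eval_form a" using J(2) by (auto simp: W_def)
		have "card J + CARD('d) \<le> CARD('m)" using J(1) dm by simp
		from eval_form_in_rows[OF good[OF this], of a] obtain c where
			"eval_form a = (\<lambda>w. \<Sum>r\<in>UNIV. c r * eval_form (form_row \<zeta> \<eta> J r) w)" by blast
		moreover have "(\<lambda>w. \<Sum>r\<in>UNIV. c r * eval_form (form_row \<zeta> \<eta> J r) w) \<in> lspan (C \<union> x ` J \<union> z ` (- J))"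
			by (intro lspan_sum lspan.scale row_span)
		ultimately show ?thesis by (simp add: a Compl_eq_Diff_UNIV)
	qed
	have spanX: "\<alpha> \<in> lspan (C \<union> x ` J)" if J: "card J = ?\<rho>" "\<alpha> \<in> X" for J \<alpha>
	proof -
		obtain a where a: "\<alpha> = eval_form a" "\<And>k. a (Some (Inr k)) = 0" using J(2) by (auto simp: X_def)
		have cJ: "card J + CARD('d) = CARD('m)" using J(1) dm by simp
		then have det: "det (form_matrix \<zeta> \<eta> J) \<noteq> 0" by (intro good) simp
		from eval_form_in_rows[OF this, of a] obtain c where
			c: "eval_form a = (\<lambda>w. \<Sum>r\<in>UNIV. c r * eval_form (form_row \<zeta> \<eta> J r) w)"
				"\<And>j. a j = (\<Sum>r\<in>UNIV. c r * form_row \<zeta> \<eta> J r j)" by blast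
		have "(\<Sum>i\<in>-J. c (Some (Inl i)) * \<zeta> (slotA k i)) = 0" for k
		proof -
			have "0 = (\<Sum>r\<in>UNIV. c r * form_row \<zeta> \<eta> J r (Some (Inr k)))" using c(2)[of "Some (Inr k)"] a(2) by simp
			also have "\<dots> = (\<Sum>i\<in>UNIV. c (Some (Inl i)) * form_row \<zeta> \<eta> J (Some (Inl i)) (Some (Inr k)))"
				by (subst sum_UNIV_option, subst sum_UNIV_sum) (simp add: form_row_def)
			also have "\<dots> = (\<Sum>i\<in>-J. - (c (Some (Inl i)) * \<zeta> (slotA k i)))"
				by (rule sum.mono_neutral_cong_right) (auto simp: form_row_def slack_form_def)
			finally show ?thesis by (simp add: sum_negf)
		qed
		note c0 = columns_independent[OF det cJ this]
		have "(\<lambda>w. \<Sum>r\<in>UNIV. c r * eval_form (form_row \<zeta> \<eta> J r) w) \<in> lspan (C \<union> x ` J)"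
		proof (rule lspan_sum)
			fix r
			show "(\<lambda>w. c r * eval_form (form_row \<zeta> \<eta> J r) w) \<in> lspan (C \<union> x ` J)"
			proof (cases "\<exists>i. r = Some (Inl i) \<and> i \<notin> J")
				case True
				then show ?thesis using c0 by (auto simp: lspan.zero)
			next
				case False
				have "eval_form (form_row \<zeta> \<eta> J r) \<in> C \<union> x ` J"
				proof (cases r)
					case None then show ?thesis by (simp add: C_def row_ind(1)[of J])
				next
					case (Some s)
					then show ?thesis using False by (cases s) (auto simp: C_def row_ind(2)[of J] row_x)
				qed
				then show ?thesis by (intro lspan.scale lspan.base)
			qed
		qed
		then show ?thesis using c(1) a(1) by simp
	qed
	have inter: "\<alpha> = (\<lambda>_. 0)" if K: "card K + ?\<rho> = CARD('m)" "\<alpha> \<in> X" "\<alpha> \<in> lspan ({} \<union> z ` K)" for K \<alpha>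
	proof -
		obtain a where a: "\<alpha> = eval_form a" "\<And>k. a (Some (Inr k)) = 0" using K(2) by (auto simp: X_def)
		obtain c where c: "\<And>w. \<alpha> w = (\<Sum>i\<in>K. c i * z i w)" using lspan_image[of \<alpha> z K] K(3) by auto
		have cJ: "card (- K) + CARD('d) = CARD('m)" using K(1) dm by (simp add: card_Compl_finite)
		then have det: "det (form_matrix \<zeta> \<eta> (- K)) \<noteq> 0" by (intro good) simp
		have "(\<Sum>i\<in>- (- K). c i * \<zeta> (slotA k i)) = 0" for k
		proof -
			let ?e = "\<lambda>j. if j = Some (Inr k) then 1 else 0 :: complex"
			have "0 = (\<Sum>i\<in>K. c i * z i ?e)" using c[of ?e] a by (simp add: eval_form_unit)
			also have "\<dots> = (\<Sum>i\<in>K. - (c i * \<zeta> (slotA k i)))" by (simp add: z_def eval_form_unit slack_form_def)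
			finally show ?thesis by (simp add: sum_negf)
		qed
		note c0 = columns_independent[OF det cJ this]
		show ?thesis using c c0 by (auto intro!: sum.neutral)
	qed
	have red: "red X W x z 0 UNIV C {} (\<Sum>i<?\<rho>. (CARD('m) - 1) choose i)"
		by (rule red_main[OF _ XW Xsub CX xX zW span spanX inter]) (use dm in auto)
	define pt where "pt p = (\<lambda>j. case j of None => 1 | Some (Inl i) => fst p i | Some (Inr k) => snd p k)"
		for p :: "('m => complex) \<times> ('d => complex)"
	have zeval: "z i (pt (u, y)) = \<zeta> (slotc i) + (\<Sum>j\<in>UNIV. \<zeta> (slotQ i j) * u j) - (\<Sum>k\<in>UNIV. \<zeta> (slotA k i) * y k)" for i u y
		by (simp add: z_def eval_form_split slack_form_def pt_def sum_negf)
	have xeval: "x i (pt p) = fst p i" for i p by (simp add: x_def eval_form_unit' pt_def)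
	have Ceval: "\<gamma> (pt (u, y)) = 0" if "\<gamma> \<in> C" "(u, y) \<in> P" for \<gamma> u y using that P(2)[OF that(2)]
		by (auto simp: C_def eval_form_split form_row_def pt_def kkt_solution_def)
	have "\<exists>\<tau>. \<tau> \<noteq> 0 \<and> (\<forall>i. x i (pt p) * z i (pt p) = \<tau>)" if p: "p \<in> P" for p
	proof -
		obtain u y where uy: "p = (u, y)" by (cases p)
		obtain \<tau> where \<tau>: "kkt_solution \<zeta> u y \<tau>" using P(2) p uy by blast
		then have eq: "x i (pt p) * z i (pt p) = \<tau>" for i by (simp add: uy xeval zeval kkt_solution_def)
		have "\<tau> \<noteq> 0"
		proof
			assume 0: "\<tau> = 0"
			\<comment> \<open>If \<tau> = 0, then for each i one of \<open>x i\<close> and \<open>z i\<close>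
			  vanishes at the point. A subset J of the vanishing coordinates of size at most m - d is chosen;
			  the homogenizing form is then a combination of forms vanishing there, although its value is 1.
			  When J has full size, no slacks are needed in that combination.\<close>
			define J0 where "J0 = {i. u i = 0}"
			have "\<exists>J. J \<subseteq> J0 \<and> card J \<le> ?\<rho> \<and> (card J = ?\<rho> \<or> J = J0)"
			proof (cases "card J0 \<le> ?\<rho>")
				case True then show ?thesis by (intro exI[of _ J0]) simp
			next
				case False
				then have "?\<rho> \<le> card J0" by linarith
				then obtain J where "J \<subseteq> J0" "card J = ?\<rho>" by (rule obtain_subset_with_card_n)
				then show ?thesis by (intro exI[of _ J]) simp
			qed
			then obtain J where J: "J \<subseteq> J0" "card J \<le> ?\<rho>" "card J = ?\<rho> \<or> J = J0"
				by (elim exE conjE) (rule that)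
			let ?one = "eval_form (\<lambda>j :: ('m + 'd) option. if j = None then 1 else 0)"
			have lspan0: "f (pt p) = 0" if S: "f \<in> lspan S" "\<And>g. g \<in> S ==> g (pt p) = 0" for f S using S(1)
			proof induction
				case (base g)
				then show ?case by (rule S(2))
			qed simp_all
			have one: "?one (pt p) = 1" by (simp add: eval_form_unit' pt_def)
			have oneX: "?one \<in> X" unfolding X_def by (intro CollectI exI conjI refl) auto
			from J(3) show False
			proof
				assume "card J = ?\<rho>"
				from spanX[OF this oneX] have "?one (pt p) = 0"
					by (rule lspan0) (use Ceval p J(1) in \<open>auto simp: uy xeval J0_def\<close>)
				then show False using one by simp
			next
				assume JJ: "J = J0"
				have "?one \<in> lspan (C \<union> {} \<union> x ` J \<union> z ` (UNIV - J))" using span[OF J(2)] oneX XW by blast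
				then have "?one (pt p) = 0"
				proof (rule lspan0)
					fix g assume "g \<in> C \<union> {} \<union> x ` J \<union> z ` (UNIV - J)"
					then consider "g \<in> C" | i where "i \<in> J" "g = x i" | i where "i \<notin> J" "g = z i" by blast
					then show "g (pt p) = 0"
					proof cases
						case 1 then show ?thesis using Ceval p uy by simp
					next
						case 2 then show ?thesis using JJ by (simp add: xeval uy J0_def)
					next
						case (3 i) then show ?thesis using JJ eq[of i] 0 by (simp add: xeval uy J0_def)
					qed
				qed
				then show False using one by simp
			qed
		qed
		then show ?thesis using eq by blast
	qed
	then obtain lam where lam: "\<And>p. p \<in> P ==> lam p \<noteq> 0" "\<And>p i. p \<in> P ==> x i (pt p) * z i (pt p) = lam p"
		by metis
	\<comment> \<open>All forms are homogeneous, so dividing by a square root of \<tau> normalizes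
	  every product \<open>x i * z i\<close> to 1.\<close>
	define sc where "sc p = (\<lambda>j. pt p j / csqrt (lam p))" for p
	have sq: "csqrt (lam p) * csqrt (lam p) = lam p" for p by (simp flip: power2_eq_square)
	have nz: "csqrt (lam p) \<noteq> 0" if "p \<in> P" for p using lam(1)[OF that] by simp
	have scale: "eval_form a (sc p) = eval_form a (pt p) / csqrt (lam p)" for a p
		by (simp add: eval_form_def sc_def sum_divide_distrib)
	have pt_inj: "\<exists>j. pt p j \<noteq> pt q j" if "p \<noteq> q" for p q
	proof (rule ccontr)
		assume "\<not> ?thesis"
		then have *: "pt p j = pt q j" for j by blast
		have "fst p i = fst q i" for i using *[of "Some (Inl i)"] by (simp add: pt_def)
		moreover have "snd p k = snd q k" for k using *[of "Some (Inr k)"] by (simp add: pt_def)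
		ultimately show False using that by (auto simp: prod_eq_iff)
	qed
	have sep: "\<exists>\<phi>. V X W 1 1 \<phi> \<and> \<phi> (sc p) = 0 \<and> \<phi> (sc q) \<noteq> 0" if pq: "p \<in> P" "q \<in> P" "p \<noteq> q" for p q
	proof -
		obtain j where j: "pt p j \<noteq> pt q j" using pt_inj[OF pq(3)] by blast
		\<comment> \<open>The separator is a product of bidegree (1, 1): \<beta> vanishes at the first
		  point and not at the second, and the homogenizing form \<alpha>, never zero at these points,
		  supplies the degree in X.\<close>
		define \<alpha> where "\<alpha> = eval_form (\<lambda>j :: ('m + 'd) option. if j = None then 1 else 0)"
		define \<beta> where "\<beta> = eval_form (\<lambda>i. (if i = j then 1 else 0) - pt p j * (if i = None then 1 else 0))"
		have "\<alpha> \<in> X" unfolding \<alpha>_def X_def by (intro CollectI exI conjI refl) auto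
		moreover have "\<beta> \<in> W" by (simp add: \<beta>_def W_def)
		ultimately have "V X W (Suc 0) (Suc 0) (\<lambda>w. \<alpha> w * (\<beta> w * 1))" by (intro V_X V_W V_one)
		then have "V X W 1 1 (\<lambda>w. \<alpha> w * \<beta> w)" by simp
		moreover have \<alpha>v: "\<alpha> (sc r) = 1 / csqrt (lam r)" for r
			by (simp add: \<alpha>_def eval_form_unit' pt_def sc_def)
		moreover have \<beta>v: "\<beta> (sc r) = (pt r j - pt p j) / csqrt (lam r)" for r
		proof -
			have "\<beta> w = eval_form (\<lambda>i. if i = j then 1 else 0) w - pt p j * eval_form (\<lambda>i. if i = None then 1 else 0) w" for w
				by (simp add: \<beta>_def eval_form_def left_diff_distrib sum_subtractf sum_distrib_left mult.assoc)
			then have "\<beta> w = w j - pt p j * w None" for w by (simp add: eval_form_unit')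
			then show ?thesis by (simp add: sc_def pt_def diff_divide_distrib)
		qed
		ultimately show ?thesis using j nz[OF pq(2)] by (intro exI[of _ "\<lambda>w. \<alpha> w * \<beta> w"]) auto
	qed
	have inj: "inj_on sc P"
	proof (rule inj_onI, rule ccontr)
		fix p q assume "p \<in> P" "q \<in> P" "sc p = sc q" "p \<noteq> q"
		then show False using sep[of p q] by auto
	qed
	have "card (sc ` P) \<le> (\<Sum>i<?\<rho>. (CARD('m) - 1) choose i)"
	proof (rule solutions_bound[OF red])
		show "x i w * z i w = 1" if "w \<in> sc ` P" for i w
		proof -
			obtain p where p: "p \<in> P" "w = sc p" using \<open>w \<in> sc ` P\<close> by blast
			have "x i w * z i w = x i (pt p) * z i (pt p) / (csqrt (lam p) * csqrt (lam p))"
				by (simp add: p(2) x_def z_def scale)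
			then show ?thesis using lam[OF p(1)] by (simp add: sq)
		qed
		show "\<gamma> w = 0" if "\<gamma> \<in> C" "w \<in> sc ` P" for \<gamma> w
		proof -
			obtain p where p: "p \<in> P" "w = sc p" using \<open>w \<in> sc ` P\<close> by blast
			obtain a where "\<gamma> = eval_form a" using \<open>\<gamma> \<in> C\<close> CX XW by (auto simp: W_def)
			then show ?thesis using Ceval[OF \<open>\<gamma> \<in> C\<close>, of "fst p" "snd p"] p by (simp add: scale)
		qed
		show "\<exists>\<phi>. V X W 1 1 \<phi> \<and> \<phi> w = 0 \<and> \<phi> w' \<noteq> 0" if "w \<in> sc ` P" "w' \<in> sc ` P" "w \<noteq> w'" for w w'
			using that sep by blast
	qed (use P(1) in auto)
	then show ?thesis using inj by (simp add: card_image)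
qed

section \<open>Analyticity of the central path\<close>

text \<open>The solution is the fixed point of a contraction on a small polydisc.\<close>

lemma quadratic_fixed_point:
	fixes v :: "'n::finite => complex" and B :: "'n => 'n => 'n => complex"
	shows "\<exists>\<epsilon>>0. \<exists>\<phi>. (\<forall>a. \<phi> a holomorphic_on ball 0 \<epsilon>) \<and> (\<forall>a. \<phi> a 0 = 0) \<and>
		(\<forall>s\<in>ball 0 \<epsilon>. \<forall>a. \<phi> a s = s * v a + (\<Sum>j\<in>UNIV. \<Sum>k\<in>UNIV. B a j k * \<phi> j s * \<phi> k s)) \<and>
		((\<forall>a. v a \<in> \<real>) --> (\<forall>a j k. B a j k \<in> \<real>) --> (\<forall>a t. complex_of_real t \<in> ball 0 \<epsilon> --> \<phi> a (of_real t) \<in> \<real>))"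
proof -
	\<comment> \<open>On the polydisc of radius \<rho> = 1 / (4 \<beta>) the quadratic part is at most
	  \<rho> / 4 and contracts by 2 \<beta> \<rho> = 1 / 2. For |s| < \<epsilon> the linear part is at
	  most \<rho> / 2, so the iterates stay inside.\<close>
	define \<beta> where "\<beta> = 1 + (\<Sum>a\<in>UNIV. \<Sum>j\<in>UNIV. \<Sum>k\<in>UNIV. norm (B a j k))"
	define \<mu> where "\<mu> = 1 + (\<Sum>a\<in>UNIV. norm (v a))"
	define \<rho> where "\<rho> = 1 / (4 * \<beta>)"
	define \<epsilon> where "\<epsilon> = \<rho> / (2 * \<mu>)"
	have pos: "\<beta> > 0" "\<mu> > 0" unfolding \<beta>_def \<mu>_def by (auto intro!: add_pos_nonneg sum_nonneg)
	then have \<rho>: "\<rho> > 0" and \<epsilon>: "\<epsilon> > 0" by (auto simp: \<rho>_def \<epsilon>_def)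
	have vle: "norm (v a) \<le> \<mu>" for a
		using member_le_sum[of a UNIV "\<lambda>a. norm (v a)"] unfolding \<mu>_def by simp
	have Ble: "(\<Sum>j\<in>UNIV. \<Sum>k\<in>UNIV. norm (B a j k)) \<le> \<beta>" for a
		using member_le_sum[of a UNIV "\<lambda>a. \<Sum>j\<in>UNIV. \<Sum>k\<in>UNIV. norm (B a j k)"]
		unfolding \<beta>_def by (simp add: sum_nonneg)
	define T where "T s p a = s * v a + (\<Sum>j\<in>UNIV. \<Sum>k\<in>UNIV. B a j k * p j * p k)" for s and p :: "'n => complex" and a
	define p where "p n s = (T s ^^ n) (\<lambda>_. 0)" for n s
	have p0: "p 0 s = (\<lambda>_. 0)" and pS: "p (Suc n) s = T s (p n s)" for n s by (simp_all add: p_def)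
	have sums: "norm (\<Sum>j\<in>UNIV. \<Sum>k\<in>UNIV. B a j k * c j k) \<le> \<beta> * C" if "\<And>j k. norm (c j k) \<le> C" for a c C
	proof -
		have "0 \<le> C" using that norm_ge_zero order_trans by blast
		have "norm (\<Sum>j\<in>UNIV. \<Sum>k\<in>UNIV. B a j k * c j k) \<le> (\<Sum>j\<in>UNIV. \<Sum>k\<in>UNIV. norm (B a j k) * C)"
			by (intro sum_norm_le) (auto simp: norm_mult intro!: mult_left_mono that)
		also have "\<dots> = (\<Sum>j\<in>UNIV. \<Sum>k\<in>UNIV. norm (B a j k)) * C" by (simp add: sum_distrib_right)
		also have "\<dots> \<le> \<beta> * C" by (intro mult_right_mono Ble \<open>0 \<le> C\<close>)
		finally show ?thesis .
	qed
	have bound: "norm (p n s a) \<le> \<rho>" if s: "norm s < \<epsilon>" for n s a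
	proof (induction n arbitrary: a)
		case 0 then show ?case using \<rho> by (simp add: p0)
	next
		case (Suc n)
		have "norm (s * v a) \<le> \<epsilon> * \<mu>" unfolding norm_mult using s vle[of a] \<epsilon> by (intro mult_mono) auto
		also have "\<dots> = \<rho> / 2" using pos by (simp add: \<epsilon>_def)
		finally have 1: "norm (s * v a) \<le> \<rho> / 2" .
		have "norm (\<Sum>j\<in>UNIV. \<Sum>k\<in>UNIV. B a j k * (p n s j * p n s k)) \<le> \<beta> * (\<rho> * \<rho>)"
			by (rule sums) (simp add: norm_mult mult_mono Suc \<rho> less_imp_le)
		also have "\<dots> = \<rho> / 4" using pos by (simp add: \<rho>_def)
		finally have 2: "norm (\<Sum>j\<in>UNIV. \<Sum>k\<in>UNIV. B a j k * p n s j * p n s k) \<le> \<rho> / 4" by (simp add: mult.assoc)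
		show ?case unfolding pS T_def by (rule order_trans[OF norm_triangle_ineq]) (use 1 2 \<rho> in linarith)
	qed
	have diff: "norm (p (Suc n) s a - p n s a) \<le> \<rho> * (1/2) ^ n" if s: "norm s < \<epsilon>" for n s a
	proof (induction n arbitrary: a)
		case 0 then show ?case using bound[OF s, of 1 a] by (simp add: p0)
	next
		case (Suc n)
		let ?d = "\<rho> * (1/2) ^ n"
		have "p (Suc (Suc n)) s a - p (Suc n) s a =
				(\<Sum>j\<in>UNIV. \<Sum>k\<in>UNIV. B a j k * (p (Suc n) s j * p (Suc n) s k - p n s j * p n s k))"
			unfolding pS[of "Suc n"] unfolding pS[of n] T_def[of s "p n s"] T_def[of s "T s (p n s)"]
			by (simp add: T_def sum_subtractf right_diff_distrib mult.assoc)
		also have "norm \<dots> \<le> \<beta> * (2 * \<rho> * ?d)"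
		proof (rule sums)
			fix j k
			have "p (Suc n) s j * p (Suc n) s k - p n s j * p n s k =
					p (Suc n) s j * (p (Suc n) s k - p n s k) + (p (Suc n) s j - p n s j) * p n s k"
				by (simp add: algebra_simps)
			also have "norm \<dots> \<le> \<rho> * ?d + ?d * \<rho>" using bound[OF s] Suc \<rho>
				by (intro order_trans[OF norm_triangle_ineq] add_mono) (simp_all add: norm_mult mult_mono less_imp_le)
			finally show "norm (p (Suc n) s j * p (Suc n) s k - p n s j * p n s k) \<le> 2 * \<rho> * ?d" by simp
		qed
		also have "\<dots> = \<rho> * (1/2) ^ Suc n" using pos by (simp add: \<rho>_def)
		finally show ?case .
	qed
	\<comment> \<open>The limit of the iterates, written as a telescoping series so that the
	  Weierstrass test gives uniform convergence.\<close>
	define \<phi> where "\<phi> a s = suminf (\<lambda>n. p (Suc n) s a - p n s a)" for a s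
	have tele: "(\<Sum>i<n. p (Suc i) s a - p i s a) = p n s a" for n s a
		using sum_lessThan_telescope[of "\<lambda>i. p i s a" n] by (simp add: p0)
	have ul: "uniform_limit (ball 0 \<epsilon>) (\<lambda>n s. p n s a) (\<phi> a) sequentially" for a
	proof -
		have "uniform_limit (ball 0 \<epsilon>) (\<lambda>n s. \<Sum>i<n. p (Suc i) s a - p i s a) (\<lambda>s. suminf (\<lambda>i. p (Suc i) s a - p i s a)) sequentially"
			by (rule Weierstrass_m_test[where M = "\<lambda>n. \<rho> * (1/2) ^ n"])
				 (use diff in \<open>auto intro!: summable_mult summable_geometric\<close>)
		then show ?thesis by (simp add: tele \<phi>_def[abs_def])
	qed
	have lim: "(\<lambda>n. p n s a) \<longlonglongrightarrow> \<phi> a s" if "s \<in> ball 0 \<epsilon>" for s a using tendsto_uniform_limitI[OF ul that] .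
	have hol: "(\<lambda>s. p n s a) holomorphic_on ball 0 \<epsilon>" for n a
	proof (induction n arbitrary: a)
		case 0 then show ?case by (simp add: p0)
	next
		case (Suc n)
		then show ?case unfolding pS T_def by (intro holomorphic_intros)
	qed
	have 1: "\<phi> a holomorphic_on ball 0 \<epsilon>" for a
	proof (rule holomorphic_uniform_sequence[OF open_ball hol])
		fix s :: complex assume "s \<in> ball 0 \<epsilon>"
		then obtain d where "d > 0" "cball s d \<subseteq> ball 0 \<epsilon>"
			using open_contains_cball[of "ball (0::complex) \<epsilon>"] by (meson open_ball)
		then show "\<exists>d>0. cball s d \<subseteq> ball 0 \<epsilon> \<and> uniform_limit (cball s d) (\<lambda>n s. p n s a) (\<phi> a) sequentially"
			using uniform_limit_on_subset[OF ul] by blast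
	qed
	have 3: "\<phi> a s = s * v a + (\<Sum>j\<in>UNIV. \<Sum>k\<in>UNIV. B a j k * \<phi> j s * \<phi> k s)" if s: "s \<in> ball 0 \<epsilon>" for s a
	proof (rule LIMSEQ_unique)
		show "(\<lambda>n. p (Suc n) s a) \<longlonglongrightarrow> \<phi> a s" using lim[OF s] by (rule LIMSEQ_Suc)
		show "(\<lambda>n. p (Suc n) s a) \<longlonglongrightarrow> s * v a + (\<Sum>j\<in>UNIV. \<Sum>k\<in>UNIV. B a j k * \<phi> j s * \<phi> k s)"
			unfolding pS T_def by (intro tendsto_intros lim s)
	qed
	have "p n 0 = (\<lambda>_. 0)" for n by (induction n) (simp_all add: p0 pS T_def)
	then have 2: "\<phi> a 0 = 0" for a by (simp add: \<phi>_def)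
	have 4: "\<phi> a (of_real t) \<in> \<real>" if "\<forall>a. v a \<in> \<real>" "\<forall>a j k. B a j k \<in> \<real>" "complex_of_real t \<in> ball 0 \<epsilon>" for a t
	proof -
		have "p n (of_real t) a \<in> \<real>" for n a
		proof (induction n arbitrary: a)
			case (Suc n)
			show ?case unfolding pS T_def by (intro Reals_add Reals_mult sum_in_Reals Suc) (use that in auto)
		qed (simp add: p0)
		then show ?thesis by (intro Lim_in_closed_set[OF closed_complex_Reals _ _ lim[OF that(3)]]) auto
	qed
	show ?thesis using \<epsilon> 1 2 3 4 by blast
qed

text \<open>Analyticity on the positive half-line, stated through local holomorphic extensions in
  the increment s. Values at nonpositive arguments are left free.\<close>

definition real_analytic :: "(real => complex) => bool" where
	"real_analytic f \<longleftrightarrow> (\<forall>\<tau>>0. \<exists>\<epsilon>>0. \<exists>F. F holomorphic_on ball 0 \<epsilon> \<and>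
		 (\<forall>s. \<bar>s\<bar> < \<epsilon> --> \<tau> + s > 0 --> f (\<tau> + s) = F (of_real s)))"

lemma real_analytic_const: "real_analytic (\<lambda>_. c)"
	unfolding real_analytic_def by (intro allI impI exI[of _ 1] conjI exI[of _ "\<lambda>_. c"]) auto

lemma real_analytic_binary:
	assumes "real_analytic f" "real_analytic g"
		and "\<And>F G S. F holomorphic_on S ==> G holomorphic_on S ==> (\<lambda>z. h (F z) (G z)) holomorphic_on S"
	shows "real_analytic (\<lambda>\<tau>. h (f \<tau>) (g \<tau>))" unfolding real_analytic_def
proof (intro allI impI)
	fix \<tau> :: real assume \<tau>: "\<tau> > 0"
	obtain e F where F: "e > 0" "F holomorphic_on ball 0 e" "\<And>s. \<bar>s\<bar> < e ==> \<tau> + s > 0 ==> f (\<tau> + s) = F (of_real s)"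
		using assms(1) \<tau> unfolding real_analytic_def by blast
	obtain d G where G: "d > 0" "G holomorphic_on ball 0 d" "\<And>s. \<bar>s\<bar> < d ==> \<tau> + s > 0 ==> g (\<tau> + s) = G (of_real s)"
		using assms(2) \<tau> unfolding real_analytic_def by blast
	have "(\<lambda>z. h (F z) (G z)) holomorphic_on ball 0 (min e d)"
		by (rule assms(3)) (auto intro: holomorphic_on_subset[OF F(2)] holomorphic_on_subset[OF G(2)])
	then show "\<exists>\<epsilon>>0. \<exists>H. H holomorphic_on ball 0 \<epsilon> \<and>
			(\<forall>s. \<bar>s\<bar> < \<epsilon> --> \<tau> + s > 0 --> h (f (\<tau> + s)) (g (\<tau> + s)) = H (of_real s))"
		using F G by (intro exI[of _ "min e d"] conjI exI[of _ "\<lambda>z. h (F z) (G z)"]) auto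
qed

lemma real_analytic_add: "real_analytic f ==> real_analytic g ==> real_analytic (\<lambda>\<tau>. f \<tau> + g \<tau>)"
	by (rule real_analytic_binary[where h = "(+)"]) (auto intro: holomorphic_intros)

lemma real_analytic_mult: "real_analytic f ==> real_analytic g ==> real_analytic (\<lambda>\<tau>. f \<tau> * g \<tau>)"
	by (rule real_analytic_binary[where h = "(*)"]) (auto intro: holomorphic_intros)

lemma real_analytic_polyfun:
	assumes "polyfun q" "\<And>a. real_analytic (\<lambda>\<tau>. x \<tau> a)"
	shows "real_analytic (\<lambda>\<tau>. q (x \<tau>))"
	using assms(1) by induction (auto intro: real_analytic_const real_analytic_add real_analytic_mult assms(2))

lemma holomorphic_zero_from_reals:
	assumes "F holomorphic_on ball 0 \<epsilon>" "\<And>n. s n \<in> ball 0 \<epsilon> - {0}" "s \<longlonglongrightarrow> (0::complex)" "\<And>n. F (s n) = 0" "\<epsilon> > 0"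
		and "w \<in> ball 0 \<epsilon>"
	shows "F w = 0"
proof (rule analytic_continuation[OF assms(1), of "range s" 0 w])
	show "0 islimpt range s" unfolding islimpt_sequential using assms(2,3) by (intro exI[of _ s]) auto
qed (use assms in auto)

text \<open>The set of zeros is either discrete or everything: the interior of the zero set is closed.\<close>

lemma real_analytic_zero:
	assumes f: "real_analytic f" and "\<tau>0 > 0" "\<epsilon>0 > 0"
		and zero: "\<And>s. \<bar>s\<bar> < \<epsilon>0 ==> \<tau>0 + s > 0 ==> f (\<tau>0 + s) = 0" and "\<tau> > 0"
	shows "f \<tau> = 0"
proof -
	define Z where "Z = {\<tau>. \<tau> > 0 \<and> (\<exists>\<epsilon>>0. \<forall>s. \<bar>s\<bar> < \<epsilon> --> \<tau> + s > 0 --> f (\<tau> + s) = 0)}"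
	have local_zero: "\<tau> \<in> Z" if "\<tau> > 0" and acc: "\<And>\<delta>. \<delta> > 0 ==> \<exists>s. s \<noteq> 0 \<and> \<bar>s\<bar> < \<delta> \<and> \<tau> + s > 0 \<and> f (\<tau> + s) = 0" for \<tau>
	proof -
		obtain e F where F: "e > 0" "F holomorphic_on ball 0 e" "\<And>s. \<bar>s\<bar> < e ==> \<tau> + s > 0 ==> f (\<tau> + s) = F (of_real s)"
			using f \<open>\<tau> > 0\<close> unfolding real_analytic_def by blast
		have "\<forall>n. \<exists>s. s \<noteq> 0 \<and> \<bar>s\<bar> < min e (1 / real (Suc n)) \<and> \<tau> + s > 0 \<and> f (\<tau> + s) = 0"
		proof
			fix n
			have "min e (1 / real (Suc n)) > 0" using F(1) by simp
			from acc[OF this] show "\<exists>s. s \<noteq> 0 \<and> \<bar>s\<bar> < min e (1 / real (Suc n)) \<and> \<tau> + s > 0 \<and> f (\<tau> + s) = 0" .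
		qed
		then obtain s where s: "\<And>n. s n \<noteq> 0 \<and> \<bar>s n\<bar> < min e (1 / real (Suc n)) \<and> \<tau> + s n > 0 \<and> f (\<tau> + s n) = 0" by metis
		have "s \<longlonglongrightarrow> 0" by (rule Lim_null_comparison[OF _ LIMSEQ_inverse_real_of_nat])
				 (use s in \<open>auto intro!: always_eventually simp: inverse_eq_divide less_imp_le\<close>)
		then have "(\<lambda>n. complex_of_real (s n)) \<longlonglongrightarrow> of_real 0" by (rule tendsto_of_real)
		then have lim: "(\<lambda>n. complex_of_real (s n)) \<longlonglongrightarrow> 0" by simp
		have mem: "complex_of_real (s n) \<in> ball 0 e - {0}" for n using s[of n] by (simp add: dist_norm)
		have Fz: "F (of_real (s n)) = 0" for n using s[of n] F(3)[of "s n"] by simp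
		have z0: "F w = 0" if "w \<in> ball 0 e" for w
			by (rule holomorphic_zero_from_reals[OF F(2) mem lim Fz F(1) that])
		have "f (\<tau> + s) = 0" if "\<bar>s\<bar> < e" "\<tau> + s > 0" for s
			using F(3)[OF that] z0[of "of_real s"] that by (simp add: dist_norm)
		then show ?thesis using \<open>\<tau> > 0\<close> F(1) unfolding Z_def by blast
	qed
	have "openin (top_of_set {0<..}) Z"
	proof -
		have "open Z" unfolding open_dist
		proof
			fix \<tau> assume "\<tau> \<in> Z"
			then obtain e where e: "\<tau> > 0" "e > 0" "\<And>s. \<bar>s\<bar> < e ==> \<tau> + s > 0 ==> f (\<tau> + s) = 0"
				unfolding Z_def by blast
			have "y \<in> Z" if y: "dist y \<tau> < min (e / 2) \<tau>" for y
			proof -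
				have "y > 0" using y by (auto simp: dist_real_def abs_if split: if_splits)
				moreover have "f (y + s) = 0" if "\<bar>s\<bar> < e / 2" "y + s > 0" for s
				proof -
					have "\<bar>y + s - \<tau>\<bar> < e" using that(1) y by (auto simp: dist_real_def abs_if split: if_splits)
					then show ?thesis using e(3)[of "y + s - \<tau>"] that(2) by simp
				qed
				ultimately show ?thesis unfolding Z_def using e(2) by (intro CollectI conjI exI[of _ "e / 2"]) auto
			qed
			then show "\<exists>e>0. \<forall>y. dist y \<tau> < e --> y \<in> Z" using e by (intro exI[of _ "min (e / 2) \<tau>"]) auto
		qed
		moreover have "Z \<subseteq> {0<..}" by (auto simp: Z_def)
		ultimately show ?thesis by (simp add: openin_open_eq)
	qed
	moreover have "closedin (top_of_set {0<..}) Z" unfolding closedin_limpt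
	proof (intro conjI allI impI)
		show "Z \<subseteq> {0<..}" by (auto simp: Z_def)
		fix \<tau> assume *: "\<tau> islimpt Z \<and> \<tau> \<in> {0<..}"
		show "\<tau> \<in> Z"
		proof (rule local_zero)
			show "\<tau> > 0" using * by simp
			fix \<delta> :: real assume "\<delta> > 0"
			then obtain y where y: "y \<in> Z" "y \<noteq> \<tau>" "dist y \<tau> < \<delta>" using * islimpt_approachable by blast
			then obtain e where e: "y > 0" "e > 0" "\<And>s. \<bar>s\<bar> < e ==> y + s > 0 ==> f (y + s) = 0"
				unfolding Z_def by blast
			then have "f (y + 0) = 0" "y > 0" using e(3)[of 0] by simp_all
			then show "\<exists>s. s \<noteq> 0 \<and> \<bar>s\<bar> < \<delta> \<and> \<tau> + s > 0 \<and> f (\<tau> + s) = 0"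
				using y by (intro exI[of _ "y - \<tau>"]) (auto simp: dist_real_def)
		qed
	qed
	moreover have "connected {0::real<..}" by (intro convex_connected convex_real_interval)
	ultimately have "Z = {} \<or> Z = {0<..}" using connected_clopen by blast
	moreover have "\<tau>0 \<in> Z" unfolding Z_def using assms by blast
	ultimately have "\<tau> \<in> Z" using \<open>\<tau> > 0\<close> by auto
	then obtain e where e: "e > 0" "\<And>s. \<bar>s\<bar> < e ==> \<tau> + s > 0 ==> f (\<tau> + s) = 0" unfolding Z_def by blast
	show ?thesis using e(2)[of 0] e(1) \<open>\<tau> > 0\<close> by simp
qed

text \<open>Where f is nonzero it stays nonzero nearby, so g vanishes on an interval and hence on
  the whole half-line. Applied to polynomials along the path, this makes the vanishing ideal
  prime.\<close>

lemma real_analytic_prime: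
	assumes f: "real_analytic f" and g: "real_analytic g" and z: "\<And>\<tau>. \<tau> > 0 ==> f \<tau> * g \<tau> = 0"
	shows "(\<forall>\<tau>>0. f \<tau> = 0) \<or> (\<forall>\<tau>>0. g \<tau> = 0)"
proof (rule ccontr)
	assume "\<not> ?thesis"
	then obtain \<tau>1 where \<tau>1: "\<tau>1 > 0" "f \<tau>1 \<noteq> 0" and ng: "\<not> (\<forall>\<tau>>0. g \<tau> = 0)" by blast
	obtain e F where F: "e > 0" "F holomorphic_on ball 0 e" "\<And>s. \<bar>s\<bar> < e ==> \<tau>1 + s > 0 ==> f (\<tau>1 + s) = F (of_real s)"
		using f \<open>\<tau>1 > 0\<close> unfolding real_analytic_def by blast
	have "F 0 \<noteq> 0" using F(3)[of 0] F(1) \<tau>1 by simp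
	moreover have "isCont F 0"
		using holomorphic_on_imp_continuous_on[OF F(2)] F(1) continuous_on_eq_continuous_at[OF open_ball]
		by (metis centre_in_ball)
	ultimately obtain d where d: "d > 0" "\<And>w. dist 0 w < d ==> F w \<noteq> 0"
		using continuous_at_avoid[of 0 F 0] by blast
	have "g \<tau> = 0" if "\<tau> > 0" for \<tau>
	proof (rule real_analytic_zero[OF g \<tau>1(1) _ _ that, of "min d e"])
		fix s assume s: "\<bar>s\<bar> < min d e" "\<tau>1 + s > 0"
		then have "f (\<tau>1 + s) \<noteq> 0" using F(3)[of s] d(2)[of "of_real s"] by simp
		then show "g (\<tau>1 + s) = 0" using z[OF s(2)] by simp
	qed (use d F in auto)
	then show False using ng by blast
qed

section \<open>Real programs and the local solution of their equations\<close>

definition urep :: "'m uprod => 'm \<times> 'm" where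
	"urep p = (SOME ij. Upair (fst ij) (snd ij) = p)"

lemma Upair_urep: "Upair (fst (urep p)) (snd (urep p)) = p"
proof -
	have "\<exists>ij. Upair (fst ij) (snd ij) = p" by (cases p) auto
	then show ?thesis unfolding urep_def by (rule someI_ex)
qed

definition slot_entry :: "('m::finite, 'd::finite) qp => ('m, 'd) slot => real" where
	"slot_entry D s = (case D of (Q, c, A, b) => (case s of Inl p => Q $ fst (urep p) $ snd (urep p)
	 | Inr (Inl (k, i)) => A $ k $ i
	 | Inr (Inr (Inl i)) => c $ i
	 | Inr (Inr (Inr k)) => b $ k))"

lemma slot_entry_simps [simp]: "slot_entry (Q, c, A, b) (Inl p) = Q $ fst (urep p) $ snd (urep p)"
	"slot_entry (Q, c, A, b) (slotA k i) = A $ k $ i" "slot_entry (Q, c, A, b) (slotc i) = c $ i"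
	"slot_entry (Q, c, A, b) (slotb k) = b $ k" by (simp_all add: slot_entry_def)

lemma symmetric_entries: "transpose Q = Q ==> Q $ i $ j = Q $ j $ i"
	by (drule arg_cong[of _ _ "\<lambda>M. M $ j $ i"]) (simp add: transpose_def)

lemma slot_entry_Q:
	assumes "transpose Q = Q"
	shows "slot_entry (Q, c, A, b) (slotQ i j) = Q $ i $ j"
proof -
	obtain i' j' where u: "urep (Upair i j) = (i', j')" by (cases "urep (Upair i j)")
	have "Upair i' j' = Upair i j" using Upair_urep[of "Upair i j"] u by simp
	then have "i' = i \<and> j' = j \<or> i' = j \<and> j' = i" by simp
	then show ?thesis using symmetric_entries[OF assms, of j i] u by auto
qed

lemma kkt_iff:
	assumes "transpose Q = Q"
	shows "kkt (Q, c, A, b) \<tau> (x, y) \<longleftrightarrow> (\<forall>i. 0 < x $ i) \<and>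
		(\<forall>i. x $ i * (c $ i + (\<Sum>j\<in>UNIV. Q $ i $ j * x $ j) - (\<Sum>k\<in>UNIV. A $ k $ i * y $ k)) = \<tau>) \<and>
		(\<forall>k. (\<Sum>i\<in>UNIV. A $ k $ i * x $ i) = b $ k)"
proof -
	note sym = symmetric_entries[OF assms]
	have 1: "(x v* Q + c - \<tau> *\<^sub>R (\<chi> i. 1 / x $ i) - y v* A) $ i =
			c $ i + (\<Sum>j\<in>UNIV. Q $ i $ j * x $ j) - (\<Sum>k\<in>UNIV. A $ k $ i * y $ k) - \<tau> / x $ i" for i
		by (simp add: vector_matrix_mult_def sym[of _ i] mult.commute)
	have 2: "a - \<tau> / u = 0 \<longleftrightarrow> u * a = \<tau>" if "u > 0" for a u :: real using that by (auto simp: field_simps)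
	have "x v* Q + c - \<tau> *\<^sub>R (\<chi> i. 1 / x $ i) - y v* A = 0 \<longleftrightarrow>
			(\<forall>i. c $ i + (\<Sum>j\<in>UNIV. Q $ i $ j * x $ j) - (\<Sum>k\<in>UNIV. A $ k $ i * y $ k) - \<tau> / x $ i = 0)"
		unfolding vec_eq_iff 1 by simp
	moreover have "A *v x = b \<longleftrightarrow> (\<forall>k. (\<Sum>i\<in>UNIV. A $ k $ i * x $ i) = b $ k)"
		by (simp add: vec_eq_iff matrix_vector_mult_def)
	ultimately show ?thesis using 2 by auto
qed

lemma admissible_kkt: "admissible D ==> \<tau> > 0 ==> kkt D \<tau> (central_path D \<tau>)"
	unfolding admissible_def central_path_def using theI'[of "kkt D \<tau>"] by blast

lemma central_path_eqI: "admissible D ==> \<tau> > 0 ==> kkt D \<tau> z ==> central_path D \<tau> = z"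
	unfolding admissible_def central_path_def using the1_equality[of "kkt D \<tau>"] by blast

lemma admissible_symmetric: "admissible (Q, c, A, b) ==> transpose Q = Q"
	by (simp add: admissible_def positive_definite_def)

text \<open>The coordinates of the point with parameter \<open>\<tau>\<close> on the central path: the slots of \<open>c\<close> and \<open>b\<close>
	hold \<open>x\<close> and \<open>y\<close>, the variable \<open>None\<close> holds \<open>\<tau>\<close>.\<close>

definition path_coords :: "('m::finite, 'd::finite) qp => real => ('m, 'd) slot option => complex" where
	"path_coords D \<tau> v = (case v of None => of_real \<tau>
		 | Some s => (case s of Inr (Inr (Inl i)) => of_real (fst (central_path D \<tau>) $ i)
				| Inr (Inr (Inr k)) => of_real (snd (central_path D \<tau>) $ k)
				| _ => of_real (slot_entry D s)))"

definition slack_coeff :: "(('m::finite, 'd::finite) slot option => complex) => 'm => 'm + 'd => complex" where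
	"slack_coeff e i a = (case a of Inl j => e (Some (slotQ i j)) | Inr k => - e (Some (slotA k i)))"

text \<open>The Jacobian of the system \<open>x i * z i = \<tau>\<close>, \<open>A x = b\<close>, its row \<open>i\<close> multiplied by \<open>x i\<close>.\<close>

definition jac :: "(('m::finite, 'd::finite) slot option => complex) => complex^('m + 'd)^('m + 'd)" where
	"jac e = (\<chi> r a. case r of
		 Inl i => (if a = Inl i then e None else 0) + (e (Some (slotc i)))\<^sup>2 * slack_coeff e i a
	 | Inr k => (case a of Inl i => e (Some (slotA k i)) | Inr _ => 0))"

lemma polyfun_slack_coeff: "polyfun (\<lambda>e. slack_coeff e i a)"
	by (cases a) (auto simp: slack_coeff_def intro!: polyfun_intros)

lemma polyfun_jac: "polyfun (\<lambda>e. jac e $ r $ a)"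
proof (cases r)
	case (Inl i)
	then show ?thesis
		by (cases "a = Inl i") (auto simp: jac_def intro!: polyfun_intros polyfun_slack_coeff)
next
	case (Inr k)
	then show ?thesis by (cases a) (auto simp: jac_def intro!: polyfun_intros)
qed

text \<open>The equations for the increments w when \<tau> grows by s, with row i multiplied by x i:
  the linear terms form \<open>jac\<close>, and the rest is gathered here. The system is quadratic,
  so this is exact and not a truncation.\<close>

definition germ_rhs :: "(('m::finite, 'd::finite) slot option => complex) => ('m + 'd => complex) => complex =>
		'm + 'd => complex" where
	"germ_rhs e w s r = (case r of
		 Inl i => s * e (Some (slotc i)) - e (Some (slotc i)) * w (Inl i) * (\<Sum>a\<in>UNIV. slack_coeff e i a * w a)
	 | Inr k => 0)"

text \<open>A kernel vector (\<xi>, \<eta>) has A \<xi> = 0, and pairing its slack rows with \<xi>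
  gives \<xi> Q \<xi> = - \<Sum> \<tau> \<xi>_i^2 / x_i^2. Definiteness forces \<xi> = 0, and the
  full rank of A then forces \<eta> = 0. The real matrix is kept because its inverse must be
  real.\<close>

lemma jacobian_real:
	fixes D :: "('m::finite, 'd::finite) qp"
	assumes adm: "admissible D" and \<tau>: "\<tau> > 0"
	shows "\<exists>L :: real^('m + 'd)^('m + 'd). jac (path_coords D \<tau>) = (\<chi> r a. of_real (L $ r $ a)) \<and> det L \<noteq> 0"
proof -
	obtain Q c A b where D: "D = (Q, c, A, b)" by (cases D)
	obtain x y where xy: "central_path D \<tau> = (x, y)" by (cases "central_path D \<tau>")
	have sym: "transpose Q = Q" using adm D admissible_symmetric by blast
	have x: "x $ i > 0" for i
		using admissible_kkt[OF adm \<tau>] unfolding D xy[unfolded D] kkt_iff[OF sym] by blast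
	define L :: "real^('m + 'd)^('m + 'd)" where "L = (\<chi> r a. case r of
		 Inl i => (case a of Inl j => (if i = j then \<tau> else 0) + (x $ i)\<^sup>2 * Q $ i $ j | Inr k => - ((x $ i)\<^sup>2 * A $ k $ i))
	 | Inr k => (case a of Inl i => A $ k $ i | Inr _ => 0))"
	have "jac (path_coords D \<tau>) $ r $ a = of_real (L $ r $ a)" for r a
		unfolding D by (cases r; cases a) (auto simp: jac_def L_def slack_coeff_def path_coords_def xy[unfolded D]
				slot_entry_Q[OF sym] simp del: slot_entry_simps(1))
	then have 1: "jac (path_coords D \<tau>) = (\<chi> r a. of_real (L $ r $ a))" by (simp add: vec_eq_iff)
	have "w = 0" if w: "L *v w = 0" for w
	proof -
		define \<xi> where "\<xi> = (\<chi> i. w $ Inl i)"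
		define \<eta> where "\<eta> = (\<chi> k. w $ Inr k)"
		have sumL: "(L *v w) $ r = (\<Sum>i\<in>UNIV. L $ r $ Inl i * \<xi> $ i) + (\<Sum>k\<in>UNIV. L $ r $ Inr k * \<eta> $ k)" for r
			by (simp add: matrix_vector_mult_def sum_UNIV_sum \<xi>_def \<eta>_def)
		have A\<xi>: "A *v \<xi> = 0"
		proof -
			have "(A *v \<xi>) $ k = 0" for k
				using sumL[of "Inr k", unfolded w] by (simp add: L_def matrix_vector_mult_def)
			then show ?thesis by (simp add: vec_eq_iff)
		qed
		have row: "\<tau> * \<xi> $ i + (x $ i)\<^sup>2 * ((Q *v \<xi>) $ i - (\<eta> v* A) $ i) = 0" for i
		proof -
			have "0 = (\<Sum>j\<in>UNIV. ((if i = j then \<tau> else 0) + (x $ i)\<^sup>2 * Q $ i $ j) * \<xi> $ j) +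
					(\<Sum>k\<in>UNIV. - ((x $ i)\<^sup>2 * A $ k $ i) * \<eta> $ k)"
				using sumL[of "Inl i", unfolded w] by (simp add: L_def)
			also have "\<dots> = \<tau> * \<xi> $ i + (x $ i)\<^sup>2 * (Q *v \<xi>) $ i - (x $ i)\<^sup>2 * (\<eta> v* A) $ i"
			proof -
				have "(\<Sum>j\<in>UNIV. ((if i = j then \<tau> else 0) + (x $ i)\<^sup>2 * Q $ i $ j) * \<xi> $ j) =
						(\<Sum>j\<in>UNIV. (if i = j then \<tau> * \<xi> $ j else 0)) + (x $ i)\<^sup>2 * (\<Sum>j\<in>UNIV. Q $ i $ j * \<xi> $ j)"
					unfolding sum_distrib_left sum.distrib[symmetric]
					by (rule sum.cong) (auto simp: algebra_simps)
				then show ?thesis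
					by (simp add: sum_negf matrix_vector_mult_def vector_matrix_mult_def sum_distrib_left mult_ac)
			qed
			finally show ?thesis by (simp add: algebra_simps)
		qed
		have eq: "(Q *v \<xi>) $ i = (\<eta> v* A) $ i - \<tau> * \<xi> $ i / (x $ i)\<^sup>2" for i
			using row[of i] x[of i] by (simp add: field_simps)
		have "\<xi> \<bullet> (\<eta> v* A) = \<eta> \<bullet> (A *v \<xi>)" by (metis dot_lmul_matrix inner_commute)
		then have perp: "\<xi> \<bullet> (\<eta> v* A) = 0" using A\<xi> by simp
		have "\<xi> \<bullet> (Q *v \<xi>) = \<xi> \<bullet> (\<eta> v* A) - (\<Sum>i\<in>UNIV. \<tau> * (\<xi> $ i)\<^sup>2 / (x $ i)\<^sup>2)"
			by (simp add: inner_vec_def eq right_diff_distrib sum_subtractf power2_eq_square mult_ac)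
		moreover have "(\<Sum>i\<in>UNIV. \<tau> * (\<xi> $ i)\<^sup>2 / (x $ i)\<^sup>2) \<ge> 0" using \<tau> by (intro sum_nonneg) auto
		ultimately have "\<not> 0 < \<xi> \<bullet> (Q *v \<xi>)" using perp by simp
		then have \<xi>0: "\<xi> = 0" using adm by (auto simp: admissible_def positive_definite_def D)
		have "(\<eta> v* A) $ i = 0" for i using eq[of i] \<xi>0 by simp
		then have "transpose A *v \<eta> = 0" by (simp add: vec_eq_iff)
		then have "transpose A *v \<eta> = transpose A *v 0" by simp
		moreover have "rank (transpose A) = CARD('d)"
			using adm by (simp add: admissible_def D rank_transpose)
		then have "inj ((*v) (transpose A))" by (simp only: full_rank_injective)
		ultimately have "\<eta> = 0" by (rule injD[rotated])
		then have "w $ a = 0" for a using \<xi>0 by (cases a) (simp_all add: \<xi>_def \<eta>_def vec_eq_iff)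
		then show "w = 0" by (simp add: vec_eq_iff)
	qed
	then have "det L \<noteq> 0" using det_nonzero_iff by blast
	with 1 show ?thesis by blast
qed

text \<open>Multiplied by the inverse Jacobian, the increment equations become a fixed point problem
  with a holomorphic solution. At small real s it is real and keeps x positive, so uniqueness of KKT
  points identifies it with the path.\<close>

theorem central_path_germ:
	fixes D :: "('m::finite, 'd::finite) qp"
	assumes adm: "admissible D" and \<tau>: "\<tau> > 0"
	defines "e \<equiv> path_coords D \<tau>"
	shows "det (jac e) \<noteq> 0" and "\<exists>\<epsilon>>0. \<exists>\<phi>. (\<forall>a. \<phi> a holomorphic_on ball 0 \<epsilon>) \<and> (\<forall>a. \<phi> a 0 = 0) \<and>
		(\<forall>s\<in>ball 0 \<epsilon>. \<forall>r. (\<Sum>a\<in>UNIV. jac e $ r $ a * \<phi> a s) = germ_rhs e (\<lambda>a. \<phi> a s) s r) \<and>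
		(\<forall>s. \<bar>s\<bar> < \<epsilon> --> \<tau> + s > 0 -->
			 (\<forall>a. complex_point (central_path D (\<tau> + s)) a = complex_point (central_path D \<tau>) a + \<phi> a (of_real s)))"
proof -
	obtain L :: "real^('m + 'd)^('m + 'd)" where L: "jac e = (\<chi> r a. of_real (L $ r $ a))" "det L \<noteq> 0"
		using jacobian_real[OF adm \<tau>] unfolding e_def by blast
	obtain L' where L': "L ** L' = mat 1" "L' ** L = mat 1"
		using L(2) invertible_det_nz[of L] unfolding invertible_def by blast
	define Li :: "complex^('m + 'd)^('m + 'd)" where "Li = (\<chi> r a. of_real (L' $ r $ a))"
	have conv: "((\<chi> r a. of_real (M $ r $ a)) ** (\<chi> r a. of_real (M' $ r $ a)) :: complex^('m + 'd)^('m + 'd)) =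
			(\<chi> r a. of_real ((M ** M') $ r $ a))" for M M' :: "real^('m + 'd)^('m + 'd)"
		by (simp add: vec_eq_iff matrix_matrix_mult_def)
	have one: "(\<chi> r a. of_real ((mat 1 :: real^('m + 'd)^('m + 'd)) $ r $ a)) = (mat 1 :: complex^('m + 'd)^('m + 'd))"
		by (simp add: vec_eq_iff mat_def)
	have inv: "jac e ** Li = mat 1" "Li ** jac e = mat 1" unfolding L(1) Li_def conv L' one by simp_all
	then show det: "det (jac e) \<noteq> 0" using invertible_det_nz[of "jac e"] unfolding invertible_def by blast
	obtain Q c A b where D: "D = (Q, c, A, b)" by (cases D)
	obtain x y where xy: "central_path D \<tau> = (x, y)" by (cases "central_path D \<tau>")
	have sym: "transpose Q = Q" using adm D admissible_symmetric by blast
	have kkt: "kkt (Q, c, A, b) \<tau> (x, y)" using admissible_kkt[OF adm \<tau>] xy D by simp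
	then have x: "x $ i > 0"
		and slack: "x $ i * (c $ i + (\<Sum>j\<in>UNIV. Q $ i $ j * x $ j) - (\<Sum>k\<in>UNIV. A $ k $ i * y $ k)) = \<tau>"
		and Ax: "(\<Sum>i\<in>UNIV. A $ k $ i * x $ i) = b $ k" for i k unfolding kkt_iff[OF sym] by blast+
	have ex: "e (Some (slotc i)) = of_real (x $ i)" and e0: "e None = of_real \<tau>"
		and eQ: "e (Some (slotQ i j)) = of_real (Q $ i $ j)" and eA: "e (Some (slotA k i)) = of_real (A $ k $ i)" for i j k
		using slot_entry_Q[OF sym, of c A b i j]
		unfolding e_def D by (simp_all add: path_coords_def xy[unfolded D])
	\<comment> \<open>Linear and quadratic part of the inverse Jacobian applied to
	  \<open>germ_rhs\<close>. Both are real, which makes the solution real at real s.\<close>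
	define v where "v a = (\<Sum>i\<in>UNIV. Li $ a $ Inl i * e (Some (slotc i)))" for a
	define B where "B a j k = (case (j :: 'm + 'd) of Inl i => - Li $ a $ Inl i * e (Some (slotc i)) * slack_coeff e i k | Inr _ => 0)"
		for a j k
	have BS: "(\<Sum>j\<in>UNIV. \<Sum>k\<in>UNIV. B a j k * w j * w k) =
			- (\<Sum>i\<in>UNIV. Li $ a $ Inl i * (e (Some (slotc i)) * w (Inl i) * (\<Sum>k\<in>UNIV. slack_coeff e i k * w k)))" for a w
		by (subst sum_UNIV_sum) (simp add: B_def sum_negf sum_distrib_left mult_ac)
	have vR: "v a \<in> \<real>" for a unfolding v_def by (intro sum_in_Reals Reals_mult) (simp_all add: Li_def ex)
	have BR: "B a j k \<in> \<real>" for a j k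
	proof (cases j)
		case (Inl i)
		have "slack_coeff e i k \<in> \<real>" by (cases k) (simp_all add: slack_coeff_def eQ eA)
		then show ?thesis using Inl by (simp add: B_def Li_def ex)
	qed (simp add: B_def)
	obtain \<epsilon>0 \<phi> where \<phi>: "\<epsilon>0 > 0" "\<And>a. \<phi> a holomorphic_on ball 0 \<epsilon>0" "\<And>a. \<phi> a 0 = 0"
		"\<And>s a. s \<in> ball 0 \<epsilon>0 ==> \<phi> a s = s * v a + (\<Sum>j\<in>UNIV. \<Sum>k\<in>UNIV. B a j k * \<phi> j s * \<phi> k s)"
		"\<And>a t. complex_of_real t \<in> ball 0 \<epsilon>0 ==> \<phi> a (of_real t) \<in> \<real>"
		using quadratic_fixed_point[of v B] vR BR by blast
	have sol: "\<phi> a s = (\<Sum>r\<in>UNIV. Li $ a $ r * germ_rhs e (\<lambda>a. \<phi> a s) s r)" if "s \<in> ball 0 \<epsilon>0" for a s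
	proof -
		have "(\<Sum>r\<in>UNIV. Li $ a $ r * germ_rhs e (\<lambda>a. \<phi> a s) s r) = (\<Sum>i\<in>UNIV. Li $ a $ Inl i * (s * e (Some (slotc i)) -
				e (Some (slotc i)) * \<phi> (Inl i) s * (\<Sum>a\<in>UNIV. slack_coeff e i a * \<phi> a s)))"
			by (subst sum_UNIV_sum) (simp add: germ_rhs_def)
		also have "\<dots> = s * v a - (\<Sum>i\<in>UNIV. Li $ a $ Inl i * (e (Some (slotc i)) * \<phi> (Inl i) s * (\<Sum>k\<in>UNIV. slack_coeff e i k * \<phi> k s)))"
			unfolding v_def sum_distrib_left[of s] sum_subtractf[symmetric]
			by (rule sum.cong) (simp_all add: algebra_simps)
		also have "\<dots> = \<phi> a s" unfolding \<phi>(4)[OF that, of a] BS[of a "\<lambda>a. \<phi> a s"] by simp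
		finally show ?thesis by simp
	qed
	have sys: "(\<Sum>a\<in>UNIV. jac e $ r $ a * \<phi> a s) = germ_rhs e (\<lambda>a. \<phi> a s) s r" if s: "s \<in> ball 0 \<epsilon>0" for r s
	proof -
		have "(\<chi> a. \<phi> a s) = Li *v (\<chi> r. germ_rhs e (\<lambda>a. \<phi> a s) s r)"
			unfolding vec_eq_iff matrix_vector_mult_def vec_lambda_beta by (intro allI sol[OF s])
		then have "jac e *v (\<chi> a. \<phi> a s) = (\<chi> r. germ_rhs e (\<lambda>a. \<phi> a s) s r)"
			by (simp only: matrix_vector_mul_assoc inv matrix_vector_mul_lid)
		from arg_cong[OF this, of "\<lambda>u. u $ r"] show ?thesis
			unfolding matrix_vector_mult_def vec_lambda_beta .
	qed
	have "\<forall>\<^sub>F s in nhds 0. \<forall>i\<in>UNIV. norm (\<phi> (Inl i) s) < x $ i"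
	proof (rule eventually_ball_finite, simp, intro ballI)
		fix i :: 'm
		have "isCont (\<phi> (Inl i)) 0"
			using holomorphic_on_imp_continuous_on[OF \<phi>(2)] \<phi>(1) continuous_on_eq_continuous_at[OF open_ball]
			by (metis centre_in_ball)
		then have "(\<phi> (Inl i) \<longlongrightarrow> \<phi> (Inl i) 0) (nhds 0)"
			by (simp only: isCont_def tendsto_at_iff_tendsto_nhds)
		from tendsto_norm[OF this] have "((\<lambda>s. norm (\<phi> (Inl i) s)) \<longlongrightarrow> 0) (nhds 0)"
			by (simp only: \<phi>(3) norm_zero)
		then show "\<forall>\<^sub>F s in nhds 0. norm (\<phi> (Inl i) s) < x $ i" using x[of i] by (rule order_tendstoD)
	qed
	\<comment> \<open>Within this radius the increments of x are smaller than x, so positivity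
	  survives.\<close>
	then obtain d where d: "d > 0" "\<And>s i. dist s 0 < d ==> norm (\<phi> (Inl i) s) < x $ i"
		unfolding eventually_nhds_metric by auto
	have pathval: "complex_point (central_path D (\<tau> + s)) a = complex_point (central_path D \<tau>) a + \<phi> a (of_real s)"
		if s: "\<bar>s\<bar> < min \<epsilon>0 d" "\<tau> + s > 0" for s a
	proof -
		have sb: "complex_of_real s \<in> ball 0 \<epsilon>0" using s by (simp add: dist_norm)
		have re: "\<phi> a (of_real s) = of_real (Re (\<phi> a (of_real s)))" for a
			using \<phi>(5)[OF sb, of a] by (simp add: complex_is_Real_iff complex_eq_iff)
		define \<delta> where "\<delta> a = Re (\<phi> a (of_real s))" for a
		have \<phi>\<delta>: "\<phi> a (of_real s) = of_real (\<delta> a)" for a unfolding \<delta>_def by (rule re)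
		define x' where "x' = (\<chi> i. x $ i + \<delta> (Inl i))"
		define y' where "y' = (\<chi> k. y $ k + \<delta> (Inr k))"
		define q where "q i = (\<Sum>j\<in>UNIV. Q $ i $ j * \<delta> (Inl j)) - (\<Sum>k\<in>UNIV. A $ k $ i * \<delta> (Inr k))" for i
		have qe: "(\<Sum>a\<in>UNIV. slack_coeff e i a * \<phi> a (of_real s)) = of_real (q i)" for i
			by (subst sum_UNIV_sum) (simp add: slack_coeff_def eQ eA \<phi>\<delta> q_def sum_negf)
		have "kkt (Q, c, A, b) (\<tau> + s) (x', y')" unfolding kkt_iff[OF sym]
		proof (intro conjI allI)
			fix i
			have "\<bar>\<delta> (Inl i)\<bar> < x $ i" using d(2)[of "of_real s" i] s by (simp add: \<phi>\<delta>)
			then show "0 < x' $ i" by (simp add: x'_def)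
			have "(\<Sum>a\<in>UNIV. jac e $ Inl i $ a * \<phi> a (of_real s)) =
					of_real \<tau> * \<phi> (Inl i) (of_real s) + (of_real (x $ i))\<^sup>2 * of_real (q i)"
			proof -
				have "(\<Sum>a\<in>UNIV. jac e $ Inl i $ a * \<phi> a (of_real s)) = (\<Sum>a\<in>UNIV. (if a = Inl i then of_real \<tau> * \<phi> a (of_real s) else 0)) +
						(of_real (x $ i))\<^sup>2 * (\<Sum>a\<in>UNIV. slack_coeff e i a * \<phi> a (of_real s))"
					unfolding sum_distrib_left sum.distrib[symmetric]
					by (rule sum.cong) (simp_all add: jac_def ex e0 algebra_simps)
				then show ?thesis by (simp add: qe)
			qed
			then have "complex_of_real (\<tau> * \<delta> (Inl i) + (x $ i)\<^sup>2 * q i) = of_real (s * x $ i - x $ i * \<delta> (Inl i) * q i)"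
				using sys[OF sb, of "Inl i"] by (simp add: germ_rhs_def ex qe[unfolded \<phi>\<delta>] \<phi>\<delta>)
			then have 1: "\<tau> * \<delta> (Inl i) + (x $ i)\<^sup>2 * q i = s * x $ i - x $ i * \<delta> (Inl i) * q i"
				unfolding of_real_eq_iff .
			define z where "z = c $ i + (\<Sum>j\<in>UNIV. Q $ i $ j * x $ j) - (\<Sum>k\<in>UNIV. A $ k $ i * y $ k)"
			have z: "x $ i * z = \<tau>" using slack[of i] by (simp add: z_def)
			have z': "c $ i + (\<Sum>j\<in>UNIV. Q $ i $ j * x' $ j) - (\<Sum>k\<in>UNIV. A $ k $ i * y' $ k) = z + q i"
				by (simp add: z_def q_def x'_def y'_def distrib_left sum.distrib)
			have "x $ i * ((x $ i + \<delta> (Inl i)) * (z + q i)) =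
					x $ i * z * (x $ i + \<delta> (Inl i)) + (x $ i)\<^sup>2 * q i + x $ i * \<delta> (Inl i) * q i"
				by (simp add: power2_eq_square algebra_simps)
			also have "\<dots> = \<tau> * x $ i + (\<tau> * \<delta> (Inl i) + (x $ i)\<^sup>2 * q i) + x $ i * \<delta> (Inl i) * q i"
				unfolding z by (simp add: algebra_simps)
			also have "\<dots> = x $ i * (\<tau> + s)" unfolding 1 by (simp add: algebra_simps)
			finally have "x $ i * ((x $ i + \<delta> (Inl i)) * (z + q i)) = x $ i * (\<tau> + s)" .
			then have "(x $ i + \<delta> (Inl i)) * (z + q i) = \<tau> + s" using x[of i] by simp
			then show "x' $ i * (c $ i + (\<Sum>j\<in>UNIV. Q $ i $ j * x' $ j) - (\<Sum>k\<in>UNIV. A $ k $ i * y' $ k)) = \<tau> + s"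
				unfolding z' by (simp add: x'_def)
		next
			fix k
			have "(\<Sum>a\<in>UNIV. jac e $ Inr k $ a * \<phi> a (of_real s)) = of_real (\<Sum>i\<in>UNIV. A $ k $ i * \<delta> (Inl i))"
				by (subst sum_UNIV_sum) (simp add: jac_def eA \<phi>\<delta>)
			then have "(\<Sum>i\<in>UNIV. A $ k $ i * \<delta> (Inl i)) = 0"
				using sys[OF sb, of "Inr k"] by (simp add: germ_rhs_def flip: of_real_sum of_real_mult)
			then show "(\<Sum>i\<in>UNIV. A $ k $ i * x' $ i) = b $ k"
				using Ax[of k] by (simp add: x'_def distrib_left sum.distrib)
		qed
		then have "central_path D (\<tau> + s) = (x', y')" using central_path_eqI[OF adm s(2)] D by simp
		then show ?thesis by (cases a) (simp_all add: complex_point_def xy x'_def y'_def \<phi>\<delta>)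
	qed
	show "\<exists>\<epsilon>>0. \<exists>\<phi>. (\<forall>a. \<phi> a holomorphic_on ball 0 \<epsilon>) \<and> (\<forall>a. \<phi> a 0 = 0) \<and>
		(\<forall>s\<in>ball 0 \<epsilon>. \<forall>r. (\<Sum>a\<in>UNIV. jac e $ r $ a * \<phi> a s) = germ_rhs e (\<lambda>a. \<phi> a s) s r) \<and>
		(\<forall>s. \<bar>s\<bar> < \<epsilon> --> \<tau> + s > 0 -->
			 (\<forall>a. complex_point (central_path D (\<tau> + s)) a = complex_point (central_path D \<tau>) a + \<phi> a (of_real s)))"
	proof (intro exI[of _ "min \<epsilon>0 d"] exI[of _ \<phi>] conjI allI ballI impI)
		show "\<phi> a holomorphic_on ball 0 (min \<epsilon>0 d)" for a by (rule holomorphic_on_subset[OF \<phi>(2)]) auto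
	qed (use \<phi>(1,3) d(1) sys pathval in auto)
qed

lemma real_analytic_path:
	assumes "admissible D"
	shows "real_analytic (\<lambda>\<tau>. complex_point (central_path D \<tau>) a)" unfolding real_analytic_def
proof (intro allI impI)
	fix \<tau> :: real assume \<tau>: "\<tau> > 0"
	obtain \<epsilon> \<phi> where *: "\<epsilon> > 0" "\<And>a. \<phi> a holomorphic_on ball 0 \<epsilon>" "\<And>s a. \<bar>s\<bar> < \<epsilon> ==> \<tau> + s > 0 ==>
			 complex_point (central_path D (\<tau> + s)) a = complex_point (central_path D \<tau>) a + \<phi> a (of_real s)"
		using central_path_germ(2)[OF assms \<tau>] by blast
	show "\<exists>\<epsilon>>0. \<exists>F. F holomorphic_on ball 0 \<epsilon> \<and> (\<forall>s. \<bar>s\<bar> < \<epsilon> --> 0 < \<tau> + s -->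
			complex_point (central_path D (\<tau> + s)) a = F (of_real s))"
		using * by (intro exI[of _ \<epsilon>] conjI exI[of _ "\<lambda>s. complex_point (central_path D \<tau>) a + \<phi> a s"])
			(auto intro!: holomorphic_intros)
qed

section \<open>Power series coefficients of the central path\<close>

text \<open>Rational functions whose only denominator is a power of the Jacobian determinant. Where
  it vanishes, the values are unconstrained.\<close>

definition jac_rational :: "((('m::finite, 'd::finite) slot option => complex) => complex) => bool" where
	"jac_rational f \<longleftrightarrow> (\<exists>M p. polyfun p \<and> (\<forall>e. det (jac e) \<noteq> 0 --> det (jac e) ^ M * f e = p e))"

lemma jac_rational_polyfun: "polyfun p ==> jac_rational p"
	unfolding jac_rational_def by (intro exI[of _ 0] exI[of _ p]) simp

lemma jac_rational_add:
	assumes "jac_rational f" "jac_rational g"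
	shows "jac_rational (\<lambda>e. f e + g e)"
proof -
	obtain M p where f: "polyfun p" "\<And>e. det (jac e) \<noteq> 0 ==> det (jac e) ^ M * f e = p e"
		using assms(1) unfolding jac_rational_def by auto
	obtain N q where g: "polyfun q" "\<And>e. det (jac e) \<noteq> 0 ==> det (jac e) ^ N * g e = q e"
		using assms(2) unfolding jac_rational_def by auto
	have "det (jac e) ^ (M + N) * (f e + g e) = det (jac e) ^ N * p e + det (jac e) ^ M * q e"
		if "det (jac e) \<noteq> 0" for e
		by (simp add: f(2)[OF that, symmetric] g(2)[OF that, symmetric] power_add algebra_simps)
	moreover have "polyfun (\<lambda>e. det (jac e) ^ N * p e + det (jac e) ^ M * q e)"
		by (intro polyfun_intros polyfun_jac f g)
	ultimately show ?thesis unfolding jac_rational_def by blast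
qed

lemma jac_rational_mult:
	assumes "jac_rational f" "jac_rational g"
	shows "jac_rational (\<lambda>e. f e * g e)"
proof -
	obtain M p where f: "polyfun p" "\<And>e. det (jac e) \<noteq> 0 ==> det (jac e) ^ M * f e = p e"
		using assms(1) unfolding jac_rational_def by auto
	obtain N q where g: "polyfun q" "\<And>e. det (jac e) \<noteq> 0 ==> det (jac e) ^ N * g e = q e"
		using assms(2) unfolding jac_rational_def by auto
	have "det (jac e) ^ (M + N) * (f e * g e) = p e * q e" if "det (jac e) \<noteq> 0" for e
		by (simp add: f(2)[OF that, symmetric] g(2)[OF that, symmetric] power_add mult_ac)
	moreover have "polyfun (\<lambda>e. p e * q e)" by (intro polyfun_intros f g)
	ultimately show ?thesis unfolding jac_rational_def by blast
qed

lemma jac_rational_div: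
	assumes "jac_rational g"
	shows "jac_rational (\<lambda>e. g e / det (jac e))"
proof -
	obtain M p where g: "polyfun p" "\<And>e. det (jac e) \<noteq> 0 ==> det (jac e) ^ M * g e = p e"
		using assms unfolding jac_rational_def by auto
	have "det (jac e) ^ Suc M * (g e / det (jac e)) = p e" if "det (jac e) \<noteq> 0" for e
		using g(2)[OF that] that by simp
	then show ?thesis using g(1) unfolding jac_rational_def by blast
qed

lemma jac_rational_sum: "(\<And>a. a \<in> A ==> jac_rational (f a)) ==> jac_rational (\<lambda>e. \<Sum>a\<in>A. f a e)"
	by (induction A rule: infinite_finite_induct)
		(auto intro: jac_rational_add jac_rational_polyfun polyfun_intros)

lemma jac_rational_prod: "(\<And>a. a \<in> A ==> jac_rational (f a)) ==> jac_rational (\<lambda>e. \<Prod>a\<in>A. f a e)"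
	by (induction A rule: infinite_finite_induct)
		(auto intro: jac_rational_mult jac_rational_polyfun polyfun_intros)

lemma jac_rational_det:
	fixes M :: "(('m::finite, 'd::finite) slot option => complex) => complex^'n::finite^'n"
	assumes "\<And>i j. jac_rational (\<lambda>e. M e $ i $ j)"
	shows "jac_rational (\<lambda>e. det (M e))" unfolding det_def
	by (intro jac_rational_sum jac_rational_mult jac_rational_prod assms jac_rational_polyfun polyfun.const)

text \<open>The increment equations compared coefficient by coefficient: \<open>u n\<close> is the
  n-th Taylor coefficient of the increments and the inner sum over k is a Cauchy product.\<close>

definition germ_system :: "(('m::finite, 'd::finite) slot option => complex) =>
		(nat => 'm + 'd => complex) => bool" where
	"germ_system e u \<longleftrightarrow> (\<forall>a. u 0 a = 0) \<and> (\<forall>n r. (\<Sum>a\<in>UNIV. jac e $ r $ a * u n a) = (case r of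
		 Inl i => (if n = 1 then e (Some (slotc i)) else 0) -
			 e (Some (slotc i)) * (\<Sum>k=0..n. u k (Inl i) * (\<Sum>a\<in>UNIV. slack_coeff e i a * u (n - k) a))
	 | Inr _ => 0))"

text \<open>As \<open>u 0\<close> is zero, both end terms of the Cauchy product vanish. The n-th
  equation is therefore linear in \<open>u n\<close> with a right-hand side of lower order, and
  Cramer's rule divides by the Jacobian determinant once more.\<close>

lemma germ_system_coeff: "\<exists>f :: 'm::finite + 'd::finite => (('m, 'd) slot option => complex) => complex.
		 (\<forall>a. jac_rational (f a)) \<and> (\<forall>e u. det (jac e) \<noteq> 0 --> germ_system e u --> (\<forall>a. u n a = f a e))"
proof (induction n rule: less_induct)
	case (less n)
	show ?case
	proof (cases "n = 0")
		case True
		then show ?thesis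
			by (intro exI[of _ "\<lambda>_ _. 0"]) (auto simp: germ_system_def intro: jac_rational_polyfun polyfun_intros)
	next
		case False
		have "\<forall>k\<in>{..<n}. \<exists>f :: 'm + 'd => (('m, 'd) slot option => complex) => complex.
				(\<forall>a. jac_rational (f a)) \<and> (\<forall>e u. det (jac e) \<noteq> 0 --> germ_system e u --> (\<forall>a. u k a = f a e))"
			using less by blast
		from bchoice[OF this] obtain f :: "nat => 'm + 'd => (('m, 'd) slot option => complex) => complex"
			where f0: "\<forall>k\<in>{..<n}. (\<forall>a. jac_rational (f k a)) \<and>
				(\<forall>e u. det (jac e) \<noteq> 0 --> germ_system e u --> (\<forall>a. u k a = f k a e))" by blast
		have f: "jac_rational (f k a)" if "k < n" for k a using f0 that by blast
		have uf: "u k a = f k a e" if "k < n" "det (jac e) \<noteq> 0" "germ_system e u" for k a e u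
			using f0 that by blast
		define R where "R e r = (case r of
				Inl i => (if n = 1 then e (Some (slotc i)) else 0) - e (Some (slotc i)) *
					(\<Sum>k\<in>{1..<n}. f k (Inl i) e * (\<Sum>a\<in>UNIV. slack_coeff e i a * f (n - k) a e))
			| Inr _ => 0)" for e :: "('m, 'd) slot option => complex" and r :: "'m + 'd"
		have R: "jac_rational (\<lambda>e. R e r)" for r
		proof (cases r)
			case (Inl i)
			have 1: "jac_rational (\<lambda>e. \<Sum>k\<in>{1..<n}. f k (Inl i) e * (\<Sum>a\<in>UNIV. slack_coeff e i a * f (n - k) a e))"
				by (intro jac_rational_sum jac_rational_mult f jac_rational_polyfun polyfun_slack_coeff) auto
			have 2: "polyfun (\<lambda>e::('m, 'd) slot option => complex. if n = 1 then e (Some (slotc i)) else 0)"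
				by (cases "n = 1") (auto intro: polyfun_intros)
			have "jac_rational (\<lambda>e. (if n = 1 then e (Some (slotc i)) else 0) + (- e (Some (slotc i))) *
					(\<Sum>k\<in>{1..<n}. f k (Inl i) e * (\<Sum>a\<in>UNIV. slack_coeff e i a * f (n - k) a e)))"
				by (intro jac_rational_add jac_rational_mult 1 jac_rational_polyfun 2 polyfun_intros)
			then show ?thesis using Inl by (simp add: R_def)
		next
			case (Inr k)
			then show ?thesis by (simp add: R_def jac_rational_polyfun polyfun.const)
		qed
		define g where "g a e = det (\<chi> r b. if b = a then R e r else jac e $ r $ b) / det (jac e)" for a e
		have g: "jac_rational (g a)" for a
		proof -
			have "jac_rational (\<lambda>e. (\<chi> r b. if b = a then R e r else jac e $ r $ b) $ i $ j)" for i j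
				by (cases "j = a") (simp_all add: R jac_rational_polyfun polyfun_jac)
			then show ?thesis unfolding g_def by (intro jac_rational_div jac_rational_det)
		qed
		have "u n a = g a e" if det: "det (jac e) \<noteq> 0" and u: "germ_system e u" for e u a
		proof -
			have u0: "u 0 a = 0" for a using u by (simp add: germ_system_def)
			have "(\<Sum>k=0..n. u k (Inl i) * (\<Sum>a\<in>UNIV. slack_coeff e i a * u (n - k) a)) =
					(\<Sum>k\<in>{1..<n}. f k (Inl i) e * (\<Sum>a\<in>UNIV. slack_coeff e i a * f (n - k) a e))" for i
			proof -
				have "(\<Sum>k=0..n. u k (Inl i) * (\<Sum>a\<in>UNIV. slack_coeff e i a * u (n - k) a)) =
						(\<Sum>k\<in>{1..<n}. u k (Inl i) * (\<Sum>a\<in>UNIV. slack_coeff e i a * u (n - k) a))"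
				proof (rule sum.mono_neutral_right)
					show "\<forall>k\<in>{0..n} - {1..<n}. u k (Inl i) * (\<Sum>a\<in>UNIV. slack_coeff e i a * u (n - k) a) = 0"
					proof
						fix k assume "k \<in> {0..n} - {1..<n}"
						then have "k = 0 \<or> k = n" by auto
						then show "u k (Inl i) * (\<Sum>a\<in>UNIV. slack_coeff e i a * u (n - k) a) = 0" by (auto simp: u0)
					qed
				qed auto
				also have "\<dots> = (\<Sum>k\<in>{1..<n}. f k (Inl i) e * (\<Sum>a\<in>UNIV. slack_coeff e i a * f (n - k) a e))"
				proof (rule sum.cong[OF refl])
					fix k assume "k \<in> {1..<n}"
					then have k: "k < n" "n - k < n" by auto
					show "u k (Inl i) * (\<Sum>a\<in>UNIV. slack_coeff e i a * u (n - k) a) =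
							f k (Inl i) e * (\<Sum>a\<in>UNIV. slack_coeff e i a * f (n - k) a e)"
						by (simp only: uf[OF k(1) det u] uf[OF k(2) det u])
				qed
				finally show ?thesis .
			qed
			then have "(\<Sum>a\<in>UNIV. jac e $ r $ a * u n a) = R e r" for r
				using u unfolding germ_system_def R_def by (auto split: sum.split)
			then have eq: "(jac e *v (\<chi> b. u n b)) $ r = R e r" for r by (simp add: matrix_vector_mult_def)
			from cramer_lemma[of a "jac e" "\<chi> b. u n b"]
			have "det (\<chi> r b. if b = a then R e r else jac e $ r $ b) = u n a * det (jac e)"
				unfolding eq vec_lambda_beta .
			then show ?thesis using det by (simp add: g_def)
		qed
		then show ?thesis using g by (intro exI[of _ g] conjI allI impI)
	qed
qed

lemma germ_system_expansion:
	fixes e :: "('m::finite, 'd::finite) slot option => complex"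
	assumes \<epsilon>: "\<epsilon> > 0" and F: "\<And>a. \<phi> a has_fps_expansion F a" and \<phi>0: "\<And>a. \<phi> a 0 = 0"
		and sys: "\<And>s r. s \<in> ball 0 \<epsilon> ==> (\<Sum>a\<in>UNIV. jac e $ r $ a * \<phi> a s) = germ_rhs e (\<lambda>a. \<phi> a s) s r"
	shows "germ_system e (\<lambda>n a. fps_nth (F a) n)" unfolding germ_system_def
proof (intro conjI allI)
	fix a show "fps_nth (F a) 0 = 0" using has_fps_expansion_imp_0_eq_fps_nth_0[OF F[of a]] \<phi>0 by simp
next
	fix n and r :: "'m + 'd"
	have lhs: "(\<lambda>s. \<Sum>a\<in>UNIV. jac e $ r $ a * \<phi> a s) has_fps_expansion (\<Sum>a\<in>UNIV. fps_const (jac e $ r $ a) * F a)"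
		by (intro fps_expansion_intros F)
	have ev: "eventually (\<lambda>s. (\<Sum>a\<in>UNIV. jac e $ r $ a * \<phi> a s) = germ_rhs e (\<lambda>a. \<phi> a s) s r) (nhds 0)"
		using eventually_nhds_in_open[of "ball 0 \<epsilon>" "0::complex"] \<epsilon> sys by (auto elim: eventually_mono)
	define x where "x i = e (Some (slotc i))" for i
	define H where "H = (case r of Inl i => fps_X * fps_const (x i) -
			fps_const (x i) * F (Inl i) * (\<Sum>a\<in>UNIV. fps_const (slack_coeff e i a) * F a) | Inr _ => 0)"
	have "(\<lambda>s. germ_rhs e (\<lambda>a. \<phi> a s) s r) has_fps_expansion H"
	proof (cases r)
		case (Inl i)
		have "(\<lambda>s. s * x i - x i * \<phi> (Inl i) s * (\<Sum>a\<in>UNIV. slack_coeff e i a * \<phi> a s)) has_fps_expansion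
				(fps_X * fps_const (x i) - fps_const (x i) * F (Inl i) * (\<Sum>a\<in>UNIV. fps_const (slack_coeff e i a) * F a))"
			by (intro fps_expansion_intros F)
		then show ?thesis by (simp add: Inl germ_rhs_def H_def x_def)
	next
		case (Inr k)
		then show ?thesis by (simp add: germ_rhs_def H_def)
	qed
	then have "(\<lambda>s. \<Sum>a\<in>UNIV. jac e $ r $ a * \<phi> a s) has_fps_expansion H"
		using has_fps_expansion_cong[OF ev refl] by blast
	from fps_expansion_unique_complex[OF lhs this]
	have "fps_nth (\<Sum>a\<in>UNIV. fps_const (jac e $ r $ a) * F a) n = fps_nth H n" by simp
	then show "(\<Sum>a\<in>UNIV. jac e $ r $ a * fps_nth (F a) n) = (case r of
		 Inl i => (if n = 1 then e (Some (slotc i)) else 0) - e (Some (slotc i)) *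
			 (\<Sum>k=0..n. fps_nth (F (Inl i)) k * (\<Sum>a\<in>UNIV. slack_coeff e i a * fps_nth (F a) (n - k)))
	 | Inr _ => 0)" by (cases r) (auto simp: H_def x_def fps_sum_nth fps_mult_nth[of "F _"] mult.assoc)
qed

definition path_point :: "(('m::finite, 'd::finite) slot option => complex) => 'm + 'd => complex" where
	"path_point e a = (case a of Inl i => e (Some (slotc i)) | Inr k => e (Some (slotb k)))"

lemma path_point_coords: "path_point (path_coords D \<tau>) = complex_point (central_path D \<tau>)"
	by (auto simp: fun_eq_iff path_point_def path_coords_def complex_point_def split: sum.split)

text \<open>The coefficient functions h are chosen before the program: one rational formula,
  depending on q and n only, serves for all paths and all base points.\<close>

lemma path_expansion:
	fixes q :: "('m::finite + 'd::finite => complex) => complex"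
	assumes "polyfun q"
	shows "\<exists>h. (\<forall>n. jac_rational (h n)) \<and> (\<forall>e \<phi> F. det (jac e) \<noteq> 0 -->
		(\<forall>a. \<phi> a has_fps_expansion F a) --> germ_system e (\<lambda>n a. fps_nth (F a) n) -->
		(\<lambda>s. q (\<lambda>a. path_point e a + \<phi> a s)) has_fps_expansion Abs_fps (\<lambda>n. h n e))" using assms
proof induction
	case (const c)
	have "fps_const c = Abs_fps (\<lambda>n. if n = 0 then c else 0)" by (simp add: fps_eq_iff)
	then have "(\<lambda>s::complex. c) has_fps_expansion Abs_fps (\<lambda>n. if n = 0 then c else 0)"
		using has_fps_expansion_const[of c] by simp
	then show ?case
		by (intro exI[of _ "\<lambda>n e. if n = 0 then c else 0"]) (auto intro: jac_rational_polyfun polyfun.const)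
next
	case (var v)
	have "\<forall>n. \<exists>f :: 'm + 'd => (('m, 'd) slot option => complex) => complex. (\<forall>a. jac_rational (f a)) \<and>
		 (\<forall>e u. det (jac e) \<noteq> 0 --> germ_system e u --> (\<forall>a. u n a = f a e))" using germ_system_coeff by blast
	from choice[OF this] obtain f :: "nat => 'm + 'd => (('m, 'd) slot option => complex) => complex" where
		f: "\<And>n a. jac_rational (f n a)"
			"\<And>n a e u. det (jac e) \<noteq> 0 ==> germ_system e u ==> u n a = f n a e" by blast
	have pp: "polyfun (\<lambda>e. path_point e v)" by (cases v) (simp_all add: path_point_def polyfun.var)
	let ?h = "\<lambda>(n::nat) e. (if n = 0 then path_point e v else 0) + f n v e"
	show ?case
	proof (intro exI[of _ ?h] conjI allI impI)
		fix n :: nat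
		have "jac_rational (\<lambda>e. if n = 0 then path_point e v else 0)"
			by (cases "n = 0") (auto intro: jac_rational_polyfun pp polyfun.const)
		then show "jac_rational (?h n)" by (intro jac_rational_add f)
	next
		fix e \<phi> and F :: "'m + 'd => complex fps"
		assume *: "det (jac e) \<noteq> 0" "\<forall>a. \<phi> a has_fps_expansion F a" "germ_system e (\<lambda>n a. fps_nth (F a) n)"
		have "(\<lambda>s. path_point e v + \<phi> v s) has_fps_expansion (fps_const (path_point e v) + F v)"
			using *(2) by (intro fps_expansion_intros) blast
		moreover have "fps_const (path_point e v) + F v = Abs_fps (\<lambda>n. ?h n e)"
			using f(2)[OF *(1,3)] by (simp add: fps_eq_iff)
		ultimately show "(\<lambda>s. path_point e v + \<phi> v s) has_fps_expansion Abs_fps (\<lambda>n. ?h n e)" by simp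
	qed
next
	case (add p q)
	obtain h where h: "(\<forall>n. jac_rational (h n)) \<and> (\<forall>e \<phi> F. det (jac e) \<noteq> 0 -->
		(\<forall>a. \<phi> a has_fps_expansion F a) --> germ_system e (\<lambda>n a. fps_nth (F a) n) -->
		(\<lambda>s. p (\<lambda>a. path_point e a + \<phi> a s)) has_fps_expansion Abs_fps (\<lambda>n. h n e))"
		using add.IH(1) by (rule exE)
	note h' = h[THEN conjunct1, THEN spec] h[THEN conjunct2, THEN spec, THEN spec, THEN spec, THEN mp, THEN mp, THEN mp]
	obtain k where k: "(\<forall>n. jac_rational (k n)) \<and> (\<forall>e \<phi> F. det (jac e) \<noteq> 0 -->
		(\<forall>a. \<phi> a has_fps_expansion F a) --> germ_system e (\<lambda>n a. fps_nth (F a) n) -->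
		(\<lambda>s. q (\<lambda>a. path_point e a + \<phi> a s)) has_fps_expansion Abs_fps (\<lambda>n. k n e))"
		using add.IH(2) by (rule exE)
	note k' = k[THEN conjunct1, THEN spec] k[THEN conjunct2, THEN spec, THEN spec, THEN spec, THEN mp, THEN mp, THEN mp]
	show ?case
	proof (intro exI[of _ "\<lambda>n e. h n e + k n e"] conjI allI impI jac_rational_add h'(1) k'(1))
		fix e \<phi> and F :: "'m + 'd => complex fps"
		assume *: "det (jac e) \<noteq> 0" "\<forall>a. \<phi> a has_fps_expansion F a" "germ_system e (\<lambda>n a. fps_nth (F a) n)"
		have "Abs_fps (\<lambda>n. h n e + k n e) = Abs_fps (\<lambda>n. h n e) + Abs_fps (\<lambda>n. k n e)" by (simp add: fps_eq_iff)
		then show "(\<lambda>s. p (\<lambda>a. path_point e a + \<phi> a s) + q (\<lambda>a. path_point e a + \<phi> a s)) has_fps_expansion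
				Abs_fps (\<lambda>n. h n e + k n e)" using has_fps_expansion_add[OF h'(2)[OF *] k'(2)[OF *]] by simp
	qed
next
	case (mult p q)
	obtain h where h: "(\<forall>n. jac_rational (h n)) \<and> (\<forall>e \<phi> F. det (jac e) \<noteq> 0 -->
		(\<forall>a. \<phi> a has_fps_expansion F a) --> germ_system e (\<lambda>n a. fps_nth (F a) n) -->
		(\<lambda>s. p (\<lambda>a. path_point e a + \<phi> a s)) has_fps_expansion Abs_fps (\<lambda>n. h n e))"
		using mult.IH(1) by (rule exE)
	note h' = h[THEN conjunct1, THEN spec] h[THEN conjunct2, THEN spec, THEN spec, THEN spec, THEN mp, THEN mp, THEN mp]
	obtain k where k: "(\<forall>n. jac_rational (k n)) \<and> (\<forall>e \<phi> F. det (jac e) \<noteq> 0 -->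
		(\<forall>a. \<phi> a has_fps_expansion F a) --> germ_system e (\<lambda>n a. fps_nth (F a) n) -->
		(\<lambda>s. q (\<lambda>a. path_point e a + \<phi> a s)) has_fps_expansion Abs_fps (\<lambda>n. k n e))"
		using mult.IH(2) by (rule exE)
	note k' = k[THEN conjunct1, THEN spec] k[THEN conjunct2, THEN spec, THEN spec, THEN spec, THEN mp, THEN mp, THEN mp]
	show ?case
	proof (intro exI[of _ "\<lambda>n e. \<Sum>i=0..n. h i e * k (n - i) e"] conjI allI impI
			jac_rational_sum jac_rational_mult h'(1) k'(1))
		fix e \<phi> and F :: "'m + 'd => complex fps"
		assume *: "det (jac e) \<noteq> 0" "\<forall>a. \<phi> a has_fps_expansion F a" "germ_system e (\<lambda>n a. fps_nth (F a) n)"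
		have "Abs_fps (\<lambda>n. \<Sum>i=0..n. h i e * k (n - i) e) = Abs_fps (\<lambda>n. h n e) * Abs_fps (\<lambda>n. k n e)"
			by (simp add: fps_eq_iff fps_mult_nth)
		then show "(\<lambda>s. p (\<lambda>a. path_point e a + \<phi> a s) * q (\<lambda>a. path_point e a + \<phi> a s)) has_fps_expansion
				Abs_fps (\<lambda>n. \<Sum>i=0..n. h i e * k (n - i) e)"
			using has_fps_expansion_mult[OF h'(2)[OF *] k'(2)[OF *]] by simp
	qed
qed

text \<open>By the identity theorem a combination vanishes along the whole path exactly when its
  germ at \<tau> vanishes, that is, when all its Taylor coefficients do. The parametrization by
  \<open>exp t\<close> lets t run through all real numbers.\<close>

lemma indep_path_iff_coeff:
	fixes D :: "('m::finite, 'd::finite) qp" and q :: "'a => ('m + 'd => complex) => complex"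
	assumes adm: "admissible D" and \<tau>: "\<tau> > 0" and A: "finite A" and q: "\<And>a. a \<in> A ==> polyfun (q a)"
		and h: "\<And>a e \<phi> F. a \<in> A ==> det (jac e) \<noteq> 0 ==> (\<forall>b. \<phi> b has_fps_expansion F b) ==>
			germ_system e (\<lambda>n b. fps_nth (F b) n) ==>
			(\<lambda>s. q a (\<lambda>b. path_point e b + \<phi> b s)) has_fps_expansion Abs_fps (\<lambda>n. h a n e)"
	shows "indep A (\<lambda>a t. q a (complex_point (central_path D (exp t)))) \<longleftrightarrow>
		indep A (\<lambda>a n. h a n (path_coords D \<tau>))"
proof -
	define e where "e = path_coords D \<tau>"
	have pp: "path_point e = complex_point (central_path D \<tau>)" unfolding e_def by (rule path_point_coords)
	have det: "det (jac e) \<noteq> 0" unfolding e_def by (rule central_path_germ(1)[OF adm \<tau>])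
	obtain \<epsilon> \<phi> where \<epsilon>: "\<epsilon> > 0" and hol: "\<And>a. \<phi> a holomorphic_on ball 0 \<epsilon>" and \<phi>0: "\<And>a. \<phi> a 0 = 0"
		and sys: "\<And>s r. s \<in> ball 0 \<epsilon> ==> (\<Sum>a\<in>UNIV. jac e $ r $ a * \<phi> a s) = germ_rhs e (\<lambda>a. \<phi> a s) s r"
		and val: "\<And>s a. \<bar>s\<bar> < \<epsilon> ==> \<tau> + s > 0 ==>
			 complex_point (central_path D (\<tau> + s)) a = path_point e a + \<phi> a (of_real s)"
		using central_path_germ(2)[OF adm \<tau>] unfolding pp unfolding e_def by blast
	define F where "F a = fps_expansion (\<phi> a) 0" for a
	have F: "\<phi> a has_fps_expansion F a" for a
		unfolding F_def by (rule has_fps_expansion_fps_expansion[OF open_ball _ hol]) (use \<epsilon> in simp)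
	have gs: "germ_system e (\<lambda>n a. fps_nth (F a) n)" by (rule germ_system_expansion[OF \<epsilon> F \<phi>0 sys])
	have exq: "(\<lambda>s. q a (\<lambda>b. path_point e b + \<phi> b s)) has_fps_expansion Abs_fps (\<lambda>n. h a n e)" if "a \<in> A" for a
		by (rule h[OF that det _ gs]) (use F in blast)
	define G where "G c s = (\<Sum>a\<in>A. c a * q a (\<lambda>b. path_point e b + \<phi> b s))" for c s
	define H where "H c = (\<Sum>a\<in>A. fps_const (c a) * Abs_fps (\<lambda>n. h a n e))" for c
	have GH: "G c has_fps_expansion H c" for c unfolding G_def H_def by (intro fps_expansion_intros exq)
	have Hn: "fps_nth (H c) n = (\<Sum>a\<in>A. c a * h a n e)" for c n by (simp add: H_def fps_sum_nth)
	have Gval: "(\<Sum>a\<in>A. c a * q a (complex_point (central_path D (\<tau> + s)))) = G c (of_real s)"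
		if "\<bar>s\<bar> < \<epsilon>" "\<tau> + s > 0" for c s
	proof -
		have "complex_point (central_path D (\<tau> + s)) = (\<lambda>a. path_point e a + \<phi> a (of_real s))"
			using val[OF that] by (rule ext)
		then show ?thesis by (simp add: G_def)
	qed
	have hq: "(\<lambda>s. q a (\<lambda>b. path_point e b + \<phi> b s)) holomorphic_on ball 0 \<epsilon>" if "a \<in> A" for a
		using q[OF that] by induction (auto intro!: holomorphic_intros hol)
	have Ghol: "G c holomorphic_on ball 0 \<epsilon>" for c unfolding G_def by (intro holomorphic_intros hq)
	have "indep A (\<lambda>a n. h a n e)" if ind: "indep A (\<lambda>a t. q a (complex_point (central_path D (exp t))))"
	proof (rule indepI)
		fix c a assume c: "\<And>n. (\<Sum>a\<in>A. c a * h a n e) = 0" and a: "a \<in> A"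
		have H0: "H c = 0" by (simp add: fps_eq_iff Hn c)
		have "eventually (\<lambda>s. G c s = 0) (nhds 0)" using GH[of c] unfolding H0 has_fps_expansion_0_iff .
		then obtain d where d: "d > 0" "\<And>s. dist s 0 < d ==> G c s = 0"
			unfolding eventually_nhds_metric by blast
		have an: "real_analytic (\<lambda>\<tau>. \<Sum>a\<in>A. c a * q a (complex_point (central_path D \<tau>)))"
		proof -
			have "real_analytic (\<lambda>\<tau>. (\<lambda>z. \<Sum>a\<in>A. c a * q a z) (complex_point (central_path D \<tau>)))"
				by (rule real_analytic_polyfun[OF _ real_analytic_path[OF adm]]) (intro polyfun_intros q)
			then show ?thesis .
		qed
		have z: "(\<Sum>a\<in>A. c a * q a (complex_point (central_path D \<tau>'))) = 0" if "\<tau>' > 0" for \<tau>'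
		proof (rule real_analytic_zero[OF an \<tau> _ _ that, of "min d \<epsilon>"])
			show "0 < min d \<epsilon>" using d(1) \<epsilon> by simp
			fix s assume "\<bar>s\<bar> < min d \<epsilon>" "0 < \<tau> + s"
			then show "(\<Sum>a\<in>A. c a * q a (complex_point (central_path D (\<tau> + s)))) = 0"
				using Gval[of s c] d(2)[of "of_real s"] by simp
		qed
		show "c a = 0" by (rule indepD[OF ind _ a]) (use z in simp)
	qed
	moreover have "indep A (\<lambda>a t. q a (complex_point (central_path D (exp t))))" if ind: "indep A (\<lambda>a n. h a n e)"
	proof (rule indepI)
		fix c a assume c: "\<And>t. (\<Sum>a\<in>A. c a * q a (complex_point (central_path D (exp t)))) = 0" and a: "a \<in> A"
		have c': "(\<Sum>a\<in>A. c a * q a (complex_point (central_path D \<tau>'))) = 0" if "\<tau>' > 0" for \<tau>'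
			using c[of "ln \<tau>'"] that by simp
		define s where "s n = complex_of_real (inverse (real (Suc n)) * (\<epsilon> / 2))" for n
		have sb: "s n \<in> ball 0 \<epsilon> - {0}" for n
		proof -
			have "inverse (real (Suc n)) * (\<epsilon> / 2) \<le> 1 * (\<epsilon> / 2)"
				using \<epsilon> by (intro mult_right_mono) (auto simp: inverse_le_1_iff)
			moreover have "inverse (real (Suc n)) * (\<epsilon> / 2) > 0" using \<epsilon> by simp
			ultimately show ?thesis using \<epsilon> unfolding s_def by (simp del: of_real_mult of_nat_Suc add: dist_norm)
		qed
		have "(\<lambda>n. inverse (real (Suc n)) * (\<epsilon> / 2)) \<longlonglongrightarrow> 0 * (\<epsilon> / 2)"
			by (intro tendsto_intros LIMSEQ_inverse_real_of_nat)
		from tendsto_of_real[OF this] have s0: "s \<longlonglongrightarrow> 0"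
			unfolding s_def by (simp only: mult_zero_left of_real_0)
		have Gs: "G c (s n) = 0" for n
		proof -
			define s' where "s' = inverse (real (Suc n)) * (\<epsilon> / 2)"
			have s': "s n = of_real s'" by (simp only: s_def s'_def)
			have "s' > 0" unfolding s'_def using \<epsilon> by simp
			moreover from sb[of n] have "\<bar>s'\<bar> < \<epsilon>" unfolding s' by (simp add: dist_norm)
			ultimately show ?thesis using Gval[of s' c] c'[of "\<tau> + s'"] \<tau> unfolding s' by simp
		qed
		have "G c w = 0" if "w \<in> ball 0 \<epsilon>" for w
			by (rule holomorphic_zero_from_reals[OF Ghol sb s0 Gs \<epsilon> that])
		then have "eventually (\<lambda>s. G c s = 0) (nhds 0)"
			using eventually_nhds_in_open[of "ball 0 \<epsilon>" "0::complex"] \<epsilon> by (auto elim: eventually_mono)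
		then have "G c has_fps_expansion 0" using has_fps_expansion_0_iff by blast
		from fps_expansion_unique_complex[OF GH this] have "H c = 0" .
		then have "(\<Sum>a\<in>A. c a * h a n e) = 0" for n using Hn[of c n] by simp
		then show "c a = 0" by (rule indepD[OF ind _ a])
	qed
	ultimately show ?thesis unfolding e_def by blast
qed

theorem path_independence_certificate:
	fixes D0 :: "('m::finite, 'd::finite) qp" and q :: "'a => ('m + 'd => complex) => complex"
	assumes adm: "admissible D0" and \<tau>: "\<tau>0 > 0" and A: "finite A" and q: "\<And>a. a \<in> A ==> polyfun (q a)"
		and ind: "indep A (\<lambda>a t. q a (complex_point (central_path D0 (exp t))))"
	shows "\<exists>p. polyfun p \<and> p (path_coords D0 \<tau>0) \<noteq> 0 \<and> (\<forall>(D :: ('m, 'd) qp) \<tau>. admissible D --> \<tau> > 0 -->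
		p (path_coords D \<tau>) \<noteq> 0 --> indep A (\<lambda>a t. q a (complex_point (central_path D (exp t)))))"
proof -
	have "\<forall>a\<in>A. \<exists>h. (\<forall>n. jac_rational (h n)) \<and> (\<forall>e \<phi> F. det (jac e) \<noteq> 0 -->
		(\<forall>b. \<phi> b has_fps_expansion F b) --> germ_system e (\<lambda>n b. fps_nth (F b) n) -->
		(\<lambda>s. q a (\<lambda>b. path_point e b + \<phi> b s)) has_fps_expansion Abs_fps (\<lambda>n. h n e))"
		using path_expansion q by blast
	from bchoice[OF this] obtain h where h: "\<And>a n. a \<in> A ==> jac_rational (h a n)"
		"\<And>a e \<phi> F. a \<in> A ==> det (jac e) \<noteq> 0 ==> (\<forall>b. \<phi> b has_fps_expansion F b) ==>
			germ_system e (\<lambda>n b. fps_nth (F b) n) ==>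
			(\<lambda>s. q a (\<lambda>b. path_point e b + \<phi> b s)) has_fps_expansion Abs_fps (\<lambda>n. h a n e)" by blast
	have "\<exists>M p. \<forall>a\<in>A. \<forall>n. polyfun (p a n) \<and> (\<forall>e. det (jac e) \<noteq> 0 --> det (jac e) ^ M a n * h a n e = p a n e)"
		using h(1) unfolding jac_rational_def by metis
	then obtain M p where p: "\<And>a n. a \<in> A ==> polyfun (p a n)"
		"\<And>a n e. a \<in> A ==> det (jac e) \<noteq> 0 ==> det (jac e) ^ M a n * h a n e = p a n e" by blast
	\<comment> \<open>For each n the denominators are cleared with one exponent common to all a. It may
	  vary with n, since rescaling the conditions one by one does not affect independence.\<close>
	define k where "k a n e = det (jac e) ^ ((\<Sum>b\<in>A. M b n) - M a n) * p a n e" for a n e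
	have k: "det (jac e) ^ (\<Sum>b\<in>A. M b n) * h a n e = k a n e" if "a \<in> A" "det (jac e) \<noteq> 0" for a n e
	proof -
		have "M a n \<le> (\<Sum>b\<in>A. M b n)" by (rule member_le_sum) (use that A in auto)
		then show ?thesis
			unfolding k_def p(2)[OF that, symmetric] by (simp add: mult.assoc[symmetric] power_add[symmetric])
	qed
	have hk: "indep A (\<lambda>a n. h a n e) \<longleftrightarrow> indep A (\<lambda>a n. k a n e)" if det: "det (jac e) \<noteq> 0" for e
	proof -
		have "(\<Sum>a\<in>A. c a * k a n e) = det (jac e) ^ (\<Sum>b\<in>A. M b n) * (\<Sum>a\<in>A. c a * h a n e)" for c n
			unfolding sum_distrib_left by (rule sum.cong) (simp_all add: k[OF _ det, symmetric] mult_ac)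
		then have "(\<Sum>a\<in>A. c a * k a n e) = 0 \<longleftrightarrow> (\<Sum>a\<in>A. c a * h a n e) = 0" for c n using det by simp
		then show ?thesis unfolding indep_def by simp
	qed
	have det: "det (jac (path_coords D \<tau>)) \<noteq> 0" if "admissible D" "\<tau> > 0" for D :: "('m, 'd) qp" and \<tau>
		by (rule central_path_germ(1)[OF that])
	have iff: "indep A (\<lambda>a t. q a (complex_point (central_path D (exp t)))) \<longleftrightarrow>
			indep A (\<lambda>a n. k a n (path_coords D \<tau>))" if "admissible D" "\<tau> > 0" for D :: "('m, 'd) qp" and \<tau>
		by (rule trans[OF indep_path_iff_coeff[OF that A q h(2)] hk[OF det[OF that]]])
	have "polyfun (\<lambda>e. k a n e)" if "a \<in> A" for a n
		unfolding k_def by (intro polyfun_intros polyfun_jac p that)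
	from indep_certificate[where f = "\<lambda>a e n. k a n e" and A = A and ?\<theta>0.0 = "path_coords D0 \<tau>0", OF A this] iff[OF adm \<tau>] ind
	obtain p' where "polyfun p'" "p' (path_coords D0 \<tau>0) \<noteq> 0"
		"\<And>e. p' e \<noteq> 0 ==> indep A (\<lambda>a n. k a n e)" by blast
	then show ?thesis using iff by blast
qed

section \<open>Strictly feasible programs are admissible\<close>

lemma full_rank_lmult_inj:
	fixes A :: "real^'m^'d"
	assumes "rank A = CARD('d)" "y v* A = 0"
	shows "y = 0"
proof -
	have "inj ((*v) (transpose A))" using assms(1) by (simp only: full_rank_injective[symmetric] rank_transpose)
	moreover have "transpose A *v y = transpose A *v 0" using assms(2) by simp
	ultimately show ?thesis by (rule injD)
qed

text \<open>The normal equations project g onto the row space. The remainder is in the kernel of A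
  and orthogonal both to g and to the row space, hence to itself.\<close>

lemma orthogonal_kernel_in_rowspace:
	fixes A :: "real^'m^'d"
	assumes "rank A = CARD('d)" "\<And>v. A *v v = 0 ==> g \<bullet> v = 0"
	shows "\<exists>y. g = y v* A"
proof -
	have "det (A ** transpose A) \<noteq> 0" unfolding det_nonzero_iff
	proof (intro allI impI)
		fix w :: "real^'d" assume "(A ** transpose A) *v w = 0"
		then have "A *v (w v* A) = 0" by (simp add: matrix_vector_mul_assoc[symmetric])
		then have "(w v* A) \<bullet> (w v* A) = 0" using dot_lmul_matrix[of w A "w v* A"] by simp
		then show "w = 0" using full_rank_lmult_inj[OF assms(1)] by simp
	qed
	then obtain B where B: "(A ** transpose A) ** B = mat 1"
		using invertible_det_nz[of "A ** transpose A"] unfolding invertible_def by blast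
	define y where "y = B *v (A *v g)"
	have "A *v (y v* A) = ((A ** transpose A) ** B) *v (A *v g)"
		by (simp add: y_def matrix_vector_mul_assoc[symmetric])
	then have Av: "A *v (g - y v* A) = 0" by (simp add: B matrix_vector_mult_diff_distrib)
	have "g \<bullet> (g - y v* A) = 0" by (rule assms(2)[OF Av])
	moreover have "(y v* A) \<bullet> (g - y v* A) = 0" using dot_lmul_matrix[of y A "g - y v* A"] Av by simp
	ultimately have "(g - y v* A) \<bullet> (g - y v* A) = 0" by (simp only: inner_diff_left[of g "y v* A"])
	then show ?thesis by auto
qed

text \<open>Strict monotonicity: pairing the difference of two systems with w = x - x' gives w Q w =
  \<tau> \<Sum> w_i (1/x_i - 1/x'_i), and the right-hand side is at most 0.\<close>

lemma kkt_unique: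
	fixes A :: "real^'m^'d"
	assumes pd: "positive_definite Q" and rank: "rank A = CARD('d)" and \<tau>: "\<tau> > 0"
		and 1: "kkt (Q, c, A, b) \<tau> (x, y)" and 2: "kkt (Q, c, A, b) \<tau> (x', y')"
	shows "x = x' \<and> y = y'"
proof -
	define w where "w = x - x'"
	have Aw: "A *v w = 0" using 1 2 by (simp add: w_def matrix_vector_mult_diff_distrib)
	have pos: "x $ i > 0" "x' $ i > 0" for i using 1 2 by auto
	let ?p = "\<lambda>x::real^'m. \<chi> i. 1 / x $ i"
	have eq: "w v* Q - \<tau> *\<^sub>R (?p x - ?p x') = (y - y') v* A"
	proof -
		have e: "x v* Q + c - \<tau> *\<^sub>R ?p x = y v* A" "x' v* Q + c - \<tau> *\<^sub>R ?p x' = y' v* A" using 1 2 by simp_all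
		have "(x v* Q + c - \<tau> *\<^sub>R ?p x) - (x' v* Q + c - \<tau> *\<^sub>R ?p x') = (x v* Q - x' v* Q) - \<tau> *\<^sub>R (?p x - ?p x')"
			by (simp add: scaleR_diff_right)
		then have "(x v* Q - x' v* Q) - \<tau> *\<^sub>R (?p x - ?p x') = y v* A - y' v* A" unfolding e by simp
		then show ?thesis
			by (simp only: w_def transpose_matrix_vector[symmetric] matrix_vector_mult_diff_distrib)
	qed
	have "w \<bullet> (?p x - ?p x') \<le> 0" unfolding inner_vec_def
	proof (rule sum_nonpos)
		fix i
		have "w $ i * (1 / x $ i - 1 / x' $ i) = - ((x $ i - x' $ i)\<^sup>2 / (x $ i * x' $ i))"
			using pos[of i] by (simp add: w_def field_simps power2_eq_square)
		then show "w $ i \<bullet> (?p x - ?p x') $ i \<le> 0" using pos[of i] by simp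
	qed
	moreover have "(w v* Q) \<bullet> w - \<tau> * ((?p x - ?p x') \<bullet> w) = (y - y') \<bullet> (A *v w)"
		unfolding dot_lmul_matrix[of "y - y'", symmetric] eq[symmetric] by (simp only: inner_diff_left inner_scaleR_left)
	then have "w \<bullet> (Q *v w) = \<tau> * ((?p x - ?p x') \<bullet> w)" unfolding dot_lmul_matrix Aw by simp
	ultimately have "w \<bullet> (Q *v w) \<le> 0"
		using \<tau> unfolding inner_commute[of w "?p x - ?p x'"] by (simp only: mult_nonneg_nonpos less_imp_le)
	then have "w = 0" using pd unfolding positive_definite_def by fastforce
	then have "x = x'" by (simp add: w_def)
	moreover have "(y - y') v* A = 0" using eq \<open>x = x'\<close> \<open>w = 0\<close> by simp
	ultimately show ?thesis using full_rank_lmult_inj[OF rank, of "y - y'"] by simp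
qed

text \<open>Solutions of the system are minimizers of the logarithmic barrier.\<close>

lemma strictly_feasible_admissible:
	fixes Q :: "real^'m^'m" and A :: "real^'m^'d"
	assumes sym: "transpose Q = Q" and \<alpha>: "\<alpha> > 0" "\<And>x. \<alpha> * (x \<bullet> x) \<le> x \<bullet> (Q *v x)"
		and rank: "rank A = CARD('d)" and feas: "A *v x0 = b" "\<And>i. 0 < x0 $ i"
	shows "admissible (Q, c, A, b)"
proof -
	have pd: "positive_definite Q" unfolding positive_definite_def
	proof (intro conjI allI impI sym)
		fix x :: "real^'m" assume "x \<noteq> 0"
		then have "0 < \<alpha> * (x \<bullet> x)" using \<alpha>(1) by simp
		then show "0 < x \<bullet> (Q *v x)" using \<alpha>(2)[of x] by linarith
	qed
	have "\<exists>x y. kkt (Q, c, A, b) \<tau> (x, y)" if \<tau>: "\<tau> > 0" for \<tau>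
	proof -
		define f where "f x = (x \<bullet> (Q *v x)) / 2 + c \<bullet> x - \<tau> * (\<Sum>i\<in>UNIV. ln (x $ i))" for x
		define C where "C = \<bar>f x0\<bar>"
		\<comment> \<open>Since ln t is at most the norm of x, the barrier and the linear term cost at
		  most \<kappa> times the norm. The quadratic term outgrows this plus C beyond radius R.\<close>
		define \<kappa> where "\<kappa> = norm c + \<tau> * CARD('m)"
		define R where "R = max 1 (2 * (\<kappa> + C) / \<alpha>)"
		have \<kappa>: "\<kappa> \<ge> 0" "C \<ge> 0" using \<tau> by (simp_all add: \<kappa>_def C_def)
		have ln_le: "ln (x $ i) \<le> norm x" if "x $ i > 0" for x :: "real^'m" and i
			using ln_le_minus_one[OF that] component_le_norm_cart[of x i] by linarith
		have cx: "- (norm c * norm x) \<le> c \<bullet> x" for x using Cauchy_Schwarz_ineq2[of c x] by (simp add: abs_le_iff)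
		have bound: "norm x \<le> R" if x: "\<And>i. x $ i > 0" "f x \<le> f x0" for x
		proof (rule ccontr)
			assume "\<not> norm x \<le> R"
			then have N: "norm x > 1" "norm x > 2 * (\<kappa> + C) / \<alpha>" by (auto simp: R_def)
			have "(\<Sum>i\<in>UNIV. ln (x $ i)) \<le> (\<Sum>i::'m\<in>UNIV. norm x)" by (intro sum_mono ln_le x)
			then have "\<tau> * (\<Sum>i\<in>UNIV. ln (x $ i)) \<le> \<tau> * (CARD('m) * norm x)" using \<tau> by simp
			moreover have "\<alpha> * (norm x)\<^sup>2 / 2 \<le> (x \<bullet> (Q *v x)) / 2" using \<alpha>(2)[of x] by (simp add: power2_norm_eq_inner)
			ultimately have "\<alpha> * (norm x)\<^sup>2 / 2 - \<kappa> * norm x \<le> f x"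
				using cx[of x] by (simp add: f_def \<kappa>_def algebra_simps)
			also have "f x \<le> C" using x(2) by (simp add: C_def)
			finally have 1: "\<alpha> * (norm x)\<^sup>2 / 2 \<le> \<kappa> * norm x + C" by simp
			have "2 * (\<kappa> + C) < \<alpha> * norm x" using N(2) \<alpha>(1) by (simp add: field_simps)
			then have "2 * (\<kappa> + C) * norm x < \<alpha> * norm x * norm x" using N(1) by (intro mult_strict_right_mono) auto
			moreover have "C * 1 \<le> C * norm x" using N(1) \<kappa>(2) by (intro mult_left_mono) auto
			ultimately show False using 1 by (simp add: power2_eq_square algebra_simps)
		qed
		\<comment> \<open>The remaining logarithms are bounded by R, so on the sublevel set of x0 the
		  logarithm of a single coordinate cannot fall below -L / \<tau>; \<delta> keeps minimizers away
		  from the boundary.\<close>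
		define L where "L = C + norm c * R + \<tau> * (CARD('m) * R)"
		define \<delta> where "\<delta> = exp (- L / \<tau>)"
		have R0: "R \<ge> 0" by (simp add: R_def)
		have lower: "\<delta> \<le> x $ i" if x: "\<And>i. x $ i > 0" "f x \<le> f x0" for x i
		proof -
			have N: "norm x \<le> R" by (rule bound[OF x])
			have "(\<Sum>j\<in>UNIV - {i}. ln (x $ j)) \<le> (\<Sum>j\<in>UNIV - {i}. R)"
				by (intro sum_mono order_trans[OF ln_le[OF x(1)] N])
			also have "\<dots> \<le> CARD('m) * R" using R0 by (simp add: mult_right_mono)
			finally have "(\<Sum>j\<in>UNIV. ln (x $ j)) \<le> ln (x $ i) + CARD('m) * R"
				by (simp add: sum.remove[of UNIV i])
			then have "\<tau> * (\<Sum>j\<in>UNIV. ln (x $ j)) \<le> \<tau> * (ln (x $ i) + CARD('m) * R)" using \<tau> by simp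
			moreover have "0 \<le> x \<bullet> (Q *v x)" using \<alpha>(2)[of x] \<alpha>(1) by (meson inner_ge_zero less_imp_le mult_nonneg_nonneg order_trans)
			moreover have "norm c * norm x \<le> norm c * R" using N by (rule mult_left_mono) simp
			moreover have "f x \<le> C" using x(2) by (simp add: C_def)
			ultimately have "- L \<le> \<tau> * ln (x $ i)"
				using cx[of x] unfolding f_def L_def by (simp add: algebra_simps)
			then have "- L / \<tau> \<le> ln (x $ i)" using \<tau> by (simp add: field_simps)
			then have "exp (- L / \<tau>) \<le> exp (ln (x $ i))" by simp
			then show ?thesis using x(1)[of i] by (simp add: \<delta>_def)
		qed
		define K where "K = {x. A *v x = b} \<inter> (\<Inter>i. {x. \<delta> \<le> x $ i}) \<inter> cball 0 R"
		have \<delta>0: "\<delta> > 0" by (simp add: \<delta>_def)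
		have contA: "continuous_on UNIV ((*v) A)"
			by (intro linear_continuous_on) (simp add: linear_conv_bounded_linear[symmetric])
		have "closed {x. A *v x = b}" by (rule closed_Collect_eq[OF contA continuous_on_const])
		moreover have "closed {x::real^'m. \<delta> \<le> x $ i}" for i by (intro closed_Collect_le continuous_intros)
		ultimately have "compact K" unfolding K_def by (intro closed_Int_compact closed_Int closed_INT compact_cball) auto
		moreover have "x0 \<in> K" unfolding K_def using feas lower[OF feas(2)] bound[OF feas(2)] by simp
		moreover have "continuous_on K f"
		proof -
			have "continuous_on K (\<lambda>x. Q *v x)"
				by (intro linear_continuous_on) (simp add: linear_conv_bounded_linear[symmetric])
			moreover have "x $ i \<noteq> 0" if "x \<in> K" for x i
			proof -
				have "\<delta> \<le> x $ i" using that by (simp add: K_def)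
				then show ?thesis using \<delta>0 by linarith
			qed
			ultimately show ?thesis unfolding f_def by (intro continuous_intros) auto
		qed
		ultimately obtain x where x: "x \<in> K" "\<And>z. z \<in> K ==> f x \<le> f z"
			using continuous_attains_inf[of K f] by blast
		have Ax: "A *v x = b" and xd: "\<delta> \<le> x $ i" for i using x(1) by (simp_all add: K_def)
		have xpos: "0 < x $ i" for i using xd[of i] \<delta>0 by linarith
		have min: "f x \<le> f z" if z: "A *v z = b" "\<And>i. 0 < z $ i" for z
		proof (cases "f z \<le> f x0")
			case True
			then have "z \<in> K" unfolding K_def using z lower[OF z(2) True] bound[OF z(2) True] by simp
			then show ?thesis by (rule x(2))
		next
			case False
			then show ?thesis using x(2)[OF \<open>x0 \<in> K\<close>] by simp
		qed
		define g where "g = x v* Q + c - \<tau> *\<^sub>R (\<chi> i. 1 / x $ i)"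
		have "g \<bullet> v = 0" if v: "A *v v = 0" for v
		proof -
			\<comment> \<open>The barrier function along a feasible direction v. A minimum at s = 0 makes the
			  gradient g orthogonal to the kernel of A, hence a combination of its rows, and the coefficients
			  are y.\<close>
			define \<Phi> where "\<Phi> s = (x \<bullet> (Q *v x) + 2 * s * ((Q *v x) \<bullet> v) + s\<^sup>2 * (v \<bullet> (Q *v v))) / 2 +
				(c \<bullet> x + s * (c \<bullet> v)) - \<tau> * (\<Sum>i\<in>UNIV. ln (x $ i + s * v $ i))" for s
			have symQ: "x \<bullet> (Q *v v) = (Q *v x) \<bullet> v" by (metis dot_lmul_matrix sym transpose_matrix_vector)
			have \<Phi>: "f (x + s *\<^sub>R v) = \<Phi> s" for s
			proof -
				have "(x + s *\<^sub>R v) \<bullet> (Q *v (x + s *\<^sub>R v)) =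
						x \<bullet> (Q *v x) + 2 * s * ((Q *v x) \<bullet> v) + s\<^sup>2 * (v \<bullet> (Q *v v))"
					by (simp add: matrix_vector_right_distrib scaleR_matrix_vector_assoc[symmetric] matrix_vector_mult_scaleR
							inner_add_left inner_add_right symQ inner_commute[of v "Q *v x"] power2_eq_square algebra_simps)
				then show ?thesis by (simp add: f_def \<Phi>_def inner_add_right)
			qed
			have "(\<Phi> has_real_derivative ((Q *v x) \<bullet> v + c \<bullet> v - \<tau> * (\<Sum>i\<in>UNIV. v $ i / x $ i))) (at 0)"
			proof -
				define \<Lambda> where "\<Lambda> s = (\<Sum>i\<in>UNIV. ln (x $ i + s * v $ i))" for s
				have "(\<Lambda> has_real_derivative (\<Sum>i\<in>UNIV. v $ i / x $ i)) (at 0)"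
					unfolding \<Lambda>_def by (rule DERIV_sum) (use xpos in \<open>auto intro!: derivative_eq_intros\<close>)
				then show ?thesis unfolding \<Phi>_def \<Lambda>_def[symmetric] by (auto intro!: derivative_eq_intros)
			qed
			moreover have "0 < \<delta> / (1 + norm v)" using \<delta>0 by (simp add: add_pos_nonneg)
			moreover have "\<forall>s. \<bar>0 - s\<bar> < \<delta> / (1 + norm v) --> \<Phi> 0 \<le> \<Phi> s"
			proof (intro allI impI)
				fix s assume s: "\<bar>0 - s\<bar> < \<delta> / (1 + norm v)"
				have "0 < (x + s *\<^sub>R v) $ i" for i
				proof -
					have "\<bar>s * v $ i\<bar> \<le> \<bar>s\<bar> * (1 + norm v)"
						unfolding abs_mult using component_le_norm_cart[of v i] by (intro mult_left_mono) auto
					also have "\<dots> < \<delta>" using s by (simp add: pos_less_divide_eq add_pos_nonneg)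
					finally show ?thesis using xd[of i] by (simp add: abs_less_iff)
				qed
				moreover have "A *v (x + s *\<^sub>R v) = b"
					using Ax v by (simp add: matrix_vector_right_distrib matrix_vector_mult_scaleR)
				ultimately have "f x \<le> f (x + s *\<^sub>R v)" using min by blast
				then show "\<Phi> 0 \<le> \<Phi> s" using \<Phi>[of s] \<Phi>[of 0] by simp
			qed
			ultimately have "(Q *v x) \<bullet> v + c \<bullet> v - \<tau> * (\<Sum>i\<in>UNIV. v $ i / x $ i) = 0" by (rule DERIV_local_min)
			moreover have "x v* Q = Q *v x" by (metis sym transpose_matrix_vector)
			ultimately show ?thesis
				by (simp add: g_def inner_diff_left inner_add_left inner_vec_def[of "\<chi> i. 1 / x $ i"])
		qed
		from orthogonal_kernel_in_rowspace[OF rank this] obtain y where "g = y v* A" by blast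
		then have "kkt (Q, c, A, b) \<tau> (x, y)" using Ax xpos by (simp add: g_def)
		then show ?thesis by blast
	qed
	then have "\<forall>\<tau>>0. \<exists>!z. kkt (Q, c, A, b) \<tau> z" using kkt_unique[OF pd rank] by (metis prod.exhaust)
	then show ?thesis using pd rank by (simp add: admissible_def)
qed

lemma det_of_real_matrix:
	fixes M :: "real^'n^'n"
	shows "det (\<chi> i j. complex_of_real (M $ i $ j)) = of_real (det M)" unfolding det_def by simp

text \<open>At t = 0 the quadratic form is the identity, the constraints select coordinates and the
  all-ones vector is feasible; at t = 1 the matrices are those of \<rho>. The vector b is defined so
  that the moving point 1 + t (x - 1) stays feasible, which makes it quadratic in t.\<close>

definition qp_curve :: "(('m::finite, 'd::finite) slot => real) => ('d => 'm) => ('m => real) => real => ('m, 'd) qp" where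
	"qp_curve \<rho> f x t =
		((\<chi> i j. (if i = j then 1 else 0) + t * (\<rho> (slotQ i j) - (if i = j then 1 else 0))),
		 (\<chi> i. t * \<rho> (slotc i)),
		 (\<chi> k i. (if i = f k then 1 else 0) + t * (\<rho> (slotA k i) - (if i = f k then 1 else 0))),
		 (\<chi> k. \<Sum>i\<in>UNIV. ((if i = f k then 1 else 0) + t * (\<rho> (slotA k i) - (if i = f k then 1 else 0))) *
			 (1 + t * (x i - 1))))"

lemma qp_curve_poly:
	"\<exists>c. \<forall>t s. complex_of_real (slot_entry (qp_curve \<rho> f x t) s) = poly (c s) (of_real t)"
proof -
	have "\<exists>c. \<forall>t. complex_of_real (slot_entry (qp_curve \<rho> f x t) s) = poly c (of_real t)" for s
	proof -
		have lin: "complex_of_real (a + t * b) = poly [:of_real a, of_real b:] (of_real t)" for a b t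
			by simp
		consider p where "s = Inl p" | k i where "s = slotA k i" | i where "s = slotc i" | k where "s = slotb k"
			by (metis old.sum.exhaust surj_pair)
		then show ?thesis
		proof cases
			case 1
			then show ?thesis
				by (intro exI allI, simp only: 1 qp_curve_def slot_entry_simps vec_lambda_beta) (rule lin)
		next
			case 2
			then show ?thesis
				by (intro exI allI, simp only: 2 qp_curve_def slot_entry_simps vec_lambda_beta) (rule lin)
		next
			case 3
			then show ?thesis using lin[of 0 _ "\<rho> s"]
				by (intro exI[of _ "[:0, of_real (\<rho> s):]"]) (simp add: qp_curve_def)
		next
			case 4
			have lin1: "complex_of_real (1 + t * b) = poly [:1, of_real b:] (of_real t)" for b t by simp
			show ?thesis
				by (intro exI[of _ "\<Sum>i\<in>UNIV. [:of_real (if i = f k then 1 else 0), of_real (\<rho> (slotA k i) - (if i = f k then 1 else 0)):] *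
					[:1, of_real (x i - 1):]"] allI)
					(simp only: 4 qp_curve_def slot_entry_simps vec_lambda_beta of_real_sum of_real_mult lin lin1 poly_sum poly_mult of_real_1)
		qed
	qed
	then show ?thesis by metis
qed

text \<open>A polynomial that is nonzero at t = 1 is nonzero at some arbitrarily small positive t,
  where the program is strictly feasible and Q close to the identity. The minor q serves twice: at t
  = 1 it makes A x = b solvable, and at small t it certifies full rank.\<close>

theorem admissible_dense:
	fixes p :: "(('m::finite, 'd::finite) slot => complex) => complex"
	assumes p: "polyfun p" "p \<zeta>0 \<noteq> 0" and card: "CARD('d) \<le> CARD('m)"
	shows "\<exists>D :: ('m, 'd) qp. admissible D \<and> p (\<lambda>s. of_real (slot_entry D s)) \<noteq> 0"
proof -
	obtain f :: "'d => 'm" where f: "inj f"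
		using card_le_inj[of "UNIV :: 'd set" "UNIV :: 'm set"] card by auto
	define q where "q \<zeta> = det (\<chi> k k'. \<zeta> (slotA k (f k')))" for \<zeta> :: "('m, 'd) slot => complex"
	have q: "polyfun q" unfolding q_def[abs_def] by (intro polyfun_det) (simp add: polyfun.var)
	define \<zeta>1 :: "('m, 'd) slot => complex" where
		"\<zeta>1 s = (case s of Inr (Inl (k, i)) => (if i = f k then 1 else 0) | _ => 0)" for s
	have "(\<chi> k k'. \<zeta>1 (slotA k (f k'))) = (mat 1 :: complex^'d^'d)"
		by (auto simp: vec_eq_iff mat_def \<zeta>1_def inj_eq[OF f])
	then have "q \<zeta>1 \<noteq> 0" by (simp add: q_def)
	from polyfun_mult_nonzero[of p q \<zeta>0 \<zeta>1, OF p(1) q p(2) this] obtain z where z: "p z * q z \<noteq> 0" by (rule exE)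
	have pq: "polyfun (\<lambda>z. p z * q z)" by (rule polyfun.mult[OF p(1) q])
	from polyfun_nonzero_real[of "\<lambda>z. p z * q z" z, OF pq z] obtain \<rho> where \<rho>: "p (\<lambda>s. of_real (\<rho> s)) * q (\<lambda>s. of_real (\<rho> s)) \<noteq> 0"
		by (rule exE)
	define M :: "real^'d^'d" where "M = (\<chi> k k'. \<rho> (slotA k (f k')))"
	have "q (\<lambda>s. of_real (\<rho> s)) = of_real (det M)"
		using det_of_real_matrix[of M] by (simp add: q_def M_def)
	then have "det M \<noteq> 0" using \<rho> by auto
	then obtain M' where M': "M ** M' = mat 1" using invertible_det_nz[of M] unfolding invertible_def by blast
	define u where "u = M' *v (\<chi> k. \<rho> (slotb k))"
	have u: "(\<Sum>k'\<in>UNIV. \<rho> (slotA k (f k')) * u $ k') = \<rho> (slotb k)" for k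
	proof -
		have "M *v u = (\<chi> k. \<rho> (slotb k))" by (simp add: u_def matrix_vector_mul_assoc M')
		from arg_cong[OF this, of "\<lambda>w. w $ k"] show ?thesis by (simp add: M_def matrix_vector_mult_def)
	qed
	\<comment> \<open>The solution of A x = b supported on the columns chosen by f. Its signs are
	  irrelevant, because positivity is only required for small t.\<close>
	define x where "x i = (\<Sum>k'\<in>UNIV. if f k' = i then u $ k' else 0)" for i
	have x: "(\<Sum>i\<in>UNIV. \<rho> (slotA k i) * x i) = \<rho> (slotb k)" for k
	proof -
		have "(\<Sum>i\<in>UNIV. \<rho> (slotA k i) * x i) = (\<Sum>k'\<in>UNIV. \<Sum>i\<in>UNIV. if f k' = i then \<rho> (slotA k i) * u $ k' else 0)"
			unfolding x_def sum_distrib_left by (subst sum.swap) (intro sum.cong refl, simp)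
		then show ?thesis using u by simp
	qed
	let ?D = "qp_curve \<rho> f x"
	obtain c where c: "\<And>t s. complex_of_real (slot_entry (?D t) s) = poly (c s) (of_real t)"
		using qp_curve_poly[of \<rho> f x] by blast
	obtain r where r: "\<And>t. p (\<lambda>s. poly (c s) t) * q (\<lambda>s. poly (c s) t) = poly r t"
		using polyfun_poly_line[OF pq, of c] by blast
	have "slot_entry (?D 1) s = \<rho> s" for s
	proof -
		consider p where "s = Inl p" | k i where "s = slotA k i" | i where "s = slotc i" | k where "s = slotb k"
			by (metis old.sum.exhaust surj_pair)
		then show ?thesis by cases (simp_all add: qp_curve_def Upair_urep x)
	qed
	then have "poly r 1 \<noteq> 0" using \<rho> c[of 1] by (simp flip: r)
	define \<beta> where "\<beta> = onorm ((*v) (\<chi> i j. \<rho> (slotQ i j)))"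
	have bl: "bounded_linear ((*v) (\<chi> i j. \<rho> (slotQ i j) :: real^'m^'m))"
		by (simp add: linear_conv_bounded_linear[symmetric])
	have \<beta>: "0 \<le> \<beta>" "norm ((\<chi> i j. \<rho> (slotQ i j)) *v w) \<le> \<beta> * norm w" for w :: "real^'m"
		unfolding \<beta>_def using onorm_pos_le[OF bl] onorm[OF bl] by auto
	define \<xi> where "\<xi> = (\<Sum>i\<in>UNIV. \<bar>x i - 1\<bar>)"
	have \<xi>: "\<bar>x i - 1\<bar> \<le> \<xi>" "0 \<le> \<xi>" for i unfolding \<xi>_def by (rule member_le_sum) (auto intro: sum_nonneg)
	\<comment> \<open>Below \<epsilon> both t + t \<beta> < 1/2 and t \<xi> < 1 hold: the first keeps Q
	  above half the identity, the second keeps the feasible point positive.\<close>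
	define \<epsilon> where "\<epsilon> = 1 / (2 * (1 + \<beta> + \<xi>))"
	have "\<epsilon> > 0" using \<beta>(1) \<xi>(2) by (simp add: \<epsilon>_def)
	from poly_nonzero_real_avoid[OF \<open>poly r 1 \<noteq> 0\<close> this] obtain t where
		t: "0 < t" "t < \<epsilon>" "poly r (of_real t) \<noteq> 0" by blast
	have "t * (2 * (1 + \<beta> + \<xi>)) < 1" using t(2) \<beta>(1) \<xi>(2) by (simp add: \<epsilon>_def pos_less_divide_eq)
	moreover have "0 \<le> t * \<beta>" "0 \<le> t * \<xi>" using t(1) \<beta>(1) \<xi>(2) by simp_all
	moreover have "t * (2 * (1 + \<beta> + \<xi>)) = 2 * t + 2 * (t * \<beta>) + 2 * (t * \<xi>)" by (simp add: algebra_simps)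
	ultimately have tb: "t + t * \<beta> < 1 / 2" "t * \<xi> < 1" using t(1) by linarith+
	have nz: "p (\<lambda>s. of_real (slot_entry (?D t) s)) \<noteq> 0" "q (\<lambda>s. of_real (slot_entry (?D t) s)) \<noteq> 0"
		using t(3) unfolding r[symmetric] c by auto
	obtain Q c' A b where D: "?D t = (Q, c', A, b)" by (cases "?D t")
	have Q: "Q $ i $ j = (if i = j then 1 else 0) + t * (\<rho> (slotQ i j) - (if i = j then 1 else 0))"
		and A: "A $ k $ i = (if i = f k then 1 else 0) + t * (\<rho> (slotA k i) - (if i = f k then 1 else 0))"
		and b: "b $ k = (\<Sum>i\<in>UNIV. A $ k $ i * (1 + t * (x i - 1)))" for i j k
		using D by (auto simp: qp_curve_def)
	have "admissible (Q, c', A, b)"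
	proof (rule strictly_feasible_admissible[where \<alpha> = "1/2" and ?x0.0 = "\<chi> i. 1 + t * (x i - 1)"])
		have U: "\<rho> (slotQ i j) = \<rho> (slotQ j i)" for i j by (rule arg_cong[where f = "\<lambda>u. \<rho> (Inl u)"]) simp
		show "transpose Q = Q" unfolding vec_eq_iff transpose_def vec_lambda_beta Q
			by (intro allI) (use U in \<open>simp only: eq_commute\<close>)
		show "1 / 2 * (w \<bullet> w) \<le> w \<bullet> (Q *v w)" for w
		proof -
			have "(Q *v w) = (1 - t) *\<^sub>R w + t *\<^sub>R ((\<chi> i j. \<rho> (slotQ i j)) *v w)"
			proof -
				have "(Q *v w) $ i = (1 - t) * w $ i + t * (\<Sum>j\<in>UNIV. \<rho> (slotQ i j) * w $ j)" for i
				proof -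
					have "(Q *v w) $ i = (\<Sum>j\<in>UNIV. (if j = i then (1 - t) * w $ j else 0) + t * (\<rho> (slotQ i j) * w $ j))"
						unfolding matrix_vector_mult_def vec_lambda_beta Q
						by (rule sum.cong) (auto simp: algebra_simps)
					then show ?thesis by (simp add: sum.distrib sum_distrib_left)
				qed
				then show ?thesis by (simp add: vec_eq_iff matrix_vector_mult_def)
			qed
			then have 1: "w \<bullet> (Q *v w) = (1 - t) * (w \<bullet> w) + t * (w \<bullet> ((\<chi> i j. \<rho> (slotQ i j)) *v w))"
				by (simp add: inner_add_right)
			have "\<bar>w \<bullet> ((\<chi> i j. \<rho> (slotQ i j)) *v w)\<bar> \<le> norm w * (\<beta> * norm w)"
				by (rule order_trans[OF Cauchy_Schwarz_ineq2 mult_left_mono[OF \<beta>(2)]]) simp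
			also have "\<dots> = \<beta> * (w \<bullet> w)" by (simp add: power2_norm_eq_inner[symmetric] power2_eq_square)
			finally have "- (\<beta> * (w \<bullet> w)) \<le> w \<bullet> ((\<chi> i j. \<rho> (slotQ i j)) *v w)" by linarith
			then have "t * - (\<beta> * (w \<bullet> w)) \<le> t * (w \<bullet> ((\<chi> i j. \<rho> (slotQ i j)) *v w))" using t(1) by (intro mult_left_mono) auto
			then have "(1 - t - t * \<beta>) * (w \<bullet> w) \<le> w \<bullet> (Q *v w)" unfolding 1 by (simp add: algebra_simps)
			moreover have "1 / 2 * (w \<bullet> w) \<le> (1 - t - t * \<beta>) * (w \<bullet> w)" using tb(1) by (intro mult_right_mono) auto
			ultimately show ?thesis by linarith
		qed
		show "rank A = CARD('d)"
		proof -
			define N :: "real^'d^'d" where "N = (\<chi> k k'. A $ k $ f k')"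
			have "q (\<lambda>s. of_real (slot_entry (?D t) s)) = of_real (det N)"
				using det_of_real_matrix[of N] by (simp add: q_def N_def D)
			then have "det N \<noteq> 0" using nz by auto
			then obtain N' where N': "N ** N' = mat 1" using invertible_det_nz[of N] unfolding invertible_def by blast
			define F :: "real^'d^'m" where "F = (\<chi> i k. if i = f k then 1 else 0)"
			have "N = A ** F"
				by (simp add: vec_eq_iff N_def F_def matrix_matrix_mult_def if_distrib cong: if_cong)
			then have "A ** (F ** N') = mat 1" using N' by (simp add: matrix_mul_assoc)
			then have "A *v ((F ** N') *v w) = w" for w by (simp add: matrix_vector_mul_assoc)
			then have "surj ((*v) A)" by (metis surjI)
			then show ?thesis by (simp only: full_rank_surjective)
		qed
		show "A *v (\<chi> i. 1 + t * (x i - 1)) = b" by (simp add: vec_eq_iff b matrix_vector_mult_def)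
		show "0 < (\<chi> i. 1 + t * (x i - 1)) $ i" for i
		proof -
			have "t * \<bar>x i - 1\<bar> \<le> t * \<xi>" using \<xi>(1) t(1) by (intro mult_left_mono) auto
			from le_less_trans[OF this tb(2)] have "\<bar>t * (x i - 1)\<bar> < 1" using t(1) by (simp add: abs_mult)
			then show ?thesis by (simp add: abs_less_iff)
		qed
	qed simp
	then show ?thesis using nz(1) D by metis
qed

section \<open>The volume of the Newton polytope\<close>

text \<open>Both sides satisfy S(r + 1) = ((d + r + 1) choose d) + 2 S(r): on the left by shifting
  the index, on the right by Pascal's rule. The right-hand form is the one that both the degree
  bound and the volume produce.\<close>

lemma binomial_sum_identity: "(\<Sum>k=0..r. ((d + r - k) choose d) * 2 ^ k) = (\<Sum>i\<le>r. (d + r + 1) choose i)"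
proof (induction r)
	case (Suc r)
	have "(\<Sum>k=0..Suc r. ((d + Suc r - k) choose d) * 2 ^ k) =
			((d + Suc r) choose d) + 2 * (\<Sum>k=0..r. ((d + r - k) choose d) * 2 ^ k)"
		by (subst sum.atLeast0_atMost_Suc_shift) (simp add: sum_distrib_left mult_ac)
	also have "\<dots> = ((d + Suc r) choose d) + 2 * (\<Sum>i\<le>r. (d + r + 1) choose i)" using Suc by simp
	also have "(d + Suc r) choose d = (d + r + 1) choose (Suc r)"
		using binomial_symmetric[of d "d + Suc r"] by simp
	also have "((d + r + 1) choose (Suc r)) + 2 * (\<Sum>i\<le>r. (d + r + 1) choose i) =
			(\<Sum>i\<le>Suc r. (d + r + 1) choose i) + (\<Sum>i\<le>r. (d + r + 1) choose i)" by simp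
	also have "(\<Sum>i\<le>Suc r. (d + r + 1) choose i) = 1 + (\<Sum>i\<le>r. (d + r + 1) choose (Suc i))"
		by (subst sum.atMost_Suc_shift) simp
	also have "1 + (\<Sum>i\<le>r. (d + r + 1) choose (Suc i)) + (\<Sum>i\<le>r. (d + r + 1) choose i) =
			1 + (\<Sum>i\<le>r. (d + r + 2) choose (Suc i))" by (simp add: sum.distrib)
	also have "\<dots> = (\<Sum>i\<le>Suc r. (d + Suc r + 1) choose i)" by (subst sum.atMost_Suc_shift) simp
	finally show ?case .
qed simp

lemma qp_degree_sum:
	assumes "d \<ge> 1" "d < m"
	shows "(\<Sum>k = 0..m - d - 1. ((m - k - 2) choose (d - 1)) * 2 ^ k) = (\<Sum>i<m - d. (m - 1) choose i)"
proof -
	have "(\<Sum>k = 0..m - d - 1. ((m - k - 2) choose (d - 1)) * 2 ^ k) =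
			(\<Sum>k = 0..m - d - 1. ((d - 1 + (m - d - 1) - k) choose (d - 1)) * 2 ^ k)"
		by (rule sum.cong[OF refl], rule arg_cong2[where f = "(*)"], rule arg_cong2[where f = "(choose)"])
			 (use assms in auto)
	also have "\<dots> = (\<Sum>i\<le>m - d - 1. (d - 1 + (m - d - 1) + 1) choose i)" by (rule binomial_sum_identity)
	also have "d - 1 + (m - d - 1) + 1 = m - 1" using assms by simp
	also have "{..m - d - 1} = {..<m - d}" using assms by auto
	finally show ?thesis .
qed

text \<open>Fubini over the coordinate b: slices outside the interval from 0 to t are empty, and the
  integral of the slice volumes g is evaluated by an antiderivative G.\<close>

lemma emeasure_PiM_insert_slices:
	fixes t :: real and A :: "'a set"
	assumes A: "finite A" "b \<notin> A" and S: "S \<in> sets (PiM (insert b A) (\<lambda>_. lborel))"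
		and S': "\<And>y. S' y \<in> sets (PiM A (\<lambda>_. lborel))"
		and iff: "\<And>x y. x \<in> space (PiM A (\<lambda>_. lborel)) ==> x(b := y) \<in> S \<longleftrightarrow> y \<in> {0..t} \<and> x \<in> S' y"
		and em: "\<And>y. y \<in> {0..t} ==> emeasure (PiM A (\<lambda>_. lborel)) (S' y) = ennreal (g y)"
		and g: "\<And>y. y \<in> {0..t} ==> 0 \<le> g y" "g \<in> borel_measurable borel"
		and G: "\<And>y. y \<in> {0..t} ==> (G has_real_derivative g y) (at y)" and t: "0 \<le> t"
	shows "emeasure (PiM (insert b A) (\<lambda>_. lborel)) S = ennreal (G t - G 0)"
proof -
	interpret product_sigma_finite "\<lambda>_. lborel" by standard
	have "emeasure (PiM (insert b A) (\<lambda>_. lborel)) S = (\<integral>\<^sup>+ x. indicator S x \<partial>PiM (insert b A) (\<lambda>_. lborel))"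
		using S by simp
	also have "\<dots> = (\<integral>\<^sup>+ y. \<integral>\<^sup>+ x. indicator S (x(b := y)) \<partial>PiM A (\<lambda>_. lborel) \<partial>lborel)"
		using A S by (intro product_nn_integral_insert_rev) auto
	also have "\<dots> = (\<integral>\<^sup>+ y. ennreal (g y) * indicator {0..t} y \<partial>lborel)"
	proof (rule nn_integral_cong)
		fix y
		have "(\<integral>\<^sup>+ x. indicator S (x(b := y)) \<partial>PiM A (\<lambda>_. lborel)) =
				(\<integral>\<^sup>+ x. indicator {0..t} y * indicator (S' y) x \<partial>PiM A (\<lambda>_. lborel))"
			by (rule nn_integral_cong) (use iff in \<open>auto simp: indicator_def\<close>)
		also have "\<dots> = indicator {0..t} y * emeasure (PiM A (\<lambda>_. lborel)) (S' y)"
			using S' by (simp add: nn_integral_cmult)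
		also have "\<dots> = ennreal (g y) * indicator {0..t} y" using em by (auto simp: indicator_def)
		finally show "(\<integral>\<^sup>+ x. indicator S (x(b := y)) \<partial>PiM A (\<lambda>_. lborel)) = ennreal (g y) * indicator {0..t} y" .
	qed
	also have "\<dots> = ennreal (G t - G 0)" using g G t by (intro nn_integral_FTC_Icc) auto
	finally show ?thesis .
qed

text \<open>The cross-section of the Newton polytope at \<lambda> = y is this set with p = q = 1 -
  y, where B carries the y-coordinates and T the t-coordinates. Two independent sizes make an
  induction over B possible.\<close>

definition trunc_simplex :: "'a set => 'a set => real => real => ('a => real) set" where
	"trunc_simplex B T p q = {x \<in> space (PiM (B \<union> T) (\<lambda>_. lborel)). (\<forall>i\<in>B \<union> T. 0 \<le> x i) \<and> sum x B \<le> p \<and> sum x (B \<union> T) \<le> p + q}"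

lemma trunc_simplex_sets:
	assumes "finite B" "finite T"
	shows "trunc_simplex B T p q \<in> sets (PiM (B \<union> T) (\<lambda>_. lborel))"
proof -
	let ?M = "PiM (B \<union> T) (\<lambda>_. lborel :: real measure)"
	have c: "(\<lambda>x. x i) \<in> borel_measurable ?M" if "i \<in> B \<union> T" for i
		using measurable_component_singleton[OF that, of "\<lambda>_. lborel"] by simp
	have "(\<lambda>x. sum x B) \<in> borel_measurable ?M" "(\<lambda>x. sum x (B \<union> T)) \<in> borel_measurable ?M"
		by (intro borel_measurable_sum c; simp)+
	then have 1: "{x \<in> space ?M. sum x B \<le> p} \<in> sets ?M" "{x \<in> space ?M. sum x (B \<union> T) \<le> p + q} \<in> sets ?M"
		by measurable
	have 2: "{x \<in> space ?M. \<forall>i\<in>B \<union> T. 0 \<le> x i} \<in> sets ?M"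
	proof (rule sets.sets_Collect_finite_All)
		fix i assume "i \<in> B \<union> T"
		from c[OF this] show "{x \<in> space ?M. 0 \<le> x i} \<in> sets ?M" by measurable
	qed (use assms in auto)
	have "trunc_simplex B T p q = {x \<in> space ?M. \<forall>i\<in>B \<union> T. 0 \<le> x i} \<inter>
			({x \<in> space ?M. sum x B \<le> p} \<inter> {x \<in> space ?M. sum x (B \<union> T) \<le> p + q})"
		by (auto simp: trunc_simplex_def)
	then show ?thesis using 1 2 by simp
qed

lemma fun_upd_in_space_PiM:
	assumes "b \<notin> A" "x \<in> space (PiM A (\<lambda>_. lborel))"
	shows "x(b := y) \<in> space (PiM (insert b A) (\<lambda>_. lborel))"
	using assms by (auto simp: space_PiM PiE_def extensional_def)

lemma sum_fun_upd: "b \<notin> A ==> sum (x(b := y)) A = sum x A" by (rule sum.cong) auto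

lemma real_deriv_shifted_power:
	"((\<lambda>y. - ((p - y) ^ Suc n / fact (Suc n))) has_real_derivative (p - y) ^ n / fact n) (at y)"
	by (rule derivative_eq_intros refl | simp add: field_simps del: of_nat_Suc)+

text \<open>Integrating (p - y)^n / n! over a new coordinate of B raises n by one in every summand
  and leaves the powers of q alone. Without B the region is a simplex of size p + q, and the sum is
  the binomial expansion of its volume.\<close>

lemma emeasure_trunc_simplex:
	fixes B T :: "'a set"
	assumes "finite B" "finite T" "B \<inter> T = {}" "0 \<le> p" "0 \<le> q"
	shows "emeasure (PiM (B \<union> T) (\<lambda>_. lborel)) (trunc_simplex B T p q) =
		ennreal (\<Sum>i\<le>card T. (p ^ (card B + i) / fact (card B + i)) * (q ^ (card T - i) / fact (card T - i)))"
	using assms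
proof (induction B arbitrary: p rule: finite_induct)
	case empty
	have "emeasure (PiM T (\<lambda>_. lborel)) (trunc_simplex {} T u 0) = ennreal (u ^ card T / fact (card T))"
		if "u \<ge> 0" for u using \<open>finite T\<close> that
	proof (induction T arbitrary: u rule: finite_induct)
		case empty
		have "(trunc_simplex {} {} u 0 :: ('a => real) set) = {\<lambda>_. undefined}" using empty by (auto simp: trunc_simplex_def space_PiM)
		then show ?case by (simp add: PiM_empty)
	next
		case (insert b T)
		have "emeasure (PiM (insert b T) (\<lambda>_. lborel)) (trunc_simplex {} (insert b T) u 0) =
				ennreal (- ((u - u) ^ Suc (card T) / fact (Suc (card T))) - (- ((u - 0) ^ Suc (card T) / fact (Suc (card T)))))"
		proof (rule emeasure_PiM_insert_slices[where S' = "\<lambda>y. trunc_simplex {} T (u - y) 0"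
					and g = "\<lambda>y. (u - y) ^ card T / fact (card T)" and t = u
					and G = "\<lambda>y. - ((u - y) ^ Suc (card T) / fact (Suc (card T)))"])
			show "trunc_simplex {} (insert b T) u 0 \<in> sets (PiM (insert b T) (\<lambda>_. lborel))"
				using trunc_simplex_sets[of "{}" "insert b T"] insert by simp
			show "trunc_simplex {} T (u - y) 0 \<in> sets (PiM T (\<lambda>_. lborel))" for y
				using trunc_simplex_sets[of "{}" T] insert by simp
			show "x(b := y) \<in> trunc_simplex {} (insert b T) u 0 \<longleftrightarrow> y \<in> {0..u} \<and> x \<in> trunc_simplex {} T (u - y) 0"
				if x: "x \<in> space (PiM T (\<lambda>_. lborel))" for x y
			proof -
				have e: "sum (x(b := y)) (insert b T) = y + sum x T"
					unfolding sum.insert[OF insert(1,2)] sum_fun_upd[OF insert(2)] by simp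
				have n: "(\<forall>i\<in>insert b T. 0 \<le> (x(b := y)) i) \<longleftrightarrow> 0 \<le> y \<and> (\<forall>i\<in>T. 0 \<le> x i)" using insert(2) by auto
				have nn: "(\<forall>i\<in>T. 0 \<le> x i) ==> 0 \<le> sum x T" by (rule sum_nonneg) auto
				show ?thesis
					unfolding trunc_simplex_def Un_empty_left using fun_upd_in_space_PiM[OF insert(2) x, of y] x nn insert(4)
					by (simp only: mem_Collect_eq e n) auto
			qed
			show "((\<lambda>y. - ((u - y) ^ Suc (card T) / fact (Suc (card T)))) has_real_derivative
					(u - y) ^ card T / fact (card T)) (at y)" for y by (rule real_deriv_shifted_power)
		qed (use insert in auto)
		then show ?case using insert by simp
	qed
	then have 1: "emeasure (PiM T (\<lambda>_. lborel)) (trunc_simplex {} T (p + q) 0) = ennreal ((p + q) ^ card T / fact (card T))"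
		using empty by simp
	have 2: "trunc_simplex {} T p q = trunc_simplex {} T (p + q) 0" using empty by (auto simp: trunc_simplex_def)
	have "(p + q) ^ card T / fact (card T) = (\<Sum>i\<le>card T. (p ^ i / fact i) * (q ^ (card T - i) / fact (card T - i)))"
		unfolding binomial_ring sum_divide_distrib
		by (rule sum.cong) (simp_all add: binomial_fact field_simps)
	then show ?case using 1 2 by simp
next
	case (insert b B)
	let ?r = "card T" and ?d = "card B"
	have fin: "finite (B \<union> T)" "b \<notin> B \<union> T" using insert by auto
	define G where "G y = (\<Sum>i\<le>?r. - ((p - y) ^ Suc (?d + i) / fact (Suc (?d + i))) * (q ^ (?r - i) / fact (?r - i)))" for y
	have "emeasure (PiM (insert b (B \<union> T)) (\<lambda>_. lborel)) (trunc_simplex (insert b B) T p q) = ennreal (G p - G 0)"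
	proof (rule emeasure_PiM_insert_slices[where S' = "\<lambda>y. trunc_simplex B T (p - y) q"
				and g = "\<lambda>y. \<Sum>i\<le>?r. ((p - y) ^ (?d + i) / fact (?d + i)) * (q ^ (?r - i) / fact (?r - i))" and t = p])
		show "trunc_simplex (insert b B) T p q \<in> sets (PiM (insert b (B \<union> T)) (\<lambda>_. lborel))"
			using trunc_simplex_sets[of "insert b B" T] insert by simp
		show "trunc_simplex B T (p - y) q \<in> sets (PiM (B \<union> T) (\<lambda>_. lborel))" for y
			using trunc_simplex_sets[of B T] insert by simp
		show "x(b := y) \<in> trunc_simplex (insert b B) T p q \<longleftrightarrow> y \<in> {0..p} \<and> x \<in> trunc_simplex B T (p - y) q"
			if x: "x \<in> space (PiM (B \<union> T) (\<lambda>_. lborel))" for x y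
		proof -
			have e: "sum (x(b := y)) (insert b B) = y + sum x B" "sum (x(b := y)) (insert b (B \<union> T)) = y + sum x (B \<union> T)"
			proof -
				show "sum (x(b := y)) (insert b B) = y + sum x B"
					unfolding sum.insert[OF insert(1,2)] sum_fun_upd[OF insert(2)] by simp
				show "sum (x(b := y)) (insert b (B \<union> T)) = y + sum x (B \<union> T)"
					unfolding sum.insert[OF fin] sum_fun_upd[OF fin(2)] by simp
			qed
			have n: "(\<forall>i\<in>insert b (B \<union> T). 0 \<le> (x(b := y)) i) \<longleftrightarrow> 0 \<le> y \<and> (\<forall>i\<in>B \<union> T. 0 \<le> x i)" using fin by auto
			have nn: "(\<forall>i\<in>B \<union> T. 0 \<le> x i) ==> 0 \<le> sum x B" by (rule sum_nonneg) auto
			show ?thesis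
				unfolding trunc_simplex_def Un_insert_left using fun_upd_in_space_PiM[OF fin(2) x, of y] x nn
				by (simp only: mem_Collect_eq e n) auto
		qed
		show "0 \<le> (\<Sum>i\<le>?r. ((p - y) ^ (?d + i) / fact (?d + i)) * (q ^ (?r - i) / fact (?r - i)))" if "y \<in> {0..p}" for y
			using that insert by (intro sum_nonneg) auto
		show "(G has_real_derivative (\<Sum>i\<le>?r. ((p - y) ^ (?d + i) / fact (?d + i)) * (q ^ (?r - i) / fact (?r - i)))) (at y)" for y
			unfolding G_def by (intro DERIV_sum DERIV_cmult_right real_deriv_shifted_power)
	qed (use insert fin in auto)
	moreover have "G p = 0" by (simp add: G_def)
	moreover have "- G 0 = (\<Sum>i\<le>?r. (p ^ (card (insert b B) + i) / fact (card (insert b B) + i)) * (q ^ (?r - i) / fact (?r - i)))"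
		using insert by (simp add: G_def sum_negf)
	ultimately show ?case by simp
qed

text \<open>The slice at height y is the slice at 0 scaled by 1 - y, so the region is a pyramid and
  the factor 1 / (|B| + |T| + 1) is that of a cone.\<close>

lemma emeasure_qp_region:
	fixes l :: "'a::euclidean_space"
	assumes Basis: "Basis = insert l (B \<union> T)" "l \<notin> B \<union> T" "B \<inter> T = {}"
	shows "emeasure lborel {x. (\<forall>i\<in>Basis. 0 \<le> x \<bullet> i) \<and> x \<bullet> l + (\<Sum>b\<in>B. x \<bullet> b) \<le> 1 \<and>
			2 * (x \<bullet> l) + (\<Sum>b\<in>B \<union> T. x \<bullet> b) \<le> 2} =
		ennreal ((\<Sum>i\<le>card T. 1 / (fact (card B + i) * fact (card T - i))) / (card B + card T + 1))"
		(is "emeasure lborel ?R = ennreal (?C / _)")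
proof -
	have fin: "finite B" "finite T" using finite_Basis Basis by (metis finite_Un finite_insert)+
	have rR: "?R \<in> sets borel" by (simp add: finite_Basis) measurable
	let ?n = "card B + card T"
	define S where "S = {x \<in> space (PiM (insert l (B \<union> T)) (\<lambda>_. lborel)). (\<forall>i\<in>insert l (B \<union> T). 0 \<le> x i) \<and>
			x l + sum x B \<le> (1::real) \<and> 2 * x l + sum x (B \<union> T) \<le> 2}"
	have proj: "(\<Sum>b\<in>Basis. f b *\<^sub>R b) \<bullet> i = f i" if "i \<in> Basis" for f and i :: 'a using that by simp
	have "emeasure lborel ?R = emeasure (distr (PiM Basis (\<lambda>b. lborel)) borel (\<lambda>f. \<Sum>b\<in>Basis. f b *\<^sub>R b)) ?R"
		by (subst lborel_eq) simp
	also have "\<dots> = emeasure (PiM Basis (\<lambda>b. lborel)) ((\<lambda>f. \<Sum>b\<in>Basis. f b *\<^sub>R b) -` ?R \<inter> space (PiM Basis (\<lambda>b. lborel)))"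
		using rR by (intro emeasure_distr) auto
	also have S: "(\<lambda>f. \<Sum>b\<in>Basis. f b *\<^sub>R b) -` ?R \<inter> space (PiM Basis (\<lambda>b. lborel)) = S"
	proof -
		have "(\<Sum>b\<in>B'. (\<Sum>b\<in>Basis. f b *\<^sub>R b) \<bullet> b) = sum f B'" if "B' \<subseteq> Basis" for f and B' :: "'a set"
		proof (rule sum.cong[OF refl])
			fix b assume "b \<in> B'"
			then show "(\<Sum>b\<in>Basis. f b *\<^sub>R b) \<bullet> b = f b" by (intro proj) (use that in blast)
		qed
		moreover have "B \<subseteq> Basis" "B \<union> T \<subseteq> Basis" "l \<in> Basis" using Basis by auto
		ultimately show ?thesis unfolding S_def Basis(1)[symmetric] by (auto simp: proj)
	qed
	finally have 1: "emeasure lborel ?R = emeasure (PiM (insert l (B \<union> T)) (\<lambda>_. lborel)) S"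
		unfolding Basis(1)[symmetric] .
	have Sm: "S \<in> sets (PiM (insert l (B \<union> T)) (\<lambda>_. lborel))"
		unfolding S[symmetric] Basis(1)[symmetric] using rR by (intro measurable_sets[of _ _ borel]) auto
	define G where "G y = - ((1 - y) ^ Suc ?n / fact (Suc ?n)) * (fact ?n * ?C)" for y :: real
	have "emeasure (PiM (insert l (B \<union> T)) (\<lambda>_. lborel)) S = ennreal (G 1 - G 0)"
	proof (rule emeasure_PiM_insert_slices[where S' = "\<lambda>y. trunc_simplex B T (1 - y) (1 - y)"
				and g = "\<lambda>y. (1 - y) ^ ?n * ?C" and t = 1])
		show "trunc_simplex B T (1 - y) (1 - y) \<in> sets (PiM (B \<union> T) (\<lambda>_. lborel))" for y
			by (rule trunc_simplex_sets[OF fin])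
		show "x(l := y) \<in> S \<longleftrightarrow> y \<in> {0..1} \<and> x \<in> trunc_simplex B T (1 - y) (1 - y)"
			if x: "x \<in> space (PiM (B \<union> T) (\<lambda>_. lborel))" for x y
		proof -
			have e: "sum (x(l := y)) B = sum x B" "sum (x(l := y)) (B \<union> T) = sum x (B \<union> T)"
				using Basis by (intro sum_fun_upd; simp)+
			have n: "(\<forall>i\<in>insert l (B \<union> T). 0 \<le> (x(l := y)) i) \<longleftrightarrow> 0 \<le> y \<and> (\<forall>i\<in>B \<union> T. 0 \<le> x i)"
				using Basis by auto
			have nn: "(\<forall>i\<in>B \<union> T. 0 \<le> x i) ==> 0 \<le> sum x B" by (rule sum_nonneg) auto
			show ?thesis
				unfolding trunc_simplex_def S_def using fun_upd_in_space_PiM[OF Basis(2) x, of y] x nn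
				by (simp only: mem_Collect_eq e n fun_upd_same) auto
		qed
		show "emeasure (PiM (B \<union> T) (\<lambda>_. lborel)) (trunc_simplex B T (1 - y) (1 - y)) = ennreal ((1 - y) ^ ?n * ?C)"
			if "y \<in> {0..1}" for y
		proof -
			have "(\<Sum>i\<le>card T. ((1 - y) ^ (card B + i) / fact (card B + i)) * ((1 - y) ^ (card T - i) / fact (card T - i))) =
					(1 - y) ^ ?n * ?C" unfolding sum_distrib_left
				by (rule sum.cong[OF refl]) (simp add: power_add[symmetric])
			then show ?thesis using emeasure_trunc_simplex[OF fin Basis(3), of "1 - y" "1 - y"] that by simp
		qed
		show "(G has_real_derivative (1 - y) ^ ?n * ?C) (at y)" for y
		proof -
			have "(G has_real_derivative (1 - y) ^ ?n / fact ?n * (fact ?n * ?C)) (at y)"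
				unfolding G_def by (intro DERIV_cmult_right real_deriv_shifted_power)
			then show ?thesis by simp
		qed
	qed (use fin Basis Sm in \<open>auto intro!: mult_nonneg_nonneg sum_nonneg\<close>)
	also have "G 1 - G 0 = ?C / (real ?n + 1)"
	proof -
		have "fact (Suc ?n) = (real ?n + 1) * fact ?n" by (simp add: algebra_simps)
		then show ?thesis unfolding G_def by simp
	qed
	finally show ?thesis unfolding 1 by (simp add: add_ac)
qed

section \<open>The inequalities of the Newton polytope\<close>

lemma convex_add_simplex:
	fixes a :: "'a::real_vector"
	assumes "convex H" "finite T" "a \<in> H" "\<And>t. t \<in> T ==> a + e t \<in> H" "\<And>t. t \<in> T ==> 0 \<le> v t" "sum v T \<le> 1"
	shows "a + (\<Sum>t\<in>T. v t *\<^sub>R e t) \<in> H"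
proof -
	have "(\<Sum>i\<in>insert None (Some ` T). (case i of None => 1 - sum v T | Some t => v t) *\<^sub>R
			(case i of None => a | Some t => a + e t)) \<in> H"
		by (rule convex_sum) (use assms in \<open>auto simp: sum.reindex\<close>)
	also have "(\<Sum>i\<in>insert None (Some ` T). (case i of None => 1 - sum v T | Some t => v t) *\<^sub>R
			(case i of None => a | Some t => a + e t)) = a + (\<Sum>t\<in>T. v t *\<^sub>R e t)"
		using assms(2) by (simp add: sum.reindex scaleR_add_right sum.distrib scaleR_diff_left scaleR_sum_left)
	finally show ?thesis .
qed

text \<open>Conversely to the check on vertices, a point of the region is a convex combination of
  e_l, of the e_b + V and of V + V, for one common V in the simplex spanned by 0 and the e_t. This
  works because the support contains all products of two factors from 1 and the t_j, and of one y_i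
  with one such factor.\<close>

lemma newton_polytope_qp_support:
	fixes p :: "('n::finite, 'a::zero) mpoly" and Y :: "'d => 'n"
	assumes l: "l \<notin> range Y" and keys: "Poly_Mapping.keys p = qp_support l Y"
	defines "T \<equiv> - insert l (range Y)"
	shows "newton_polytope p = {x. (\<forall>i. 0 \<le> x $ i) \<and> x $ l + (\<Sum>b\<in>range Y. x $ b) \<le> 1 \<and>
		2 * x $ l + (\<Sum>b\<in>range Y \<union> T. x $ b) \<le> 2}" (is "_ = ?R")
proof -
	let ?B = "range Y"
	define e :: "'n => real^'n" where "e i = axis i 1" for i
	define \<psi> :: "('n \<Rightarrow>\<^sub>0 nat) => real^'n" where "\<psi> \<mu> = (\<chi> i. real (Poly_Mapping.lookup \<mu> i))" for \<mu>
	have \<psi>: "\<psi> 0 = 0" "\<psi> (var v) = e v" "\<psi> (\<mu> + \<nu>) = \<psi> \<mu> + \<psi> \<nu>" for v \<mu> \<nu>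
		by (simp_all add: \<psi>_def e_def axis_def vec_eq_iff lookup_single lookup_add when_def)
	define K where "K = \<psi> ` qp_support l Y"
	have hull: "newton_polytope p = convex hull K" by (simp add: newton_polytope_def keys K_def \<psi>_def[abs_def])
	have KI: "\<psi> \<mu> \<in> K" if "\<mu> \<in> qp_support l Y" for \<mu> using that by (simp add: K_def)
	have Ke1: "e l \<in> K" and Ke2: "0 \<in> K"
		using KI[of "var l"] KI[of 0] unfolding \<psi> by (simp_all add: qp_support_def Let_def)
	have Ke3: "e t \<in> K" if "t \<in> T" for t
		using KI[of "var t"] that unfolding \<psi> qp_support_def Let_def T_def[symmetric] by blast
	have Ke4: "e s + e t \<in> K" if "s \<in> T" "t \<in> T" for s t
		using KI[of "var s + var t"] that unfolding \<psi> qp_support_def Let_def T_def[symmetric] by blast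
	have Ke5: "e b \<in> K" if "b \<in> ?B" for b
		using KI[of "var b"] that unfolding \<psi> qp_support_def Let_def T_def[symmetric] by blast
	have Ke6: "e b + e t \<in> K" if "b \<in> ?B" "t \<in> T" for b t
		using KI[of "var b + var t"] that unfolding \<psi> qp_support_def Let_def T_def[symmetric] by blast
	note Ke = Ke1 Ke2 Ke3 Ke4 Ke5 Ke6
	have sd: "(\<Sum>b\<in>C. e i $ b) = (if i \<in> C then 1 else 0)" for i and C :: "'n set"
		by (simp add: e_def axis_def)
	have disj: "l \<notin> T" "t \<in> T ==> t \<notin> ?B" "t \<in> T ==> t \<noteq> l" "b \<in> ?B ==> b \<noteq> l" for t b
		using l by (auto simp: T_def)
	have ecomp: "e i $ j = (if i = j then 1 else 0)" for i j by (auto simp: e_def axis_def)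
	have "K \<subseteq> ?R"
	proof
		fix x assume "x \<in> K"
		then obtain \<mu> where \<mu>: "x = \<psi> \<mu>" "\<mu> \<in> qp_support l Y" by (auto simp: K_def)
		from \<mu>(2) have "\<exists>t s b. \<mu> = var l \<or> \<mu> = 0 \<or> (t \<in> T \<and> \<mu> = var t) \<or> (s \<in> T \<and> t \<in> T \<and> \<mu> = var s + var t) \<or>
			(b \<in> ?B \<and> \<mu> = var b) \<or> (b \<in> ?B \<and> t \<in> T \<and> \<mu> = var b + var t)"
			unfolding qp_support_def Let_def T_def[symmetric] by blast
		then show "x \<in> ?R"
			unfolding \<mu>(1) by (elim exE disjE conjE) (simp_all add: \<psi> \<psi>(2)[unfolded One_nat_def] sum.distrib sd ecomp l disj)
	qed
	moreover have "convex ?R"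
	proof (rule convexI)
		fix x y :: "real^'n" and u v :: real
		assume x: "x \<in> ?R" and y: "y \<in> ?R" and uv: "0 \<le> u" "0 \<le> v" "u + v = 1"
		have 1: "u * a + v * b \<le> c" if "a \<le> c" "b \<le> c" for a b c :: real
		proof -
			have "u * a + v * b \<le> u * c + v * c" using that uv by (intro add_mono mult_left_mono) auto
			also have "\<dots> = c" using uv by (simp flip: distrib_right)
			finally show ?thesis .
		qed
		have 2: "(u *\<^sub>R x + v *\<^sub>R y) $ l + (\<Sum>b\<in>?B. (u *\<^sub>R x + v *\<^sub>R y) $ b) =
				u * (x $ l + (\<Sum>b\<in>?B. x $ b)) + v * (y $ l + (\<Sum>b\<in>?B. y $ b))"
			by (simp add: sum.distrib sum_distrib_left distrib_left)
		have 3: "2 * (u *\<^sub>R x + v *\<^sub>R y) $ l + (\<Sum>b\<in>?B \<union> T. (u *\<^sub>R x + v *\<^sub>R y) $ b) =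
				u * (2 * x $ l + (\<Sum>b\<in>?B \<union> T. x $ b)) + v * (2 * y $ l + (\<Sum>b\<in>?B \<union> T. y $ b))"
			by (simp add: sum.distrib sum_distrib_left distrib_left)
		show "u *\<^sub>R x + v *\<^sub>R y \<in> ?R" unfolding mem_Collect_eq 2 3 using x y uv 1 by auto
	qed
	ultimately have sub: "convex hull K \<subseteq> ?R" by (rule hull_minimal)
	have "x \<in> convex hull K" if x: "x \<in> ?R" for x
	proof -
		let ?H = "convex hull K"
		define \<beta> where "\<beta> = (\<Sum>b\<in>?B. x $ b)"
		\<comment> \<open>The total weight with which V is used: twice in V + V, which has weight 1 - x_l
		  - \<beta>, and once in each e_b + V, of joint weight \<beta>.\<close>
		define c where "c = 2 - 2 * x $ l - \<beta>"
		have x0: "0 \<le> x $ i" for i using x by auto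
		have \<beta>: "0 \<le> \<beta>" "x $ l + \<beta> \<le> 1" using x x0 by (auto simp: \<beta>_def intro: sum_nonneg)
		have "(\<Sum>b\<in>?B \<union> T. x $ b) = \<beta> + (\<Sum>t\<in>T. x $ t)"
			unfolding \<beta>_def by (rule sum.union_disjoint) (use disj in auto)
		then have \<sigma>: "(\<Sum>t\<in>T. x $ t) \<le> c" using x by (auto simp: c_def)
		have c0: "c \<ge> 0" using order_trans[OF sum_nonneg \<sigma>] x0 by simp
		\<comment> \<open>If c = 0, division yields 0; this is the right value, as all t-coordinates of x
		  then vanish.\<close>
		define v where "v t = x $ t / c" for t
		have cv: "c * v t = x $ t" if t: "t \<in> T" for t
		proof (cases "c = 0")
			case True
			have "x $ t \<le> (\<Sum>t\<in>T. x $ t)" by (rule member_le_sum[OF t]) (use x0 in auto)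
			then show ?thesis using True \<sigma> x0[of t] by simp
		qed (simp add: v_def)
		have v0: "v t \<ge> 0" for t using x0 c0 by (simp add: v_def)
		have v1: "sum v T \<le> 1"
		proof (cases "c = 0")
			case False
			then show ?thesis using \<sigma> c0 by (simp add: v_def sum_divide_distrib[symmetric])
		qed (simp add: v_def)
		define V where "V = (\<Sum>t\<in>T. v t *\<^sub>R e t)"
		have H: "convex ?H" "K \<subseteq> ?H" by (rule convex_convex_hull, rule hull_subset)
		have aV: "a + V \<in> ?H" if "a \<in> ?H" "\<And>t. t \<in> T ==> a + e t \<in> ?H" for a
			unfolding V_def by (rule convex_add_simplex[OF H(1) _ that]) (use v0 v1 in auto)
		have "0 + V \<in> ?H" by (rule aV) (use Ke H(2) in auto)
		then have V: "V \<in> ?H" by simp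
		have eV: "e t + V \<in> ?H" if "t \<in> T" for t using aV[of "e t"] Ke H(2) that by blast
		have VV: "V + V \<in> ?H" by (rule aV[OF V]) (use eV in \<open>simp add: add.commute\<close>)
		have bV: "e b + V \<in> ?H" if "b \<in> ?B" for b using aV[of "e b"] Ke H(2) that by blast
		let ?S = "insert None (insert (Some l) (Some ` ?B))"
		have "(\<Sum>i\<in>?S. (case i of None => 1 - x $ l - \<beta> | Some i => x $ i) *\<^sub>R
				(case i of None => V + V | Some i => if i = l then e l else e i + V)) \<in> ?H"
		proof (rule convex_sum)
			show "sum (case_option (1 - x $ l - \<beta>) (($) x)) ?S = 1"
				using l by (simp add: sum.reindex \<beta>_def image_iff)
		qed (use \<beta> x0 VV bV Ke(1) H in auto)
		also have "(\<Sum>i\<in>?S. (case i of None => 1 - x $ l - \<beta> | Some i => x $ i) *\<^sub>R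
				(case i of None => V + V | Some i => if i = l then e l else e i + V)) =
				(1 - x $ l - \<beta>) *\<^sub>R (V + V) + (x $ l *\<^sub>R e l + (\<Sum>b\<in>?B. x $ b *\<^sub>R (e b + V)))"
		proof -
			have "(\<Sum>b\<in>?B. x $ b *\<^sub>R (if b = l then e l else e b + V)) = (\<Sum>b\<in>?B. x $ b *\<^sub>R (e b + V))"
				by (rule sum.cong) (use disj in auto)
			then show ?thesis using l by (simp add: sum.reindex image_iff)
		qed
		also have "(\<Sum>b\<in>?B. x $ b *\<^sub>R (e b + V)) = (\<Sum>b\<in>?B. x $ b *\<^sub>R e b) + \<beta> *\<^sub>R V"
			by (simp add: scaleR_add_right sum.distrib scaleR_sum_left \<beta>_def)
		also have "(1 - x $ l - \<beta>) *\<^sub>R (V + V) + (x $ l *\<^sub>R e l + ((\<Sum>b\<in>?B. x $ b *\<^sub>R e b) + \<beta> *\<^sub>R V)) =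
				x $ l *\<^sub>R e l + (\<Sum>b\<in>?B. x $ b *\<^sub>R e b) + c *\<^sub>R V"
		proof -
			have "c *\<^sub>R V = (1 - x $ l - \<beta>) *\<^sub>R (V + V) + \<beta> *\<^sub>R V"
				unfolding c_def scaleR_2[symmetric] scaleR_scaleR scaleR_add_left[symmetric]
				by (rule arg_cong[where f = "\<lambda>a. a *\<^sub>R V"]) (simp add: algebra_simps)
			then show ?thesis by simp
		qed
		also have "c *\<^sub>R V = (\<Sum>t\<in>T. x $ t *\<^sub>R e t)"
			unfolding V_def scaleR_sum_right by (rule sum.cong) (simp_all add: cv)
		also have "x $ l *\<^sub>R e l + (\<Sum>b\<in>?B. x $ b *\<^sub>R e b) + (\<Sum>t\<in>T. x $ t *\<^sub>R e t) = (\<Sum>i\<in>UNIV. x $ i *\<^sub>R e i)"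
		proof -
			have U: "insert l (?B \<union> T) = (UNIV :: 'n set)" by (auto simp: T_def)
			have "l \<notin> ?B \<union> T" "?B \<inter> T = {}" using l disj by auto
			then have "(\<Sum>i\<in>insert l (?B \<union> T). x $ i *\<^sub>R e i) =
					x $ l *\<^sub>R e l + ((\<Sum>b\<in>?B. x $ b *\<^sub>R e b) + (\<Sum>t\<in>T. x $ t *\<^sub>R e t))"
				by (simp add: sum.union_disjoint)
			then show ?thesis unfolding U by (simp only: add.assoc)
		qed
		also have "\<dots> = x" by (simp add: vec_eq_iff ecomp if_distrib cong: if_cong)
		finally show ?thesis .
	qed
	with sub show ?thesis unfolding hull by blast
qed

theorem normalized_volume_qp_support:
	fixes p :: "('n::finite, 'a::zero) mpoly" and Y :: "'d::finite => 'n"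
	assumes Y: "inj Y" and l: "l \<notin> range Y" and keys: "Poly_Mapping.keys p = qp_support l Y"
	shows "normalized_volume (newton_polytope p) = real (\<Sum>i<CARD('n) - CARD('d). (CARD('n) - 1) choose i)"
proof -
	let ?T = "- insert l (range Y)" and ?e = "\<lambda>i. axis i 1 :: real^'n"
	define d where "d = CARD('d)"
	define r where "r = card ?T"
	have inj: "inj_on ?e C" for C by (auto simp: inj_on_def axis_eq_axis)
	have cB: "card (?e ` range Y) = d" and cT: "card (?e ` ?T) = r"
		unfolding d_def r_def by (simp_all add: card_image[OF inj] card_image[OF Y])
	have "CARD('n) = card (insert l (range Y) \<union> ?T)" by (simp add: Compl_partition)
	also have "\<dots> = card (insert l (range Y)) + r" unfolding r_def by (rule card_Un_disjoint) auto
	also have "card (insert l (range Y)) = d + 1" using l by (simp add: card_image[OF Y] d_def)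
	finally have n: "CARD('n) = d + r + 1" by simp
	have Basis: "(Basis :: (real^'n) set) = insert (?e l) (?e ` range Y \<union> ?e ` ?T)"
	proof -
		have "(Basis :: (real^'n) set) = range ?e" by (auto simp: Basis_vec_def)
		also have "(UNIV :: 'n set) = insert l (range Y \<union> ?T)" by auto
		finally show ?thesis by (simp only: image_insert image_Un)
	qed
	have disj: "?e l \<notin> ?e ` range Y \<union> ?e ` ?T" "?e ` range Y \<inter> ?e ` ?T = {}"
		using l by (auto simp: axis_eq_axis)
	have P: "newton_polytope p = {x. (\<forall>i\<in>Basis. 0 \<le> x \<bullet> i) \<and> x \<bullet> ?e l + (\<Sum>b\<in>?e ` range Y. x \<bullet> b) \<le> 1 \<and>
			2 * (x \<bullet> ?e l) + (\<Sum>b\<in>?e ` range Y \<union> ?e ` ?T. x \<bullet> b) \<le> 2}"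
	proof -
		have s: "(\<Sum>b\<in>?e ` C. x \<bullet> b) = (\<Sum>i\<in>C. x $ i)" for C and x :: "real^'n"
			by (simp add: sum.reindex[OF inj] inner_axis)
		have b: "(\<forall>i\<in>Basis. 0 \<le> x \<bullet> i) \<longleftrightarrow> (\<forall>i. 0 \<le> x $ i)" for x :: "real^'n"
			by (auto simp: Basis_vec_def inner_axis)
		show ?thesis
			unfolding newton_polytope_qp_support[OF l keys] image_Un[symmetric] s b by (simp add: inner_axis)
	qed
	have "newton_polytope p \<in> sets borel" unfolding newton_polytope_def
		by (intro borel_compact finite_imp_compact_convex_hull finite_imageI finite_keys)
	then have "measure lebesgue (newton_polytope p) = measure lborel (newton_polytope p)"
		by (simp add: measure_completion)
	also have "\<dots> = (\<Sum>i\<le>r. 1 / (fact (d + i) * fact (r - i))) / (d + r + 1)"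
		unfolding measure_def P emeasure_qp_region[OF Basis disj] cB cT
		by (rule enn2real_ennreal) (intro divide_nonneg_nonneg sum_nonneg, auto)
	finally have "normalized_volume (newton_polytope p) =
			fact (d + r) * (\<Sum>i\<le>r. 1 / (fact (d + i) * fact (r - i)))" by (simp add: normalized_volume_def n)
	also have "\<dots> = (\<Sum>i\<le>r. real ((d + r) choose (r - i)))"
		unfolding sum_distrib_left by (rule sum.cong[OF refl]) (simp add: binomial_fact algebra_simps)
	also have "\<dots> = (\<Sum>i\<le>r. real ((d + r) choose i))"
		by (rule sum.reindex_bij_witness[of _ "\<lambda>i. r - i" "\<lambda>i. r - i"]) auto
	also have "\<dots> = real (\<Sum>i<CARD('n) - CARD('d). (CARD('n) - 1) choose i)"
		by (simp add: n d_def[symmetric] lessThan_Suc_atMost)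
	finally show ?thesis .
qed

section \<open>Generic programs\<close>

lemma slot_exhaust:
	fixes s :: "('m, 'd) slot"
	obtains p where "s = Inl p" | k i where "s = slotA k i" | i where "s = slotc i" | k where "s = slotb k"
proof (cases s)
	case (Inr s')
	then show thesis
	proof (cases s')
		case (Inl ki)
		then show thesis using that(2) Inr by (cases ki) simp
	next
		case (Inr s'')
		then show thesis using that(3,4) \<open>s = Inr s'\<close> by (cases s'') simp_all
	qed
qed (rule that(1))

text \<open>The program of which a given point is on the central path: \<open>c\<close> and \<open>b\<close> are determined by
	\<open>Q\<close>, \<open>A\<close>, \<open>x\<close>, \<open>y\<close> and \<open>\<tau>\<close>, which are thus coordinates for pairs of a program and a parameter.\<close>

definition program_at :: "(('m::finite, 'd::finite) slot option => complex) => ('m, 'd) slot => complex" where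
	"program_at e s = (case s of Inr (Inr (Inl i)) => e None / e (Some (slotc i)) +
			 ((\<Sum>k\<in>UNIV. e (Some (slotA k i)) * e (Some (slotb k))) - (\<Sum>j\<in>UNIV. e (Some (slotQ i j)) * e (Some (slotc j))))
	 | Inr (Inr (Inr k)) => (\<Sum>i\<in>UNIV. e (Some (slotA k i)) * e (Some (slotc i)))
	 | _ => e (Some s))"

definition x_product :: "(('m::finite, 'd::finite) slot option => complex) => complex" where
	"x_product e = (\<Prod>i\<in>UNIV. e (Some (slotc i)))"

lemma polyfun_x_product: "polyfun x_product" unfolding x_product_def[abs_def] by (intro polyfun_intros)

lemma x_product_nonzero: "x_product e \<noteq> 0 \<longleftrightarrow> (\<forall>i. e (Some (slotc i)) \<noteq> 0)" by (simp add: x_product_def)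

lemma program_at_polyfun: "\<exists>n. polyfun n \<and> (\<forall>e. x_product e \<noteq> 0 --> x_product e * program_at e s = n e)"
proof -
	show ?thesis
	proof (cases s rule: slot_exhaust)
		case (3 i)
		let ?r = "\<lambda>e. (\<Sum>k\<in>UNIV. e (Some (slotA k i)) * e (Some (slotb k))) - (\<Sum>j\<in>UNIV. e (Some (slotQ i j)) * e (Some (slotc j)))"
		let ?n = "\<lambda>e. e None * (\<Prod>j\<in>UNIV - {i}. e (Some (slotc j))) + x_product e * ?r e"
		have "polyfun ?n" by (intro polyfun_intros polyfun_x_product)
		moreover have "x_product e * program_at e s = ?n e" if "x_product e \<noteq> 0" for e
		proof -
			have "x_product e = e (Some (slotc i)) * (\<Prod>j\<in>UNIV - {i}. e (Some (slotc j)))"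
				unfolding x_product_def by (rule prod.remove) auto
			moreover have "e (Some (slotc i)) \<noteq> 0" using that by (simp add: x_product_nonzero)
			ultimately have "x_product e * (e None / e (Some (slotc i))) = e None * (\<Prod>j\<in>UNIV - {i}. e (Some (slotc j)))"
				by (simp add: field_simps)
			then show ?thesis by (simp add: program_at_def 3 distrib_left)
		qed
		ultimately show ?thesis by (intro exI[of _ ?n]) auto
	next
		case (4 k)
		let ?n = "\<lambda>e. x_product e * (\<Sum>i\<in>UNIV. e (Some (slotA k i)) * e (Some (slotc i)))"
		have "polyfun ?n" by (intro polyfun_intros polyfun_x_product)
		then show ?thesis by (intro exI[of _ ?n]) (simp add: program_at_def 4)
	next
		case (1 p)
		have "polyfun (\<lambda>e. x_product e * e (Some s))" by (intro polyfun_intros polyfun_x_product)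
		then show ?thesis by (intro exI[of _ "\<lambda>e. x_product e * e (Some s)"]) (simp add: program_at_def 1)
	next
		case (2 k i)
		have "polyfun (\<lambda>e. x_product e * e (Some s))" by (intro polyfun_intros polyfun_x_product)
		then show ?thesis by (intro exI[of _ "\<lambda>e. x_product e * e (Some s)"]) (simp add: program_at_def 2)
	qed
qed

abbreviation "entries D \<equiv> (\<lambda>s. complex_of_real (slot_entry D s))"

lemma path_coords_simps:
	assumes "transpose Q = Q" "central_path (Q, c, A, b) \<tau> = (x, y)"
	shows "path_coords (Q, c, A, b) \<tau> None = of_real \<tau>"
		"path_coords (Q, c, A, b) \<tau> (Some (slotc i)) = of_real (x $ i)"
		"path_coords (Q, c, A, b) \<tau> (Some (slotb k)) = of_real (y $ k)"
		"path_coords (Q, c, A, b) \<tau> (Some (slotA k i)) = of_real (A $ k $ i)"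
		"path_coords (Q, c, A, b) \<tau> (Some (slotQ i j)) = of_real (Q $ i $ j)"
	using slot_entry_Q[OF assms(1), of c A b i j] assms(2) by (simp_all add: path_coords_def)

lemma program_at_path:
	fixes D :: "('m::finite, 'd::finite) qp"
	assumes adm: "admissible D" and \<tau>: "\<tau> > 0"
	shows "program_at (path_coords D \<tau>) = entries D" and "x_product (path_coords D \<tau>) \<noteq> 0"
proof -
	obtain Q c A b where D: "D = (Q, c, A, b)" by (cases D)
	obtain x y where xy: "central_path D \<tau> = (x, y)" by (cases "central_path D \<tau>")
	have sym: "transpose Q = Q" using adm D admissible_symmetric by blast
	have kkt: "kkt (Q, c, A, b) \<tau> (x, y)" using admissible_kkt[OF adm \<tau>] xy D by simp
	then have x: "x $ i > 0"
		and slack: "x $ i * (c $ i + (\<Sum>j\<in>UNIV. Q $ i $ j * x $ j) - (\<Sum>k\<in>UNIV. A $ k $ i * y $ k)) = \<tau>"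
		and Ax: "(\<Sum>i\<in>UNIV. A $ k $ i * x $ i) = b $ k" for i k unfolding kkt_iff[OF sym] by blast+
	note pc = path_coords_simps[OF sym xy[unfolded D]]
	have "x $ i \<noteq> 0" for i using x[of i] by simp
	then show "x_product (path_coords D \<tau>) \<noteq> 0" unfolding x_product_nonzero D pc by simp
	show "program_at (path_coords D \<tau>) = entries D"
	proof
		fix s :: "('m, 'd) slot"
		show "program_at (path_coords D \<tau>) s = entries D s"
		proof (cases s rule: slot_exhaust)
			case (3 i)
			have "\<tau> / x $ i + ((\<Sum>k\<in>UNIV. A $ k $ i * y $ k) - (\<Sum>j\<in>UNIV. Q $ i $ j * x $ j)) = c $ i"
			proof -
				have "z = \<tau> / u" if "u * z = \<tau>" "u > 0" for z u :: real using that by auto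
				from this[OF slack[of i] x[of i]] show ?thesis by linarith
			qed
			from arg_cong[OF this, of complex_of_real] show ?thesis
				unfolding 3 D program_at_def by (simp add: pc del: slot_entry_simps(1))
		next
			case (4 k)
			from arg_cong[OF Ax[of k], of complex_of_real] show ?thesis
				unfolding 4 D program_at_def by (simp add: pc)
		next
			case (1 p)
			then show ?thesis unfolding D by (simp add: program_at_def path_coords_def)
		next
			case (2 k i)
			then show ?thesis unfolding D by (simp add: program_at_def path_coords_def)
		qed
	qed
qed

text \<open>The functions g, \<tau> and the program coordinates are one more in number than the
  variables, so they satisfy a polynomial relation. After dividing out the power of g, setting g = 0
  leaves a nonzero condition on program and parameter alone: the zeros of g lie over a proper
  algebraic set.\<close>

lemma vanishing_on_paths:
	fixes g :: "(('m::finite, 'd::finite) slot option => complex) => complex"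
	assumes g: "polyfun g" "g e0 \<noteq> 0"
	shows "\<exists>a. polyfun a \<and> (\<exists>\<zeta>. a \<zeta> \<noteq> 0) \<and> (\<forall>(D :: ('m, 'd) qp) \<tau>. admissible D --> \<tau> > 0 -->
		g (path_coords D \<tau>) = 0 --> a (\<lambda>v. case v of None => of_real \<tau> | Some s => entries D s) = 0)"
proof -
	define f :: "('m, 'd) slot option option => (('m, 'd) slot option => complex) => complex" where
		"f i e = (case i of None => g e | Some v => (case v of None => e None | Some s => program_at e s))" for i e
	have "\<exists>n. polyfun n \<and> (\<forall>e. x_product e \<noteq> 0 --> x_product e * f i e = n e)" for i
	proof (cases i)
		case None
		have "polyfun (\<lambda>e. x_product e * g e)" by (rule polyfun.mult[OF polyfun_x_product g(1)])
		then show ?thesis using None by (intro exI[of _ "\<lambda>e. x_product e * g e"]) (simp add: f_def)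
	next
		case (Some v)
		show ?thesis
		proof (cases v)
			case None
			have "polyfun (\<lambda>e. x_product e * e None)" by (rule polyfun.mult[OF polyfun_x_product polyfun.var])
			then show ?thesis using None Some by (intro exI[of _ "\<lambda>e. x_product e * e None"]) (simp add: f_def)
		next
			case (Some s)
			then show ?thesis using program_at_polyfun[of s] \<open>i = Some v\<close> by (simp add: f_def)
		qed
	qed
	then have "\<exists>n. \<forall>i. polyfun (n i) \<and> (\<forall>e. x_product e \<noteq> 0 --> x_product e * f i e = n i e)" by (rule choice[OF allI])
	then obtain n where n: "\<And>i. polyfun (n i)" "\<And>i e. x_product e \<noteq> 0 ==> x_product e * f i e = n i e" by auto
	have card: "CARD(('m, 'd) slot option) < CARD(('m, 'd) slot option option)" by simp
	have "\<exists>P. polyfun P \<and> (\<exists>\<zeta>. P \<zeta> \<noteq> 0) \<and> (\<forall>e. x_product e \<noteq> 0 --> P (\<lambda>i. f i e) = 0)"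
		by (rule algebraic_dependence[where f = f and q = x_product and g = n, OF card polyfun_x_product n(1) n(2)])
	then obtain P where PP: "polyfun P \<and> (\<exists>\<zeta>. P \<zeta> \<noteq> 0) \<and> (\<forall>e. x_product e \<noteq> 0 --> P (\<lambda>i. f i e) = 0)"
		by (rule exE)
	have P: "polyfun P" using PP by (rule conjunct1)
	have P0: "P (\<lambda>i. f i e) = 0" if "x_product e \<noteq> 0" for e using PP that by blast
	obtain \<zeta> where "P \<zeta> \<noteq> 0" using PP by blast
	from polyfun_divide_var[of P \<zeta> None, OF P this] obtain k P' z0 where
		P': "polyfun P'" "\<And>z. P z = z None ^ k * P' z" "z0 None = 0" "P' z0 \<noteq> 0"
		by (elim exE conjE) (rule that, assumption, blast, assumption, assumption)
	from polyfun_clear_denominator[of P' x_product n, OF P'(1) polyfun_x_product n(1)] obtain M R where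
		R: "polyfun R" "\<And>e x. (\<And>i. x_product e * x i = n i e) ==> R e = x_product e ^ M * P' x"
		by (elim exE conjE) (rule that, assumption, blast)
	have Rf: "R e = x_product e ^ M * P' (\<lambda>i. f i e)" if "x_product e \<noteq> 0" for e
		by (rule R(2)) (rule n(2)[OF that])
	\<comment> \<open>Where g and the product of the x i are nonzero, the power of g cancels from the
	  relation. So R times these two polynomials vanishes everywhere, and R must be zero.\<close>
	have R0: "R e = 0" for e
	proof (rule ccontr)
		assume "R e \<noteq> 0"
		have "x_product (\<lambda>_. 1) \<noteq> 0" by (simp add: x_product_nonzero)
		from polyfun_mult_nonzero[of g x_product e0 "\<lambda>_. 1", OF g(1) polyfun_x_product g(2) this]
		obtain z where "g z * x_product z \<noteq> 0" by (rule exE)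
		from polyfun_mult_nonzero[of R "\<lambda>z. g z * x_product z" e z, OF R(1) polyfun.mult[OF g(1) polyfun_x_product] \<open>R e \<noteq> 0\<close> this]
		obtain z where z: "R z * (g z * x_product z) \<noteq> 0" by (rule exE)
		then have "x_product z \<noteq> 0" by simp
		from P0[OF this] have "g z ^ k * P' (\<lambda>i. f i z) = 0" unfolding P'(2) by (simp add: f_def)
		moreover have "P' (\<lambda>i. f i z) \<noteq> 0" using Rf[OF \<open>x_product z \<noteq> 0\<close>] z by auto
		ultimately show False using z by simp
	qed
	have Pf: "P' (\<lambda>i. f i e) = 0" if "x_product e \<noteq> 0" for e using Rf[OF that] R0[of e] that by simp
	define a where "a \<zeta> = P' (\<lambda>i. case i of None => 0 | Some v => \<zeta> v)" for \<zeta>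
	have "polyfun a" unfolding a_def[abs_def]
		by (rule polyfun_compose[OF P'(1)], rename_tac v, case_tac v) (simp_all add: polyfun.const polyfun.var)
	moreover have "a (\<lambda>v. z0 (Some v)) \<noteq> 0"
	proof -
		have "(\<lambda>i. case i of None => 0 | Some v => z0 (Some v)) = z0" using P'(3) by (auto simp: fun_eq_iff split: option.split)
		then show ?thesis using P'(4) by (simp add: a_def)
	qed
	moreover have "a (\<lambda>v. case v of None => of_real \<tau> | Some s => entries D s) = 0"
		if "admissible D" "\<tau> > 0" "g (path_coords D \<tau>) = 0" for D :: "('m, 'd) qp" and \<tau>
	proof -
		have "(\<lambda>i. case i of None => 0 | Some v => (case v of None => of_real \<tau> | Some s => entries D s)) =
				(\<lambda>i. f i (path_coords D \<tau>))" using that(3) program_at_path(1)[OF that(1,2)]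
			by (auto simp: fun_eq_iff f_def path_coords_def split: option.split)
		then show ?thesis using Pf[OF program_at_path(2)[OF that(1,2)]] by (simp only: a_def)
	qed
	ultimately show ?thesis by (intro exI[of _ a]) blast
qed

text \<open>The parameter is specialized to a complex value at which the condition is nontrivial.
  For a program passing this test, the condition is a nonzero polynomial in \<tau>, so some positive
  real \<tau> avoids its roots.\<close>

lemma nonvanishing_on_generic_paths:
	fixes g :: "(('m::finite, 'd::finite) slot option => complex) => complex"
	assumes g: "polyfun g" "g e0 \<noteq> 0"
	shows "\<exists>p. polyfun p \<and> (\<exists>\<zeta>. p \<zeta> \<noteq> 0) \<and> (\<forall>D :: ('m, 'd) qp. admissible D --> p (entries D) \<noteq> 0 -->
		(\<exists>\<tau>>0. g (path_coords D \<tau>) \<noteq> 0))"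
proof -
	from vanishing_on_paths[OF g] obtain a \<zeta> where a: "polyfun a" "a \<zeta> \<noteq> 0"
		"\<And>D \<tau>. admissible D ==> \<tau> > 0 ==> g (path_coords D \<tau>) = 0 ==>
			a (\<lambda>v. case v of None => of_real \<tau> | Some s => entries D s) = 0" by auto
	define p where "p z = a (\<lambda>v. case v of None => \<zeta> None | Some s => z s)" for z
	have "polyfun p" unfolding p_def[abs_def]
		by (rule polyfun_compose[OF a(1)], rename_tac v, case_tac v) (simp_all add: polyfun.const polyfun.var)
	moreover have "p (\<lambda>s. \<zeta> (Some s)) \<noteq> 0"
	proof -
		have "(\<lambda>v. case v of None => \<zeta> None | Some s => \<zeta> (Some s)) = \<zeta>" by (auto simp: fun_eq_iff split: option.split)
		then show ?thesis using a(2) by (simp add: p_def)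
	qed
	moreover have "\<exists>\<tau>>0. g (path_coords D \<tau>) \<noteq> 0" if D: "admissible D" "p (entries D) \<noteq> 0" for D :: "('m, 'd) qp"
	proof -
		define l where "l v = (case v of None => [:0, 1:] | Some s => [:entries D s:])" for v
		obtain r where r: "\<And>t. a (\<lambda>v. poly (l v) t) = poly r t"
			using polyfun_poly_line[OF a(1), of l] by auto
		have l: "(\<lambda>v. poly (l v) t) = (\<lambda>v. case v of None => t | Some s => entries D s)" for t
			by (auto simp: fun_eq_iff l_def split: option.split)
		have "poly r (\<zeta> None) \<noteq> 0" using D(2) unfolding r[symmetric] l p_def .
		from poly_nonzero_real_avoid[OF this, of 1] obtain t :: real where "0 < t" "poly r (of_real t) \<noteq> 0" by auto
		then have "g (path_coords D t) \<noteq> 0" using a(3)[OF D(1), of t] unfolding r[symmetric] l by auto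
		then show ?thesis using \<open>0 < t\<close> by blast
	qed
	ultimately show ?thesis by (intro exI[of _ p]) auto
qed

section \<open>The path as a curve parametrized by the real line\<close>

definition path_x :: "('m::finite, 'd::finite) qp => real => 'm => complex" where
	"path_x D t i = of_real (fst (central_path D (exp t)) $ i)"

definition path_y :: "('m::finite, 'd::finite) qp => real => 'd => complex" where
	"path_y D t k = of_real (snd (central_path D (exp t)) $ k)"

lemma complex_point_path: "complex_point (central_path D (exp t)) = case_sum (path_x D t) (path_y D t)"
	by (auto simp: fun_eq_iff complex_point_def path_x_def path_y_def split: sum.split)

text \<open>The program, the coefficients of two linear forms and the values of these forms at x are
  one more function than the variables Q, A, x, y, \<tau> and the form coefficients. Their algebraic
  relation, read as a polynomial in the two values, bounds the bidegree uniformly over all programs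
  and projections.\<close>

lemma plane_monoms_dependent:
	"\<exists>N p. N \<ge> 1 \<and> polyfun p \<and> (\<exists>\<zeta>. p \<zeta> \<noteq> 0) \<and> (\<forall>D :: ('m::finite, 'd::finite) qp. admissible D --> p (entries D) \<noteq> 0 -->
		 (\<forall>\<theta>. \<not> indep ({..N} \<times> {..N}) (\<lambda>a. plane_monom (path_x D) a \<theta>)))"
proof -
	define qq :: "(('m, 'd) slot option + ('m + 'm) => complex) => complex" where
		"qq z = x_product (\<lambda>v. z (Inl v))" for z
	define xx where "xx z i = z (Inl (Some (slotc i)))" for z :: "('m, 'd) slot option + ('m + 'm) => complex" and i
	define f :: "(('m, 'd) slot + ('m + 'm)) option option => (('m, 'd) slot option + ('m + 'm) => complex) => complex" where
		"f w z = (case w of None => lin (\<lambda>k. z (Inr (Inl k))) (xx z)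
			| Some None => lin (\<lambda>k. z (Inr (Inr k))) (xx z)
			| Some (Some (Inl s)) => program_at (\<lambda>v. z (Inl v)) s
			| Some (Some (Inr b)) => z (Inr b))" for w z
	have qq: "polyfun qq" unfolding qq_def[abs_def]
		by (rule polyfun_compose[OF polyfun_x_product]) (rule polyfun.var)
	have "\<exists>n. polyfun n \<and> (\<forall>z. qq z \<noteq> 0 --> qq z * f w z = n z)" for w
	proof -
		have poly: ?thesis if "polyfun (f w)"
			using polyfun.mult[OF qq that] by (intro exI[of _ "\<lambda>z. qq z * f w z"]) simp
		consider "w = None" | "w = Some None" | s where "w = Some (Some (Inl s))" | b where "w = Some (Some (Inr b))"
			by (metis old.sum.exhaust option.exhaust)
		then show ?thesis
		proof cases
			case (3 s)
			obtain n where n: "polyfun n" "\<And>e. x_product e \<noteq> 0 ==> x_product e * program_at e s = n e"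
				using program_at_polyfun[of s] by auto
			have "polyfun (\<lambda>z :: ('m, 'd) slot option + ('m + 'm) => complex. n (\<lambda>v. z (Inl v)))"
				by (rule polyfun_compose[OF n(1)]) (rule polyfun.var)
			then show ?thesis by (intro exI[of _ "\<lambda>z. n (\<lambda>v. z (Inl v))"]) (simp add: 3 f_def qq_def n(2))
		qed (rule poly, simp add: f_def[abs_def] lin_def xx_def, intro polyfun_intros)+
	qed
	then have "\<exists>n. \<forall>w. polyfun (n w) \<and> (\<forall>z. qq z \<noteq> 0 --> qq z * f w z = n w z)" by (rule choice[OF allI])
	then obtain n where n: "\<And>w. polyfun (n w)" "\<And>w z. qq z \<noteq> 0 ==> qq z * f w z = n w z" by auto
	have card: "CARD(('m, 'd) slot option + ('m + 'm)) < CARD((('m, 'd) slot + ('m + 'm)) option option)"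
		by (simp add: card_UNIV_sum card_UNIV_option)
	have "\<exists>P. polyfun P \<and> (\<exists>\<zeta>. P \<zeta> \<noteq> 0) \<and> (\<forall>z. qq z \<noteq> 0 --> P (\<lambda>i. f i z) = 0)"
		by (rule algebraic_dependence[where f = f and q = qq and g = n, OF card qq n(1) n(2)])
	then obtain P where PP: "polyfun P \<and> (\<exists>\<zeta>. P \<zeta> \<noteq> 0) \<and> (\<forall>z. qq z \<noteq> 0 --> P (\<lambda>i. f i z) = 0)" by (rule exE)
	have P1: "polyfun P" using PP by (rule conjunct1)
	have P0: "P (\<lambda>i. f i z) = 0" if "qq z \<noteq> 0" for z using PP that by blast
	obtain \<omega>' where P2: "P \<omega>' \<noteq> 0" using PP by blast
	obtain n1 a where a: "\<And>j. polyfun (a j)" "\<And>j z w. a j (z(None := w)) = a j z"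
		"\<And>z. P z = (\<Sum>j\<le>n1. a j z * z None ^ j)" using polyfun_expand[OF P1, of None] by auto
	have "\<forall>i. \<exists>n b. (\<forall>j. polyfun (b j)) \<and> (\<forall>j z w. b j (z(Some None := w)) = b j z) \<and>
		(\<forall>z. a i z = (\<Sum>j\<le>n. b j z * z (Some None) ^ j)) \<and> (\<forall>j>n. \<forall>z. b j z = 0)"
		using polyfun_expand[OF a(1), where v = "Some None"] by blast
	then obtain n2 where "\<forall>i. \<exists>b. (\<forall>j. polyfun (b j)) \<and> (\<forall>j z w. b j (z(Some None := w)) = b j z) \<and>
		(\<forall>z. a i z = (\<Sum>j\<le>n2 i. b j z * z (Some None) ^ j)) \<and> (\<forall>j>n2 i. \<forall>z. b j z = 0)"
		by (rule choice[THEN exE])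
	then obtain b where b0: "\<forall>i. (\<forall>j. polyfun (b i j)) \<and> (\<forall>j z w. b i j (z(Some None := w)) = b i j z) \<and>
		(\<forall>z. a i z = (\<Sum>j\<le>n2 i. b i j z * z (Some None) ^ j)) \<and> (\<forall>j>n2 i. \<forall>z. b i j z = 0)"
		by (rule choice[THEN exE])
	then have b: "\<And>i j. polyfun (b i j)" "\<And>i j z w. b i j (z(Some None := w)) = b i j z"
		"\<And>i z. a i z = (\<Sum>j\<le>n2 i. b i j z * z (Some None) ^ j)" "\<And>i j z. n2 i < j ==> b i j z = 0" by auto
	\<comment> \<open>N dominates both degrees of the relation. The successor ensures N \<ge> 1, so
	  that 1 and u are among the monomials.\<close>
	define N where "N = Suc (n1 + (\<Sum>i\<le>n1. n2 i))"
	have n2N: "n2 i \<le> N" if "i \<le> n1" for i using member_le_sum[of i "{..n1}" n2] that by (simp add: N_def)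
	\<comment> \<open>The coefficients do not involve the two plane variables, so these may be set to
	  0.\<close>
	define reset where "reset \<omega> w = (case w of Some (Some s) => \<omega> s | _ => 0)"
		for \<omega> :: "('m, 'd) slot + ('m + 'm) => complex" and w :: "(('m, 'd) slot + ('m + 'm)) option option"
	define B where "B i j \<omega> = (if i \<le> n1 then b i j (reset \<omega>) else 0)" for i j \<omega>
	have B: "polyfun (B i j)" for i j
	proof -
		have "polyfun (\<lambda>\<omega>. b i j (\<lambda>w. reset \<omega> w))"
		proof (rule polyfun_compose[OF b(1)])
			show "polyfun (\<lambda>\<omega>. reset \<omega> w)" for w
				by (cases w; cases "the w") (simp_all add: reset_def polyfun.const polyfun.var)
		qed
		then show ?thesis by (cases "i \<le> n1") (simp_all add: B_def[abs_def] polyfun.const)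
	qed
	have PB: "P z = (\<Sum>i\<le>N. \<Sum>j\<le>N. B i j (\<lambda>s. z (Some (Some s))) * (z None ^ i * z (Some None) ^ j))" for z
	proof -
		let ?z = "z(None := 0)"
		have re: "reset (\<lambda>s. z (Some (Some s))) = ?z(Some None := 0)"
			by (auto simp: fun_eq_iff reset_def split: option.split)
		have "a i z = (\<Sum>j\<le>N. B i j (\<lambda>s. z (Some (Some s))) * z (Some None) ^ j)" if "i \<le> n1" for i
		proof -
			have "a i z = a i ?z" by (simp only: a(2))
			also have "\<dots> = (\<Sum>j\<le>n2 i. b i j ?z * ?z (Some None) ^ j)" by (rule b(3))
			also have "\<dots> = (\<Sum>j\<le>N. b i j ?z * z (Some None) ^ j)"
				by (rule sum.mono_neutral_cong_left) (use n2N[OF that] b(4) in auto)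
			also have "\<dots> = (\<Sum>j\<le>N. B i j (\<lambda>s. z (Some (Some s))) * z (Some None) ^ j)"
				using that by (simp only: B_def re b(2) if_True)
			finally show ?thesis .
		qed
		then have "P z = (\<Sum>i\<le>n1. (\<Sum>j\<le>N. B i j (\<lambda>s. z (Some (Some s))) * z (Some None) ^ j) * z None ^ i)"
			unfolding a(3) by (intro sum.cong) auto
		also have "\<dots> = (\<Sum>i\<le>N. (\<Sum>j\<le>N. B i j (\<lambda>s. z (Some (Some s))) * z (Some None) ^ j) * z None ^ i)"
			by (rule sum.mono_neutral_left) (auto simp: N_def B_def)
		also have "\<dots> = (\<Sum>i\<le>N. \<Sum>j\<le>N. B i j (\<lambda>s. z (Some (Some s))) * (z None ^ i * z (Some None) ^ j))"
			unfolding sum_distrib_right by (intro sum.cong refl) (simp add: mult_ac)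
		finally show ?thesis .
	qed
	have "\<exists>i0 j0. i0 \<le> N \<and> j0 \<le> N \<and> B i0 j0 (\<lambda>s. \<omega>' (Some (Some s))) \<noteq> 0"
	proof (rule ccontr)
		assume *: "\<not> ?thesis"
		have "B i j (\<lambda>s. \<omega>' (Some (Some s))) = 0" if "i \<le> N" "j \<le> N" for i j using that * by simp
		then have "P \<omega>' = 0" unfolding PB by (intro sum.neutral ballI) simp
		then show False using P2 by simp
	qed
	then obtain i0 j0 where ij: "i0 \<le> N" "j0 \<le> N" "B i0 j0 (\<lambda>s. \<omega>' (Some (Some s))) \<noteq> 0" by blast
	define \<omega> where "\<omega> s = \<omega>' (Some (Some s))" for s
	\<comment> \<open>One coefficient that is not identically zero, with its form coefficients frozen:
	  where it is nonzero, the relation is nontrivial for at least one projection.\<close>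
	define p where "p \<zeta> = B i0 j0 (\<lambda>s. case s of Inl s => \<zeta> s | Inr b => \<omega> (Inr b))" for \<zeta>
	have p: "polyfun p" unfolding p_def[abs_def]
		by (rule polyfun_compose[OF B], rename_tac v, case_tac v) (simp_all add: polyfun.const polyfun.var)
	have p0: "p (\<lambda>s. \<omega> (Inl s)) \<noteq> 0"
	proof -
		have eq: "(\<lambda>s. case s of Inl s => \<omega> (Inl s) | Inr b => \<omega> (Inr b)) = (\<lambda>s. \<omega>' (Some (Some s)))"
			by (auto simp: fun_eq_iff \<omega>_def split: sum.split)
		show ?thesis using ij(3) unfolding p_def eq .
	qed
	have "\<not> indep ({..N} \<times> {..N}) (\<lambda>a. plane_monom (path_x D) a \<theta>)"
		if D: "admissible D" and pD: "p (entries D) \<noteq> 0" for D :: "('m, 'd) qp" and \<theta>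
	proof
		define \<gamma> where "\<gamma> i j \<theta> = B i j (\<lambda>s. case s of Inl s => entries D s | Inr b => \<theta> b)" for i j \<theta>
		have \<gamma>: "polyfun (\<gamma> i j)" for i j unfolding \<gamma>_def[abs_def]
			by (rule polyfun_compose[OF B], rename_tac v, case_tac v) (simp_all add: polyfun.const polyfun.var)
		have rel: "(\<Sum>i\<le>N. \<Sum>j\<le>N. \<gamma> i j \<theta> * plane_monom (path_x D) (i, j) \<theta> t) = 0" for \<theta> t
		proof -
			let ?z = "\<lambda>v. case v of Inl v => path_coords D (exp t) v | Inr b => \<theta> b"
			have "qq ?z \<noteq> 0" using program_at_path(2)[OF D, of "exp t"] by (simp add: qq_def)
			from P0[OF this] have "P (\<lambda>i. f i ?z) = 0" .
			moreover have "xx ?z = path_x D t" by (auto simp: fun_eq_iff xx_def path_x_def path_coords_def)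
			moreover have "(\<lambda>s. f (Some (Some s)) ?z) = (\<lambda>s. case s of Inl s => entries D s | Inr b => \<theta> b)"
				using program_at_path(1)[OF D, of "exp t"] by (auto simp: fun_eq_iff f_def split: sum.split)
			ultimately show ?thesis unfolding PB by (simp add: f_def plane_monom_def \<gamma>_def)
		qed
		assume ind: "indep ({..N} \<times> {..N}) (\<lambda>a. plane_monom (path_x D) a \<theta>)"
		\<comment> \<open>At \<theta> itself all coefficients of the relation might vanish. Independence
		  is open in \<theta>, however, so it would persist at a \<theta>' where the chosen coefficient is
		  nonzero.\<close>
		from indep_certificate[where f = "\<lambda>a \<theta> t. plane_monom (path_x D) a \<theta> t" and A = "{..N} \<times> {..N}" and ?\<theta>0.0 = \<theta>,
				OF _ polyfun_plane_monom ind]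
		obtain p1 where p1: "polyfun p1" "p1 \<theta> \<noteq> 0"
			"\<And>\<theta>. p1 \<theta> \<noteq> 0 ==> indep ({..N} \<times> {..N}) (\<lambda>a. plane_monom (path_x D) a \<theta>)" by auto
		have "\<gamma> i0 j0 (\<lambda>b. \<omega> (Inr b)) \<noteq> 0" using pD by (simp add: \<gamma>_def p_def)
		from polyfun_mult_nonzero[of p1 "\<gamma> i0 j0" \<theta> "\<lambda>b. \<omega> (Inr b)", OF p1(1) \<gamma> p1(2) this]
		obtain \<theta>' where \<theta>': "p1 \<theta>' * \<gamma> i0 j0 \<theta>' \<noteq> 0" by (rule exE)
		then have "p1 \<theta>' \<noteq> 0" by simp
		have "\<gamma> (fst (i0, j0)) (snd (i0, j0)) \<theta>' = 0"
		proof (rule indepD[OF p1(3)[OF \<open>p1 \<theta>' \<noteq> 0\<close>], where c = "\<lambda>a. \<gamma> (fst a) (snd a) \<theta>'"])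
			fix t
			show "(\<Sum>a\<in>{..N} \<times> {..N}. \<gamma> (fst a) (snd a) \<theta>' * plane_monom (path_x D) a \<theta>' t) = 0"
				using rel[where \<theta> = \<theta>' and t = t] by (simp add: sum.cartesian_product split_def)
		qed (use ij in auto)
		then show False using \<theta>' by simp
	qed
	then show ?thesis using p p0 by (intro exI[of _ N] exI[of _ p] conjI) (auto simp: N_def)
qed

section \<open>The degree of the central curve\<close>

lemma zariski_closure_polyfun:
	fixes X :: "('v => complex) set"
	shows "z \<in> zariski_closure X \<longleftrightarrow> (\<forall>q. polyfun q --> (\<forall>s\<in>X. q s = 0) --> q z = 0)"
proof
	assume z: "z \<in> zariski_closure X"
	show "\<forall>q. polyfun q --> (\<forall>s\<in>X. q s = 0) --> q z = 0"
	proof (intro allI impI)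
		fix q :: "('v => complex) => complex" assume q: "polyfun q" "\<forall>s\<in>X. q s = 0"
		obtain P where P: "\<forall>z. eval_mpoly P z = q z" using polyfun_imp_mpoly[OF q(1)] by (rule exE)
		then have "\<forall>s\<in>X. eval_mpoly P s = 0" using q(2) by simp
		then have "eval_mpoly P z = 0" using z unfolding zariski_closure_def zero_locus_def by blast
		then show "q z = 0" using P by simp
	qed
next
	assume *: "\<forall>q. polyfun q --> (\<forall>s\<in>X. q s = 0) --> q z = 0"
	show "z \<in> zariski_closure X" unfolding zariski_closure_def zero_locus_def
	proof (intro CollectI ballI)
		fix P assume "P \<in> {p. \<forall>s\<in>X. eval_mpoly p s = 0}"
		then show "eval_mpoly P z = 0" using *[THEN spec, of "eval_mpoly P"] polyfun_eval_mpoly[of P] by simp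
	qed
qed

lemma hyperplane_coords_surj: "hyperplane_coords ((\<chi> i. \<zeta> (Some i)), \<zeta> None) = \<zeta>"
	by (auto simp: fun_eq_iff hyperplane_coords_def split: option.split)

lemma has_degreeI:
	fixes C :: "(complex^'n) set"
	assumes p: "polyfun p" "p \<zeta>0 \<noteq> 0"
		and n: "\<And>h. p (hyperplane_coords h) \<noteq> 0 ==> finite (C \<inter> affine_hyperplane h) \<and> card (C \<inter> affine_hyperplane h) = n"
	shows "has_degree C n"
proof -
	obtain P where P: "\<forall>z. eval_mpoly P z = p z" using polyfun_imp_mpoly[OF p(1)] by (rule exE)
	define i0 :: 'n where "i0 = undefined"
	from polyfun_mult_nonzero[of p "\<lambda>\<zeta>. \<zeta> (Some i0)" \<zeta>0 "\<lambda>_. 1", OF p(1) polyfun.var p(2)]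
	obtain \<zeta> where \<zeta>: "p \<zeta> * \<zeta> (Some i0) \<noteq> 0" by auto
	define h where "h = ((\<chi> i. \<zeta> (Some i)) :: complex^'n, \<zeta> None)"
	have h: "hyperplane_coords h = \<zeta>" unfolding h_def by (rule hyperplane_coords_surj)
	have "fst h $ i0 \<noteq> 0" using \<zeta> by (simp add: h_def)
	then have "fst h \<noteq> 0" by auto
	have loc: "z \<notin> zero_locus {P} \<longleftrightarrow> p z \<noteq> 0" for z using P by (simp add: zero_locus_def)
	show ?thesis unfolding has_degree_def generically_on_def
	proof (intro exI[of _ "{P}"] conjI bexI[of _ h] ballI impI)
		show "hyperplane_coords h \<notin> zero_locus {P}" using \<zeta> unfolding loc h by simp
		show "h \<in> {h. fst h \<noteq> 0}" using \<open>fst h \<noteq> 0\<close> by simp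
	qed (use n loc in blast)+
qed

lemma has_degreeD:
	fixes C :: "(complex^'n) set"
	assumes "has_degree C n"
	shows "\<exists>p. polyfun p \<and> (\<exists>\<zeta>. p \<zeta> \<noteq> 0) \<and>
		(\<forall>h. fst h \<noteq> 0 --> p (hyperplane_coords h) \<noteq> 0 --> card (C \<inter> affine_hyperplane h) = n)"
proof -
	obtain F u where F: "hyperplane_coords u \<notin> zero_locus F"
		"\<And>h. fst h \<noteq> 0 ==> hyperplane_coords h \<notin> zero_locus F ==> card (C \<inter> affine_hyperplane h) = n"
		using assms unfolding has_degree_def generically_on_def by blast
	then obtain P where P: "P \<in> F" "eval_mpoly P (hyperplane_coords u) \<noteq> 0" by (auto simp: zero_locus_def)
	have "card (C \<inter> affine_hyperplane h) = n" if "fst h \<noteq> 0" "eval_mpoly P (hyperplane_coords h) \<noteq> 0" for h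
		by (rule F(2)[OF that(1)]) (use that(2) P(1) in \<open>auto simp: zero_locus_def\<close>)
	then show ?thesis using polyfun_eval_mpoly[of P] P(2) by (intro exI[of _ "eval_mpoly P"]) auto
qed

lemma has_degree_unique:
	fixes C :: "(complex^'n) set"
	assumes "has_degree C n" "has_degree C n'"
	shows "n = n'"
proof -
	obtain p \<zeta> where p: "polyfun p" "p \<zeta> \<noteq> 0"
		"\<forall>h. fst h \<noteq> 0 --> p (hyperplane_coords h) \<noteq> 0 --> card (C \<inter> affine_hyperplane h) = n"
		using has_degreeD[OF assms(1)] by auto
	obtain p' \<zeta>' where p': "polyfun p'" "p' \<zeta>' \<noteq> 0"
		"\<forall>h. fst h \<noteq> 0 --> p' (hyperplane_coords h) \<noteq> 0 --> card (C \<inter> affine_hyperplane h) = n'"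
		using has_degreeD[OF assms(2)] by auto
	from polyfun_mult_nonzero[of p p' \<zeta> \<zeta>', OF p(1) p'(1) p(2) p'(2)]
	obtain \<zeta>1 where \<zeta>1: "p \<zeta>1 * p' \<zeta>1 \<noteq> 0" by (rule exE)
	define i0 :: 'n where "i0 = undefined"
	from polyfun_mult_nonzero[of "\<lambda>z. p z * p' z" "\<lambda>\<zeta>. \<zeta> (Some i0)" \<zeta>1 "\<lambda>_. 1",
			OF polyfun.mult[OF p(1) p'(1)] polyfun.var \<zeta>1]
	obtain z where z: "p z * p' z * z (Some i0) \<noteq> 0" by auto
	define h where "h = ((\<chi> i. z (Some i)) :: complex^'n, z None)"
	have h: "hyperplane_coords h = z" unfolding h_def by (rule hyperplane_coords_surj)
	have "fst h $ i0 \<noteq> 0" using z by (simp add: h_def)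
	then have "fst h \<noteq> 0" by auto
	then have "card (C \<inter> affine_hyperplane h) = n" "card (C \<inter> affine_hyperplane h) = n'"
		using p(3)[rule_format, of h] p'(3)[rule_format, of h] z by (simp_all add: h)
	then show ?thesis by simp
qed

lemma central_path_points:
	"{complex_point (central_path D \<tau>) |\<tau>. 0 < \<tau>} = range (\<lambda>t. case_sum (path_x D t) (path_y D t))"
	unfolding complex_point_path[symmetric]
proof (intro equalityI subsetI)
	fix z assume "z \<in> {complex_point (central_path D \<tau>) |\<tau>. 0 < \<tau>}"
	then obtain \<tau> where "0 < \<tau>" "z = complex_point (central_path D \<tau>)" by blast
	then have "z = complex_point (central_path D (exp (ln \<tau>)))" by simp
	then show "z \<in> range (\<lambda>t. complex_point (central_path D (exp t)))" by blast
next
	fix z assume "z \<in> range (\<lambda>t. complex_point (central_path D (exp t)))"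
	then obtain t where "z = complex_point (central_path D (exp t))" by blast
	then show "z \<in> {complex_point (central_path D \<tau>) |\<tau>. 0 < \<tau>}" using exp_gt_zero[of t] by blast
qed

definition closure_section :: "('m::finite, 'd::finite) qp => ('m option => complex) => ('m => complex) set" where
	"closure_section D \<zeta> = {x0. (\<exists>y0. \<forall>q. polyfun q --> (\<forall>t. q (case_sum (path_x D t) (path_y D t)) = 0) -->
			q (case_sum x0 y0) = 0) \<and> lin (\<lambda>i. \<zeta> (Some i)) x0 = \<zeta> None}"

lemma central_curve_section:
	"central_curve D \<inter> affine_hyperplane h = (\<lambda>x0. \<chi> i. x0 i) ` closure_section D (hyperplane_coords h)"
proof -
	have cl: "z \<in> zariski_closure {complex_point (central_path D \<tau>) |\<tau>. 0 < \<tau>} \<longleftrightarrow>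
			(\<forall>q. polyfun q --> (\<forall>t. q (case_sum (path_x D t) (path_y D t)) = 0) --> q z = 0)" for z
		unfolding central_path_points zariski_closure_polyfun by simp
	have hp: "(\<chi> i. x0 i) \<in> affine_hyperplane h \<longleftrightarrow>
			lin (\<lambda>i. hyperplane_coords h (Some i)) x0 = hyperplane_coords h None" for x0
		by (simp add: affine_hyperplane_def hyperplane_coords_def lin_def)
	have "central_curve D = (\<lambda>x0. \<chi> i. x0 i) ` {x0. \<exists>y0. \<forall>q. polyfun q -->
			(\<forall>t. q (case_sum (path_x D t) (path_y D t)) = 0) --> q (case_sum x0 y0) = 0}"
	proof (intro equalityI subsetI)
		fix x assume "x \<in> central_curve D"
		then obtain z where z: "x = (\<chi> i. z (Inl i))" "\<forall>q. polyfun q -->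
				(\<forall>t. q (case_sum (path_x D t) (path_y D t)) = 0) --> q z = 0"
			unfolding central_curve_def image_iff Bex_def cl by auto
		have "case_sum (\<lambda>i. z (Inl i)) (\<lambda>k. z (Inr k)) = z" by (auto simp: fun_eq_iff split: sum.split)
		then have "\<forall>q. polyfun q --> (\<forall>t. q (case_sum (path_x D t) (path_y D t)) = 0) -->
				q (case_sum (\<lambda>i. z (Inl i)) (\<lambda>k. z (Inr k))) = 0" using z(2) by simp
		then show "x \<in> (\<lambda>x0. \<chi> i. x0 i) ` {x0. \<exists>y0. \<forall>q. polyfun q -->
			(\<forall>t. q (case_sum (path_x D t) (path_y D t)) = 0) --> q (case_sum x0 y0) = 0}"
			unfolding z(1) by (intro imageI CollectI exI)
	next
		fix x assume "x \<in> (\<lambda>x0. \<chi> i. x0 i) ` {x0. \<exists>y0. \<forall>q. polyfun q -->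
			(\<forall>t. q (case_sum (path_x D t) (path_y D t)) = 0) --> q (case_sum x0 y0) = 0}"
		then obtain x0 y0 where *: "x = (\<chi> i. x0 i)" "\<forall>q. polyfun q -->
			(\<forall>t. q (case_sum (path_x D t) (path_y D t)) = 0) --> q (case_sum x0 y0) = 0" by auto
		have "case_sum x0 y0 \<in> zariski_closure {complex_point (central_path D \<tau>) |\<tau>. 0 < \<tau>}"
			unfolding cl by (rule *(2))
		from imageI[OF this, of "\<lambda>z. \<chi> i. z (Inl i)"] show "x \<in> central_curve D"
			unfolding central_curve_def *(1) by simp
	qed
	then show ?thesis unfolding closure_section_def using hp by auto
qed

text \<open>The projected curve then contains at most the single point x0, which a generic
  hyperplane misses.\<close>

lemma has_degree_constant_path:
	fixes D :: "('m::finite, 'd::finite) qp"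
	assumes "\<And>t. path_x D t = x0"
	shows "has_degree (central_curve D) 0"
proof (rule has_degreeI[where p = "\<lambda>\<zeta>. (\<Sum>i\<in>UNIV. \<zeta> (Some i) * x0 i) - \<zeta> None" and ?\<zeta>0.0 = "\<lambda>i. if i = None then 1 else 0"])
	show "polyfun (\<lambda>\<zeta>. (\<Sum>i\<in>UNIV. \<zeta> (Some i) * x0 i) - \<zeta> None)" by (intro polyfun_intros)
	fix h :: "(complex^'m) \<times> complex"
	assume h: "(\<Sum>i\<in>UNIV. hyperplane_coords h (Some i) * x0 i) - hyperplane_coords h None \<noteq> 0"
	have "closure_section D (hyperplane_coords h) = {}"
	proof (rule equals0I)
		fix x assume "x \<in> closure_section D (hyperplane_coords h)"
		then obtain y where y: "\<And>q. polyfun q ==> (\<And>t. q (case_sum (path_x D t) (path_y D t)) = 0) ==> q (case_sum x y) = 0"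
			and l: "lin (\<lambda>i. hyperplane_coords h (Some i)) x = hyperplane_coords h None"
			unfolding closure_section_def by auto
		have "x i - x0 i = 0" for i
			using y[of "\<lambda>z. z (Inl i) - x0 i"] assms by (simp add: polyfun_diff polyfun.intros)
		then have "x = x0" by auto
		then show False using l h by (simp add: lin_def)
	qed
	then show "finite (central_curve D \<inter> affine_hyperplane h) \<and> card (central_curve D \<inter> affine_hyperplane h) = 0"
		unfolding central_curve_section by simp
qed simp

lemma path_equations:
	fixes D :: "('m::finite, 'd::finite) qp"
	assumes "admissible D"
	shows "(\<forall>i. path_x D t i * (entries D (slotc i) + (\<Sum>j\<in>UNIV. entries D (slotQ i j) * path_x D t j) -
			(\<Sum>k\<in>UNIV. entries D (slotA k i) * path_y D t k)) = of_real (exp t)) \<and>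
		(\<forall>k. (\<Sum>i\<in>UNIV. entries D (slotA k i) * path_x D t i) = entries D (slotb k))"
proof -
	obtain Q c A b where D: "D = (Q, c, A, b)" by (cases D)
	obtain x y where xy: "central_path D (exp t) = (x, y)" by (cases "central_path D (exp t)")
	have sym: "transpose Q = Q" using assms D admissible_symmetric by blast
	have "kkt (Q, c, A, b) (exp t) (x, y)" using admissible_kkt[OF assms, of "exp t"] xy D by simp
	then have s: "x $ i * (c $ i + (\<Sum>j\<in>UNIV. Q $ i $ j * x $ j) - (\<Sum>k\<in>UNIV. A $ k $ i * y $ k)) = exp t"
		and Ax: "(\<Sum>i\<in>UNIV. A $ k $ i * x $ i) = b $ k" for i k unfolding kkt_iff[OF sym] by blast+
	have e: "entries D (slotQ i j) = of_real (Q $ i $ j)" "entries D (slotA k i) = of_real (A $ k $ i)"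
		"entries D (slotc i) = of_real (c $ i)" "entries D (slotb k) = of_real (b $ k)" for i j k
		unfolding D slot_entry_Q[OF sym] by simp_all
	have p: "path_x D t i = of_real (x $ i)" "path_y D t k = of_real (y $ k)" for i k
		by (simp_all add: path_x_def path_y_def xy)
	show ?thesis
		unfolding e p using s Ax by (simp flip: of_real_mult of_real_sum of_real_add of_real_diff)
qed

text \<open>The difference of the reciprocals would lie in the row space and x - x' in the kernel,
  so they are orthogonal; but every summand (1/a - 1/b) (a - b) is at most 0, with equality only for
  a = b.\<close>

lemma path_reciprocal_not_in_rowspace:
	fixes A :: "real^'m^'d"
	assumes "A *v x = A *v x'" "\<And>i. 0 < x $ i" "\<And>i. 0 < x' $ i"
		and "\<And>i. 1 / x $ i = (z v* A) $ i" "\<And>i. 1 / x' $ i = (z' v* A) $ i"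
	shows "x = x'"
proof -
	have zz: "(z v* A - z' v* A) \<bullet> (x - x') = 0"
		unfolding inner_diff_left dot_lmul_matrix using assms(1) by (simp add: matrix_vector_mult_diff_distrib)
	have t: "(1 / x $ i - 1 / x' $ i) * (x $ i - x' $ i) = - ((x $ i - x' $ i)\<^sup>2 / (x $ i * x' $ i))" for i
	proof -
		have "x $ i \<noteq> 0" "x' $ i \<noteq> 0" using assms(2,3)[of i] by auto
		then show ?thesis by (simp add: field_simps power2_eq_square)
	qed
	have "(\<Sum>i\<in>UNIV. (x $ i - x' $ i)\<^sup>2 / (x $ i * x' $ i)) = 0"
	proof -
		have "(\<Sum>i\<in>UNIV. - ((x $ i - x' $ i)\<^sup>2 / (x $ i * x' $ i))) = 0"
			using zz unfolding inner_vec_def vector_minus_component assms(4,5)[symmetric] inner_real_def t .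
		then show ?thesis by (simp add: sum_negf)
	qed
	then have "(x $ i - x' $ i)\<^sup>2 / (x $ i * x' $ i) = 0" for i
		by (subst (asm) sum_nonneg_eq_0_iff) (auto simp: assms(2,3) less_imp_le)
	then have "x $ i = x' $ i" for i using assms(2,3)[of i] by (metis divide_eq_0_iff less_numeral_extra(3) mult_eq_0_iff power_eq_0_iff eq_iff_diff_eq_0)
	then show ?thesis by (simp add: vec_eq_iff)
qed

text \<open>The equations \<open>x\<^sub>i (A\<^sup>t y)\<^sub>i + \<tau> = x\<^sub>i (Q x + c)\<^sub>i\<close> are linear in \<open>(y, \<tau>)\<close> and, as \<open>x\<close> is not
	constant, determine them at some point; the normal equations express \<open>y\<close> as a rational function of \<open>x\<close>.\<close>

lemma path_y_rational:
	fixes D :: "('m::finite, 'd::finite) qp"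
	assumes adm: "admissible D" and nc: "path_x D t1 \<noteq> path_x D t2"
	shows "\<exists>e Y. polyfun e \<and> (\<exists>t. e (path_x D t) \<noteq> 0) \<and> (\<forall>k. polyfun (Y k)) \<and>
		(\<forall>k t. e (path_x D t) * path_y D t k = Y k (path_x D t))"
proof -
	define M :: "('m => complex) => complex^('d option)^'m" where
		"M x = (\<chi> i r. case r of None => 1 | Some k => x i * entries D (slotA k i))" for x
	define w where "w x i = entries D (slotc i) + (\<Sum>j\<in>UNIV. entries D (slotQ i j) * x j)" for x i
	\<comment> \<open>The Gram matrix without conjugation, which keeps its entries polynomial in x. At
	  the real points of the path its singularity still yields a kernel vector of M.\<close>
	define G where "G x = transpose (M x) ** M x" for x
	define v where "v x = transpose (M x) *v (\<chi> i. x i * w x i)" for x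
	define Y where "Y k x = det (\<chi> i j. if j = Some k then v x $ i else G x $ i $ j)" for k x
	have pM: "polyfun (\<lambda>x. M x $ i $ r)" for i r by (cases r) (auto simp: M_def intro: polyfun_intros)
	have pG: "polyfun (\<lambda>x. G x $ i $ j)" for i j
		unfolding G_def matrix_matrix_mult_def transpose_def vec_lambda_beta by (intro polyfun_intros pM)
	have pw: "polyfun (\<lambda>x. w x i)" for i unfolding w_def by (intro polyfun_intros)
	have pv: "polyfun (\<lambda>x. v x $ i)" for i
		unfolding v_def matrix_vector_mult_def transpose_def vec_lambda_beta by (intro polyfun_intros pM pw)
	have pY: "polyfun (Y k)" for k
	proof -
		have "polyfun (\<lambda>x. (\<chi> i j. if j = Some k then v x $ i else G x $ i $ j) $ i $ j)" for i j
			by (cases "j = Some k") (simp_all add: pv pG)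
		then show ?thesis unfolding Y_def[abs_def] by (rule polyfun_det)
	qed
	have eq: "det (G (path_x D t)) * path_y D t k = Y k (path_x D t)" for k t
	proof -
		define u :: "complex^('d option)" where
			"u = (\<chi> r. case r of None => of_real (exp t) | Some k => path_y D t k)"
		have "(M (path_x D t) *v u) $ i = path_x D t i * w (path_x D t) i" for i
		proof -
			have "(M (path_x D t) *v u) $ i = of_real (exp t) + path_x D t i * (\<Sum>k\<in>UNIV. entries D (slotA k i) * path_y D t k)"
				by (simp add: matrix_vector_mult_def M_def u_def sum_UNIV_option sum_distrib_left mult.assoc)
			also have "of_real (exp t) = path_x D t i * (entries D (slotc i) + (\<Sum>j\<in>UNIV. entries D (slotQ i j) * path_x D t j) -
					(\<Sum>k\<in>UNIV. entries D (slotA k i) * path_y D t k))" using path_equations[OF adm, of t] by simp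
			finally show ?thesis by (simp add: w_def algebra_simps)
		qed
		then have "M (path_x D t) *v u = (\<chi> i. path_x D t i * w (path_x D t) i)" by (simp add: vec_eq_iff)
		then have "G (path_x D t) *v u = v (path_x D t)"
			by (simp only: G_def v_def matrix_vector_mul_assoc[symmetric])
		from cramer_lemma[of "Some k" "G (path_x D t)" u, unfolded this]
		have "Y k (path_x D t) = u $ Some k * det (G (path_x D t))" unfolding Y_def .
		then show ?thesis by (simp add: u_def)
	qed
	have "\<exists>t. det (G (path_x D t)) \<noteq> 0"
	proof (rule ccontr)
		assume "\<not> ?thesis"
		\<comment> \<open>A singular Gram matrix at every t would put the vector of reciprocals 1 / x_i
		  into the row space of A at every point of the path, which is impossible at two points with
		  different x.\<close>
		then have dz: "det (G (path_x D t)) = 0" for t by simp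
		obtain Q c A b where D: "D = (Q, c, A, b)" by (cases D)
		have sym: "transpose Q = Q" and rank: "rank A = CARD('d)"
			using adm D admissible_symmetric by (auto simp: admissible_def)
		define X where "X t = fst (central_path D (exp t))" for t
		have kkt: "kkt (Q, c, A, b) (exp t) (X t, snd (central_path D (exp t)))" for t
			using admissible_kkt[OF adm, of "exp t"] D by (simp add: X_def)
		have Xpos: "0 < X t $ i" and AX: "A *v X t = b" for t i using kkt[of t] by simp_all
		have "\<exists>z. \<forall>i. 1 / X t $ i = (z v* A) $ i" for t
		proof -
			define R :: "real^('d option)^'m" where
				"R = (\<chi> i r. case r of None => 1 | Some k => X t $ i * A $ k $ i)"
			have "M (path_x D t) $ i $ r = of_real (R $ i $ r)" for i r
				by (cases r) (simp_all add: M_def R_def path_x_def X_def D)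
			then have "G (path_x D t) = (\<chi> r s. of_real ((transpose R ** R) $ r $ s))"
				by (simp add: vec_eq_iff G_def matrix_matrix_mult_def transpose_def)
			then have "det (transpose R ** R) = 0"
				using dz[of t] det_of_real_matrix[of "transpose R ** R"] by simp
			then obtain u where u: "(transpose R ** R) *v u = 0" "u \<noteq> 0" using det_nonzero_iff by blast
			have "(R *v u) \<bullet> (R *v u) = ((R *v u) v* R) \<bullet> u" by (simp only: dot_lmul_matrix)
			also have "(R *v u) v* R = 0" using u(1) by (simp only: matrix_vector_mul_assoc[symmetric] transpose_matrix_vector)
			finally have "R *v u = 0" by simp
			then have Ru: "u $ None + X t $ i * (\<Sum>k\<in>UNIV. A $ k $ i * u $ Some k) = 0" for i
			proof -
				have "(R *v u) $ i = u $ None + X t $ i * (\<Sum>k\<in>UNIV. A $ k $ i * u $ Some k)"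
					by (simp add: matrix_vector_mult_def R_def sum_UNIV_option sum_distrib_left mult.assoc)
				then show ?thesis using \<open>R *v u = 0\<close> by simp
			qed
			have vA: "(z v* A) $ i = (\<Sum>k\<in>UNIV. A $ k $ i * z $ k)" for z i
				by (simp add: vector_matrix_mult_def mult.commute)
			have "u $ None \<noteq> 0"
			proof
				assume 0: "u $ None = 0"
				have "((\<chi> k. u $ Some k) v* A) $ i = 0" for i
				proof -
					have "X t $ i * (\<Sum>k\<in>UNIV. A $ k $ i * u $ Some k) = 0" using Ru[of i] 0 by simp
					then show ?thesis using Xpos[of t i] unfolding vA by simp
				qed
				then have "(\<chi> k. u $ Some k) v* A = 0" by (simp add: vec_eq_iff)
				from full_rank_lmult_inj[OF rank this] have "u $ Some k = 0" for k by (simp add: vec_eq_iff)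
				then have "u $ r = 0" for r using 0 by (cases r) simp_all
				then show False using u(2) by (simp add: vec_eq_iff)
			qed
			show ?thesis
			proof (intro exI[of _ "\<chi> k. - (u $ Some k) / u $ None"] allI)
				fix i
				have "((\<chi> k. - (u $ Some k) / u $ None) v* A) $ i = - (\<Sum>k\<in>UNIV. A $ k $ i * u $ Some k) / u $ None"
					unfolding vA by (simp add: sum_negf sum_divide_distrib)
				also have "\<dots> = 1 / X t $ i"
				proof -
					have "- (\<Sum>k\<in>UNIV. A $ k $ i * u $ Some k) * X t $ i = u $ None" using Ru[of i] by (simp add: mult.commute)
					moreover have "X t $ i \<noteq> 0" using Xpos[of t i] by simp
					ultimately show ?thesis using \<open>u $ None \<noteq> 0\<close> by (simp only: frac_eq_eq mult_1_left not_False_eq_True)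
				qed
				finally show "1 / X t $ i = ((\<chi> k. - (u $ Some k) / u $ None) v* A) $ i" by simp
			qed
		qed
		then obtain z1 z2 where "\<And>i. 1 / X t1 $ i = (z1 v* A) $ i" "\<And>i. 1 / X t2 $ i = (z2 v* A) $ i" by meson
		from path_reciprocal_not_in_rowspace[OF _ Xpos Xpos this] have "X t1 = X t2" by (simp add: AX)
		then show False using nc by (auto simp: path_x_def X_def fun_eq_iff)
	qed
	moreover have "polyfun (\<lambda>x. det (G x))" by (intro polyfun_det pG)
	ultimately show ?thesis using pY eq by (intro exI[of _ "\<lambda>x. det (G x)"] exI[of _ Y]) auto
qed

lemma prime_curve_path:
	fixes D :: "('m::finite, 'd::finite) qp"
	assumes adm: "admissible D" and nc: "path_x D t1 \<noteq> path_x D t2"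
		and dep: "\<And>\<theta>. \<not> indep ({..N} \<times> {..N}) (\<lambda>a. plane_monom (path_x D) a \<theta>)"
	shows "prime_curve (path_x D) N"
proof
	fix p q :: "('m => complex) => complex"
	assume pq: "polyfun p" "polyfun q" "\<And>t. p (path_x D t) * q (path_x D t) = 0"
	let ?x = "\<lambda>\<tau> i. complex_point (central_path D \<tau>) (Inl i)"
	have x: "?x (exp t) = path_x D t" for t by (auto simp: complex_point_path)
	have an: "real_analytic (\<lambda>\<tau>. f (?x \<tau>))" if "polyfun f" for f
		by (rule real_analytic_polyfun[OF that]) (rule real_analytic_path[OF adm])
	have "p (?x \<tau>) * q (?x \<tau>) = 0" if "\<tau> > 0" for \<tau> using pq(3)[of "ln \<tau>"] x[of "ln \<tau>"] that by simp
	from real_analytic_prime[OF an[OF pq(1)] an[OF pq(2)] this]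
	show "(\<forall>t. p (path_x D t) = 0) \<or> (\<forall>t. q (path_x D t) = 0)" unfolding x[symmetric] by auto
qed (use nc dep in blast)+

lemma has_degree_curve_degree:
	fixes D :: "('m::finite, 'd::finite) qp"
	assumes adm: "admissible D" and nc: "path_x D t1 \<noteq> path_x D t2" and pc: "prime_curve (path_x D) N"
	shows "has_degree (central_curve D) (prime_curve.curve_degree (path_x D) N)"
		and "\<exists>p. polyfun p \<and> (\<exists>\<zeta>. p \<zeta> \<noteq> 0) \<and> (\<forall>\<zeta>. p \<zeta> \<noteq> 0 -->
			finite (closure_section D \<zeta>) \<and> card (closure_section D \<zeta>) = prime_curve.curve_degree (path_x D) N)"
proof -
	obtain e Y where e: "polyfun e" "\<exists>t. e (path_x D t) \<noteq> 0" and Y: "\<And>k. polyfun (Y k)"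
		"\<And>k t. e (path_x D t) * path_y D t k = Y k (path_x D t)" using path_y_rational[OF adm nc] by auto
	show *: "\<exists>p. polyfun p \<and> (\<exists>\<zeta>. p \<zeta> \<noteq> 0) \<and> (\<forall>\<zeta>. p \<zeta> \<noteq> 0 -->
			finite (closure_section D \<zeta>) \<and> card (closure_section D \<zeta>) = prime_curve.curve_degree (path_x D) N)"
		unfolding closure_section_def by (rule prime_curve.curve_degree_count[OF pc e Y])
	obtain p \<zeta>0 where p: "polyfun p" "p \<zeta>0 \<noteq> 0" "\<forall>\<zeta>. p \<zeta> \<noteq> 0 -->
			finite (closure_section D \<zeta>) \<and> card (closure_section D \<zeta>) = prime_curve.curve_degree (path_x D) N"
		using * by auto
	have inj: "inj_on (\<lambda>x0. \<chi> i. x0 i) S" for S :: "('m => complex) set"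
		by (auto simp: inj_on_def vec_eq_iff)
	show "has_degree (central_curve D) (prime_curve.curve_degree (path_x D) N)"
		by (rule has_degreeI[OF p(1,2)]) (use p(3) in \<open>auto simp: central_curve_section card_image[OF inj]\<close>)
qed

lemma polyfun_prod_nonzero:
	assumes "finite S" "\<And>a. a \<in> S ==> polyfun (p a)" "\<And>a. a \<in> S ==> \<exists>z. p a z \<noteq> 0"
	shows "\<exists>z. (\<Prod>a\<in>S. p a z) \<noteq> 0" using assms
proof (induction S rule: finite_induct)
	case (insert a S)
	obtain z where z: "(\<Prod>a\<in>S. p a z) \<noteq> 0" using insert by auto
	obtain z' where z': "p a z' \<noteq> 0" using insert.prems(2)[of a] by auto
	have "polyfun (\<lambda>z. \<Prod>a\<in>S. p a z)" "polyfun (p a)" using insert by (auto intro: polyfun_intros)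
	from polyfun_mult_nonzero[of "p a" "\<lambda>z. \<Prod>a\<in>S. p a z" z' z, OF this(2,1) z' z] insert(1,2)
	show ?case by simp
qed simp

text \<open>One hyperplane is chosen that both gives the right number of points and is in general
  position to the program; \<eta>0 only witnesses that the latter is possible. Each point of the
  section is lifted to a point of the closure, where the equations of the path persist.\<close>

lemma curve_degree_bound:
	fixes D :: "('m::finite, 'd::finite) qp"
	assumes dm: "CARD('d) < CARD('m)" and adm: "admissible D" and nc: "path_x D t1 \<noteq> path_x D t2"
		and pc: "prime_curve (path_x D) N"
		and good: "\<And>J. card J + CARD('d) \<le> CARD('m) ==> det (form_matrix (entries D) \<eta>0 J) \<noteq> 0"
	shows "prime_curve.curve_degree (path_x D) N \<le> (\<Sum>i<CARD('m) - CARD('d). (CARD('m) - 1) choose i)"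
proof -
	obtain p \<zeta>0 where p: "polyfun p" "p \<zeta>0 \<noteq> 0" "\<forall>\<zeta>. p \<zeta> \<noteq> 0 -->
			finite (closure_section D \<zeta>) \<and> card (closure_section D \<zeta>) = prime_curve.curve_degree (path_x D) N"
		using has_degree_curve_degree(2)[OF adm nc pc] by auto
	define JJ where "JJ = {J :: 'm set. card J + CARD('d) \<le> CARD('m)}"
	define q where "q \<eta> = (\<Prod>J\<in>JJ. det (form_matrix (entries D) \<eta> J))" for \<eta>
	have q: "polyfun q"
		unfolding q_def[abs_def] by (intro polyfun_prod polyfun_det_form_matrix polyfun.const polyfun.var)
	have "q \<eta>0 \<noteq> 0" using good by (simp add: q_def JJ_def)
	from polyfun_mult_nonzero[of p q \<zeta>0 \<eta>0, OF p(1) q p(2) this] obtain \<eta> where \<eta>: "p \<eta> * q \<eta> \<noteq> 0" by (rule exE)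
	then have fin: "finite (closure_section D \<eta>)"
		and card: "card (closure_section D \<eta>) = prime_curve.curve_degree (path_x D) N" using p(3) by auto
	have J: "det (form_matrix (entries D) \<eta> J) \<noteq> 0" if "card J + CARD('d) \<le> CARD('m)" for J
		using \<eta> that by (auto simp: q_def JJ_def)
	have "\<forall>x\<in>closure_section D \<eta>. \<exists>y. \<forall>q. polyfun q --> (\<forall>t. q (case_sum (path_x D t) (path_y D t)) = 0) -->
			q (case_sum x y) = 0" unfolding closure_section_def by blast
	from bchoice[OF this] obtain Y where Y: "\<forall>x\<in>closure_section D \<eta>. \<forall>q. polyfun q -->
			(\<forall>t. q (case_sum (path_x D t) (path_y D t)) = 0) --> q (case_sum x (Y x)) = 0" by (rule exE)
	define P where "P = (\<lambda>x. (x, Y x)) ` closure_section D \<eta>"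
	have "card P \<le> (\<Sum>i<CARD('m) - CARD('d). (CARD('m) - 1) choose i)"
	proof (rule kkt_solutions_bound[OF dm J])
		show "finite P" unfolding P_def using fin by simp
		fix x y assume "(x, y) \<in> P"
		then have x: "x \<in> closure_section D \<eta>" and y: "y = Y x" by (auto simp: P_def)
		have van: "q (case_sum x y) = 0" if "polyfun q" "\<And>t. q (case_sum (path_x D t) (path_y D t)) = 0" for q
			using Y x y that by blast
		\<comment> \<open>The parameter \<tau> is not a coordinate of the closure, so only the equality of
		  all products with the one at a fixed index i1 can be transported; their common value then serves
		  as \<tau>.\<close>
		define i1 :: 'm where "i1 = undefined"
		define s where "s z i = z (Inl i) * (entries D (slotc i) + (\<Sum>j\<in>UNIV. entries D (slotQ i j) * z (Inl j)) -
			(\<Sum>k\<in>UNIV. entries D (slotA k i) * z (Inr k)))" for z :: "'m + 'd => complex" and i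
		have s: "s (case_sum x y) i - s (case_sum x y) i1 = 0" for i
		proof (rule van)
			show "polyfun (\<lambda>z. s z i - s z i1)" unfolding s_def by (intro polyfun_intros)
			show "s (case_sum (path_x D t) (path_y D t)) i - s (case_sum (path_x D t) (path_y D t)) i1 = 0" for t
				using path_equations[OF adm, of t] by (simp add: s_def)
		qed
		have b: "(\<Sum>i\<in>UNIV. entries D (slotA k i) * (case_sum x y) (Inl i)) - entries D (slotb k) = 0" for k
		proof (rule van)
			show "polyfun (\<lambda>z. (\<Sum>i\<in>UNIV. entries D (slotA k i) * z (Inl i)) - entries D (slotb k))"
				by (intro polyfun_intros)
			show "(\<Sum>i\<in>UNIV. entries D (slotA k i) * (case_sum (path_x D t) (path_y D t)) (Inl i)) - entries D (slotb k) = 0" for t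
				using path_equations[OF adm, of t] by simp
		qed
		have "kkt_solution (entries D) x y (s (case_sum x y) i1)"
			unfolding kkt_solution_def using s b by (simp add: s_def)
		moreover have "(\<Sum>i\<in>UNIV. \<eta> (Some i) * x i) = \<eta> None" using x by (simp add: closure_section_def lin_def)
		ultimately show "(\<exists>\<tau>. kkt_solution (entries D) x y \<tau>) \<and> (\<Sum>i\<in>UNIV. \<eta> (Some i) * x i) = \<eta> None" by blast
	qed
	moreover have "card P = card (closure_section D \<eta>)"
		unfolding P_def by (rule card_image) (auto simp: inj_on_def)
	ultimately show ?thesis using card by simp
qed

text \<open>Independence of the monomials below the maximal degree gives only a lower bound for the
  degree on generic paths; maximality turns it into equality. Using one N for all programs is what
  makes their degrees comparable.\<close>

theorem generic_central_curve_degree: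
	assumes dm: "CARD('d::finite) < CARD('m::finite)"
	shows "\<exists>n p. n \<le> (\<Sum>i<CARD('m) - CARD('d). (CARD('m) - 1) choose i) \<and> polyfun p \<and> (\<exists>\<zeta>. p \<zeta> \<noteq> 0) \<and>
		(\<forall>D :: ('m, 'd) qp. admissible D --> p (entries D) \<noteq> 0 --> has_degree (central_curve D) n)"
proof -
	let ?S = "\<Sum>i<CARD('m) - CARD('d). (CARD('m) - 1) choose i"
	obtain N pF \<zeta>F where N: "N \<ge> 1" and pF: "polyfun pF" "pF \<zeta>F \<noteq> 0"
		and dep: "\<And>(D :: ('m, 'd) qp) \<theta>. admissible D ==> pF (entries D) \<noteq> 0 ==>
			\<not> indep ({..N} \<times> {..N}) (\<lambda>a. plane_monom (path_x D) a \<theta>)"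
		using plane_monoms_dependent[where 'm = 'm and 'd = 'd] by auto
	define \<eta>0 :: "'m option => complex" where "\<eta>0 = (\<lambda>j. if j = None then 1 else 0)"
	define JJ where "JJ = {J :: 'm set. card J + CARD('d) \<le> CARD('m)}"
	define p2 :: "(('m, 'd) slot => complex) => complex" where "p2 \<zeta> = (\<Prod>J\<in>JJ. det (form_matrix \<zeta> \<eta>0 J))" for \<zeta>
	have pJ: "polyfun (\<lambda>\<zeta> :: ('m, 'd) slot => complex. det (form_matrix \<zeta> \<eta>0 J))" for J
		by (intro polyfun_det_form_matrix polyfun.const polyfun.var)
	have p2: "polyfun p2" unfolding p2_def[abs_def] by (intro polyfun_prod pJ)
	have "\<exists>\<zeta>. p2 \<zeta> \<noteq> 0" unfolding p2_def
	proof (rule polyfun_prod_nonzero[where p = "\<lambda>J \<zeta>. det (form_matrix \<zeta> \<eta>0 J)", OF _ pJ])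
		fix J assume "J \<in> JJ"
		then show "\<exists>\<zeta> :: ('m, 'd) slot => complex. det (form_matrix \<zeta> \<eta>0 J) \<noteq> 0"
			unfolding \<eta>0_def using det_form_matrix_nonzero_exists[of J, where 'd = 'd] by (simp add: JJ_def)
	qed simp
	then obtain \<zeta>2 where "p2 \<zeta>2 \<noteq> 0" by (rule exE)
	from polyfun_mult_nonzero[of pF p2 \<zeta>F \<zeta>2, OF pF(1) p2 pF(2) this]
	obtain \<zeta>3 where \<zeta>3: "pF \<zeta>3 * p2 \<zeta>3 \<noteq> 0" by (rule exE)
	have p3: "polyfun (\<lambda>\<zeta>. pF \<zeta> * p2 \<zeta>)" by (rule polyfun.mult[OF pF(1) p2])
	define good where "good D \<longleftrightarrow> admissible D \<and> pF (entries D) * p2 (entries D) \<noteq> 0 \<and> (\<exists>t t'. path_x D t \<noteq> path_x D t')"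
		for D :: "('m, 'd) qp"
	define deg where "deg D = prime_curve.curve_degree (path_x D) N" for D :: "('m, 'd) qp"
	have pc: "prime_curve (path_x D) N" if g: "good D" for D
	proof -
		obtain t t' where t: "path_x D t \<noteq> path_x D t'" using g by (auto simp: good_def)
		have adm: "admissible D" and "pF (entries D) \<noteq> 0" using g by (auto simp: good_def)
		from dep[OF this] show ?thesis by (rule prime_curve_path[OF adm t])
	qed
	have hd: "has_degree (central_curve D) (deg D)" and bd: "deg D \<le> ?S" if g: "good D" for D
	proof -
		obtain t t' where t: "path_x D t \<noteq> path_x D t'" using g by (auto simp: good_def)
		have adm: "admissible D" using g by (simp add: good_def)
		show "has_degree (central_curve D) (deg D)"
			unfolding deg_def by (rule has_degree_curve_degree(1)[OF adm t pc[OF g]])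
		show "deg D \<le> ?S" unfolding deg_def
		proof (rule curve_degree_bound[OF dm adm t pc[OF g], of \<eta>0])
			fix J :: "'m set" assume "card J + CARD('d) \<le> CARD('m)"
			then show "det (form_matrix (entries D) \<eta>0 J) \<noteq> 0" using g by (auto simp: good_def p2_def JJ_def)
		qed
	qed
	show ?thesis
	proof (cases "\<exists>D. good D")
		\<comment> \<open>Here every admissible program outside the exceptional set has constant x, so 0
		  is the generic degree.\<close>
		case False
		have "has_degree (central_curve D) 0"
			if D: "admissible D" "pF (entries D) * p2 (entries D) \<noteq> 0" for D :: "('m, 'd) qp"
		proof (rule has_degree_constant_path)
			show "path_x D t = path_x D 0" for t using False D unfolding good_def by blast
		qed
		then show ?thesis using p3 \<zeta>3 by (intro exI[of _ 0] exI[of _ "\<lambda>\<zeta>. pF \<zeta> * p2 \<zeta>"]) auto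
	next
		case True
		then obtain D0 where "good D0" by blast
		then have D0: "\<exists>D. good D \<and> deg D = deg D0" by blast
		\<comment> \<open>The maximum exists because all degrees are bounded by \<open>?S\<close>.\<close>
		have "\<exists>n. (\<exists>D. good D \<and> deg D = n) \<and> (\<forall>m. (\<exists>D. good D \<and> deg D = m) --> m \<le> n)"
			by (rule ex_has_greatest_nat[where P = "\<lambda>n. \<exists>D. good D \<and> deg D = n" and b = "Suc ?S", OF D0]) (use bd in \<open>auto simp: less_Suc_eq_le intro: le_SucI\<close>)
		then obtain D1 where D1: "good D1" and max: "\<And>D. good D ==> deg D \<le> deg D1" by blast
		interpret D1: prime_curve "path_x D1" N by (rule pc[OF D1])
		have "deg D1 > 0" unfolding deg_def by (rule D1.curve_degree_pos)
		obtain \<theta> where \<theta>: "indep ({..N} \<times> {..<deg D1}) (\<lambda>a. plane_monom (path_x D1) a \<theta>)"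
			unfolding deg_def using D1.curve_degree_indep by (rule exE)
		define q where "q a z = lin (\<lambda>k. \<theta> (Inl k)) (\<lambda>i. z (Inl i)) ^ fst a * lin (\<lambda>k. \<theta> (Inr k)) (\<lambda>i. z (Inl i)) ^ snd a"
			for a :: "nat \<times> nat" and z :: "'m + 'd => complex"
		have q: "polyfun (q a)" for a unfolding q_def[abs_def] lin_def by (intro polyfun_intros)
		have qm: "q a (complex_point (central_path D (exp t))) = plane_monom (path_x D) a \<theta> t" for a t and D :: "('m, 'd) qp"
			by (simp add: q_def plane_monom_def complex_point_path)
		have adm1: "admissible D1" using D1 by (simp add: good_def)
		have "\<exists>p. polyfun p \<and> p (path_coords D1 1) \<noteq> 0 \<and> (\<forall>(D :: ('m, 'd) qp) \<tau>. admissible D --> \<tau> > 0 -->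
				p (path_coords D \<tau>) \<noteq> 0 --> indep ({..N} \<times> {..<deg D1}) (\<lambda>a t. q a (complex_point (central_path D (exp t)))))"
			by (rule path_independence_certificate[OF adm1 _ _ q]) (use \<theta> in \<open>simp_all add: qm\<close>)
		then obtain g where g: "polyfun g" "g (path_coords D1 1) \<noteq> 0"
			"\<And>(D :: ('m, 'd) qp) \<tau>. admissible D ==> \<tau> > 0 ==> g (path_coords D \<tau>) \<noteq> 0 ==>
				indep ({..N} \<times> {..<deg D1}) (\<lambda>a. plane_monom (path_x D) a \<theta>)" unfolding qm by auto
		obtain p4 \<zeta>4 where p4: "polyfun p4" "p4 \<zeta>4 \<noteq> 0"
			"\<And>D :: ('m, 'd) qp. admissible D ==> p4 (entries D) \<noteq> 0 ==> \<exists>\<tau>>0. g (path_coords D \<tau>) \<noteq> 0"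
			using nonvanishing_on_generic_paths[OF g(1,2)] by auto
		have "has_degree (central_curve D) (deg D1)"
			if D: "admissible D" "pF (entries D) * p2 (entries D) * p4 (entries D) \<noteq> 0" for D :: "('m, 'd) qp"
		proof -
			have "p4 (entries D) \<noteq> 0" using D(2) by simp
			from p4(3)[OF D(1) this] obtain \<tau> where "\<tau> > 0" "g (path_coords D \<tau>) \<noteq> 0" by blast
			from g(3)[OF D(1) this] have ind: "indep ({..N} \<times> {..<deg D1}) (\<lambda>a. plane_monom (path_x D) a \<theta>)" .
			\<comment> \<open>On a constant path u would be a constant, contradicting the independence of 1
			  and u. So the generic path inherits nonconstancy from D1.\<close>
			have "\<exists>t t'. path_x D t \<noteq> path_x D t'"
			proof (rule ccontr)
				assume "\<not> ?thesis"
				then have const: "path_x D t = path_x D 0" for t by blast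
				define u where "u = lin (\<lambda>k. \<theta> (Inl k)) (path_x D 0)"
				define c :: "nat \<times> nat => complex" where "c a = (if a = (1, 0) then 1 else if a = (0, 0) then - u else 0)" for a
				have "c (1, 0) = 0"
				proof (rule indepD[OF ind])
					fix t
					have "(\<Sum>a\<in>{..N} \<times> {..<deg D1}. c a * plane_monom (path_x D) a \<theta> t) =
							(\<Sum>a\<in>{(1, 0), (0, 0)}. c a * plane_monom (path_x D) a \<theta> t)"
						by (rule sum.mono_neutral_right) (use N \<open>deg D1 > 0\<close> in \<open>auto simp: c_def\<close>)
					also have "\<dots> = 0" by (simp add: c_def plane_monom_def const[of t] u_def)
					finally show "(\<Sum>a\<in>{..N} \<times> {..<deg D1}. c a * plane_monom (path_x D) a \<theta> t) = 0" .
				qed (use N \<open>deg D1 > 0\<close> in auto)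
				then show False by (simp add: c_def)
			qed
			then have gD: "good D" using D by (simp add: good_def)
			have "deg D1 \<le> deg D" using prime_curve.curve_degree_ge[OF pc[OF gD] ind] by (simp add: deg_def)
			then have "deg D = deg D1" using max[OF gD] by simp
			then show ?thesis using hd[OF gD] by simp
		qed
		moreover have "\<exists>\<zeta>. pF \<zeta> * p2 \<zeta> * p4 \<zeta> \<noteq> 0"
			by (rule polyfun_mult_nonzero[of "\<lambda>\<zeta>. pF \<zeta> * p2 \<zeta>" p4 \<zeta>3 \<zeta>4, OF p3 p4(1) \<zeta>3 p4(2)])
		moreover have "polyfun (\<lambda>\<zeta>. pF \<zeta> * p2 \<zeta> * p4 \<zeta>)" by (rule polyfun.mult[OF p3 p4(1)])
		ultimately show ?thesis
			using bd[OF D1] by (intro exI[of _ "deg D1"] exI[of _ "\<lambda>\<zeta>. pF \<zeta> * p2 \<zeta> * p4 \<zeta>"]) auto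
	qed
qed

section \<open>Translation to the real coordinates of the program space\<close>

definition slot_of :: "('m, 'd) qp_index => ('m, 'd) slot" where
	"slot_of idx = (case idx of Q_entry i j => slotQ i j | c_entry i => slotc i | A_entry k i => slotA k i | b_entry k => slotb k)"

definition index_of :: "('m, 'd) slot => ('m, 'd) qp_index" where
	"index_of s = (case s of Inl p => Q_entry (fst (urep p)) (snd (urep p)) | Inr (Inl (k, i)) => A_entry k i
		 | Inr (Inr (Inl i)) => c_entry i | Inr (Inr (Inr k)) => b_entry k)"

lemma slot_entry_slot_of:
	assumes "D \<in> qp_space"
	shows "slot_entry D (slot_of idx) = qp_coords D idx"
proof -
	obtain Q c A b where D: "D = (Q, c, A, b)" by (cases D)
	have "transpose Q = Q" using assms by (simp add: qp_space_def D)
	then show ?thesis unfolding D by (cases idx) (simp_all add: slot_of_def slot_entry_Q del: slot_entry_simps(1))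
qed

lemma qp_coords_index_of: "qp_coords D (index_of s) = slot_entry D s"
proof -
	obtain Q c A b where D: "D = (Q, c, A, b)" by (cases D)
	show ?thesis unfolding D by (cases s rule: slot_exhaust) (simp_all add: index_of_def)
qed

text \<open>The complex condition becomes the nonvanishing of one of two real polynomials. The
  admissible witness D0 shows that the exceptional set is proper.\<close>

lemma is_generic_qp_degreeI:
	fixes D0 :: "('m::finite, 'd::finite) qp"
	assumes p: "polyfun p" and D0: "admissible D0" "p (entries D0) \<noteq> 0"
		and n: "\<And>D :: ('m, 'd) qp. admissible D ==> p (entries D) \<noteq> 0 ==> has_degree (central_curve D) n"
	shows "is_generic_qp_degree TYPE('m) TYPE('d) n"
proof -
	have "polyfun (\<lambda>z. p (\<lambda>s. z (index_of s)))" by (rule polyfun_compose[OF p polyfun.var])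
	from polyfun_imp_real_mpoly[OF this] obtain P Q where
		PQ: "\<And>x. p (\<lambda>s. of_real (x (index_of s))) = Complex (eval_mpoly P x) (eval_mpoly Q x)" by auto
	have loc: "qp_coords D \<notin> zero_locus {P, Q} \<longleftrightarrow> p (entries D) \<noteq> 0" for D :: "('m, 'd) qp"
	proof -
		have "p (entries D) = Complex (eval_mpoly P (qp_coords D)) (eval_mpoly Q (qp_coords D))"
			using PQ[of "qp_coords D"] by (simp add: qp_coords_index_of)
		then show ?thesis by (auto simp: zero_locus_def complex_eq_iff)
	qed
	have "D0 \<in> qp_space" using D0(1) by (cases D0) (simp add: qp_space_def admissible_symmetric)
	then show ?thesis unfolding is_generic_qp_degree_def generically_on_def
		using D0 n by (intro exI[of _ "{P, Q}"] conjI bexI[of _ D0] ballI impI) (simp_all add: loc)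
qed

lemma is_generic_qp_degreeD:
	assumes "is_generic_qp_degree TYPE('m::finite) TYPE('d::finite) n"
	shows "\<exists>p. polyfun p \<and> (\<exists>\<zeta>. p \<zeta> \<noteq> 0) \<and>
		(\<forall>D :: ('m, 'd) qp. admissible D --> p (entries D) \<noteq> 0 --> has_degree (central_curve D) n)"
proof -
	obtain F and u :: "('m, 'd) qp" where F: "u \<in> qp_space" "qp_coords u \<notin> zero_locus F"
		"\<And>D :: ('m, 'd) qp. D \<in> qp_space ==> qp_coords D \<notin> zero_locus F ==> admissible D ==> has_degree (central_curve D) n"
		using assms unfolding is_generic_qp_degree_def generically_on_def by blast
	then obtain P where P: "P \<in> F" "eval_mpoly P (qp_coords u) \<noteq> 0" by (auto simp: zero_locus_def)
	define p where "p \<zeta> = eval_mpoly (Poly_Mapping.map of_real P) (\<lambda>i. \<zeta> (slot_of i))" for \<zeta> :: "('m, 'd) slot => complex"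
	have p: "polyfun p" unfolding p_def[abs_def] by (rule polyfun_compose[OF polyfun_eval_mpoly polyfun.var])
	have pe: "p (entries D) = of_real (eval_mpoly P (qp_coords D))" if "D \<in> qp_space" for D
		unfolding p_def slot_entry_slot_of[OF that] eval_mpoly_of_real ..
	have "has_degree (central_curve D) n" if D: "admissible D" "p (entries D) \<noteq> 0" for D :: "('m, 'd) qp"
	proof -
		have "D \<in> qp_space" using D(1) by (cases D) (simp add: qp_space_def admissible_symmetric)
		moreover from this have "qp_coords D \<notin> zero_locus F" using D(2) P(1) by (auto simp: pe zero_locus_def)
		ultimately show ?thesis using F(3) D(1) by blast
	qed
	moreover have "p (entries u) \<noteq> 0" using P(2) F(1) by (simp add: pe)
	ultimately show ?thesis using p by (intro exI[of _ p]) auto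
qed

theorem theorem4p1:
	assumes "CARD('d::finite) < CARD('m::finite)"
	shows "is_generic_qp_degree TYPE('m) TYPE('d) (psi_QP TYPE('m) TYPE('d)) \<and> psi_QP TYPE('m) TYPE('d) \<le>
			(\<Sum>k = 0..CARD('m) - CARD('d) - 1. ((CARD('m) - k - 2) choose (CARD('d) - 1)) * 2 ^ k) \<and>
		(\<forall>(l :: 'm) (Y :: 'd \<Rightarrow> 'm) (p :: ('m, complex) mpoly).
			inj Y \<and> l \<notin> range Y \<and> Poly_Mapping.keys p = qp_support l Y \<longrightarrow>
			normalized_volume (newton_polytope p) = real (\<Sum>k = 0..CARD('m) - CARD('d) - 1.
					((CARD('m) - k - 2) choose (CARD('d) - 1)) * 2 ^ k))"
proof -
	have sum: "(\<Sum>k = 0..CARD('m) - CARD('d) - 1. ((CARD('m) - k - 2) choose (CARD('d) - 1)) * 2 ^ k) =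
			(\<Sum>i<CARD('m) - CARD('d). (CARD('m) - 1) choose i)"
		by (rule qp_degree_sum) (use assms in \<open>auto simp: Suc_le_eq\<close>)
	obtain n p \<zeta> where n: "n \<le> (\<Sum>i<CARD('m) - CARD('d). (CARD('m) - 1) choose i)" and p: "polyfun p" "p \<zeta> \<noteq> 0"
		and deg: "\<And>D :: ('m, 'd) qp. admissible D ==> p (entries D) \<noteq> 0 ==> has_degree (central_curve D) n"
		using generic_central_curve_degree[OF assms] by auto
	obtain D0 :: "('m, 'd) qp" where D0: "admissible D0" "p (entries D0) \<noteq> 0"
		using admissible_dense[OF p] assms by auto
	have gen: "is_generic_qp_degree TYPE('m) TYPE('d) n" by (rule is_generic_qp_degreeI[OF p(1) D0 deg])
	\<comment> \<open>Two generic degrees are compared on one admissible program that avoids both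
	  exceptional sets; without such a program the implications in \<open>is_generic_qp_degree\<close>
	  could hold vacuously for several values.\<close>
	have "n' = n" if g: "is_generic_qp_degree TYPE('m) TYPE('d) n'" for n'
	proof -
		obtain p' \<zeta>' where p': "polyfun p'" "p' \<zeta>' \<noteq> 0"
			and deg': "\<And>D :: ('m, 'd) qp. admissible D ==> p' (entries D) \<noteq> 0 ==> has_degree (central_curve D) n'"
			using is_generic_qp_degreeD[OF g] by auto
		from polyfun_mult_nonzero[of p p' \<zeta> \<zeta>', OF p(1) p'(1) p(2) p'(2)]
		obtain z where z: "p z * p' z \<noteq> 0" by (rule exE)
		have le: "CARD('d) \<le> CARD('m)" using assms by simp
		from admissible_dense[of "\<lambda>z. p z * p' z" z, OF polyfun.mult[OF p(1) p'(1)] z le]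
		obtain D :: "('m, 'd) qp" where D: "admissible D" "p (entries D) * p' (entries D) \<noteq> 0" by auto
		then show ?thesis using has_degree_unique[OF deg'[of D] deg[of D]] by simp
	qed
	then have "psi_QP TYPE('m) TYPE('d) = n" unfolding psi_QP_def using gen by (intro the_equality)
	then show ?thesis unfolding sum using gen n normalized_volume_qp_support by blast
qed

end
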